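(* For every fixed $d \in \mathbb{N}$, the Bounded Skolem Problem restricted to linear recurrence sequences of order $d$ is disjunctively Turing reducible (in polynomial time) to $\mathsf{EqSLP}$, and hence lies in $\mathsf{coRP}$.
   Context: A linear recurrence sequence (LRS) $\langle u_n\rangle_{n=0}^\infty$ of order $d$ is a sequence of integers satisfying $u_{n+d} = a_{d-1}u_{n+d-1}+\cdots+a_0u_n$ for all $n\in\mathbb N$, with $a_0,\dots,a_{d-1}\in\mathbb Z$ (the order is the least such $d$). An LRS is given as input by the integers $a_0,\dots,a_{d-1},u_0,\dots,u_{d-1}$ written in binary; its size $\|\boldsymbol u\|$ is the total number of bits. The Bounded Skolem Problem: given an LRS $\boldsymbol u$ and an integer $N>0$ written in binary, decide whether there exists $n\in\{0,\dots,N\}$ with $u_n=0$. $\mathsf{EqSLP}$ is the problem: given an arithmetic circuit (straight-line program) over the integers using the constants and the operations $+,-,\times$, decide whether its output equals $0$. A disjunctive Turing reduction from problem $A$ to problem $B$ is a polynomial-time algorithm that maps an instance $x$ of $A$ to a finite list of instances $y_1,\dots,y_m$ of $B$ such that $x$ is a yes-instance of $A$ if and only if at least one $y_i$ is a yes-instance of $B$. *)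

theory Defs
  imports "HOL-Probability.Probability" "HOL-Computational_Algebra.Polynomial"
begin

section \<open>Multi-tape Turing machines and polynomial time\<close>

text \<open>
  Tapes are infinite in both directions. The states of a machine are \<open>0, \<dots>, tm_states M\<close>,
  where \<open>0\<close> is initial and \<open>tm_states M\<close> is the only halting state. The tape
  symbols are \<open>0, \<dots>, tm_symbols M - 1\<close>: \<open>0\<close> is the blank, \<open>1\<close> and \<open>2\<close> stand for the bits
  \<open>False\<close> and \<open>True\<close>.
\<close>

datatype move = Left | Stay | Right

primrec offset :: "move \<Rightarrow> int" where
  "offset Left = -1"
| "offset Stay = 0"
| "offset Right = 1"

record tm =
  tm_tapes :: nat
  tm_symbols :: nat
  tm_states :: nat
  tm_delta :: "nat \<Rightarrow> nat list \<Rightarrow> nat \<times> (nat \<times> move) list"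

definition wf_tm :: "tm \<Rightarrow> bool" where
  "wf_tm M \<longleftrightarrow> tm_tapes M \<ge> 1 \<and> tm_symbols M \<ge> 3 \<and>
     (\<forall>q < tm_states M. \<forall>ss. length ss = tm_tapes M \<longrightarrow> set ss \<subseteq> {..<tm_symbols M} \<longrightarrow>
        (case tm_delta M q ss of (q', acts) \<Rightarrow>
           q' \<le> tm_states M \<and> length acts = tm_tapes M \<and>
           (\<forall>(s, m) \<in> set acts. s < tm_symbols M)))"

text \<open>A tape is given by its contents and the position of its head.\<close>

type_synonym tape = "(int \<Rightarrow> nat) \<times> int"
type_synonym config = "nat \<times> tape list"

fun read_tape :: "tape \<Rightarrow> nat" where
  "read_tape (c, h) = c h"

fun act_tape :: "nat \<times> move \<Rightarrow> tape \<Rightarrow> tape" where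
  "act_tape (s, m) (c, h) = (c(h := s), h + offset m)"

fun tm_step :: "tm \<Rightarrow> config \<Rightarrow> config" where
  "tm_step M (q, ts) =
     (if q = tm_states M then (q, ts)
      else case tm_delta M q (map read_tape ts) of (q', acts) \<Rightarrow> (q', map2 act_tape acts ts))"

definition tape_contents :: "bool list \<Rightarrow> int \<Rightarrow> nat" where
  "tape_contents w = (\<lambda>i. if 0 \<le> i \<and> i < int (length w) then (if w ! nat i then 2 else 1) else 0)"

definition tm_init :: "tm \<Rightarrow> bool list \<Rightarrow> config" where
  "tm_init M x = (0, (tape_contents x, 0) # replicate (tm_tapes M - 1) (tape_contents [], 0))"

text \<open>The input is on the first tape; on halting the output is on the last tape.\<close>

definition halts_with :: "tm \<Rightarrow> config \<Rightarrow> bool list \<Rightarrow> bool" where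
  "halts_with M c y \<longleftrightarrow> fst c = tm_states M \<and> fst (last (snd c)) = tape_contents y"

definition polytime_computable :: "(bool list \<Rightarrow> bool list) \<Rightarrow> bool" where
  "polytime_computable f \<longleftrightarrow>
     (\<exists>M. wf_tm M \<and>
       (\<exists>p :: nat poly. \<forall>x. \<exists>t \<le> poly p (length x).
          halts_with M ((tm_step M ^^ t) (tm_init M x)) (f x)))"


section \<open>Encodings as bit strings\<close>

text \<open>
  A list of words is encoded by putting \<open>True\<close> in front of every bit and marking the end of
  each word with \<open>False\<close>; this is injective and at most doubles the length, up to one bit
  per word. Numbers are written in binary, least significant bit first and without leading
  zeros; integers are preceded by a sign bit.
\<close>

definition enc_word :: "bool list \<Rightarrow> bool list" where
  "enc_word w = concat (map (\<lambda>b. [True, b]) w) @ [False]"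

definition enc_words :: "bool list list \<Rightarrow> bool list" where
  "enc_words ws = concat (map enc_word ws)"

fun bin_nat :: "nat \<Rightarrow> bool list" where
  "bin_nat n = (if n = 0 then [] else odd n # bin_nat (n div 2))"

declare bin_nat.simps [simp del]

definition bin_int :: "int \<Rightarrow> bool list" where
  "bin_int i = (i < 0) # bin_nat (nat \<bar>i\<bar>)"

lemma enc_word_append_inj: "enc_word v @ x = enc_word w @ y \<Longrightarrow> v = w \<and> x = y"
proof (induction v arbitrary: w)
  case Nil
  then show ?case by (cases w) (auto simp: enc_word_def)
next
  case (Cons b v)
  then show ?case by (cases w) (auto simp: enc_word_def)
qed

lemma inj_enc_words: "inj enc_words"
proof (rule injI)
  fix vs ws
  show "enc_words vs = enc_words ws \<Longrightarrow> vs = ws"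
  proof (induction vs arbitrary: ws)
    case Nil
    then show ?case by (cases ws) (auto simp: enc_words_def enc_word_def)
  next
    case (Cons v vs)
    then obtain w ws' where ws: "ws = w # ws'"
      by (cases ws) (auto simp: enc_words_def enc_word_def)
    have "enc_word v @ enc_words vs = enc_word w @ enc_words ws'"
      using Cons.prems ws by (simp add: enc_words_def)
    then have "v = w" "enc_words vs = enc_words ws'"
      by (auto dest: enc_word_append_inj)
    then show ?case using Cons.IH ws by simp
  qed
qed

lemma inj_bin_nat: "inj bin_nat"
proof (rule injI)
  fix m n
  show "bin_nat m = bin_nat n \<Longrightarrow> m = n"
  proof (induction m arbitrary: n rule: less_induct)
    case (less m)
    show ?case
    proof (cases "m = 0 \<or> n = 0")
      case True
      then show ?thesis
        using less.prems by (auto simp: bin_nat.simps[of m] bin_nat.simps[of n] split: if_splits)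
    next
      case False
      then have *: "odd m = odd n" "bin_nat (m div 2) = bin_nat (n div 2)"
        using less.prems by (auto simp: bin_nat.simps[of m] bin_nat.simps[of n])
      then have "m div 2 = n div 2" using less.IH False by simp
      then show ?thesis using *(1) by presburger
    qed
  qed
qed

lemma inj_bin_int: "inj bin_int"
  by (rule injI) (auto simp: bin_int_def dest!: injD[OF inj_bin_nat] split: if_splits)


section \<open>Decision problems, disjunctive reductions and coRP\<close>

text \<open>Decision problems are languages; a string that encodes no instance is not a member.\<close>

type_synonym language = "bool list set"

definition disj_reducible :: "language \<Rightarrow> language \<Rightarrow> bool" where
  "disj_reducible A B \<longleftrightarrow>
     (\<exists>f. polytime_computable f \<and>
       (\<forall>x. \<exists>ys. f x = enc_words ys \<and> (x \<in> A \<longleftrightarrow> (\<exists>y \<in> set ys. y \<in> B))))"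

definition coin_tosses :: "nat \<Rightarrow> bool list pmf" where
  "coin_tosses m = pmf_of_set {r. length r = m}"

text \<open>
  The coin tosses of a randomized machine are supplied as an auxiliary random input of
  polynomial length; the machine accepts by writing \<open>[True]\<close>.
\<close>

definition RP :: "language set" where
  "RP = {L. \<exists>V. polytime_computable V \<and> (\<exists>p :: nat poly. \<forall>x.
     (let acc = measure_pmf.prob (coin_tosses (poly p (length x))) {r. V (enc_words [x, r]) = [True]}
      in (x \<in> L \<longrightarrow> acc \<ge> 1 / 2) \<and> (x \<notin> L \<longrightarrow> acc = 0)))}"

definition coRP :: "language set" where
  "coRP = {L. - L \<in> RP}"


section \<open>EqSLP\<close>

text \<open>
  A circuit is a list of gates; a gate refers to its arguments by their positions in the
  list, and the last gate is the output.
\<close>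

datatype gate = Const0 | Const1 | Add nat nat | Sub nat nat | Mul nat nat

fun gate_args :: "gate \<Rightarrow> nat set" where
  "gate_args Const0 = {}"
| "gate_args Const1 = {}"
| "gate_args (Add i j) = {i, j}"
| "gate_args (Sub i j) = {i, j}"
| "gate_args (Mul i j) = {i, j}"

definition wf_circuit :: "gate list \<Rightarrow> bool" where
  "wf_circuit c \<longleftrightarrow> c \<noteq> [] \<and> (\<forall>k < length c. gate_args (c ! k) \<subseteq> {..<k})"

fun gate_val :: "int list \<Rightarrow> gate \<Rightarrow> int" where
  "gate_val vs Const0 = 0"
| "gate_val vs Const1 = 1"
| "gate_val vs (Add i j) = vs ! i + vs ! j"
| "gate_val vs (Sub i j) = vs ! i - vs ! j"
| "gate_val vs (Mul i j) = vs ! i * vs ! j"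

definition circuit_vals :: "gate list \<Rightarrow> int list" where
  "circuit_vals c = foldl (\<lambda>vs g. vs @ [gate_val vs g]) [] c"

definition circuit_output :: "gate list \<Rightarrow> int" where
  "circuit_output c = last (circuit_vals c)"

fun enc_gate :: "gate \<Rightarrow> bool list" where
  "enc_gate Const0 = enc_words [bin_nat 0]"
| "enc_gate Const1 = enc_words [bin_nat 1]"
| "enc_gate (Add i j) = enc_words [bin_nat 2, bin_nat i, bin_nat j]"
| "enc_gate (Sub i j) = enc_words [bin_nat 3, bin_nat i, bin_nat j]"
| "enc_gate (Mul i j) = enc_words [bin_nat 4, bin_nat i, bin_nat j]"

definition enc_circuit :: "gate list \<Rightarrow> bool list" where
  "enc_circuit c = enc_words (map enc_gate c)"

definition EqSLP :: language where
  "EqSLP = {enc_circuit c | c. wf_circuit c \<and> circuit_output c = 0}"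

lemma inj_enc_gate: "inj enc_gate"
proof (rule injI)
  fix g h assume "enc_gate g = enc_gate h"
  then show "g = h"
    by (cases g; cases h) (auto dest!: injD[OF inj_enc_words] injD[OF inj_bin_nat])
qed

lemma inj_enc_circuit: "inj enc_circuit"
  by (rule injI)
    (auto simp: enc_circuit_def inj_map_eq_map[OF inj_enc_gate] dest!: injD[OF inj_enc_words])


section \<open>The Bounded Skolem Problem\<close>

definition satisfies_rec :: "int list \<Rightarrow> (nat \<Rightarrow> int) \<Rightarrow> bool" where
  "satisfies_rec a u \<longleftrightarrow> (\<forall>n. u (n + length a) = (\<Sum>i < length a. a ! i * u (n + i)))"

definition is_lrs :: "(nat \<Rightarrow> int) \<Rightarrow> bool" where
  "is_lrs u \<longleftrightarrow> (\<exists>a. satisfies_rec a u)"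

definition lrs_order :: "(nat \<Rightarrow> int) \<Rightarrow> nat" where
  "lrs_order u = (LEAST d. \<exists>a. length a = d \<and> satisfies_rec a u)"

definition enc_instance :: "int list \<Rightarrow> int list \<Rightarrow> nat \<Rightarrow> bool list" where
  "enc_instance a us N = enc_words (map bin_int a @ map bin_int us @ [bin_nat N])"

text \<open>
  A sequence of order \<open>d\<close> is presented by \<open>d\<close> recurrence coefficients and its first \<open>d\<close>
  terms, which determine it.
\<close>

definition bounded_skolem :: "nat \<Rightarrow> language" where
  "bounded_skolem d =
     {enc_instance a (map u [0..<d]) N | a u N.
        is_lrs u \<and> lrs_order u = d \<and> length a = d \<and> satisfies_rec a u \<and>
        N > 0 \<and> (\<exists>n \<in> {0..N}. u n = 0)}"

lemma enc_instance_inj: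
  assumes "enc_instance a us N = enc_instance a' us' N'"
    and "length a = length us" "length a' = length us'"
  shows "a = a' \<and> us = us' \<and> N = N'"
proof -
  have eq: "map bin_int a @ map bin_int us @ [bin_nat N] =
      map bin_int a' @ map bin_int us' @ [bin_nat N']"
    using assms(1) by (auto simp: enc_instance_def dest: injD[OF inj_enc_words])
  from arg_cong[OF this, of length] have "length a = length a'"
    using assms(2,3) by simp
  with eq assms(2,3) show ?thesis
    by (auto simp: inj_map_eq_map[OF inj_bin_int] dest: injD[OF inj_bin_nat])
qed

lemma satisfies_rec_unique:
  assumes "satisfies_rec a u" "satisfies_rec a v" "map u [0..<length a] = map v [0..<length a]"
  shows "u = v"
proof
  fix n
  show "u n = v n"
  proof (induction n rule: less_induct)
    case (less n)
    show ?case
    proof (cases "n < length a")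
      case True
      then show ?thesis using assms(3) by simp
    next
      case False
      then obtain m where m: "n = m + length a" using le_Suc_ex[of "length a" n] by (auto simp: add.commute)
      have "(\<Sum>i < length a. a ! i * u (m + i)) = (\<Sum>i < length a. a ! i * v (m + i))"
        using less.IH m by (intro sum.cong) auto
      then show ?thesis using assms(1,2) m by (simp add: satisfies_rec_def)
    qed
  qed
qed

end

theory Submission
  imports Defs
begin

text \<open>
  Polynomial-time functions are closed under pairing, case distinction and iteration of polynomial
  length with results of polynomial size, because while programs on word registers compile to Turing
  machines; all algorithms below are built from these closure properties.

  Take a prime \<open>p \<ge> 3\<close> of polynomial size that divides no nonzero recurrence coefficient. Modulo \<open>p\<close> the
  sequence \<open>u\<close> is eventually periodic with a period \<open>T \<le> p ^ (d * d)\<close>, so the \<open>j\<close>-th difference of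
  \<open>k \<mapsto> u (r + k T)\<close> is divisible by \<open>p ^ j\<close>. Hence \<open>J! u (r + k T)\<close> agrees modulo \<open>p ^ J\<close> with an integer
  polynomial in \<open>k\<close> of degree less than \<open>J\<close>, a truncated Newton series. Divided by its content it has a
  small degree \<open>w\<close> modulo \<open>p\<close>, and the corresponding degrees on the residue classes modulo \<open>p ^ e\<close> add up
  to at most \<open>w\<close>; so few residue classes can contain zeros, and descending level by level through them
  yields polynomially many candidates, among which the sequence has a zero below the bound if it has one at
  all. Repeated squaring of the companion matrix turns each candidate \<open>n\<close> into a circuit with value \<open>u n\<close>.
  That the order of \<open>u\<close> is not smaller than \<open>d\<close> means that its Hankel matrix is nonsingular; this rests on
  Fatou's lemma, by which a rational recurrence relation of minimal length is integral.

  For \<open>coRP\<close>, the product of the outputs of all circuits, less than \<open>2 ^ 2 ^ s\<close> in absolute value, is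
  evaluated modulo a product of random numbers with \<open>2 s + 4\<close> bits. If it is not zero, then by Chebyshev's
  estimate sufficiently many numbers of that length are primes that do not divide it.
\<close>

section \<open>A while language compiled to Turing machines\<close>

text \<open>The count of residue classes must not depend on the bound of the instance, only on the
  number of its digits. One nonzero difference makes this possible: if the first \<open>d\<close>
  differences on a progression all vanish, its first index is a zero of bounded size; otherwise some
  difference is nonzero and less than \<open>2 ^ V\<close>, where \<open>V\<close> is polynomial
  because \<open>d\<close> is fixed. Multiplied by \<open>J!\<close>, the series has a content that
  exceeds the multiplicity of \<open>p\<close> in \<open>J!\<close> by at most \<open>V\<close>. Its
  \<open>j\<close>-th term gains \<open>p ^ j\<close> but loses the multiplicity of \<open>p\<close>
  in \<open>j!\<close>, which is at most \<open>j / 2\<close> as \<open>p \<ge> 3\<close>; beyond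
  \<open>j = 2 V\<close> the gain wins, so the degree \<open>w\<close> is at most
  \<open>2 V\<close>. Each level raises the content by at most \<open>w\<close>, hence a precision
  \<open>J\<close> of the order of \<open>V E\<close> suffices for \<open>E\<close> levels. Integer
  polynomials modulo \<open>p ^ J\<close> thus replace \<open>p\<close>-adic analysis, and a class
  that fails a divisibility test on its coefficients contains no zero.\<close>

datatype cmd =
    Skip
  | Act nat "nat option" move
  | Seq cmd cmd
  | Cond nat cmd cmd cmd
  | While nat cmd

definition noact :: "nat list \<Rightarrow> (nat \<times> move) list" where
  "noact ss = map (\<lambda>s. (s, Stay)) ss"

text \<open>Every step prescribes one action for each tape, so that it is one transition of a Turing
  machine; a mere change of control rewrites the scanned symbols in place by
  \<open>noact\<close>.\<close>

fun cstep :: "cmd \<Rightarrow> nat list \<Rightarrow> cmd \<times> (nat \<times> move) list" where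
  "cstep Skip ss = (Skip, noact ss)"
| "cstep (Act r a m) ss = (Skip, (noact ss)[r := (case a of None \<Rightarrow> ss ! r | Some s \<Rightarrow> s, m)])"
| "cstep (Seq c d) ss =
     (if c = Skip then (d, noact ss) else (Seq (fst (cstep c ss)) d, snd (cstep c ss)))"
| "cstep (Cond r c0 c1 c2) ss = (if ss ! r = 0 then c0 else if ss ! r = 1 then c1 else c2, noact ss)"
| "cstep (While r c) ss = (if ss ! r = 0 then Skip else Seq c (While r c), noact ss)"

definition gstep :: "cmd \<times> tape list \<Rightarrow> cmd \<times> tape list" where
  "gstep p = (case cstep (fst p) (map read_tape (snd p)) of (c', acts) \<Rightarrow> (c', map2 act_tape acts (snd p)))"

text \<open>The analogue of the partial derivatives of a regular expression: a finite set that
  contains the program and is closed under \<open>cstep\<close>, which makes the control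
  finite.\<close>

fun residuals :: "cmd \<Rightarrow> cmd set" where
  "residuals Skip = {Skip}"
| "residuals (Act r a m) = {Act r a m, Skip}"
| "residuals (Seq c d) = (\<lambda>c'. Seq c' d) ` residuals c \<union> residuals d"
| "residuals (Cond r c0 c1 c2) = {Cond r c0 c1 c2} \<union> residuals c0 \<union> residuals c1 \<union> residuals c2"
| "residuals (While r c) = {While r c, Skip} \<union> (\<lambda>c'. Seq c' (While r c)) ` residuals c"

fun wfc :: "nat \<Rightarrow> cmd \<Rightarrow> bool" where
  "wfc k Skip = True"
| "wfc k (Act r a m) = (r < k \<and> (\<forall>s. a = Some s \<longrightarrow> s < 3))"
| "wfc k (Seq c d) = (wfc k c \<and> wfc k d)"
| "wfc k (Cond r c0 c1 c2) = (r < k \<and> wfc k c0 \<and> wfc k c1 \<and> wfc k c2)"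
| "wfc k (While r c) = (r < k \<and> wfc k c)"

lemma finite_residuals [simp]: "finite (residuals c)"
  by (induction c) auto

lemma self_residual [simp]: "c \<in> residuals c"
  by (induction c) auto

lemma Skip_residual [simp]: "Skip \<in> residuals c"
  by (induction c) auto

lemma cstep_residual: "c' \<in> residuals c \<Longrightarrow> fst (cstep c' ss) \<in> residuals c"
proof (induction c arbitrary: c')
  case (Seq c d)
  then show ?case by (auto split: if_splits)
next
  case (While r c)
  then show ?case by (auto split: if_splits)
qed (auto split: if_splits)

lemma wfc_residual: "c' \<in> residuals c \<Longrightarrow> wfc k c \<Longrightarrow> wfc k c'"
proof (induction c arbitrary: c')
  case (Seq c d)
  have "c' \<in> (\<lambda>x. Seq x d) ` residuals c \<or> c' \<in> residuals d"
    using Seq.prems(1) by (simp only: residuals.simps Un_iff)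
  then show ?case
  proof (elim disjE imageE)
    fix x assume "c' = Seq x d" "x \<in> residuals c"
    then show ?case using Seq.IH(1)[of x] Seq.prems(2) by (simp only: wfc.simps)
  next
    assume "c' \<in> residuals d"
    then show ?case using Seq.IH(2)[of c'] Seq.prems(2) by (simp only: wfc.simps)
  qed
next
  case (Cond r c0 c1 c2)
  have "c' = Cond r c0 c1 c2 \<or> c' \<in> residuals c0 \<or> c' \<in> residuals c1 \<or> c' \<in> residuals c2"
    using Cond.prems(1) by (simp only: residuals.simps Un_iff singleton_iff disj_assoc)
  then show ?case using Cond.IH[of c'] Cond.prems(2) by (elim disjE) (simp_all only: wfc.simps)
next
  case (While r c)
  have "c' = While r c \<or> c' = Skip \<or> c' \<in> (\<lambda>x. Seq x (While r c)) ` residuals c"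
    using While.prems(1) by (simp only: residuals.simps Un_iff insert_iff empty_iff disj_assoc simp_thms)
  then show ?case
  proof (elim disjE imageE)
    fix x assume "c' = Seq x (While r c)" "x \<in> residuals c"
    then show ?case using While.IH[of x] While.prems(2) by (simp only: wfc.simps)
  qed (use While.prems(2) in \<open>simp_all only: wfc.simps\<close>)
qed auto

lemma wfc_mono: "wfc k c \<Longrightarrow> k \<le> k' \<Longrightarrow> wfc k' c"
  by (induction c) auto

lemma length_noact [simp]: "length (noact ss) = length ss"
  by (simp add: noact_def)

lemma length_cstep [simp]: "length (snd (cstep c ss)) = length ss"
  by (induction c) auto

lemma set_noact: "p \<in> set (noact ss) \<Longrightarrow> fst p \<in> set ss"
  by (auto simp: noact_def)

lemma cstep_symbols:
  "wfc k c \<Longrightarrow> length ss = k \<Longrightarrow> set ss \<subseteq> {..<3} \<Longrightarrow> p \<in> set (snd (cstep c ss)) \<Longrightarrow> fst p < 3"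
proof (induction c)
  case (Act r a m)
  have "p \<in> insert (case a of None \<Rightarrow> ss ! r | Some s \<Rightarrow> s, m) (set (noact ss))"
    using Act.prems(4) set_update_subset_insert by fastforce
  moreover have "ss ! r < 3" using Act.prems nth_mem by fastforce
  ultimately show ?case using Act.prems by (auto dest: set_noact split: option.splits)
qed (auto dest: set_noact split: if_splits)

lemma map2_noact [simp]: "map2 act_tape (noact (map read_tape ts)) ts = ts"
  by (induction ts) (auto simp: noact_def)

lemma fst_gstep: "fst (gstep p) = fst (cstep (fst p) (map read_tape (snd p)))"
  by (simp add: gstep_def split: prod.splits)

lemma gstep_Skip [simp]: "gstep (Skip, ts) = (Skip, ts)"
  by (simp add: gstep_def)

lemma gstep_Skip_pow [simp]: "(gstep ^^ n) (Skip, ts) = (Skip, ts)"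
  by (induction n) auto

lemma map2_noact_update:
  "map2 act_tape ((noact (map read_tape ts))[r := x]) ts = ts[r := act_tape x (ts ! r)]"
proof (cases "r < length ts")
  case True
  have "map2 act_tape ((noact (map read_tape ts))[r := x]) (ts[r := ts ! r])
      = (map2 act_tape (noact (map read_tape ts)) ts)[r := act_tape x (ts ! r)]"
    by (simp only: zip_update map_update prod.case)
  then show ?thesis by simp
qed (simp add: list_update_beyond)

lemma gstep_Seq_Skip: "gstep (Seq Skip d, ts) = (d, ts)"
  by (simp add: gstep_def)

lemma gstep_Act:
  assumes "r < length ts"
  shows "gstep (Act r a m, ts) =
    (Skip, ts[r := act_tape (case a of None \<Rightarrow> read_tape (ts ! r) | Some s \<Rightarrow> s, m) (ts ! r)])"
  using assms by (auto simp: gstep_def map2_noact_update split: option.splits)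

lemma gstep_Seq:
  assumes "c \<noteq> Skip"
  shows "gstep (Seq c d, ts) = (Seq (fst (gstep (c, ts))) d, snd (gstep (c, ts)))"
  using assms by (auto simp: gstep_def split: prod.splits)

text \<open>The additional step discards the finished \<open>Skip\<close>; the bound is an
  inequality because \<open>c\<close> may have stopped before step \<open>n\<close>.\<close>

lemma gstep_Seq_run:
  assumes "(gstep ^^ n) (c, ts) = (Skip, ts')"
  shows "\<exists>m\<le>Suc n. (gstep ^^ m) (Seq c d, ts) = (d, ts')"
  using assms
proof (induction n arbitrary: c ts)
  case 0
  then show ?case by (intro exI[of _ 1]) (simp add: gstep_def)
next
  case (Suc n)
  show ?case
  proof (cases "c = Skip")
    case True
    with Suc.prems have "ts = ts'" using gstep_Skip_pow[of "Suc n" ts] by simp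
    then show ?thesis using True by (intro exI[of _ 1]) (simp add: gstep_def)
  next
    case False
    obtain c1 ts1 where 1: "gstep (c, ts) = (c1, ts1)" by force
    then have "(gstep ^^ n) (c1, ts1) = (Skip, ts')"
      using Suc.prems by (simp add: funpow_Suc_right del: funpow.simps)
    from Suc.IH[OF this] obtain m where m: "m \<le> Suc n" "(gstep ^^ m) (Seq c1 d, ts1) = (d, ts')" by auto
    have "(gstep ^^ Suc m) (Seq c d, ts) = (d, ts')"
      using m 1 False by (simp add: funpow_Suc_right gstep_Seq del: funpow.simps)
    then show ?thesis using m by (intro exI[of _ "Suc m"]) simp
  qed
qed

text \<open>The states of the compiled machine are the residual commands, in a list that starts with
  the program itself and ends with \<^const>\<open>Skip\<close>.\<close>

lemma list_with_ends: "a \<in> A \<Longrightarrow> b \<in> A \<Longrightarrow> set xs = A - {a, b} \<Longrightarrow> set (a # xs @ [b]) = A"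
  by auto

text \<open>A state is the position of a residual in a list of distinct commands.
  \<open>c \<noteq> Skip\<close> keeps the two ends of the list, the initial and the halting state,
  apart.\<close>

lemma compile:
  assumes wf: "wfc k c" and ne: "c \<noteq> Skip" and k: "k \<ge> 1"
  obtains M ix where "wf_tm M" "tm_tapes M = k" "ix c = 0" "ix Skip = tm_states M"
    "\<And>n ts. (tm_step M ^^ n) (0, ts) = (ix (fst ((gstep ^^ n) (c, ts))), snd ((gstep ^^ n) (c, ts)))"
proof -
  obtain xs where xs: "set xs = residuals c - {c, Skip}" "distinct xs"
    using finite_distinct_list[of "residuals c - {c, Skip}"] by auto
  define L where "L = c # xs @ [Skip]"
  have dL: "distinct L" using xs ne by (auto simp: L_def)
  have sL: "set L = residuals c"
    unfolding L_def by (rule list_with_ends[OF self_residual Skip_residual xs(1)])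
  define ix where "ix c' = (THE i. i < length L \<and> L ! i = c')" for c'
  have ix_nth: "ix (L ! i) = i" if "i < length L" for i
    unfolding ix_def using that dL by (intro the_equality) (auto simp: nth_eq_iff_index_eq)
  have nth_ix: "ix c' < length L \<and> L ! ix c' = c'" if "c' \<in> residuals c" for c'
  proof -
    obtain i where "i < length L" "L ! i = c'" using \<open>c' \<in> residuals c\<close> unfolding sL[symmetric] in_set_conv_nth by blast
    then show ?thesis using ix_nth[of i] by simp
  qed
  define M where "M = \<lparr>tm_tapes = k, tm_symbols = 3, tm_states = Suc (length xs),
    tm_delta = (\<lambda>q ss. (ix (fst (cstep (L ! q) ss)), snd (cstep (L ! q) ss)))\<rparr>"
  have ix0: "ix c = 0" using ix_nth[of 0] by (simp add: L_def)
  have ixS: "ix Skip = tm_states M" using ix_nth[of "Suc (length xs)"] by (simp add: L_def M_def nth_append)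
  have lenL: "length L = Suc (Suc (length xs))" by (simp add: L_def)
  have "wf_tm M"
    unfolding wf_tm_def
  proof (intro conjI allI impI)
    fix q ss assume q: "q < tm_states M" and ss: "length ss = tm_tapes M" "set ss \<subseteq> {..<tm_symbols M}"
    have res: "L ! q \<in> residuals c" using q sL lenL nth_mem[of q L] by (simp add: M_def)
    have "ix (fst (cstep (L ! q) ss)) < length L" using nth_ix[OF cstep_residual[OF res]] by simp
    moreover have "\<forall>p \<in> set (snd (cstep (L ! q) ss)). fst p < 3"
      using cstep_symbols[OF wfc_residual[OF res wf]] ss by (auto simp: M_def)
    ultimately show "case tm_delta M q ss of (q', acts) \<Rightarrow> q' \<le> tm_states M \<and>
           length acts = tm_tapes M \<and> (\<forall>(s, m)\<in>set acts. s < tm_symbols M)"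
      using ss lenL by (auto simp: M_def)
  qed (use k in \<open>auto simp: M_def\<close>)
  moreover have step: "tm_step M (ix c', ts) = (ix (fst (gstep (c', ts))), snd (gstep (c', ts)))"
    if "c' \<in> residuals c" for c' ts
  proof (cases "ix c' = tm_states M")
    case True
    then have "c' = Skip" using nth_ix[OF that] nth_ix[of Skip] ixS by (metis Skip_residual)
    then show ?thesis using True by simp
  next
    case False
    then show ?thesis using nth_ix[OF that] by (simp add: M_def gstep_def split: prod.splits)
  qed
  have gres: "fst ((gstep ^^ n) (c, ts)) \<in> residuals c" for n ts
  proof (induction n)
    case (Suc n)
    then show ?case using cstep_residual[OF Suc.IH] by (simp add: fst_gstep)
  qed simp
  have "(tm_step M ^^ n) (0, ts) = (ix (fst ((gstep ^^ n) (c, ts))), snd ((gstep ^^ n) (c, ts)))" for n ts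
  proof (induction n)
    case 0
    then show ?case using ix0 by simp
  next
    case (Suc n)
    then show ?case using step[OF gres] by simp
  qed
  ultimately show ?thesis using that ix0 ixS by (auto simp: M_def)
qed

section \<open>Registers holding words\<close>

definition holds_word :: "bool list \<Rightarrow> tape \<Rightarrow> bool" where
  "holds_word w t \<longleftrightarrow> (\<forall>i\<ge>0. fst t (snd t + i) = tape_contents w i)"

definition store :: "nat \<Rightarrow> (nat \<Rightarrow> bool list) \<Rightarrow> tape list \<Rightarrow> bool" where
  "store k s ts \<longleftrightarrow> length ts = Suc k \<and> (\<forall>r<k. holds_word (s r) (ts ! r))"

text \<open>Quantifying over every \<open>k\<close> lets a command run beside any number of further
  registers. Tape \<open>k\<close>, the one after the registers, is reserved for the output and
  stays untouched.\<close>

definition runs :: "cmd \<Rightarrow> (nat \<Rightarrow> bool list) \<Rightarrow> (nat \<Rightarrow> bool list) \<Rightarrow> nat \<Rightarrow> bool" where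
  "runs c s s' n \<longleftrightarrow> (\<forall>k ts. wfc k c \<longrightarrow> store k s ts \<longrightarrow>
     (\<exists>m\<le>n. \<exists>ts'. (gstep ^^ m) (c, ts) = (Skip, ts') \<and> store k s' ts' \<and> ts' ! k = ts ! k))"

lemma runs_mono: "runs c s s' n \<Longrightarrow> n \<le> n' \<Longrightarrow> runs c s s' n'"
  unfolding runs_def by (meson order_trans)

lemma runs_Skip: "runs Skip s s n"
  unfolding runs_def by (auto intro!: exI[of _ 0])

lemma runs_Seq:
  assumes "runs c s s1 n" "runs d s1 s2 m"
  shows "runs (Seq c d) s s2 (n + m + 1)"
  unfolding runs_def
proof (intro allI impI)
  fix k ts assume wf: "wfc k (Seq c d)" and st: "store k s ts"
  obtain i ts1 where i: "i \<le> n" "(gstep ^^ i) (c, ts) = (Skip, ts1)" "store k s1 ts1" "ts1 ! k = ts ! k"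
    using assms(1) wf st unfolding runs_def wfc.simps by metis
  obtain j ts2 where j: "j \<le> m" "(gstep ^^ j) (d, ts1) = (Skip, ts2)" "store k s2 ts2" "ts2 ! k = ts1 ! k"
    using assms(2) wf i(3) unfolding runs_def wfc.simps by metis
  obtain l where l: "l \<le> Suc i" "(gstep ^^ l) (Seq c d, ts) = (d, ts1)"
    using gstep_Seq_run[OF i(2)] by blast
  have "(gstep ^^ (j + l)) (Seq c d, ts) = (Skip, ts2)"
    using l j by (simp add: funpow_add)
  then show "\<exists>i\<le>n + m + 1. \<exists>ts'. (gstep ^^ i) (Seq c d, ts) = (Skip, ts') \<and> store k s2 ts' \<and> ts' ! k = ts ! k"
    using i j l by (intro exI[of _ "j + l"]) auto
qed

lemma read_holds: "holds_word w t \<Longrightarrow> read_tape t = (case w of [] \<Rightarrow> 0 | b # _ \<Rightarrow> if b then 2 else 1)"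
  by (cases t) (auto simp: holds_word_def tape_contents_def split: list.splits dest!: spec[of _ 0])

lemma read_store:
  "store k s ts \<Longrightarrow> r < k \<Longrightarrow> map read_tape ts ! r = (case s r of [] \<Rightarrow> 0 | b # _ \<Rightarrow> if b then 2 else 1)"
  using read_holds by (auto simp: store_def)

lemma runs_step:
  assumes "\<And>k ts. wfc k c \<Longrightarrow> store k s ts \<Longrightarrow> gstep (c, ts) = (d, ts) \<and> wfc k d" "runs d s s' n"
  shows "runs c s s' (Suc n)"
  unfolding runs_def
proof (intro allI impI)
  fix k ts assume wf: "wfc k c" and st: "store k s ts"
  have g: "gstep (c, ts) = (d, ts)" "wfc k d" using assms(1)[OF wf st] by auto
  obtain j ts2 where j: "j \<le> n" "(gstep ^^ j) (d, ts) = (Skip, ts2)" "store k s' ts2" "ts2 ! k = ts ! k"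
    using assms(2) g st unfolding runs_def by blast
  show "\<exists>i\<le>Suc n. \<exists>ts'. (gstep ^^ i) (c, ts) = (Skip, ts') \<and> store k s' ts' \<and> ts' ! k = ts ! k"
    using j g by (intro exI[of _ "Suc j"]) (auto simp: funpow_Suc_right simp del: funpow.simps)
qed

lemma runs_Cond:
  assumes "runs (case s r of [] \<Rightarrow> c0 | b # _ \<Rightarrow> if b then c2 else c1) s s' n"
  shows "runs (Cond r c0 c1 c2) s s' (Suc n)"
  by (rule runs_step[OF _ assms]) (auto simp: gstep_def read_store split: list.splits)

lemma runs_While_Nil: "s r = [] \<Longrightarrow> runs (While r c) s s 1"
  unfolding One_nat_def
  by (rule runs_step[OF _ runs_Skip]) (auto simp: gstep_def read_store split: list.splits)

lemma runs_While:
  assumes "s r \<noteq> []" "runs c s s1 n" "runs (While r c) s1 s2 m"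
  shows "runs (While r c) s s2 (n + m + 2)"
proof -
  have "runs (While r c) s s2 (Suc (n + m + 1))"
    by (rule runs_step[OF _ runs_Seq[OF assms(2,3)]])
      (use assms(1) in \<open>auto simp: gstep_def read_store split: list.splits\<close>)
  then show ?thesis by simp
qed

text \<open>A register may have garbage to the left of its head; popping only moves the head.\<close>

definition Pop :: "nat \<Rightarrow> cmd" where "Pop r = Act r None Right"

text \<open>The head moves first, since the symbol under it is the top of the stack; the write then
  erases whatever was left of it.\<close>

definition Push :: "bool \<Rightarrow> nat \<Rightarrow> cmd" where
  "Push b r = Seq (Act r None Left) (Act r (Some (if b then 2 else 1)) Stay)"

lemma wfc_Pop [simp]: "wfc k (Pop r) \<longleftrightarrow> r < k" and wfc_Push [simp]: "wfc k (Push b r) \<longleftrightarrow> r < k"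
  by (auto simp: Pop_def Push_def)

lemma store_update:
  assumes "store k s ts" "r < k" "holds_word w t"
  shows "store k (s(r := w)) (ts[r := t])"
  using assms by (auto simp: store_def nth_list_update)

lemma runs_Pop: "runs (Pop r) s (s(r := tl (s r))) 1"
  unfolding runs_def
proof (intro allI impI)
  fix k ts assume "wfc k (Pop r)" and st: "store k s ts"
  then have r: "r < k" "r < length ts" by (auto simp: store_def)
  obtain c h where ch: "ts ! r = (c, h)" by force
  have "holds_word (s r) (c, h)" using st r ch by (auto simp: store_def)
  then have "\<forall>i\<ge>0. c (h + (1 + i)) = tape_contents (s r) (1 + i)" by (auto simp: holds_word_def)
  moreover have "tape_contents (tl w) i = tape_contents w (1 + i)" if "i \<ge> 0" for w i
    using that by (cases w) (auto simp: tape_contents_def nat_add_distrib)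
  ultimately have "holds_word (tl (s r)) (c, h + 1)" by (simp add: holds_word_def add.assoc)
  then show "\<exists>m\<le>1. \<exists>ts'. (gstep ^^ m) (Pop r, ts) = (Skip, ts') \<and>
      store k (s(r := tl (s r))) ts' \<and> ts' ! k = ts ! k"
    using r ch by (intro exI[of _ 1]) (auto simp: Pop_def gstep_Act intro!: store_update[OF st])
qed

lemma runs_Push: "runs (Push b r) s (s(r := b # s r)) 3"
  unfolding runs_def
proof (intro allI impI)
  fix k ts assume "wfc k (Push b r)" and st: "store k s ts"
  then have r: "r < k" "r < length ts" by (auto simp: store_def)
  obtain c h where ch: "ts ! r = (c, h)" by force
  let ?t = "(c(h - 1 := if b then 2 else 1), h - 1)"
  have hc: "holds_word (s r) (c, h)" using st r ch by (auto simp: store_def)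
  have "holds_word (b # s r) ?t"
    unfolding holds_word_def
  proof (intro allI impI)
    fix i :: int assume i: "i \<ge> 0"
    show "fst ?t (snd ?t + i) = tape_contents (b # s r) i"
    proof (cases "i = 0")
      case True
      then show ?thesis by (simp add: tape_contents_def)
    next
      case False
      then have j: "i = 1 + (i - 1)" "i - 1 \<ge> 0" using i by auto
      have "c (h + (i - 1)) = tape_contents (s r) (i - 1)" using hc j by (auto simp: holds_word_def)
      moreover have "tape_contents (b # s r) i = tape_contents (s r) (i - 1)"
        using j by (auto simp: tape_contents_def nth_Cons' nat_diff_distrib)
      ultimately show ?thesis using j by (simp add: algebra_simps)
    qed
  qed
  then have st': "store k (s(r := b # s r)) (ts[r := ?t])" using r by (intro store_update[OF st]) auto
  have "gstep (Push b r, ts) = (Seq Skip (Act r (Some (if b then 2 else 1)) Stay), ts[r := (c, h - 1)])"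
    using r ch by (simp add: Push_def gstep_Seq gstep_Act)
  moreover have "gstep (Act r (Some (if b then 2 else 1)) Stay, ts[r := (c, h - 1)]) = (Skip, ts[r := ?t])"
    using r by (simp add: gstep_Act)
  \<comment> \<open>One step moves, one discards the \<open>Skip\<close>, one writes.\<close>
  ultimately have "(gstep ^^ 3) (Push b r, ts) = (Skip, ts[r := ?t])"
    by (simp add: numeral_3_eq_3 gstep_Seq_Skip)
  then show "\<exists>m\<le>3. \<exists>ts'. (gstep ^^ m) (Push b r, ts) = (Skip, ts') \<and>
      store k (s(r := b # s r)) ts' \<and> ts' ! k = ts ! k"
    using r st' by (intro exI[of _ 3] exI[of _ "ts[r := ?t]"] conjI) simp_all
qed

section \<open>Polynomial time on words\<close>

text \<open>The base is at least 2 for every \<open>n\<close>, so sums and constant factors are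
  absorbed by a larger exponent and no coefficients have to be carried along.\<close>

definition polyb :: "(nat \<Rightarrow> nat) \<Rightarrow> bool" where
  "polyb T \<longleftrightarrow> (\<exists>e. \<forall>n. T n \<le> (n + 2) ^ e)"

lemma polyb_const: "polyb (\<lambda>_. c)"
proof -
  have "c \<le> (n + 2) ^ c" for n
    by (rule order_trans[OF less_imp_le[OF less_exp]]) (simp add: power_mono)
  then show ?thesis unfolding polyb_def by blast
qed

lemma polyb_id: "polyb (\<lambda>n. n)"
  unfolding polyb_def by (rule exI[of _ 1]) simp

lemma polyb_pow: "polyb (\<lambda>n. (n + 2) ^ e)"
  unfolding polyb_def by auto

lemma polyb_mult:
  assumes "polyb S" "polyb T"
  shows "polyb (\<lambda>n. S n * T n)"
proof -
  obtain a b where "\<And>n. S n \<le> (n + 2) ^ a" "\<And>n. T n \<le> (n + 2) ^ b"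
    using assms unfolding polyb_def by blast
  then have "S n * T n \<le> (n + 2) ^ (a + b)" for n by (simp add: power_add mult_mono)
  then show ?thesis unfolding polyb_def by blast
qed

lemma polyb_add:
  assumes "polyb S" "polyb T"
  shows "polyb (\<lambda>n. S n + T n)"
proof -
  obtain a b where ab: "\<And>n. S n \<le> (n + 2) ^ a" "\<And>n. T n \<le> (n + 2) ^ b"
    using assms unfolding polyb_def by blast
  have "S n + T n \<le> (n + 2) ^ (a + b + 1)" for n
  proof -
    have "S n \<le> (n + 2) ^ (a + b)" "T n \<le> (n + 2) ^ (a + b)"
      by (auto intro!: order_trans[OF ab(1)] order_trans[OF ab(2)] power_increasing)
    then have "S n + T n \<le> 2 * (n + 2) ^ (a + b)" by simp
    also have "\<dots> \<le> (n + 2) ^ (a + b + 1)" by simp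
    finally show ?thesis .
  qed
  then show ?thesis unfolding polyb_def by blast
qed

lemma polyb_power: "polyb S \<Longrightarrow> polyb (\<lambda>n. S n ^ e)"
  by (induction e) (auto intro: polyb_const polyb_mult)

lemma polyb_comp_pow:
  assumes "polyb S"
  shows "polyb (\<lambda>n. (S n + 2) ^ e)"
  by (intro polyb_power polyb_add polyb_const assms)

lemmas polyb_intros = polyb_const polyb_id polyb_pow polyb_mult polyb_add polyb_power

text \<open>The domain \<open>D\<close> exempts words that encode no datum. Registers from
  \<open>K\<close> on may hold anything and have to survive, which lets programs be combined by
  saving data above \<open>K\<close>.\<close>

definition pw :: "bool list set \<Rightarrow> (bool list \<Rightarrow> bool list) \<Rightarrow> bool" where
  "pw D f \<longleftrightarrow> (\<exists>c K e. K \<ge> 1 \<and> wfc K c \<and>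
     (\<forall>s. s 0 \<in> D \<longrightarrow> (\<forall>i. 0 < i \<and> i < K \<longrightarrow> s i = []) \<longrightarrow> runs c s (s(0 := f (s 0))) ((length (s 0) + 2) ^ e)) \<and>
     (\<forall>w\<in>D. length (f w) \<le> (length w + 2) ^ e))"

lemma pwI:
  assumes K: "K \<ge> 1" "wfc K c"
    and r: "\<And>s. s 0 \<in> D \<Longrightarrow> (\<And>i. 0 < i \<Longrightarrow> i < K \<Longrightarrow> s i = []) \<Longrightarrow>
      runs c s (s(0 := f (s 0))) (T (length (s 0)))"
    and l: "\<And>w. w \<in> D \<Longrightarrow> length (f w) \<le> L (length w)"
    and p: "polyb T" "polyb L"
  shows "pw D f"
proof -
  obtain e where e: "\<And>n. T n + L n \<le> (n + 2) ^ e"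
    using polyb_add[OF p] unfolding polyb_def by blast
  have "runs c s (s(0 := f (s 0))) ((length (s 0) + 2) ^ e)"
    if "s 0 \<in> D" "\<forall>i. 0 < i \<and> i < K \<longrightarrow> s i = []" for s
    using r[of s] that e[of "length (s 0)"] by (auto elim: runs_mono)
  moreover have "length (f w) \<le> (length w + 2) ^ e" if "w \<in> D" for w
    using l[OF that] e[of "length w"] by simp
  ultimately show ?thesis unfolding pw_def using K by blast
qed

lemma pwE:
  assumes "pw D f"
  obtains c K e where "K \<ge> 1" "\<And>K'. K \<le> K' \<Longrightarrow> wfc K' c"
    "\<And>s. (\<And>i. 0 < i \<Longrightarrow> i < K \<Longrightarrow> s i = []) \<Longrightarrow> s 0 \<in> D \<Longrightarrow>
      runs c s (s(0 := f (s 0))) ((length (s 0) + 2) ^ e)"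
    "\<And>w. w \<in> D \<Longrightarrow> length (f w) \<le> (length w + 2) ^ e"
proof -
  obtain c K e where *: "K \<ge> 1" "wfc K c"
    "\<forall>s. s 0 \<in> D \<longrightarrow> (\<forall>i. 0 < i \<and> i < K \<longrightarrow> s i = []) \<longrightarrow> runs c s (s(0 := f (s 0))) ((length (s 0) + 2) ^ e)"
    "\<forall>w\<in>D. length (f w) \<le> (length w + 2) ^ e"
    using assms unfolding pw_def by blast
  show ?thesis
    by (rule that[OF *(1) wfc_mono[OF *(2)]]) (use *(3,4) in auto)
qed

lemma runs_SeqI: "runs c s s1 n \<Longrightarrow> runs d s1 s2 m \<Longrightarrow> n + m + 1 \<le> t \<Longrightarrow> runs (Seq c d) s s2 t"
  using runs_Seq runs_mono by blast

section \<open>Moving and copying registers\<close>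

definition mv :: "nat \<Rightarrow> nat \<Rightarrow> cmd" where
  "mv a b = While a (Seq (Cond a Skip (Push False b) (Push True b)) (Pop a))"

lemma runs_mv:
  assumes "a \<noteq> b"
  shows "runs (mv a b) s (s(a := [], b := rev (s a) @ s b)) (8 * length (s a) + 1)"
proof (induction "s a" arbitrary: s)
  case Nil
  then have eq: "s(a := [], b := rev (s a) @ s b) = s" by (auto simp: fun_eq_iff)
  show ?case unfolding mv_def eq by (rule runs_mono[OF runs_While_Nil]) (use Nil in auto)
next
  case (Cons x xs)
  let ?s1 = "s(b := x # s b)" and ?s2 = "s(b := x # s b, a := xs)"
  have 1: "runs (Cond a Skip (Push False b) (Push True b)) s ?s1 (Suc 3)"
    by (rule runs_Cond) (use runs_Push[of x b s] Cons(2) in \<open>cases x; simp add: Cons(2)[symmetric]\<close>)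
  have 2: "runs (Pop a) ?s1 ?s2 1"
    using runs_Pop[of a ?s1] Cons(2)[symmetric] assms by simp
  have 3: "runs (mv a b) ?s2 (?s2(a := [], b := rev xs @ ?s2 b)) (8 * length xs + 1)"
    using Cons(1)[of ?s2] by simp
  have eq: "?s2(a := [], b := rev xs @ ?s2 b) = s(a := [], b := rev (s a) @ s b)"
    using assms Cons(2)[symmetric] by (auto simp: fun_eq_iff)
  have "runs (mv a b) s (?s2(a := [], b := rev xs @ ?s2 b)) (6 + (8 * length xs + 1) + 2)"
    unfolding mv_def
    by (rule runs_While[OF _ runs_SeqI[OF 1 2] 3[unfolded mv_def]]) (use Cons(2)[symmetric] in auto)
  then show ?case unfolding eq using Cons(2)[symmetric] by (auto elim: runs_mono)
qed

definition mv2 :: "nat \<Rightarrow> nat \<Rightarrow> nat \<Rightarrow> cmd" where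
  "mv2 a b c = While a (Seq (Cond a Skip (Seq (Push False b) (Push False c)) (Seq (Push True b) (Push True c))) (Pop a))"

lemma runs_mv2:
  assumes "a \<noteq> b" "a \<noteq> c" "b \<noteq> c"
  shows "runs (mv2 a b c) s (s(a := [], b := rev (s a) @ s b, c := rev (s a) @ s c)) (12 * length (s a) + 1)"
proof (induction "s a" arbitrary: s)
  case Nil
  then have eq: "s(a := [], b := rev (s a) @ s b, c := rev (s a) @ s c) = s" by (auto simp: fun_eq_iff)
  show ?case unfolding mv2_def eq by (rule runs_mono[OF runs_While_Nil]) (use Nil in auto)
next
  case (Cons x xs)
  let ?s1 = "s(b := x # s b, c := x # s c)" and ?s2 = "s(b := x # s b, c := x # s c, a := xs)"
  have 0: "runs (Seq (Push x b) (Push x c)) s ?s1 7"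
    by (rule runs_SeqI[OF runs_Push]) (use runs_Push[of x c "s(b := x # s b)"] assms in auto)
  have 1: "runs (Cond a Skip (Seq (Push False b) (Push False c)) (Seq (Push True b) (Push True c))) s ?s1 (Suc 7)"
    by (rule runs_Cond) (use 0 Cons(2) in \<open>cases x; simp add: Cons(2)[symmetric]\<close>)
  have 2: "runs (Pop a) ?s1 ?s2 1"
    using runs_Pop[of a ?s1] Cons(2)[symmetric] assms by simp
  have 3: "runs (mv2 a b c) ?s2 (?s2(a := [], b := rev xs @ ?s2 b, c := rev xs @ ?s2 c)) (12 * length xs + 1)"
    using Cons(1)[of ?s2] by simp
  have eq: "?s2(a := [], b := rev xs @ ?s2 b, c := rev xs @ ?s2 c) = s(a := [], b := rev (s a) @ s b, c := rev (s a) @ s c)"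
    using assms Cons(2)[symmetric] by (auto simp: fun_eq_iff)
  have "runs (mv2 a b c) s (?s2(a := [], b := rev xs @ ?s2 b, c := rev xs @ ?s2 c)) (10 + (12 * length xs + 1) + 2)"
    unfolding mv2_def
    by (rule runs_While[OF _ runs_SeqI[OF 1 2] 3[unfolded mv2_def]]) (use Cons(2)[symmetric] in auto)
  then show ?case unfolding eq using Cons(2)[symmetric] by (auto elim: runs_mono)
qed

definition clear :: "nat \<Rightarrow> cmd" where "clear a = While a (Pop a)"

lemma runs_clear: "runs (clear a) s (s(a := [])) (3 * length (s a) + 1)"
proof (induction "s a" arbitrary: s)
  case Nil
  then have eq: "s(a := []) = s" by (auto simp: fun_eq_iff)
  show ?case unfolding clear_def eq by (rule runs_mono[OF runs_While_Nil]) (use Nil in auto)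
next
  case (Cons x xs)
  have 2: "runs (Pop a) s (s(a := xs)) 1"
    using runs_Pop[of a s] Cons(2)[symmetric] by simp
  have 3: "runs (clear a) (s(a := xs)) (s(a := [])) (3 * length xs + 1)"
    using Cons(1)[of "s(a := xs)"] by simp
  have "runs (clear a) s (s(a := [])) (1 + (3 * length xs + 1) + 2)"
    unfolding clear_def
    by (rule runs_While[OF _ 2 3[unfolded clear_def]]) (use Cons(2)[symmetric] in auto)
  then show ?case using Cons(2)[symmetric] by (auto elim: runs_mono)
qed

text \<open>Registers are stacks, so a move reverses the word; going through the auxiliary register
  \<open>t\<close> restores the order.\<close>

definition cpy :: "nat \<Rightarrow> nat \<Rightarrow> nat \<Rightarrow> cmd" where "cpy a b t = Seq (mv a t) (mv2 t a b)"

lemma runs_cpy: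
  assumes "distinct [a, b, t]" "s t = []" "s b = []"
  shows "runs (cpy a b t) s (s(b := s a)) (20 * length (s a) + 3)"
  unfolding cpy_def
proof (rule runs_SeqI[OF runs_mv])
  let ?s1 = "s(a := [], t := rev (s a) @ s t)"
  have "?s1(t := [], a := rev (?s1 t) @ ?s1 a, b := rev (?s1 t) @ ?s1 b) = s(b := s a)"
    using assms by (auto simp: fun_eq_iff)
  with runs_mv2[of t a b ?s1] show "runs (mv2 t a b) ?s1 (s(b := s a)) (12 * length (s a) + 1)"
    using assms by simp
qed (use assms in auto)

definition mvv :: "nat \<Rightarrow> nat \<Rightarrow> nat \<Rightarrow> cmd" where "mvv a b t = Seq (mv a t) (mv t b)"

lemma runs_mvv:
  assumes "distinct [a, b, t]" "s t = []" "s b = []"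
  shows "runs (mvv a b t) s (s(a := [], b := s a)) (16 * length (s a) + 3)"
  unfolding mvv_def
proof (rule runs_SeqI[OF runs_mv])
  let ?s1 = "s(a := [], t := rev (s a) @ s t)"
  have "?s1(t := [], b := rev (?s1 t) @ ?s1 b) = s(a := [], b := s a)"
    using assms by (auto simp: fun_eq_iff)
  with runs_mv[of t b ?s1] show "runs (mv t b) ?s1 (s(a := [], b := s a)) (8 * length (s a) + 1)"
    using assms by simp
qed (use assms in auto)

lemma wfc_macros [simp]:
  "wfc k (mv a b) \<longleftrightarrow> a < k \<and> b < k"
  "wfc k (mv2 a b c) \<longleftrightarrow> a < k \<and> b < k \<and> c < k"
  "wfc k (clear a) \<longleftrightarrow> a < k"
  "wfc k (cpy a b t) \<longleftrightarrow> a < k \<and> b < k \<and> t < k"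
  "wfc k (mvv a b t) \<longleftrightarrow> a < k \<and> b < k \<and> t < k"
  by (auto simp: mv_def mv2_def clear_def cpy_def mvv_def)

section \<open>Closure properties of polynomial time on words\<close>

lemma pw_Nil: "pw D (\<lambda>_. [])"
  by (rule pwI[of 1 "clear 0" D _ "\<lambda>n. 3 * n + 1" "\<lambda>_. 0"])
    ((simp; fail) | rule runs_clear | (intro polyb_intros))+

lemma pw_Cons: "pw D (Cons b)"
  by (rule pwI[of 1 "Push b 0" D _ "\<lambda>n. 3" "\<lambda>n. n + 1"])
    ((simp; fail) | rule runs_Push | (intro polyb_intros))+

lemma pw_tl: "pw D tl"
  by (rule pwI[of 1 "Pop 0" D _ "\<lambda>n. 1" "\<lambda>n. n"])
    ((simp; fail) | rule runs_Pop | (intro polyb_intros))+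

lemma pw_id: "pw D (\<lambda>w. w)"
  by (rule pwI[of 1 Skip D _ "\<lambda>n. 0" "\<lambda>n. n"])
    ((simp add: runs_Skip; fail) | (intro polyb_intros))+

lemma pw_comp:
  assumes "pw D f" "pw E g" and DE: "\<And>w. w \<in> D \<Longrightarrow> f w \<in> E"
  shows "pw D (\<lambda>w. g (f w))"
proof -
  from assms(1) obtain cf Kf ef where f: "Kf \<ge> 1" "\<And>K'. Kf \<le> K' \<Longrightarrow> wfc K' cf"
    "\<And>s. (\<And>i. 0 < i \<Longrightarrow> i < Kf \<Longrightarrow> s i = []) \<Longrightarrow> s 0 \<in> D \<Longrightarrow> runs cf s (s(0 := f (s 0))) ((length (s 0) + 2) ^ ef)"
    "\<And>w. w \<in> D \<Longrightarrow> length (f w) \<le> (length w + 2) ^ ef" by (rule pwE) blast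
  from assms(2) obtain cg Kg eg where g: "Kg \<ge> 1" "\<And>K'. Kg \<le> K' \<Longrightarrow> wfc K' cg"
    "\<And>s. (\<And>i. 0 < i \<Longrightarrow> i < Kg \<Longrightarrow> s i = []) \<Longrightarrow> s 0 \<in> E \<Longrightarrow> runs cg s (s(0 := g (s 0))) ((length (s 0) + 2) ^ eg)"
    "\<And>w. w \<in> E \<Longrightarrow> length (g w) \<le> (length w + 2) ^ eg" by (rule pwE) blast
  have b: "(length (f w) + 2) ^ eg \<le> ((length w + 2) ^ ef + 2) ^ eg" if "w \<in> D" for w
    using f(4)[OF that] by (intro power_mono) auto
  show ?thesis
  proof (rule pwI)
    show "1 \<le> max Kf Kg" "wfc (max Kf Kg) (Seq cf cg)" using f g by auto
    show "runs (Seq cf cg) s (s(0 := g (f (s 0)))) ((length (s 0) + 2) ^ ef + ((length (s 0) + 2) ^ ef + 2) ^ eg + 1)"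
      if D: "s 0 \<in> D" and s: "\<And>i. 0 < i \<Longrightarrow> i < max Kf Kg \<Longrightarrow> s i = []" for s
      using s b[OF D] D DE[OF D]
      by (intro runs_SeqI[OF f(3) g(3)[of "s(0 := f (s 0))", simplified]]) auto
    show "length (g (f w)) \<le> ((length w + 2) ^ ef + 2) ^ eg" if "w \<in> D" for w
      using g(4)[OF DE[OF that]] b[OF that] by simp
  qed (intro polyb_intros)+
qed

text \<open>Each bit is pushed before its marker \<open>True\<close>, and popping a reversed word
  delivers the last bit first; so the code appears in the right order on the stack
  \<open>b\<close>.\<close>

lemma runs_loop_enc:
  assumes "a \<noteq> b"
  shows "runs (While a (Seq (Cond a Skip (Push False b) (Push True b)) (Seq (Push True b) (Pop a)))) s
    (s(a := [], b := concat (map (\<lambda>x. [True, x]) (rev (s a))) @ s b)) (12 * length (s a) + 1)"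
proof (induction "s a" arbitrary: s)
  case Nil
  then have eq: "s(a := [], b := concat (map (\<lambda>x. [True, x]) (rev (s a))) @ s b) = s" by (auto simp: fun_eq_iff)
  show ?case unfolding eq by (rule runs_mono[OF runs_While_Nil]) (use Nil in auto)
next
  case (Cons x xs)
  let ?s1 = "s(b := x # s b)" and ?s2 = "s(b := True # x # s b)" and ?s3 = "s(b := True # x # s b, a := xs)"
  have 1: "runs (Cond a Skip (Push False b) (Push True b)) s ?s1 (Suc 3)"
    by (rule runs_Cond) (use runs_Push[of x b s] Cons(2) in \<open>cases x; simp add: Cons(2)[symmetric]\<close>)
  have 2: "runs (Push True b) ?s1 ?s2 3" using runs_Push[of True b ?s1] by simp
  have 3: "runs (Pop a) ?s2 ?s3 1"
    using runs_Pop[of a ?s2] Cons(2)[symmetric] assms by simp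
  let ?t = "\<lambda>s. s(a := [], b := concat (map (\<lambda>x. [True, x]) (rev (s a))) @ s b)"
  have eq: "?t ?s3 = ?t s"
    using assms Cons(2)[symmetric] by (auto simp: fun_eq_iff)
  have 4: "runs (While a (Seq (Cond a Skip (Push False b) (Push True b)) (Seq (Push True b) (Pop a)))) ?s3
      (?t ?s3) (12 * length xs + 1)"
    using Cons(1)[of ?s3] by simp
  have "runs (While a (Seq (Cond a Skip (Push False b) (Push True b)) (Seq (Push True b) (Pop a)))) s
      (?t ?s3) (10 + (12 * length xs + 1) + 2)"
    by (rule runs_While[OF _ runs_SeqI[OF 1 runs_SeqI[OF 2 3 order_refl]] 4])
      (use Cons(2)[symmetric] in auto)
  then show ?case unfolding eq using Cons(2)[symmetric] by (auto elim: runs_mono)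
qed

definition wpair :: "bool list \<Rightarrow> bool list \<Rightarrow> bool list" where
  "wpair a b = enc_word a @ b"

lemma length_enc_word [simp]: "length (enc_word w) = 2 * length w + 1"
  by (simp add: enc_word_def length_concat comp_def sum_list_triv)

lemma pw_pair:
  assumes "pw D f" "pw D g"
  shows "pw D (\<lambda>w. wpair (f w) (g w))"
proof -
  from assms(1) obtain cf Kf ef where f: "Kf \<ge> 1" "\<And>K'. Kf \<le> K' \<Longrightarrow> wfc K' cf"
    "\<And>s. (\<And>i. 0 < i \<Longrightarrow> i < Kf \<Longrightarrow> s i = []) \<Longrightarrow> s 0 \<in> D \<Longrightarrow> runs cf s (s(0 := f (s 0))) ((length (s 0) + 2) ^ ef)"
    "\<And>w. w \<in> D \<Longrightarrow> length (f w) \<le> (length w + 2) ^ ef" by (rule pwE) blast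
  from assms(2) obtain cg Kg eg where g: "Kg \<ge> 1" "\<And>K'. Kg \<le> K' \<Longrightarrow> wfc K' cg"
    "\<And>s. (\<And>i. 0 < i \<Longrightarrow> i < Kg \<Longrightarrow> s i = []) \<Longrightarrow> s 0 \<in> D \<Longrightarrow> runs cg s (s(0 := g (s 0))) ((length (s 0) + 2) ^ eg)"
    "\<And>w. w \<in> D \<Longrightarrow> length (g w) \<le> (length w + 2) ^ eg" by (rule pwE) blast
  define K where "K = max Kf Kg"
  have K: "Kf \<le> K" "Kg \<le> K" "1 \<le> K" "K \<noteq> 0" using f(1) by (auto simp: K_def)
  define L where "L = While (K+1) (Seq (Cond (K+1) Skip (Push False 0) (Push True 0)) (Seq (Push True 0) (Pop (K+1))))"
  \<comment> \<open>Register \<open>K\<close> keeps the input for \<open>cg\<close>,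
    \<open>K+1\<close> the reversed result of \<open>cf\<close>, and \<open>K+2\<close> is
    auxiliary. The reversal is what lets \<open>L\<close> encode by pushing.\<close>
  define c where "c = Seq (cpy 0 K (K+1)) (Seq cf (Seq (mv 0 (K+1)) (Seq (mvv K 0 (K+2)) (Seq cg (Seq (Push False 0) L)))))"
  show ?thesis
  proof (rule pwI)
    show "1 \<le> K + 3" "wfc (K+3) c" using K f(2)[of "K+3"] g(2)[of "K+3"] by (auto simp: c_def L_def)
    fix s :: "nat \<Rightarrow> bool list" assume D: "s 0 \<in> D" and s: "\<And>i. 0 < i \<Longrightarrow> i < K + 3 \<Longrightarrow> s i = []"
    let ?w = "s 0" let ?n = "length (s 0)"
    have 1: "runs (cpy 0 K (K+1)) s (s(K := ?w)) (20 * ?n + 3)"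
      by (rule runs_cpy) (use K s in auto)
    have 2: "runs cf (s(K := ?w)) (s(K := ?w, 0 := f ?w)) ((?n + 2) ^ ef)"
      using f(3)[of "s(K := ?w)"] K s D by simp
    let ?s3 = "s(K := ?w, 0 := [], K+1 := rev (f ?w))"
    have 3: "runs (mv 0 (K+1)) (s(K := ?w, 0 := f ?w)) ?s3 (8 * (?n + 2) ^ ef + 1)"
      using runs_mv[of 0 "K+1" "s(K := ?w, 0 := f ?w)"] K s f(4)[OF D] by (auto elim!: runs_mono)
    let ?s4 = "s(K+1 := rev (f ?w))"
    have "?s3(K := [], 0 := ?w) = ?s4" using K s by (auto simp: fun_eq_iff)
    then have 4: "runs (mvv K 0 (K+2)) ?s3 ?s4 (16 * ?n + 3)"
      using runs_mvv[of K 0 "K+2" ?s3] K s by simp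
    let ?s5 = "s(K+1 := rev (f ?w), 0 := g ?w)"
    have 5: "runs cg ?s4 ?s5 ((?n + 2) ^ eg)"
      using g(3)[of ?s4] K s D by simp
    let ?s6 = "s(K+1 := rev (f ?w), 0 := False # g ?w)"
    have 6: "runs (Push False 0) ?s5 ?s6 3" using runs_Push[of False 0 ?s5] by simp
    have "?s6(K + 1 := [], 0 := concat (map (\<lambda>x. [True, x]) (f ?w)) @ False # g ?w) = s(0 := wpair (f ?w) (g ?w))"
      using K s by (auto simp: fun_eq_iff wpair_def enc_word_def)
    then have 7: "runs L ?s6 (s(0 := wpair (f ?w) (g ?w))) (12 * (?n + 2) ^ ef + 1)"
      unfolding L_def using runs_loop_enc[of "K+1" 0 ?s6] f(4)[OF D] K by (auto elim!: runs_mono)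
    show "runs c s (s(0 := wpair (f ?w) (g ?w)))
       ((20 * ?n + 3) + (((?n + 2) ^ ef) + ((8 * (?n + 2) ^ ef + 1) + ((16 * ?n + 3) + ((?n + 2) ^ eg + (3 + (12 * (?n + 2) ^ ef + 1) + 1) + 1) + 1) + 1) + 1) + 1)"
      unfolding c_def by (intro runs_Seq[OF 1] runs_Seq[OF 2] runs_Seq[OF 3] runs_Seq[OF 4] runs_Seq[OF 5] runs_Seq[OF 6] 7)
  next
    show "length (wpair (f w) (g w)) \<le> 2 * (length w + 2) ^ ef + 1 + (length w + 2) ^ eg" if "w \<in> D" for w
      using f(4)[OF that] g(4)[OF that] by (simp add: wpair_def)
  qed (intro polyb_intros)+
qed

lemma pw_case:
  assumes "pw D t" "pw D f" "pw D g" "pw D h"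
  shows "pw D (\<lambda>w. case t w of [] \<Rightarrow> f w | b # _ \<Rightarrow> if b then g w else h w)"
proof -
  from assms(1) obtain ct Kt et where t: "Kt \<ge> 1" "\<And>K'. Kt \<le> K' \<Longrightarrow> wfc K' ct"
    "\<And>s. (\<And>i. 0 < i \<Longrightarrow> i < Kt \<Longrightarrow> s i = []) \<Longrightarrow> s 0 \<in> D \<Longrightarrow> runs ct s (s(0 := t (s 0))) ((length (s 0) + 2) ^ et)"
    "\<And>w. w \<in> D \<Longrightarrow> length (t w) \<le> (length w + 2) ^ et" by (rule pwE) blast
  from assms(2) obtain cf Kf ef where f: "Kf \<ge> 1" "\<And>K'. Kf \<le> K' \<Longrightarrow> wfc K' cf"
    "\<And>s. (\<And>i. 0 < i \<Longrightarrow> i < Kf \<Longrightarrow> s i = []) \<Longrightarrow> s 0 \<in> D \<Longrightarrow> runs cf s (s(0 := f (s 0))) ((length (s 0) + 2) ^ ef)"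
    "\<And>w. w \<in> D \<Longrightarrow> length (f w) \<le> (length w + 2) ^ ef" by (rule pwE) blast
  from assms(3) obtain cg Kg eg where g: "Kg \<ge> 1" "\<And>K'. Kg \<le> K' \<Longrightarrow> wfc K' cg"
    "\<And>s. (\<And>i. 0 < i \<Longrightarrow> i < Kg \<Longrightarrow> s i = []) \<Longrightarrow> s 0 \<in> D \<Longrightarrow> runs cg s (s(0 := g (s 0))) ((length (s 0) + 2) ^ eg)"
    "\<And>w. w \<in> D \<Longrightarrow> length (g w) \<le> (length w + 2) ^ eg" by (rule pwE) blast
  from assms(4) obtain ch Kh eh where h: "Kh \<ge> 1" "\<And>K'. Kh \<le> K' \<Longrightarrow> wfc K' ch"
    "\<And>s. (\<And>i. 0 < i \<Longrightarrow> i < Kh \<Longrightarrow> s i = []) \<Longrightarrow> s 0 \<in> D \<Longrightarrow> runs ch s (s(0 := h (s 0))) ((length (s 0) + 2) ^ eh)"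
    "\<And>w. w \<in> D \<Longrightarrow> length (h w) \<le> (length w + 2) ^ eh" by (rule pwE) blast
  define K where "K = max (max Kt Kf) (max Kg Kh)"
  have K: "Kt \<le> K" "Kf \<le> K" "Kg \<le> K" "Kh \<le> K" "1 \<le> K" "K \<noteq> 0" using f(1) by (auto simp: K_def)
  \<comment> \<open>Each branch first replaces the result of the test by the saved input.\<close>
  define B where "B x = Seq (clear 0) (Seq (mvv K 0 (K+1)) x)" for x
  define c where "c = Seq (cpy 0 K (K+1)) (Seq ct (Cond 0 (B cf) (B ch) (B cg)))"
  let ?r = "\<lambda>w. case t w of [] \<Rightarrow> f w | b # _ \<Rightarrow> if b then g w else h w"
  show ?thesis
  proof (rule pwI)
    show "1 \<le> K + 2" "wfc (K+2) c" using K t(2)[of "K+2"] f(2)[of "K+2"] g(2)[of "K+2"] h(2)[of "K+2"]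
      by (auto simp: c_def B_def)
    fix s :: "nat \<Rightarrow> bool list" assume D: "s 0 \<in> D" and s: "\<And>i. 0 < i \<Longrightarrow> i < K + 2 \<Longrightarrow> s i = []"
    let ?w = "s 0" let ?n = "length (s 0)"
    have 1: "runs (cpy 0 K (K+1)) s (s(K := ?w)) (20 * ?n + 3)"
      by (rule runs_cpy) (use K s in auto)
    let ?s2 = "s(K := ?w, 0 := t ?w)"
    have 2: "runs ct (s(K := ?w)) ?s2 ((?n + 2) ^ et)"
      using t(3)[of "s(K := ?w)"] K s D by simp
    have 3: "runs (clear 0) ?s2 (s(K := ?w, 0 := [])) (3 * (?n + 2) ^ et + 1)"
      using runs_clear[of 0 ?s2] t(4)[OF D] by (auto elim!: runs_mono)
    have "(s(K := ?w, 0 := []))(K := [], 0 := ?w) = s" using K s by (auto simp: fun_eq_iff)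
    then have 4: "runs (mvv K 0 (K+1)) (s(K := ?w, 0 := [])) s (16 * ?n + 3)"
      using runs_mvv[of K 0 "K+1" "s(K := ?w, 0 := [])"] K s by simp
    let ?T = "(3 * (?n + 2) ^ et + 1) + ((16 * ?n + 3) + ((?n + 2) ^ ef + (?n + 2) ^ eg + (?n + 2) ^ eh) + 1) + 1"
    have B: "runs (B x) ?s2 s' ?T" if "runs x s s' ((?n + 2) ^ ef + (?n + 2) ^ eg + (?n + 2) ^ eh)" for x s'
      unfolding B_def by (intro runs_Seq[OF 3] runs_Seq[OF 4] that)
    have F: "runs cf s (s(0 := f ?w)) ((?n + 2) ^ ef + (?n + 2) ^ eg + (?n + 2) ^ eh)"
      by (rule runs_mono[OF f(3)]) (use s K D in auto)
    have G: "runs cg s (s(0 := g ?w)) ((?n + 2) ^ ef + (?n + 2) ^ eg + (?n + 2) ^ eh)"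
      by (rule runs_mono[OF g(3)]) (use s K D in auto)
    have H: "runs ch s (s(0 := h ?w)) ((?n + 2) ^ ef + (?n + 2) ^ eg + (?n + 2) ^ eh)"
      by (rule runs_mono[OF h(3)]) (use s K D in auto)
    have 5: "runs (Cond 0 (B cf) (B ch) (B cg)) ?s2 (s(0 := ?r ?w)) (Suc ?T)"
      by (rule runs_Cond) (use B[OF F] B[OF G] B[OF H] in \<open>auto split: list.splits\<close>)
    show "runs c s (s(0 := ?r ?w)) ((20 * ?n + 3) + ((?n + 2) ^ et + (?T + 1) + 1) + 1)"
      unfolding c_def using runs_Seq[OF 1 runs_Seq[OF 2 5]] by simp
  next
    show "length (?r w) \<le> (length w + 2) ^ ef + (length w + 2) ^ eg + (length w + 2) ^ eh" if "w \<in> D" for w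
      using f(4)[OF that] g(4)[OF that] h(4)[OF that] by (auto split: list.splits)
  qed (intro polyb_intros)+
qed

lemma runs_iterate:
  assumes "\<And>s. (\<And>i. 0 < i \<Longrightarrow> i < K \<Longrightarrow> s i = []) \<Longrightarrow> s 0 \<in> E \<Longrightarrow> runs c s (s(0 := F (s 0))) ((length (s 0) + 2) ^ e)"
    and E: "\<And>w. w \<in> E \<Longrightarrow> F w \<in> E"
    and "a \<ge> K" "a \<noteq> 0"
  shows "s 0 \<in> E \<Longrightarrow> (\<And>i. 0 < i \<Longrightarrow> i < K \<Longrightarrow> s i = []) \<Longrightarrow> (\<And>n. n < length (s a) \<Longrightarrow> length ((F ^^ n) (s 0)) \<le> B) \<Longrightarrow>
    runs (While a (Seq (Pop a) c)) s (s(a := [], 0 := (F ^^ length (s a)) (s 0)))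
      (length (s a) * ((B + 2) ^ e + 4) + 1)"
proof (induction "s a" arbitrary: s)
  case Nil
  then have eq: "s(a := [], 0 := (F ^^ length (s a)) (s 0)) = s" by (auto simp: fun_eq_iff)
  show ?case unfolding eq by (rule runs_mono[OF runs_While_Nil]) (use Nil in auto)
next
  case (Cons x xs)
  have sa: "s a = x # xs" using Cons(2) by simp
  let ?s1 = "s(a := xs)" and ?s2 = "s(a := xs, 0 := F (s 0))"
  have 1: "runs (Pop a) s ?s1 1" using runs_Pop[of a s] sa by simp
  have "runs c ?s1 ?s2 ((length (s 0) + 2) ^ e)"
    using assms(1)[of ?s1] Cons(3,4) assms(3,4) by simp
  moreover have "(length (s 0) + 2) ^ e \<le> (B + 2) ^ e" using Cons(5)[of 0] sa by (intro power_mono) auto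
  ultimately have 2: "runs c ?s1 ?s2 ((B + 2) ^ e)" by (rule runs_mono)
  have "length ((F ^^ n) (F (s 0))) \<le> B" if "n < length xs" for n
    using Cons(5)[of "Suc n"] that sa by (simp add: funpow_Suc_right del: funpow.simps)
  then have 3: "runs (While a (Seq (Pop a) c)) ?s2 (?s2(a := [], 0 := (F ^^ length xs) (F (s 0)))) (length xs * ((B + 2) ^ e + 4) + 1)"
    using Cons(1)[of ?s2] Cons(3,4) E assms(3,4) by simp
  have eq: "?s2(a := [], 0 := (F ^^ length xs) (F (s 0))) = s(a := [], 0 := (F ^^ length (s a)) (s 0))"
    using sa by (auto simp: fun_eq_iff funpow_Suc_right simp del: funpow.simps)
  have "runs (While a (Seq (Pop a) c)) s (?s2(a := [], 0 := (F ^^ length xs) (F (s 0))))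
    ((1 + (B + 2) ^ e + 1) + (length xs * ((B + 2) ^ e + 4) + 1) + 2)"
    by (rule runs_While[OF _ runs_Seq[OF 1 2] 3]) (use sa in auto)
  then show ?case unfolding eq using sa by (auto elim: runs_mono)
qed

text \<open>Iteration may square the length in every round, so a polynomial bound on all
  intermediate results is a hypothesis. The word \<open>t w\<close> serves as a unary
  counter.\<close>

lemma pw_iterate:
  assumes "pw E F" "pw D t" "pw D g"
    and E: "\<And>w. w \<in> D \<Longrightarrow> g w \<in> E" "\<And>w. w \<in> E \<Longrightarrow> F w \<in> E"
    and b: "\<And>w n. w \<in> D \<Longrightarrow> n \<le> length (t w) \<Longrightarrow> length ((F ^^ n) (g w)) \<le> (length w + 2) ^ b"
  shows "pw D (\<lambda>w. (F ^^ length (t w)) (g w))"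
proof -
  from assms(1) obtain cf Kf ef where f: "Kf \<ge> 1" "\<And>K'. Kf \<le> K' \<Longrightarrow> wfc K' cf"
    "\<And>s. (\<And>i. 0 < i \<Longrightarrow> i < Kf \<Longrightarrow> s i = []) \<Longrightarrow> s 0 \<in> E \<Longrightarrow> runs cf s (s(0 := F (s 0))) ((length (s 0) + 2) ^ ef)"
    "\<And>w. w \<in> E \<Longrightarrow> length (F w) \<le> (length w + 2) ^ ef" by (rule pwE) blast
  from assms(2) obtain ct Kt et where t: "Kt \<ge> 1" "\<And>K'. Kt \<le> K' \<Longrightarrow> wfc K' ct"
    "\<And>s. (\<And>i. 0 < i \<Longrightarrow> i < Kt \<Longrightarrow> s i = []) \<Longrightarrow> s 0 \<in> D \<Longrightarrow> runs ct s (s(0 := t (s 0))) ((length (s 0) + 2) ^ et)"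
    "\<And>w. w \<in> D \<Longrightarrow> length (t w) \<le> (length w + 2) ^ et" by (rule pwE) blast
  from assms(3) obtain cg Kg eg where g: "Kg \<ge> 1" "\<And>K'. Kg \<le> K' \<Longrightarrow> wfc K' cg"
    "\<And>s. (\<And>i. 0 < i \<Longrightarrow> i < Kg \<Longrightarrow> s i = []) \<Longrightarrow> s 0 \<in> D \<Longrightarrow> runs cg s (s(0 := g (s 0))) ((length (s 0) + 2) ^ eg)"
    "\<And>w. w \<in> D \<Longrightarrow> length (g w) \<le> (length w + 2) ^ eg" by (rule pwE) blast
  define K where "K = max (max Kf Kt) Kg"
  have K: "Kf \<le> K" "Kt \<le> K" "Kg \<le> K" "1 \<le> K" "K \<noteq> 0" using f(1) by (auto simp: K_def)
  define L where "L = While (K+1) (Seq (Pop (K+1)) cf)"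
  define c where "c = Seq (cpy 0 K (K+1)) (Seq ct (Seq (mv 0 (K+1)) (Seq (mvv K 0 (K+2)) (Seq cg L))))"
  show ?thesis
  proof (rule pwI)
    show "1 \<le> K + 3" "wfc (K+3) c" using K f(2)[of "K+3"] t(2)[of "K+3"] g(2)[of "K+3"] by (auto simp: c_def L_def)
    fix s :: "nat \<Rightarrow> bool list" assume D: "s 0 \<in> D" and s: "\<And>i. 0 < i \<Longrightarrow> i < K + 3 \<Longrightarrow> s i = []"
    let ?w = "s 0" let ?n = "length (s 0)"
    have 1: "runs (cpy 0 K (K+1)) s (s(K := ?w)) (20 * ?n + 3)"
      by (rule runs_cpy) (use K s in auto)
    have 2: "runs ct (s(K := ?w)) (s(K := ?w, 0 := t ?w)) ((?n + 2) ^ et)"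
      using t(3)[of "s(K := ?w)"] K s D by simp
    let ?s3 = "s(K := ?w, 0 := [], K+1 := rev (t ?w))"
    have 3: "runs (mv 0 (K+1)) (s(K := ?w, 0 := t ?w)) ?s3 (8 * (?n + 2) ^ et + 1)"
      using runs_mv[of 0 "K+1" "s(K := ?w, 0 := t ?w)"] K s t(4)[OF D] by (auto elim!: runs_mono)
    let ?s4 = "s(K+1 := rev (t ?w))"
    have "?s3(K := [], 0 := ?w) = ?s4" using K s by (auto simp: fun_eq_iff)
    then have 4: "runs (mvv K 0 (K+2)) ?s3 ?s4 (16 * ?n + 3)"
      using runs_mvv[of K 0 "K+2" ?s3] K s by simp
    let ?s5 = "s(K+1 := rev (t ?w), 0 := g ?w)"
    have 5: "runs cg ?s4 ?s5 ((?n + 2) ^ eg)"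
      using g(3)[of ?s4] K s D by simp
    let ?r = "(F ^^ length (t ?w)) (g ?w)" and ?B = "(?n + 2) ^ b"
    have eq: "?s5(K + 1 := [], 0 := (F ^^ length (?s5 (K + 1))) (?s5 0)) = s(0 := ?r)"
      using K s by (auto simp: fun_eq_iff)
    have "runs L ?s5 (?s5(K + 1 := [], 0 := (F ^^ length (?s5 (K + 1))) (?s5 0)))
        (length (?s5 (K + 1)) * ((?B + 2) ^ ef + 4) + 1)"
      unfolding L_def by (rule runs_iterate[OF f(3) E(2)]) (use K s b D E(1) in auto)
    then have 6: "runs L ?s5 (s(0 := ?r)) ((?n + 2) ^ et * ((?B + 2) ^ ef + 4) + 1)"
      unfolding eq by (rule runs_mono) (use t(4)[OF D] K in \<open>auto intro!: mult_right_mono\<close>)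
    show "runs c s (s(0 := ?r))
       ((20 * ?n + 3) + (((?n + 2) ^ et) + ((8 * (?n + 2) ^ et + 1) + ((16 * ?n + 3) + ((?n + 2) ^ eg + ((?n + 2) ^ et * (((?n + 2) ^ b + 2) ^ ef + 4) + 1) + 1) + 1) + 1) + 1) + 1)"
      unfolding c_def by (intro runs_Seq[OF 1] runs_Seq[OF 2] runs_Seq[OF 3] runs_Seq[OF 4] runs_Seq[OF 5] 6)
  next
    show "length ((F ^^ length (t w)) (g w)) \<le> (length w + 2) ^ b" if "w \<in> D" for w using b that by simp
  qed (intro polyb_intros)+
qed

text \<open>The inverse of \<open>wpair\<close>; the last equation gives words without an end marker
  a default value.\<close>

fun wsplit :: "bool list \<Rightarrow> bool list \<times> bool list" where
  "wsplit (True # b # w) = (b # fst (wsplit w), snd (wsplit w))"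
| "wsplit (False # w) = ([], w)"
| "wsplit _ = ([], [])"

lemma wsplit_enc_word [simp]: "wsplit (enc_word a @ b) = (a, b)"
  by (induction a) (auto simp: enc_word_def)

lemma length_wsplit: "length (fst (wsplit w)) \<le> length w \<and> length (snd (wsplit w)) \<le> length w"
  by (induction w rule: wsplit.induct) auto

text \<open>Register 2 is a flag that keeps the loop running; it is popped at the end marker or when
  the input ends prematurely.\<close>

definition split_loop :: cmd where
  "split_loop = While 2 (Cond 0 (Pop 2) (Seq (Pop 0) (Pop 2))
     (Seq (Pop 0) (Cond 0 (Pop 2) (Seq (Pop 0) (Push False 1)) (Seq (Pop 0) (Push True 1)))))"

lemma runs_split_loop:
  "s 2 = [True] \<Longrightarrow> runs split_loop s
    (s(0 := snd (wsplit (s 0)), 1 := rev (fst (wsplit (s 0))) @ s 1, 2 := [])) (11 * length (s 0) + 12)"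
proof (induction "s 0" arbitrary: s rule: wsplit.induct)
  case (1 b w)
  have s0: "s 0 = True # b # w" using 1(3) by simp
  let ?s1 = "s(0 := b # w)" and ?s2 = "s(0 := w)" and ?s3 = "s(0 := w, 1 := b # s 1)"
  have a: "runs (Pop 0) s ?s1 1" using runs_Pop[of 0 s] s0 by simp
  have b: "runs (Pop 0) ?s1 ?s2 1" using runs_Pop[of 0 ?s1] by simp
  have c: "runs (Push b 1) ?s2 ?s3 3" using runs_Push[of b 1 ?s2] by simp
  have d: "runs (Cond 0 (Pop 2) (Seq (Pop 0) (Push False 1)) (Seq (Pop 0) (Push True 1))) ?s1 ?s3 (Suc 5)"
    by (rule runs_Cond) (use runs_SeqI[OF b c, of 5] in \<open>cases b; simp\<close>)
  have e: "runs (Cond 0 (Pop 2) (Seq (Pop 0) (Pop 2))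
     (Seq (Pop 0) (Cond 0 (Pop 2) (Seq (Pop 0) (Push False 1)) (Seq (Pop 0) (Push True 1))))) s ?s3 (Suc 8)"
    by (rule runs_Cond) (use runs_SeqI[OF a d, of 8] s0 in simp)
  let ?t = "\<lambda>s. s(0 := snd (wsplit (s 0)), 1 := rev (fst (wsplit (s 0))) @ s 1, 2 := [])"
  have f: "runs split_loop ?s3 (?t ?s3) (11 * length w + 12)" using 1(1)[of ?s3] 1(4) by simp
  have eq: "?t ?s3 = ?t s" using s0 by (auto simp: fun_eq_iff)
  have "runs split_loop s (?t ?s3) (Suc 8 + (11 * length w + 12) + 2)"
    unfolding split_loop_def by (rule runs_While[OF _ e f[unfolded split_loop_def]]) (use 1(4) in simp)
  then show ?case unfolding eq using s0 by (auto elim: runs_mono)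
next
  case (2 w)
  have s0: "s 0 = False # w" using 2(1) by simp
  let ?s1 = "s(0 := w)" and ?s2 = "s(0 := w, 2 := [])"
  have a: "runs (Pop 0) s ?s1 1" using runs_Pop[of 0 s] s0 by simp
  have b: "runs (Pop 2) ?s1 ?s2 1" using runs_Pop[of 2 ?s1] 2(2) by simp
  have e: "runs (Cond 0 (Pop 2) (Seq (Pop 0) (Pop 2))
     (Seq (Pop 0) (Cond 0 (Pop 2) (Seq (Pop 0) (Push False 1)) (Seq (Pop 0) (Push True 1))))) s ?s2 (Suc 3)"
    by (rule runs_Cond) (use runs_SeqI[OF a b, of 3] s0 in simp)
  have r: "runs split_loop s ?s2 (Suc 3 + 1 + 2)"
    unfolding split_loop_def by (rule runs_While[OF _ e runs_While_Nil]) (use 2(2) in auto)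
  have eq: "?s2 = s(0 := snd (wsplit (s 0)), 1 := rev (fst (wsplit (s 0))) @ s 1, 2 := [])"
    using s0 by (auto simp: fun_eq_iff)
  from r show ?case unfolding eq by (rule runs_mono) simp
next
  case "3_1"
  let ?s2 = "s(2 := [])"
  have e: "runs (Cond 0 (Pop 2) (Seq (Pop 0) (Pop 2))
     (Seq (Pop 0) (Cond 0 (Pop 2) (Seq (Pop 0) (Push False 1)) (Seq (Pop 0) (Push True 1))))) s ?s2 (Suc 1)"
    by (rule runs_Cond) (use runs_Pop[of 2 s] "3_1" in \<open>simp add: "3_1"(1)[symmetric]\<close>)
  have r: "runs split_loop s ?s2 (Suc 1 + 1 + 2)"
    unfolding split_loop_def by (rule runs_While[OF _ e runs_While_Nil]) (use "3_1"(2) in auto)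
  have eq: "?s2 = s(0 := snd (wsplit (s 0)), 1 := rev (fst (wsplit (s 0))) @ s 1, 2 := [])"
    using "3_1"(1)[symmetric] by (auto simp: fun_eq_iff)
  from r show ?case unfolding eq by (rule runs_mono) simp
next
  case "3_2"
  have s0: "s 0 = [True]" using "3_2"(1) by simp
  let ?s1 = "s(0 := [])" and ?s2 = "s(0 := [], 2 := [])"
  have a: "runs (Pop 0) s ?s1 1" using runs_Pop[of 0 s] s0 by simp
  have b: "runs (Pop 2) ?s1 ?s2 1" using runs_Pop[of 2 ?s1] "3_2"(2) by simp
  have d: "runs (Cond 0 (Pop 2) (Seq (Pop 0) (Push False 1)) (Seq (Pop 0) (Push True 1))) ?s1 ?s2 (Suc 1)"
    by (rule runs_Cond) (use b in simp)
  have e: "runs (Cond 0 (Pop 2) (Seq (Pop 0) (Pop 2))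
     (Seq (Pop 0) (Cond 0 (Pop 2) (Seq (Pop 0) (Push False 1)) (Seq (Pop 0) (Push True 1))))) s ?s2 (Suc 4)"
    by (rule runs_Cond) (use runs_SeqI[OF a d, of 4] s0 in simp)
  have r: "runs split_loop s ?s2 (Suc 4 + 1 + 2)"
    unfolding split_loop_def by (rule runs_While[OF _ e runs_While_Nil]) (use "3_2"(2) in auto)
  have eq: "?s2 = s(0 := snd (wsplit (s 0)), 1 := rev (fst (wsplit (s 0))) @ s 1, 2 := [])"
    using s0 by (auto simp: fun_eq_iff)
  from r show ?case unfolding eq by (rule runs_mono) simp
qed

lemma pw_wfst: "pw D (\<lambda>w. fst (wsplit w))"
proof (rule pwI)
  let ?c = "Seq (Push True 2) (Seq split_loop (Seq (clear 0) (mv 1 0)))"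
  show "1 \<le> (3::nat)" "wfc 3 ?c" by (auto simp: split_loop_def)
  fix s :: "nat \<Rightarrow> bool list" assume s: "\<And>i. 0 < i \<Longrightarrow> i < 3 \<Longrightarrow> s i = []"
  let ?w = "s 0" let ?n = "length (s 0)"
  let ?s1 = "s(2 := [True])" and ?s2 = "s(0 := snd (wsplit ?w), 1 := rev (fst (wsplit ?w)))"
  have 1: "runs (Push True 2) s ?s1 3" using runs_Push[of True 2 s] s by simp
  have "?s1(0 := snd (wsplit (?s1 0)), 1 := rev (fst (wsplit (?s1 0))) @ ?s1 1, 2 := []) = ?s2"
    using s by (auto simp: fun_eq_iff)
  then have 2: "runs split_loop ?s1 ?s2 (11 * ?n + 12)" using runs_split_loop[of ?s1] by simp
  have 3: "runs (clear 0) ?s2 (?s2(0 := [])) (3 * ?n + 1)"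
    using runs_clear[of 0 ?s2] length_wsplit[of ?w] by (auto elim!: runs_mono)
  have "(?s2(0 := []))(1 := [], 0 := fst (wsplit ?w)) = s(0 := fst (wsplit ?w))"
    using s by (auto simp: fun_eq_iff)
  then have 4: "runs (mv 1 0) (?s2(0 := [])) (s(0 := fst (wsplit ?w))) (8 * ?n + 1)"
    using runs_mv[of 1 0 "?s2(0 := [])"] length_wsplit[of ?w] by (auto elim!: runs_mono)
  show "runs ?c s (s(0 := fst (wsplit ?w))) (3 + ((11 * ?n + 12) + ((3 * ?n + 1) + (8 * ?n + 1) + 1) + 1) + 1)"
    by (intro runs_Seq[OF 1] runs_Seq[OF 2] runs_Seq[OF 3] 4)
next
  show "length (fst (wsplit w)) \<le> length w" for w using length_wsplit by simp
qed (intro polyb_intros)+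

lemma pw_wsnd: "pw D (\<lambda>w. snd (wsplit w))"
proof (rule pwI)
  let ?c = "Seq (Push True 2) (Seq split_loop (clear 1))"
  show "1 \<le> (3::nat)" "wfc 3 ?c" by (auto simp: split_loop_def)
  fix s :: "nat \<Rightarrow> bool list" assume s: "\<And>i. 0 < i \<Longrightarrow> i < 3 \<Longrightarrow> s i = []"
  let ?w = "s 0" let ?n = "length (s 0)"
  let ?s1 = "s(2 := [True])" and ?s2 = "s(0 := snd (wsplit ?w), 1 := rev (fst (wsplit ?w)))"
  have 1: "runs (Push True 2) s ?s1 3" using runs_Push[of True 2 s] s by simp
  have "?s1(0 := snd (wsplit (?s1 0)), 1 := rev (fst (wsplit (?s1 0))) @ ?s1 1, 2 := []) = ?s2"
    using s by (auto simp: fun_eq_iff)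
  then have 2: "runs split_loop ?s1 ?s2 (11 * ?n + 12)" using runs_split_loop[of ?s1] by simp
  have "?s2(1 := []) = s(0 := snd (wsplit ?w))" using s by (auto simp: fun_eq_iff)
  then have 3: "runs (clear 1) ?s2 (s(0 := snd (wsplit ?w))) (3 * ?n + 1)"
    using runs_clear[of 1 ?s2] length_wsplit[of ?w] by (auto elim!: runs_mono)
  show "runs ?c s (s(0 := snd (wsplit ?w))) (3 + ((11 * ?n + 12) + (3 * ?n + 1) + 1) + 1)"
    by (intro runs_Seq[OF 1] runs_Seq[OF 2] 3)
next
  show "length (snd (wsplit w)) \<le> length w" for w using length_wsplit by simp
qed (intro polyb_intros)+

lemma pw_const: "pw D (\<lambda>_. c)"
  by (induction c) (auto intro: pw_Nil pw_comp[OF _ pw_Cons[of UNIV]])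

text \<open>\<open>halts_with\<close> fixes the whole output tape, whereas a register may carry
  garbage to the left of its head. The result is therefore copied to the blank tape
  \<open>K\<close>.\<close>

definition out_loop :: "nat \<Rightarrow> cmd" where
  "out_loop K = While 0 (Seq (Cond 0 Skip (Act K (Some 1) Right) (Act K (Some 2) Right)) (Pop 0))"

lemma gstep_While_run:
  assumes "read_tape (ts ! r) \<noteq> 0" "r < length ts" "(gstep ^^ n) (c, ts) = (Skip, ts1)"
    "(gstep ^^ m) (While r c, ts1) = (Skip, ts2)"
  shows "\<exists>l\<le>n + m + 2. (gstep ^^ l) (While r c, ts) = (Skip, ts2)"
proof -
  obtain l where l: "l \<le> Suc n" "(gstep ^^ l) (Seq c (While r c), ts) = (While r c, ts1)"
    using gstep_Seq_run[OF assms(3)] by blast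
  have "gstep (While r c, ts) = (Seq c (While r c), ts)" using assms(1,2) by (simp add: gstep_def)
  then have "(gstep ^^ (m + Suc l)) (While r c, ts) = (Skip, ts2)"
    using l(2) assms(4) by (simp add: funpow_add funpow_Suc_right del: funpow.simps)
  then show ?thesis using l(1) by (intro exI[of _ "m + Suc l"]) auto
qed

lemma out_loop_run:
  assumes "K \<ge> 1"
  shows "length ts = Suc K \<Longrightarrow> holds_word y (ts ! 0) \<Longrightarrow> ts ! K = (tape_contents u, int (length u)) \<Longrightarrow>
    \<exists>m\<le>7 * length y + 1. \<exists>ts'. (gstep ^^ m) (out_loop K, ts) = (Skip, ts') \<and> length ts' = Suc K \<and>
      fst (ts' ! K) = tape_contents (u @ y)"
proof (induction y arbitrary: ts u)
  case Nil
  have "gstep (out_loop K, ts) = (Skip, ts)"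
    using read_holds[OF Nil(2)] Nil(1) by (simp add: gstep_def out_loop_def)
  then show ?case using Nil by (intro exI[of _ 1]) auto
next
  case (Cons b y)
  let ?b = "if b then 2 else (1::nat)"
  have rd: "read_tape (ts ! 0) = ?b" using read_holds[OF Cons(3)] by simp
  then have nz: "read_tape (ts ! 0) \<noteq> 0" by simp
  have K: "0 < length ts" "K < length ts" "K \<noteq> 0" using Cons(2) assms by auto
  let ?ts1 = "ts[K := (tape_contents (u @ [b]), int (length (u @ [b])))]"
  let ?ts2 = "?ts1[0 := (fst (ts ! 0), snd (ts ! 0) + 1)]"
  let ?C = "Cond 0 Skip (Act K (Some 1) Right) (Act K (Some 2) Right)"
  have tc: "(tape_contents u)(int (length u) := ?b) = tape_contents (u @ [b])"
    by (auto simp: tape_contents_def fun_eq_iff nth_append)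
  have "gstep (?C, ts) = (Act K (Some ?b) Right, ts)"
    using rd K by (auto simp: gstep_def)
  moreover have "gstep (Act K (Some ?b) Right, ts) = (Skip, ?ts1)"
    using K Cons(4) tc by (simp add: gstep_Act add.commute)
  ultimately have "(gstep ^^ 2) (?C, ts) = (Skip, ?ts1)" by (simp add: numeral_2_eq_2)
  from gstep_Seq_run[OF this, of "Pop 0"] obtain l where
    l: "l \<le> 3" "(gstep ^^ l) (Seq ?C (Pop 0), ts) = (Pop 0, ?ts1)" by auto
  have "gstep (Pop 0, ?ts1) = (Skip, ?ts2)"
    using K by (cases "ts ! 0") (simp add: Pop_def gstep_Act)
  then have body: "(gstep ^^ (Suc l)) (Seq ?C (Pop 0), ts) = (Skip, ?ts2)" using l by simp
  have "holds_word y (fst (ts ! 0), snd (ts ! 0) + 1)"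
    unfolding holds_word_def
  proof (intro allI impI)
    fix i :: int assume i: "i \<ge> 0"
    have "fst (ts ! 0) (snd (ts ! 0) + (1 + i)) = tape_contents (b # y) (1 + i)"
      using Cons(3) i by (auto simp: holds_word_def)
    also have "\<dots> = tape_contents y i" using i by (auto simp: tape_contents_def nat_add_distrib)
    finally show "fst (fst (ts ! 0), snd (ts ! 0) + 1) (snd (fst (ts ! 0), snd (ts ! 0) + 1) + i) = tape_contents y i"
      by (simp add: add.assoc)
  qed
  then obtain m ts' where m: "m \<le> 7 * length y + 1" "(gstep ^^ m) (out_loop K, ?ts2) = (Skip, ts')"
    "length ts' = Suc K" "fst (ts' ! K) = tape_contents ((u @ [b]) @ y)"
    using Cons(1)[of ?ts2 "u @ [b]"] K Cons(2) by auto
  obtain l' where "l' \<le> Suc l + m + 2" "(gstep ^^ l') (out_loop K, ts) = (Skip, ts')"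
    using gstep_While_run[OF nz K(1) body m(2)[unfolded out_loop_def]] unfolding out_loop_def by blast
  then show ?case using m l by (intro exI[of _ l'] conjI exI[of _ ts']) auto
qed

theorem pw_polytime:
  assumes "pw UNIV f"
  shows "polytime_computable f"
proof -
  obtain c K e where c: "K \<ge> 1" "\<And>K'. K \<le> K' \<Longrightarrow> wfc K' c"
    "\<And>s. (\<And>i. 0 < i \<Longrightarrow> i < K \<Longrightarrow> s i = []) \<Longrightarrow> s 0 \<in> UNIV \<Longrightarrow> runs c s (s(0 := f (s 0))) ((length (s 0) + 2) ^ e)"
    "\<And>w. w \<in> UNIV \<Longrightarrow> length (f w) \<le> (length w + 2) ^ e"
    using assms by (rule pwE) blast
  let ?p = "Seq c (out_loop K)"
  have wf: "wfc (Suc K) ?p" using c(1) c(2)[of "Suc K"] by (auto simp: out_loop_def)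
  obtain M ix where M: "wf_tm M" "tm_tapes M = Suc K" "ix Skip = tm_states M"
    "\<And>n ts. (tm_step M ^^ n) (0, ts) = (ix (fst ((gstep ^^ n) (?p, ts))), snd ((gstep ^^ n) (?p, ts)))"
    using compile[OF wf] by (metis cmd.distinct(3) le_add1 plus_1_eq_Suc)
  \<comment> \<open>The summands bound the run of \<open>c\<close>, seven steps for each bit of
    output, and the steps between and after the two loops.\<close>
  define P :: "nat poly" where "P = [:2, 1:] ^ e + 7 * [:2, 1:] ^ e + [:3:]"
  have "\<exists>t\<le>poly P (length x). halts_with M ((tm_step M ^^ t) (tm_init M x)) (f x)" for x
  proof -
    let ?ts = "(tape_contents x, 0) # replicate K (tape_contents [], 0)"
    define s where "s = (\<lambda>r :: nat. if r = 0 then x else [] :: bool list)"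
    have init: "tm_init M x = (0, ?ts)" by (simp add: tm_init_def M(2))
    have "store K s ?ts" by (auto simp: store_def s_def holds_word_def nth_Cons split: nat.splits)
    moreover have "runs c s (s(0 := f x)) ((length x + 2) ^ e)" using c(3)[of s] by (simp add: s_def)
    ultimately obtain m ts1 where m: "m \<le> (length x + 2) ^ e" "(gstep ^^ m) (c, ?ts) = (Skip, ts1)"
      "store K (s(0 := f x)) ts1" "ts1 ! K = ?ts ! K"
      using c(2)[of K] unfolding runs_def by blast
    obtain l where l: "l \<le> Suc m" "(gstep ^^ l) (?p, ?ts) = (out_loop K, ts1)"
      using gstep_Seq_run[OF m(2)] by blast
    have "length ts1 = Suc K" "holds_word (f x) (ts1 ! 0)" "ts1 ! K = (tape_contents [], int (length []))"
      using m(3,4) c(1) by (auto simp: store_def)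
    then obtain i ts2 where i: "i \<le> 7 * length (f x) + 1" "(gstep ^^ i) (out_loop K, ts1) = (Skip, ts2)"
      "length ts2 = Suc K" "fst (ts2 ! K) = tape_contents ([] @ f x)"
      using out_loop_run[OF c(1)] by blast
    have "(gstep ^^ (i + l)) (?p, ?ts) = (Skip, ts2)" using l i by (simp add: funpow_add)
    then have "(tm_step M ^^ (i + l)) (tm_init M x) = (tm_states M, ts2)" using M(3,4) init by simp
    moreover have "last ts2 = ts2 ! K" using i(3) by (metis diff_Suc_1 last_conv_nth length_0_conv nat.distinct(1))
    ultimately have "halts_with M ((tm_step M ^^ (i + l)) (tm_init M x)) (f x)"
      using i(4) by (simp add: halts_with_def)
    moreover have "i + l \<le> poly P (length x)"
      using i(1) l(1) m(1) c(4)[of x] by (simp add: P_def add.commute)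
    ultimately show ?thesis by blast
  qed
  then show ?thesis unfolding polytime_computable_def using M(1) by blast
qed

section \<open>Polynomial time on encoded data\<close>

class pcode =
  fixes code :: "'a \<Rightarrow> bool list"

text \<open>Raw words are their own code, whereas a \<open>bool list\<close> is coded as a list of
  separately encoded elements.\<close>

datatype word = W (unW: "bool list")

instantiation word :: pcode begin
definition "code_word = unW"
instance ..
end

instantiation bool :: pcode begin
definition "code_bool b = [b :: bool]"
instance ..
end

instantiation unit :: pcode begin
definition "code_unit (u :: unit) = ([] :: bool list)"
instance ..
end

instantiation nat :: pcode begin
definition "code_nat = bin_nat"
instance ..
end

instantiation int :: pcode begin
definition "code_int = bin_int"
instance ..
end

instantiation prod :: (pcode, pcode) pcode begin
definition "code_prod p = wpair (code (fst p :: 'a)) (code (snd p :: 'b))"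
instance ..
end

instantiation list :: (pcode) pcode begin
definition "code_list xs = enc_words (map code (xs :: 'a list))"
instance ..
end

instantiation gate :: pcode begin
definition "code_gate = enc_gate"
instance ..
end

definition sz :: "'a :: pcode \<Rightarrow> nat" where "sz x = length (code x)"

definition computes :: "(bool list \<Rightarrow> bool list) \<Rightarrow> ('a :: pcode \<Rightarrow> 'b :: pcode) \<Rightarrow> bool" where
  "computes F f \<longleftrightarrow> pw (range (code :: 'a \<Rightarrow> bool list)) F \<and> (\<forall>x. F (code x) = code (f x))"

definition ptime :: "('a :: pcode \<Rightarrow> 'b :: pcode) \<Rightarrow> bool" where
  "ptime f \<longleftrightarrow> (\<exists>F. computes F f)"

definition pbd :: "('a :: pcode \<Rightarrow> nat) \<Rightarrow> bool" where
  "pbd g \<longleftrightarrow> (\<exists>e. \<forall>x. g x \<le> (sz x + 2) ^ e)"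

text \<open>A function under a binder depends on its free variables; in the rules below they form the first
  component of its argument.\<close>

named_theorems pt

lemma ptimeI:
  fixes f :: "'a :: pcode \<Rightarrow> 'b :: pcode"
  shows "pw (range (code :: 'a \<Rightarrow> bool list)) F \<Longrightarrow> (\<And>x. F (code x) = code (f x)) \<Longrightarrow> ptime f"
  unfolding ptime_def computes_def by blast

lemma ptimeE:
  assumes "ptime f"
  obtains F where "computes F f"
  using assms unfolding ptime_def by blast

lemma computesD:
  fixes f :: "'a :: pcode \<Rightarrow> 'b :: pcode"
  assumes "computes F f"
  shows "pw (range (code :: 'a \<Rightarrow> bool list)) F" "F (code x) = code (f x)"
  using assms unfolding computes_def by auto

lemma pbd_polyb: "polyb b \<Longrightarrow> (\<And>x. g x \<le> b (sz x)) \<Longrightarrow> pbd g"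
  unfolding polyb_def pbd_def by (meson order_trans)

lemma pbd_mono: "pbd g \<Longrightarrow> (\<And>x. f x \<le> g x) \<Longrightarrow> pbd f"
  unfolding pbd_def by (meson order_trans)

lemma pbd_const: "pbd (\<lambda>_. c)"
  by (rule pbd_polyb[OF polyb_const order_refl])

lemma pbd_add: "pbd f \<Longrightarrow> pbd g \<Longrightarrow> pbd (\<lambda>x. f x + g x)"
proof -
  assume "pbd f" "pbd g"
  then obtain a b where "\<And>x. f x \<le> (sz x + 2) ^ a" "\<And>x. g x \<le> (sz x + 2) ^ b" unfolding pbd_def by blast
  then show ?thesis
    by (intro pbd_polyb[OF polyb_add[OF polyb_pow[of a] polyb_pow[of b]]]) (simp add: add_mono)
qed

lemma pbd_mult: "pbd f \<Longrightarrow> pbd g \<Longrightarrow> pbd (\<lambda>x. f x * g x)"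
proof -
  assume "pbd f" "pbd g"
  then obtain a b where "\<And>x. f x \<le> (sz x + 2) ^ a" "\<And>x. g x \<le> (sz x + 2) ^ b" unfolding pbd_def by blast
  then show ?thesis
    by (intro pbd_polyb[OF polyb_mult[OF polyb_pow[of a] polyb_pow[of b]]]) (simp add: mult_mono)
qed

lemma pbd_Suc: "pbd f \<Longrightarrow> pbd (\<lambda>x. Suc (f x))"
  using pbd_add[OF _ pbd_const[of 1]] by simp

lemma pbd_power: "pbd f \<Longrightarrow> pbd (\<lambda>x. f x ^ k)"
  by (induction k) (auto intro: pbd_const pbd_mult simp del: One_nat_def)

lemma pbd_sz:
  fixes f :: "'a :: pcode \<Rightarrow> 'b :: pcode"
  assumes "ptime f"
  shows "pbd (\<lambda>x. sz (f x))"
proof -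
  obtain F where F: "computes F f" using assms by (rule ptimeE)
  obtain e where "\<And>w. w \<in> range (code :: 'a \<Rightarrow> bool list) \<Longrightarrow> length (F w) \<le> (length w + 2) ^ e"
    using computesD(1)[OF F] by (elim pwE) blast
  then have "sz (f x) \<le> (sz x + 2) ^ e" for x unfolding sz_def computesD(2)[OF F, symmetric] by blast
  then show ?thesis unfolding pbd_def by blast
qed

lemma ptime_id [pt]: "ptime (\<lambda>x. x)"
  by (rule ptimeI[OF pw_id]) simp

lemma ptime_const [pt]: "ptime (\<lambda>_. c)"
  by (rule ptimeI[OF pw_const]) simp

lemma ptime_comp:
  assumes "ptime g" "ptime f"
  shows "ptime (\<lambda>x. g (f x))"
proof -
  from assms obtain F G where c: "computes F f" "computes G g" by (elim ptimeE)
  show ?thesis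
    by (rule ptimeI[OF pw_comp[OF computesD(1)[OF c(1)] computesD(1)[OF c(2)]]])
      (auto simp: computesD(2)[OF c(1)] computesD(2)[OF c(2)])
qed

lemma pbd_comp:
  assumes "pbd g" "ptime f"
  shows "pbd (\<lambda>x. g (f x))"
proof -
  obtain a b where a: "\<And>x. g x \<le> (sz x + 2) ^ a" and b: "\<And>x. sz (f x) \<le> (sz x + 2) ^ b"
    using assms(1) pbd_sz[OF assms(2)] unfolding pbd_def by blast
  have "g (f x) \<le> ((sz x + 2) ^ b + 2) ^ a" for x
    by (rule order_trans[OF a]) (use b[of x] in \<open>auto intro: power_mono\<close>)
  then show ?thesis by (intro pbd_polyb[OF polyb_comp_pow[OF polyb_pow]])
qed

lemma ptime_Pair [pt]:
  assumes "ptime f" "ptime g"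
  shows "ptime (\<lambda>x. (f x, g x))"
proof -
  from assms obtain F G where c: "computes F f" "computes G g" by (elim ptimeE)
  show ?thesis
    by (rule ptimeI[OF pw_pair[OF computesD(1)[OF c(1)] computesD(1)[OF c(2)]]])
      (auto simp: computesD(2)[OF c(1)] computesD(2)[OF c(2)] code_prod_def)
qed

lemma ptime_fst [pt]: "ptime f \<Longrightarrow> ptime (\<lambda>x. fst (f x))"
  by (rule ptime_comp[OF ptimeI[OF pw_wfst]]) (auto simp: code_prod_def wpair_def)

lemma ptime_snd [pt]: "ptime f \<Longrightarrow> ptime (\<lambda>x. snd (f x))"
  by (rule ptime_comp[OF ptimeI[OF pw_wsnd]]) (auto simp: code_prod_def wpair_def)

lemma ptime_comp2:
  assumes "ptime (\<lambda>z. g (fst z) (snd z))" "ptime f1" "ptime f2"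
  shows "ptime (\<lambda>x. g (f1 x) (f2 x))"
  using ptime_comp[OF assms(1) ptime_Pair[OF assms(2,3)]] by simp

lemma ptime_comp3:
  assumes "ptime (\<lambda>z. g (fst z) (fst (snd z)) (snd (snd z)))" "ptime f1" "ptime f2" "ptime f3"
  shows "ptime (\<lambda>x. g (f1 x) (f2 x) (f3 x))"
  using ptime_comp[OF assms(1) ptime_Pair[OF assms(2) ptime_Pair[OF assms(3,4)]]] by simp

lemma ptime_if [pt]:
  assumes "ptime b" "ptime f" "ptime g"
  shows "ptime (\<lambda>x. if b x then f x else g x)"
proof -
  from assms obtain B F G where c: "computes B b" "computes F f" "computes G g" by (elim ptimeE)
  show ?thesis
    by (rule ptimeI[OF pw_case[OF computesD(1)[OF c(1)] computesD(1)[OF c(2)] computesD(1)[OF c(2)] computesD(1)[OF c(3)]]])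
      (auto simp: computesD(2)[OF c(1)] computesD(2)[OF c(2)] computesD(2)[OF c(3)] code_bool_def)
qed

lemma ptime_Not [pt]:
  assumes "ptime a"
  shows "ptime (\<lambda>x. \<not> a x)"
proof -
  have eq: "(\<not> a x) = (if a x then False else True)" for x by simp
  show ?thesis unfolding eq by (intro ptime_if ptime_const assms)
qed

lemma ptime_conj [pt]:
  assumes "ptime a" "ptime b"
  shows "ptime (\<lambda>x. a x \<and> b x)"
proof -
  have eq: "(a x \<and> b x) = (if a x then b x else False)" for x by simp
  show ?thesis unfolding eq by (intro ptime_if ptime_const assms)
qed

lemma ptime_disj [pt]:
  assumes "ptime a" "ptime b"
  shows "ptime (\<lambda>x. a x \<or> b x)"
proof -
  have eq: "(a x \<or> b x) = (if a x then True else b x)" for x by simp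
  show ?thesis unfolding eq by (intro ptime_if ptime_const assms)
qed

lemma ptime_imp [pt]:
  assumes "ptime a" "ptime b"
  shows "ptime (\<lambda>x. a x \<longrightarrow> b x)"
proof -
  have eq: "(a x \<longrightarrow> b x) = (if a x then b x else True)" for x by simp
  show ?thesis unfolding eq by (intro ptime_if ptime_const assms)
qed

lemma code_Nil: "code ([] :: 'a :: pcode list) = []"
  by (simp add: code_list_def enc_words_def)

lemma code_Cons: "code (x # xs) = wpair (code x) (code xs)"
  by (simp add: code_list_def enc_words_def wpair_def)

lemma ptime_Cons [pt]:
  assumes "ptime f" "ptime g"
  shows "ptime (\<lambda>x. f x # g x)"
proof -
  from assms obtain F G where c: "computes F f" "computes G g" by (elim ptimeE)
  show ?thesis
    by (rule ptimeI[OF pw_pair[OF computesD(1)[OF c(1)] computesD(1)[OF c(2)]]])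
      (auto simp: computesD(2)[OF c(1)] computesD(2)[OF c(2)] code_Cons)
qed

lemma wpair_neq_Nil: "wpair a b \<noteq> []"
  by (simp add: wpair_def enc_word_def)

lemma ptime_case_list [pt]:
  fixes xs :: "'e :: pcode \<Rightarrow> 'a :: pcode list" and f :: "'e \<Rightarrow> 'b :: pcode"
  assumes "ptime xs" "ptime f" "ptime (\<lambda>z. g (fst z) (fst (snd z)) (snd (snd z)))"
  shows "ptime (\<lambda>x. case xs x of [] \<Rightarrow> f x | y # ys \<Rightarrow> g x y ys)"
proof -
  let ?g = "\<lambda>z. case xs z of [] \<Rightarrow> f z | y # ys \<Rightarrow> g z y ys"
  from assms obtain X F G where c: "computes X xs" "computes F f"
    "computes G (\<lambda>z. g (fst z) (fst (snd z)) (snd (snd z)))" by (elim ptimeE)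
  \<comment> \<open>A nonempty list has the code of the pair of its head and tail, so prefixing
    \<open>w\<close> yields the code of \<open>(x, y, ys)\<close>; the branch for the empty list
    only supplies some valid code.\<close>
  let ?P = "\<lambda>w. case X w of [] \<Rightarrow> code (undefined :: 'e, undefined :: 'a, undefined :: 'a list) | b # _ \<Rightarrow>
    if b then wpair w (X w) else wpair w (X w)"
  have P: "?P (code x) = code (case xs x of [] \<Rightarrow> (undefined :: 'e, undefined :: 'a, undefined :: 'a list) | y # ys \<Rightarrow> (x, y, ys))" for x
    using wpair_neq_Nil by (cases "xs x")
      (auto simp: computesD(2)[OF c(1)] code_Nil code_Cons code_prod_def split: list.splits)
  have "pw (range (code :: 'e \<Rightarrow> bool list)) ?P"
    by (intro pw_case pw_const computesD(1)[OF c(1)] pw_pair pw_id)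
  then have "ptime (\<lambda>x. case xs x of [] \<Rightarrow> (undefined :: 'e, undefined :: 'a, undefined :: 'a list) | y # ys \<Rightarrow> (x, y, ys))"
    by (rule ptimeI) (rule P)
  then have "ptime (\<lambda>x. case (case xs x of [] \<Rightarrow> (undefined :: 'e, undefined :: 'a, undefined :: 'a list) | y # ys \<Rightarrow> (x, y, ys))
      of (x, y, ys) \<Rightarrow> g x y ys)"
    using ptime_comp[OF assms(3)] by (simp add: case_prod_beta')
  then obtain G' where G': "computes G' (\<lambda>x. case (case xs x of [] \<Rightarrow> (undefined :: 'e, undefined :: 'a, undefined :: 'a list) | y # ys \<Rightarrow> (x, y, ys))
      of (x, y, ys) \<Rightarrow> g x y ys)" by (rule ptimeE)
  show ?thesis
  proof (rule ptimeI[OF pw_case[OF computesD(1)[OF c(1)] computesD(1)[OF c(2)] computesD(1)[OF G'] computesD(1)[OF G']]])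
    fix x
    show "(case X (code x) of [] \<Rightarrow> F (code x) | b # _ \<Rightarrow> if b then G' (code x) else G' (code x)) =
      code (case xs x of [] \<Rightarrow> f x | y # ys \<Rightarrow> g x y ys)"
      using wpair_neq_Nil
      by (cases "xs x") (auto simp: computesD(2)[OF c(1)] computesD(2)[OF c(2)] computesD(2)[OF G']
          code_Nil code_Cons split: list.splits)
  qed
qed

lemma ptime_tl [pt]: "ptime xs \<Longrightarrow> ptime (\<lambda>x. tl (xs x))"
  unfolding tl_def by (intro pt)

lemma sz_Pair: "sz (x, y) = 2 * sz x + 1 + sz y"
  by (simp add: sz_def code_prod_def wpair_def)

lemma sz_Nil [simp]: "sz ([] :: 'a :: pcode list) = 0"
  by (simp add: sz_def code_Nil)

lemma sz_Cons [simp]: "sz (x # xs) = 2 * sz x + 1 + sz xs"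
  by (simp add: sz_def code_Cons wpair_def)

lemma sz_append [simp]: "sz (xs @ ys) = sz xs + sz ys"
  by (induction xs) auto

lemma sz_rev [simp]: "sz (rev xs) = sz xs"
  by (induction xs) auto

lemma length_le_sz: "length xs \<le> sz xs"
  by (induction xs) auto

lemma sz_list_bound: "(\<And>x. x \<in> set xs \<Longrightarrow> sz x \<le> B) \<Longrightarrow> sz xs \<le> length xs * (2 * B + 1)"
proof (induction xs)
  case (Cons x xs)
  then have "sz x \<le> B" "sz xs \<le> length xs * (2 * B + 1)" by auto
  then show ?case by simp
qed simp

lemma sz_mem: "x \<in> set xs \<Longrightarrow> sz x \<le> sz xs"
  by (induction xs) auto

lemma sz_take: "sz (take n xs) \<le> sz xs"
  by (metis append_take_drop_id le_add1 sz_append)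

lemma sz_drop: "sz (drop n xs) \<le> sz xs"
  by (metis append_take_drop_id le_add2 sz_append)

theorem ptime_iterate:
  fixes s :: "'e :: pcode \<Rightarrow> 's :: pcode \<Rightarrow> 's" and c :: "'e \<Rightarrow> 'c :: pcode"
  assumes s: "ptime (\<lambda>z. s (fst z) (snd z))" and i: "ptime i" and c: "ptime c"
    and B: "pbd B" "\<And>x n. n \<le> sz (c x) \<Longrightarrow> sz ((s x ^^ n) (i x)) \<le> B x"
  shows "ptime (\<lambda>x. (s x ^^ sz (c x)) (i x))"
proof -
  \<comment> \<open>The environment travels in the state, since the iterated function sees nothing
    else.\<close>
  obtain F where F: "computes F (\<lambda>z. (fst z, s (fst z) (snd z)))"
    using ptime_Pair[OF ptime_fst[OF ptime_id] s] by (rule ptimeE)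
  obtain I where I: "computes I (\<lambda>x. (x, i x))"
    using ptime_Pair[OF ptime_id i] by (rule ptimeE)
  obtain C where C: "computes C c" using c by (rule ptimeE)
  have it: "(F ^^ n) (I (code x)) = code (x, (s x ^^ n) (i x))" for n x
    by (induction n) (simp_all add: computesD(2)[OF F] computesD(2)[OF I])
  obtain b where b: "\<And>x. 2 * sz x + 1 + B x \<le> (sz x + 2) ^ b"
    using pbd_add[OF pbd_add[OF pbd_mult[OF pbd_const[of 2] pbd_sz[OF ptime_id]] pbd_const[of 1]] B(1)]
    unfolding pbd_def by blast
  have "pw (range (code :: 'e \<Rightarrow> bool list)) (\<lambda>w. (F ^^ length (C w)) (I w))"
  proof (rule pw_iterate[OF computesD(1)[OF F] computesD(1)[OF C] computesD(1)[OF I]])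
    fix w n assume w: "w \<in> range (code :: 'e \<Rightarrow> bool list)" and n: "n \<le> length (C w)"
    then obtain x :: 'e where x: "w = code x" by blast
    then have "n \<le> sz (c x)" using n by (simp add: sz_def computesD(2)[OF C])
    then have "length ((F ^^ n) (I w)) \<le> 2 * sz x + 1 + B x"
      using B(2)[of n x] unfolding x it by (simp add: sz_def[symmetric] sz_Pair)
    then show "length ((F ^^ n) (I w)) \<le> (length w + 2) ^ b"
      using b[of x] by (simp add: x sz_def)
  qed (auto simp: computesD(2)[OF F] computesD(2)[OF I])
  then have "ptime (\<lambda>x. (x, (s x ^^ sz (c x)) (i x)))"
    by (rule ptimeI) (simp add: computesD(2)[OF C] it sz_def)
  from ptime_snd[OF this] show ?thesis by simp
qed

theorem ptime_foldl:
  fixes f :: "'e :: pcode \<Rightarrow> 's :: pcode \<Rightarrow> 'a :: pcode \<Rightarrow> 's"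
  assumes f: "ptime (\<lambda>z. f (fst z) (fst (snd z)) (snd (snd z)))" and i: "ptime i" and xs: "ptime xs"
    and B: "pbd B" "\<And>x n. sz (foldl (f x) (i x) (take n (xs x))) \<le> B x"
  shows "ptime (\<lambda>x. foldl (f x) (i x) (xs x))"
proof -
  \<comment> \<open>The iteration runs \<open>sz (xs x)\<close> times, possibly more often than the
    list is long; with nothing left it idles.\<close>
  let ?s = "\<lambda>x st. case snd st of [] \<Rightarrow> (fst st, []) | y # ys \<Rightarrow> (f x (fst st) y, ys)"
  have it: "(?s x ^^ n) (i x, xs x) = (foldl (f x) (i x) (take n (xs x)), drop n (xs x))" for n x
  proof (induction n)
    case (Suc n)
    show ?case
    proof (cases "n < length (xs x)")
      case True
      then show ?thesis using Suc by (simp add: take_Suc_conv_app_nth Cons_nth_drop_Suc[symmetric])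
    qed (use Suc in simp)
  qed simp
  have "ptime (\<lambda>x. (?s x ^^ sz (xs x)) (i x, xs x))"
  proof (rule ptime_iterate)
    show "pbd (\<lambda>x. 2 * B x + 1 + sz (xs x))" by (intro pbd_add pbd_mult pbd_const B pbd_sz xs)
    show "sz ((?s x ^^ n) (i x, xs x)) \<le> 2 * B x + 1 + sz (xs x)" for x n
      unfolding it sz_Pair using B(2)[of x n] sz_drop[of n "xs x"] by simp
    show "ptime (\<lambda>z. ?s (fst z) (snd z))"
      by (intro pt ptime_comp3[OF f])
  qed (intro pt i xs)+
  from ptime_fst[OF this] show ?thesis by (simp add: it take_all[OF length_le_sz])
qed

section \<open>List functions in polynomial time\<close>

lemma ptime_rev [pt]:
  assumes "ptime xs"
  shows "ptime (\<lambda>x. rev (xs x))"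
proof -
  have rev: "foldl (\<lambda>acc y. y # acc) zs ys = rev ys @ zs" for zs ys :: "'b list" by (induction ys arbitrary: zs) auto
  have "ptime (\<lambda>x. foldl (\<lambda>acc y. y # acc) [] (xs x))"
    by (rule ptime_foldl[where B = "\<lambda>x. sz (xs x)"])
      (auto intro!: pt assms pbd_sz simp: rev sz_take)
  then show ?thesis by (simp add: rev)
qed

lemma ptime_append [pt]:
  assumes "ptime xs" "ptime ys"
  shows "ptime (\<lambda>x. xs x @ ys x)"
proof -
  have rev: "foldl (\<lambda>acc y. y # acc) zs ys = rev ys @ zs" for zs ys :: "'b list" by (induction ys arbitrary: zs) auto
  have "ptime (\<lambda>x. foldl (\<lambda>acc y. y # acc) (ys x) (rev (xs x)))"
    by (rule ptime_foldl[where B = "\<lambda>x. sz (xs x) + sz (ys x)"])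
      (auto intro!: pt assms pbd_sz pbd_add simp: rev order_trans[OF sz_take])
  then show ?thesis by (simp add: rev)
qed

text \<open>An element is no larger than its list, so a bound that depends on the element becomes
  uniform in the environment.\<close>

lemma pbd_env:
  fixes h :: "'e :: pcode \<Rightarrow> 'a :: pcode \<Rightarrow> nat"
  assumes "pbd (\<lambda>z. h (fst z) (snd z))" "ptime xs"
  obtains B where "pbd B" "\<And>x y. y \<in> set (xs x) \<Longrightarrow> h x y \<le> B x"
proof -
  obtain e where e: "\<And>z. h (fst z) (snd z) \<le> (sz z + 2) ^ e" using assms(1) unfolding pbd_def by blast
  let ?B = "\<lambda>x. (2 * sz x + 1 + sz (xs x) + 2) ^ e"
  have "h x y \<le> ?B x" if "y \<in> set (xs x)" for x y
  proof -
    have "h x y \<le> (sz (x, y) + 2) ^ e" using e[of "(x, y)"] by simp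
    also have "\<dots> \<le> ?B x" using sz_mem[OF that] by (intro power_mono) (auto simp: sz_Pair)
    finally show ?thesis .
  qed
  moreover have "pbd ?B" by (intro pbd_power pbd_add pbd_mult pbd_const pbd_sz assms ptime_id)
  ultimately show ?thesis using that by blast
qed

lemma ptime_map [pt]:
  fixes f :: "'e :: pcode \<Rightarrow> 'a :: pcode \<Rightarrow> 'b :: pcode"
  assumes f: "ptime (\<lambda>z. f (fst z) (snd z))" and xs: "ptime xs"
  shows "ptime (\<lambda>x. map (f x) (xs x))"
proof -
  have fl: "foldl (\<lambda>acc y. f x y # acc) zs ys = rev (map (f x) ys) @ zs" for zs ys x by (induction ys arbitrary: zs) auto
  obtain B where B: "pbd B" "\<And>x y. y \<in> set (xs x) \<Longrightarrow> sz (f x y) \<le> B x"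
    by (rule pbd_env[of "\<lambda>x y. sz (f x y)" xs]) (use pbd_sz[OF f] xs in auto)
  have "ptime (\<lambda>x. rev (foldl (\<lambda>acc y. f x y # acc) [] (xs x)))"
  proof (intro ptime_rev ptime_foldl)
    show "sz (foldl (\<lambda>acc y. f x y # acc) [] (take n (xs x))) \<le> sz (xs x) * (2 * B x + 1)" for x n
    proof -
      have "sz (map (f x) (take n (xs x))) \<le> length (take n (xs x)) * (2 * B x + 1)"
        using sz_list_bound[of "map (f x) (take n (xs x))" "B x"] B(2) by (auto dest: in_set_takeD)
      also have "\<dots> \<le> sz (xs x) * (2 * B x + 1)"
        using length_le_sz[of "xs x"] by (intro mult_right_mono) auto
      finally show ?thesis by (simp add: fl)
    qed
    show "pbd (\<lambda>x. sz (xs x) * (2 * B x + 1))" by (intro pbd_mult pbd_add pbd_const B pbd_sz xs)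
  qed (intro pt xs ptime_comp2[OF f])+
  then show ?thesis by (simp add: fl)
qed

lemma ptime_filter [pt]:
  assumes f: "ptime (\<lambda>z. f (fst z) (snd z))" and xs: "ptime xs"
  shows "ptime (\<lambda>x. filter (f x) (xs x))"
proof -
  have fl: "foldl (\<lambda>acc y. if f x y then y # acc else acc) zs ys = rev (filter (f x) ys) @ zs" for zs ys x
    by (induction ys arbitrary: zs) auto
  have sf: "sz (filter P ys) \<le> sz ys" for P and ys :: "'b list" by (induction ys) auto
  have "ptime (\<lambda>x. rev (foldl (\<lambda>acc y. if f x y then y # acc else acc) [] (xs x)))"
  proof (intro ptime_rev ptime_foldl)
    show "sz (foldl (\<lambda>acc y. if f x y then y # acc else acc) [] (take n (xs x))) \<le> sz (xs x)" for x n
      using order_trans[OF sf sz_take] by (simp add: fl)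
  qed (intro pt xs ptime_comp2[OF f] pbd_sz)+
  then show ?thesis by (simp add: fl)
qed

lemma ptime_concat [pt]:
  assumes xs: "ptime xs"
  shows "ptime (\<lambda>x. concat (xs x))"
proof -
  have fl: "foldl (\<lambda>acc y. acc @ y) zs ys = zs @ concat ys" for zs :: "'b list" and ys by (induction ys arbitrary: zs) auto
  have sf: "sz (concat ys) \<le> sz ys" for ys :: "'b list list" by (induction ys) auto
  have "ptime (\<lambda>x. foldl (\<lambda>acc y. acc @ y) [] (xs x))"
  proof (rule ptime_foldl)
    show "sz (foldl (\<lambda>acc y. acc @ y) [] (take n (xs x))) \<le> sz (xs x)" for x n
      using order_trans[OF sf sz_take] by (simp add: fl)
  qed (intro pt xs pbd_sz)+
  then show ?thesis by (simp add: fl)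
qed

lemma sz_bool [simp]: "sz (b :: bool) = 1"
  by (simp add: sz_def code_bool_def)

lemma ptime_Ball [pt]:
  assumes f: "ptime (\<lambda>z. f (fst z) (snd z))" and xs: "ptime xs"
  shows "ptime (\<lambda>x. \<forall>y\<in>set (xs x). f x y)"
proof -
  have fl: "foldl (\<lambda>acc y. acc \<and> f x y) b ys = (b \<and> (\<forall>y\<in>set ys. f x y))" for b ys x
    by (induction ys arbitrary: b) auto
  have "ptime (\<lambda>x. foldl (\<lambda>acc y. acc \<and> f x y) True (xs x))"
    by (rule ptime_foldl[where B = "\<lambda>_. 1"]) (intro pt xs ptime_comp2[OF f] pbd_const | simp)+
  then show ?thesis by (simp add: fl)
qed

lemma sz_unit [simp]: "sz (u :: unit) = 0"
  by (simp add: sz_def code_unit_def)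

text \<open>A clock: every polynomial bound is turned into a unary list that loops can run
  through.\<close>

lemma ptime_ticks:
  assumes "pbd b"
  shows "\<exists>c :: 'e :: pcode \<Rightarrow> unit list. ptime c \<and> (\<forall>x. b x \<le> length (c x))"
proof -
  have "ptime (\<lambda>x :: 'e. (Cons () ^^ sz x) [])"
  proof (rule ptime_iterate[where B = sz])
    show "sz ((Cons () ^^ n) []) \<le> sz x" if "n \<le> sz x" for n and x :: 'e
    proof -
      have "sz ((Cons () ^^ n) []) = n" by (induction n) auto
      then show ?thesis using that by simp
    qed
    show "pbd (sz :: 'e \<Rightarrow> nat)" using pbd_sz[OF ptime_id] by simp
  qed (intro pt)+
  moreover have "(Cons () ^^ n) [] = replicate n ()" for n by (induction n) auto
  ultimately have 1: "ptime (\<lambda>x :: 'e. replicate (sz x) ())" by simp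
  have "\<exists>c :: 'e \<Rightarrow> unit list. ptime c \<and> (\<forall>x. length (c x) = (sz x + 2) ^ k)" for k
  proof (induction k)
    case 0
    have "ptime (\<lambda>_ :: 'e. [()])" by (rule ptime_const)
    then show ?case by (intro exI[of _ "\<lambda>_. [()]"]) simp
  next
    case (Suc k)
    then obtain c :: "'e \<Rightarrow> unit list" where c: "ptime c" "\<And>x. length (c x) = (sz x + 2) ^ k" by blast
    let ?c = "\<lambda>x. concat (map (\<lambda>_. c x) (() # () # replicate (sz x) ()))"
    have l: "length (concat (map (\<lambda>_. ys) us)) = length us * length ys" for ys us :: "unit list"
      by (induction us) auto
    have "ptime ?c" by (intro pt 1 ptime_comp[OF c(1)])
    moreover have "length (?c x) = (sz x + 2) ^ Suc k" for x unfolding l by (simp add: c(2))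
    ultimately show ?case by blast
  qed
  moreover obtain k where "\<And>x. b x \<le> (sz x + 2) ^ k" using assms unfolding pbd_def by blast
  ultimately show ?thesis by metis
qed

section \<open>Arithmetic in polynomial time\<close>

lemma bin_nat_0 [simp]: "bin_nat 0 = []"
  by (simp add: bin_nat.simps)

lemma bin_nat_pos: "n > 0 \<Longrightarrow> bin_nat n = odd n # bin_nat (n div 2)"
  by (subst bin_nat.simps) simp

lemma bin_nat_eq_Nil [simp]: "bin_nat n = [] \<longleftrightarrow> n = 0"
  by (subst bin_nat.simps) simp

lemma length_bin_nat: "length (bin_nat n) \<le> k \<longleftrightarrow> n < 2 ^ k"
proof (induction k arbitrary: n)
  case (Suc k)
  show ?case
  proof (cases "n = 0")
    case False
    then have "length (bin_nat n) \<le> Suc k \<longleftrightarrow> n div 2 < 2 ^ k" using Suc by (simp add: bin_nat_pos)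
    also have "\<dots> \<longleftrightarrow> n < 2 ^ Suc k" by auto
    finally show ?thesis .
  qed simp
qed simp

lemma sz_nat_le: "sz (n :: nat) \<le> k \<longleftrightarrow> n < 2 ^ k"
  by (simp add: sz_def code_nat_def length_bin_nat)

lemma less_two_sz: "n < 2 ^ sz (n :: nat)"
  using sz_nat_le[of n "sz n"] by simp

lemma sz_nat_le_self: "sz (n :: nat) \<le> n"
  by (simp add: sz_nat_le less_exp)

lemma sz_int: "sz (i :: int) = 1 + sz (nat \<bar>i\<bar>)"
  by (simp add: sz_def code_int_def code_nat_def bin_int_def)

lemma sz_int_le: "sz (i :: int) \<le> Suc k \<longleftrightarrow> \<bar>i\<bar> < 2 ^ k"
proof -
  have "nat \<bar>i\<bar> < 2 ^ k \<longleftrightarrow> \<bar>i\<bar> < 2 ^ k"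
    by (metis abs_ge_zero nat_less_iff of_nat_numeral of_nat_power)
  then show ?thesis by (simp add: sz_int sz_nat_le)
qed

lemma abs_less_two_sz: "\<bar>i\<bar> < 2 ^ sz (i :: int)"
proof -
  have "\<bar>i\<bar> < 2 ^ (sz i - 1)" using sz_int_le[of i "sz i - 1"] by (simp add: sz_int)
  also have "\<dots> \<le> 2 ^ sz i" by (rule power_increasing) auto
  finally show ?thesis .
qed

lemma bin_nat_double: "bin_nat (2 * n + of_bool b) = (if b then True # bin_nat n else if n = 0 then [] else False # bin_nat n)"
  by (auto simp: bin_nat_pos)

lemma ptime_dbl [pt]:
  fixes n :: "'e :: pcode \<Rightarrow> nat"
  assumes "ptime n" "ptime b"
  shows "ptime (\<lambda>x. 2 * n x + of_bool (b x))"
proof -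
  from assms obtain N B where c: "computes N n" "computes B b" by (elim ptimeE)
  note N = computesD(1)[OF c(1)] and B = computesD(1)[OF c(2)]
  have "pw (range (code :: 'e \<Rightarrow> bool list)) (\<lambda>w. case B w of [] \<Rightarrow> [] | b # _ \<Rightarrow> if b then True # N w
      else case N w of [] \<Rightarrow> [] | b # _ \<Rightarrow> if b then False # N w else False # N w)"
    by (intro pw_case B N pw_const pw_comp[OF N pw_Cons, of UNIV]) auto
  then show ?thesis
    by (rule ptimeI) (auto simp: computesD(2)[OF c(1)] computesD(2)[OF c(2)] code_bool_def code_nat_def
        bin_nat_double bin_nat_pos[of "n _"] split: list.splits)
qed

lemma ptime_half [pt]:
  assumes "ptime n"
  shows "ptime (\<lambda>x. n x div 2 :: nat)"
proof -
  have "ptime (\<lambda>n :: nat. n div 2)"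
  proof (rule ptimeI[OF pw_tl])
    show "tl (code n) = code (n div 2)" for n :: nat
    proof (cases "n = 0")
      case False
      then show ?thesis using bin_nat_pos[of n] by (simp add: code_nat_def)
    qed (simp add: code_nat_def)
  qed
  then show ?thesis using assms by (rule ptime_comp)
qed

lemma bin_nat_odd: "(case bin_nat n of [] \<Rightarrow> [True] | b # _ \<Rightarrow> if b then [False] else [True]) = [even n]"
proof (cases "n = 0")
  case False
  then show ?thesis using bin_nat_pos[of n] by simp
qed simp

lemma ptime_even [pt]:
  assumes "ptime n"
  shows "ptime (\<lambda>x. even (n x :: nat))"
proof -
  have "ptime (\<lambda>n :: nat. even n)"
    by (rule ptimeI[OF pw_case[OF pw_id pw_const[of _ "[True]"] pw_const[of _ "[False]"] pw_const[of _ "[True]"]]])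
      (simp add: code_nat_def code_bool_def bin_nat_odd)
  then show ?thesis using assms by (rule ptime_comp)
qed

lemma ptime_bool_eq [pt]:
  assumes "ptime a" "ptime b"
  shows "ptime (\<lambda>x. a x = (b x :: bool))"
proof -
  have eq: "(a x = b x) = (if a x then b x else \<not> b x)" for x by simp
  show ?thesis unfolding eq by (intro pt assms)
qed

text \<open>Horner's scheme with the most significant bit first, the order opposite to that of
  \<open>bin_nat\<close>.\<close>

definition bval :: "bool list \<Rightarrow> nat" where
  "bval bs = foldl (\<lambda>m b. 2 * m + of_bool b) 0 bs"

lemma bval_foldl: "foldl (\<lambda>m b. 2 * m + of_bool b) n bs = n * 2 ^ length bs + bval bs"
proof (induction bs arbitrary: n)
  case (Cons b bs)
  have "bval (b # bs) = of_bool b * 2 ^ length bs + bval bs"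
    using Cons[of "of_bool b"] by (simp add: bval_def)
  then show ?case using Cons[of "2 * n + of_bool b"] by (simp add: algebra_simps)
qed (simp add: bval_def)

lemma bval_simps [simp]: "bval [] = 0" "bval (b # bs) = of_bool b * 2 ^ length bs + bval bs"
  "bval (bs @ [b]) = 2 * bval bs + of_bool b"
  using bval_foldl[of "of_bool b" bs] by (simp_all add: bval_def[of "[]"] bval_def[of "b # bs"] bval_def[of "bs @ [b]"] bval_def[of bs, symmetric])

lemma bval_less: "bval bs < 2 ^ length bs"
  by (induction bs) auto

lemma ptime_bval [pt]:
  assumes "ptime bs"
  shows "ptime (\<lambda>x. bval (bs x))"
  unfolding bval_def
proof (rule ptime_foldl)
  show "sz (foldl (\<lambda>m b. 2 * m + of_bool b) (0 :: nat) (take n (bs x))) \<le> sz (bs x)" for x n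
  proof -
    have "bval (take n (bs x)) < 2 ^ length (take n (bs x))" by (rule bval_less)
    also have "\<dots> \<le> 2 ^ sz (bs x)" using length_le_sz[of "bs x"] by (intro power_increasing) auto
    finally show ?thesis by (simp add: sz_nat_le bval_def)
  qed
qed (intro pt assms pbd_sz)+

definition nbits :: "nat \<Rightarrow> bool list" where "nbits n = rev (bin_nat n)"

lemma bval_nbits [simp]: "bval (nbits n) = n"
proof (induction n rule: less_induct)
  case (less n)
  show ?case
  proof (cases "n = 0")
    case False
    then show ?thesis using less[of "n div 2"] by (auto simp: nbits_def bin_nat_pos)
  qed (simp add: nbits_def)
qed

lemma length_nbits [simp]: "length (nbits n) = sz n"
  by (simp add: nbits_def sz_def code_nat_def)

text \<open>The code of a number is its raw bits, not the code of a list of booleans, so the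
  conversion peels off one parity at a time.\<close>

lemma ptime_nbits [pt]:
  assumes "ptime n"
  shows "ptime (\<lambda>x. nbits (n x))"
proof -
  let ?s = "\<lambda>st. (fst st div 2, odd (fst st) # snd st) :: nat \<times> bool list"
  have it: "k \<le> sz n \<Longrightarrow> (?s ^^ k) (n, []) = (n div 2 ^ k, rev (take k (bin_nat n))) \<and> (\<forall>m. bin_nat n = take k (bin_nat n) @ bin_nat (n div 2 ^ k))" for k n
  proof (induction k)
    case (Suc k)
    have "n div 2 ^ k > 0"
    proof (rule ccontr)
      assume "\<not> n div 2 ^ k > 0"
      then have "sz n \<le> k" by (simp add: sz_nat_le div_eq_0_iff)
      then show False using Suc.prems by simp
    qed
    note p = bin_nat_pos[OF this]
    have IH: "(?s ^^ k) (n, []) = (n div 2 ^ k, rev (take k (bin_nat n)))"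
      "bin_nat n = take k (bin_nat n) @ bin_nat (n div 2 ^ k)" using Suc by auto
    have lk: "length (take k (bin_nat n)) = k" using Suc.prems by (simp add: sz_def code_nat_def)
    have d: "n div 2 ^ k div 2 = n div 2 ^ Suc k" by (simp only: power_Suc2 div_mult2_eq)
    have e: "bin_nat n = (take k (bin_nat n) @ [odd (n div 2 ^ k)]) @ bin_nat (n div 2 ^ Suc k)"
      using IH(2) unfolding p d by simp
    have "take (Suc k) (bin_nat n) = take k (bin_nat n) @ [odd (n div 2 ^ k)]"
      by (subst e) (use lk in simp)
    then show ?case using IH(1) e d by simp
  qed simp
  have "ptime (\<lambda>n. (?s ^^ sz n) (n :: nat, []))"
  proof (rule ptime_iterate)
    show "sz ((?s ^^ k) (n, [])) \<le> 2 * sz n + 1 + 3 * sz n" if "k \<le> sz n" for n :: nat and k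
    proof -
      have "n div 2 ^ k < 2 ^ sz n" using less_two_sz[of n] by (meson div_le_dividend le_less_trans)
      then have "sz (n div 2 ^ k) \<le> sz n" by (simp add: sz_nat_le)
      moreover have "sz (take k (bin_nat n)) \<le> k * (2 * 1 + 1)"
        using sz_list_bound[of "take k (bin_nat n)" 1] by (auto intro: order_trans)
      ultimately show ?thesis using it[OF that] that by (simp add: sz_Pair)
    qed
    show "pbd (\<lambda>n :: nat. 2 * sz n + 1 + 3 * sz n)" by (intro pbd_add pbd_mult pbd_const pbd_sz pt)
  qed (intro pt)+
  from ptime_snd[OF this] have "ptime (\<lambda>n :: nat. rev (take (sz n) (bin_nat n)))" using it by simp
  then have "ptime (\<lambda>n. nbits n)" by (simp add: sz_def code_nat_def nbits_def)
  then show ?thesis using assms by (rule ptime_comp)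
qed

text \<open>A serial adder: the third component is the carry and the last one collects the digits of
  the sum, lowest first, so the list ends up with the highest digit in front.
  \<open>sub_step\<close> is the same with a borrow.\<close>

definition add_step :: "nat \<times> nat \<times> bool \<times> bool list \<Rightarrow> nat \<times> nat \<times> bool \<times> bool list" where
  "add_step = (\<lambda>st. let a = fst st; b = fst (snd st); c = fst (snd (snd st)); r = snd (snd (snd st)) in
     (a div 2, b div 2, (odd a \<and> odd b) \<or> (c \<and> (odd a \<or> odd b)), ((odd a \<noteq> odd b) \<noteq> c) # r))"

definition sub_step :: "nat \<times> nat \<times> bool \<times> bool list \<Rightarrow> nat \<times> nat \<times> bool \<times> bool list" where
  "sub_step = (\<lambda>st. let a = fst st; b = fst (snd st); c = fst (snd (snd st)); r = snd (snd (snd st)) in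
     (a div 2, b div 2, (even a \<and> (odd b \<or> c)) \<or> (odd b \<and> c), ((odd a \<noteq> odd b) \<noteq> c) # r))"

lemma add_step_app: "add_step (a, b, c, r) =
    (a div 2, b div 2, (odd a \<and> odd b) \<or> (c \<and> (odd a \<or> odd b)), ((odd a \<noteq> odd b) \<noteq> c) # r)"
  by (simp add: add_step_def)

lemma sub_step_app: "sub_step (a, b, c, r) =
    (a div 2, b div 2, (even a \<and> (odd b \<or> c)) \<or> (odd b \<and> c), ((odd a \<noteq> odd b) \<noteq> c) # r)"
  by (simp add: sub_step_def)

lemma full_adder:
  "a + b + of_bool c = 2 * (a div 2 + b div 2 + of_bool ((odd a \<and> odd b) \<or> (c \<and> (odd a \<or> odd b)))) +
    of_bool ((odd a \<noteq> odd b) \<noteq> c)" for a b :: nat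
  by (cases "even a"; cases "even b"; cases c) (auto elim!: evenE oddE)

lemma full_subtractor:
  "int a - int b - of_bool c = 2 * (int (a div 2) - int (b div 2) - of_bool ((even a \<and> (odd b \<or> c)) \<or> (odd b \<and> c))) +
    of_bool ((odd a \<noteq> odd b) \<noteq> c)"
  by (cases "even a"; cases "even b"; cases c) (auto elim!: evenE oddE)

lemma add_step_inv:
  "\<exists>c r. (add_step ^^ k) (a, b, False, []) = (a div 2 ^ k, b div 2 ^ k, c, r) \<and> length r = k \<and>
     bval r + 2 ^ k * (a div 2 ^ k + b div 2 ^ k + of_bool c) = a + b"
proof (induction k)
  case (Suc k)
  then obtain c r where IH: "(add_step ^^ k) (a, b, False, []) = (a div 2 ^ k, b div 2 ^ k, c, r)" "length r = k"
    "bval r + 2 ^ k * (a div 2 ^ k + b div 2 ^ k + of_bool c) = a + b" by blast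
  let ?a = "a div 2 ^ k" and ?b = "b div 2 ^ k"
  let ?c = "(odd ?a \<and> odd ?b) \<or> (c \<and> (odd ?a \<or> odd ?b))" and ?d = "(odd ?a \<noteq> odd ?b) \<noteq> c"
  have d: "x div 2 ^ Suc k = x div 2 ^ k div 2" for x :: nat by (simp only: power_Suc2 div_mult2_eq)
  have "?a + ?b + of_bool c = 2 * (?a div 2 + ?b div 2 + of_bool ?c) + of_bool ?d" by (rule full_adder)
  then have "bval r + 2 ^ k * (2 * (?a div 2 + ?b div 2 + of_bool ?c) + of_bool ?d) = a + b" using IH(3) by simp
  then have "bval (?d # r) + 2 ^ Suc k * (?a div 2 + ?b div 2 + of_bool ?c) = a + b"
    using IH(2) by (simp only: bval_simps) (simp add: algebra_simps)
  moreover have "(add_step ^^ Suc k) (a, b, False, []) = (?a div 2, ?b div 2, ?c, ?d # r)"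
    by (simp only: funpow.simps comp_apply IH(1) add_step_app)
  ultimately show ?case unfolding d using IH(2) by (intro exI[of _ ?c] exI[of _ "?d # r"]) (simp only: list.size simp_thms add_Suc_right add_0_right)
qed auto

lemma sub_step_inv:
  "\<exists>c r. (sub_step ^^ k) (a, b, False, []) = (a div 2 ^ k, b div 2 ^ k, c, r) \<and> length r = k \<and>
     int (bval r) + 2 ^ k * (int (a div 2 ^ k) - int (b div 2 ^ k) - of_bool c) = int a - int b"
proof (induction k)
  case (Suc k)
  then obtain c r where IH: "(sub_step ^^ k) (a, b, False, []) = (a div 2 ^ k, b div 2 ^ k, c, r)" "length r = k"
    "int (bval r) + 2 ^ k * (int (a div 2 ^ k) - int (b div 2 ^ k) - of_bool c) = int a - int b" by blast
  let ?a = "a div 2 ^ k" and ?b = "b div 2 ^ k"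
  let ?c = "(even ?a \<and> (odd ?b \<or> c)) \<or> (odd ?b \<and> c)" and ?d = "(odd ?a \<noteq> odd ?b) \<noteq> c"
  have d: "x div 2 ^ Suc k = x div 2 ^ k div 2" for x :: nat by (simp only: power_Suc2 div_mult2_eq)
  have "int ?a - int ?b - of_bool c = 2 * (int (?a div 2) - int (?b div 2) - of_bool ?c) + of_bool ?d"
    by (rule full_subtractor)
  then have "int (bval r) + 2 ^ k * (2 * (int (?a div 2) - int (?b div 2) - of_bool ?c) + of_bool ?d) = int a - int b" using IH(3) by simp
  then have "int (bval (?d # r)) + 2 ^ Suc k * (int (?a div 2) - int (?b div 2) - of_bool ?c) = int a - int b"
    using IH(2) by (simp only: bval_simps) (simp add: algebra_simps)
  moreover have "(sub_step ^^ Suc k) (a, b, False, []) = (?a div 2, ?b div 2, ?c, ?d # r)"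
    by (simp only: funpow.simps comp_apply IH(1) sub_step_app)
  ultimately show ?case unfolding d using IH(2) by (intro exI[of _ ?c] exI[of _ "?d # r"]) (simp only: list.size simp_thms add_Suc_right add_0_right)
qed auto

lemma sz_div_pow: "sz (n div 2 ^ k :: nat) \<le> sz n"
proof -
  have "n div 2 ^ k < 2 ^ sz n" using less_two_sz[of n] by (meson div_le_dividend le_less_trans)
  then show ?thesis by (simp add: sz_nat_le)
qed

lemma sz_bool_list: "sz (bs :: bool list) = 3 * length bs"
  by (induction bs) auto

lemma ptime_serial:
  assumes s: "s = add_step \<or> s = sub_step" and ab: "ptime a" "ptime b"
  shows "ptime (\<lambda>x. (s ^^ sz (a x, b x)) (a x, b x, False, []))"
proof (rule ptime_iterate)
  have "ptime add_step" "ptime sub_step" unfolding add_step_def sub_step_def Let_def by (intro pt)+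
  then have "ptime s" using s by auto
  then show "ptime (\<lambda>z. s (snd z))" by (rule ptime_comp) (intro pt)
  let ?B = "\<lambda>x. (2 * sz (a x) + 1) + ((2 * sz (b x) + 1) + (3 + 3 * sz (a x, b x)))"
  show "pbd ?B" by (intro pbd_add pbd_mult pbd_const pbd_sz pt ab)
  show "sz ((s ^^ k) (a x, b x, False, [])) \<le> ?B x" if "k \<le> sz (a x, b x)" for k x
  proof -
    obtain c r where "(s ^^ k) (a x, b x, False, []) = (a x div 2 ^ k, b x div 2 ^ k, c, r)" "length r = k"
      using s add_step_inv[of k "a x" "b x"] sub_step_inv[of k "a x" "b x"] by metis
    then show ?thesis using that sz_div_pow[of "a x" k] sz_div_pow[of "b x" k]
      by (simp add: sz_Pair sz_bool_list)
  qed
qed (intro pt ab)+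

lemma ptime_add_nat [pt]:
  assumes "ptime a" "ptime b"
  shows "ptime (\<lambda>x. a x + b x :: nat)"
proof -
  have eq: "bval (snd (snd (snd ((add_step ^^ sz (a x, b x)) (a x, b x, False, []))))) = a x + b x" for x
  proof -
    let ?k = "sz (a x, b x)"
    obtain c r where r: "(add_step ^^ ?k) (a x, b x, False, []) = (a x div 2 ^ ?k, b x div 2 ^ ?k, c, r)"
      "bval r + 2 ^ ?k * (a x div 2 ^ ?k + b x div 2 ^ ?k + of_bool c) = a x + b x"
      using add_step_inv by blast
    \<comment> \<open>The number of rounds exceeds the length of the sum, so operands and carry are
      exhausted.\<close>
    have "(2 :: nat) ^ sz (a x) + 2 ^ sz (b x) \<le> 2 ^ (sz (a x) + sz (b x)) + 2 ^ (sz (a x) + sz (b x))"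
      by (intro add_mono power_increasing) auto
    also have "\<dots> = 2 ^ (sz (a x) + sz (b x) + 1)" by simp
    also have "\<dots> \<le> 2 ^ ?k" by (intro power_increasing) (auto simp: sz_Pair)
    finally have "a x + b x < 2 ^ ?k" using less_two_sz[of "a x"] less_two_sz[of "b x"] by linarith
    then have "(2 :: nat) ^ ?k * (a x div 2 ^ ?k + b x div 2 ^ ?k + of_bool c) < 2 ^ ?k * 1" using r(2) by linarith
    then have "a x div 2 ^ ?k + b x div 2 ^ ?k + of_bool c = 0"
      using mult_less_cancel1 by (metis less_one)
    then show ?thesis using r by simp
  qed
  have "ptime (\<lambda>x. bval (snd (snd (snd ((add_step ^^ sz (a x, b x)) (a x, b x, False, []))))))"
    by (intro ptime_bval ptime_snd ptime_serial assms) simp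
  then show ?thesis by (simp only: eq)
qed

text \<open>The final borrow decides the comparison, so \<open><\<close> and subtraction share one
  run.\<close>

lemma sub_step_result:
  "\<exists>c r. (sub_step ^^ sz (a, b)) (a, b, False, []) = (0, 0, c, r) \<and> c = (a < b) \<and> (\<not> c \<longrightarrow> bval r = a - b)"
proof -
  let ?k = "sz (a, b)"
  obtain c r where r: "(sub_step ^^ ?k) (a, b, False, []) = (a div 2 ^ ?k, b div 2 ^ ?k, c, r)" "length r = ?k"
    "int (bval r) + 2 ^ ?k * (int (a div 2 ^ ?k) - int (b div 2 ^ ?k) - of_bool c) = int a - int b"
    using sub_step_inv by blast
  have "(2 :: nat) ^ sz a \<le> 2 ^ ?k" "(2 :: nat) ^ sz b \<le> 2 ^ ?k"
    by (intro power_increasing; simp add: sz_Pair)+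
  then have "a < 2 ^ ?k" "b < 2 ^ ?k" using less_two_sz[of a] less_two_sz[of b] by linarith+
  then have z: "a div 2 ^ ?k = 0" "b div 2 ^ ?k = 0" by simp_all
  have "int (bval r) < 2 ^ ?k" using bval_less[of r] r(2) by (metis of_nat_less_iff of_nat_numeral of_nat_power)
  moreover have "int (bval r) - (if c then 2 ^ ?k else 0) = int a - int b" using r(3) unfolding z by (cases c) simp_all
  moreover have "int (bval r) \<ge> 0" by simp
  ultimately have "c = (a < b) \<and> (\<not> c \<longrightarrow> bval r = a - b)"
  proof (cases c)
    case True
    have "int a < int b" using True \<open>int (bval r) < 2 ^ ?k\<close> \<open>int (bval r) - (if c then 2 ^ ?k else 0) = int a - int b\<close>
      by (simp only: if_True)
    then show ?thesis using True by simp
  next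
    case False
    have "int (bval r) = int a - int b" using False \<open>int (bval r) - (if c then 2 ^ ?k else 0) = int a - int b\<close>
      by simp
    then show ?thesis using False by auto
  qed
  then show ?thesis using r(1) z by auto
qed

lemma ptime_less_nat [pt]:
  assumes "ptime a" "ptime b"
  shows "ptime (\<lambda>x. (a x :: nat) < b x)"
proof -
  have eq: "fst (snd (snd ((sub_step ^^ sz (a x, b x)) (a x, b x, False, [])))) = (a x < b x)" for x
    using sub_step_result[of "a x" "b x"] by auto
  have "ptime (\<lambda>x. fst (snd (snd ((sub_step ^^ sz (a x, b x)) (a x, b x, False, [])))))"
    by (intro ptime_fst ptime_snd ptime_serial assms) simp
  then show ?thesis by (simp only: eq)
qed

lemma ptime_diff_nat [pt]:
  assumes "ptime a" "ptime b"
  shows "ptime (\<lambda>x. (a x :: nat) - b x)"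
proof -
  have eq: "(if a x < b x then 0 else bval (snd (snd (snd ((sub_step ^^ sz (a x, b x)) (a x, b x, False, [])))))) = a x - b x" for x
    using sub_step_result[of "a x" "b x"] by auto
  have "ptime (\<lambda>x. if a x < b x then 0 else bval (snd (snd (snd ((sub_step ^^ sz (a x, b x)) (a x, b x, False, []))))))"
    by (intro ptime_if ptime_const ptime_less_nat ptime_bval ptime_snd ptime_serial assms) simp
  then show ?thesis by (simp only: eq)
qed

lemma ptime_le_nat [pt]:
  assumes "ptime a" "ptime b"
  shows "ptime (\<lambda>x. (a x :: nat) \<le> b x)"
  unfolding not_less[symmetric] by (intro pt assms)

lemma ptime_eq_nat [pt]:
  assumes "ptime a" "ptime b"
  shows "ptime (\<lambda>x. (a x :: nat) = b x)"
  unfolding eq_iff by (intro pt assms)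

lemma ptime_Suc [pt]:
  assumes "ptime a"
  shows "ptime (\<lambda>x. Suc (a x))"
  unfolding Suc_eq_plus1 by (intro pt assms)

lemma bval_take_less: "bval (take n bs) < 2 ^ length bs"
  by (rule less_le_trans[OF bval_less]) (auto intro: power_increasing)

lemma ptime_mult_nat [pt]:
  assumes "ptime a" "ptime b"
  shows "ptime (\<lambda>x. a x * b x :: nat)"
proof -
  \<comment> \<open>Shift and add; the summand \<open>of_bool False\<close> gives the doubling the
    form covered by \<open>ptime_dbl\<close>.\<close>
  have fl: "foldl (\<lambda>m c. 2 * m + of_bool False + (if c then a x else 0)) 0 bs = a x * bval bs" for x bs
    by (induction bs rule: rev_induct) (auto simp: algebra_simps)
  have "ptime (\<lambda>x. foldl (\<lambda>m c. 2 * m + of_bool False + (if c then a x else 0)) 0 (nbits (b x)))"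
  proof (rule ptime_foldl)
    show "pbd (\<lambda>x. sz (a x) + sz (b x))" by (intro pbd_add pbd_sz assms)
    show "sz (foldl (\<lambda>m c. 2 * m + of_bool False + (if c then a x else 0)) 0 (take n (nbits (b x)))) \<le> sz (a x) + sz (b x)" for x n
      unfolding fl sz_nat_le power_add
      using less_two_sz[of "a x"] bval_take_less[of n "nbits (b x)"] by (intro mult_strict_mono) auto
  qed (intro pt assms ptime_comp[OF assms(1)])+
  then show ?thesis by (simp only: fl bval_nbits)
qed

text \<open>One digit of binary long division; the state consists of quotient and remainder.\<close>

definition dm_step :: "nat \<Rightarrow> nat \<times> nat \<Rightarrow> bool \<Rightarrow> nat \<times> nat" where
  "dm_step b qr c = (if b \<le> 2 * snd qr + of_bool c then (2 * fst qr + of_bool True, 2 * snd qr + of_bool c - b)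
     else (2 * fst qr + of_bool False, 2 * snd qr + of_bool c))"

lemma dm_step_le:
  "fst (foldl (dm_step b) (0, 0) bs) < 2 ^ length bs \<and> snd (foldl (dm_step b) (0, 0) bs) < 2 ^ length bs"
proof (induction bs rule: rev_induct)
  case (snoc c bs)
  have "fst (dm_step b qr c) \<le> 2 * fst qr + 1 \<and> snd (dm_step b qr c) \<le> 2 * snd qr + 1" for qr
    by (cases c) (auto simp: dm_step_def)
  from this[of "foldl (dm_step b) (0, 0) bs"] snoc show ?case by simp
qed simp

lemma dm_step_correct:
  assumes "b > 0"
  shows "foldl (dm_step b) (0, 0) bs = (bval bs div b, bval bs mod b)"
proof (induction bs rule: rev_induct)
  case (snoc c bs)
  let ?v = "bval bs" let ?r = "2 * (?v mod b) + of_bool c"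
  have v: "bval (bs @ [c]) = b * (2 * (?v div b)) + ?r"
  proof -
    have "b * (2 * (?v div b)) + 2 * (?v mod b) = 2 * ?v" by (metis distrib_left mult.left_commute mult_div_mod_eq)
    then show ?thesis by simp
  qed
  have r: "?r < 2 * b" using mod_less_divisor[OF assms, of ?v] by (cases c) auto
  show ?case
  proof (cases "b \<le> ?r")
    case True
    define Q R where "Q = 2 * (?v div b) + 1" and "R = ?r - b"
    have e: "bval (bs @ [c]) = b * Q + R" using v True by (simp add: Q_def R_def algebra_simps)
    have "R < b" using r True by (simp add: R_def)
    then have "bval (bs @ [c]) div b = Q" "bval (bs @ [c]) mod b = R"
      unfolding e using assms by simp_all
    then have "bval (bs @ [c]) div b = 2 * (?v div b) + 1" "bval (bs @ [c]) mod b = ?r - b"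
      unfolding Q_def R_def .
    then show ?thesis using True snoc by (simp add: dm_step_def del: bval_simps)
  next
    case False
    define Q R where "Q = 2 * (?v div b)" and "R = ?r"
    have "R < b" using False by (simp add: R_def)
    then have "(b * Q + R) div b = Q" "(b * Q + R) mod b = R" using assms by simp_all
    then have "bval (bs @ [c]) div b = 2 * (?v div b)" "bval (bs @ [c]) mod b = ?r"
      unfolding Q_def R_def v by simp_all
    then show ?thesis using False snoc by (simp add: dm_step_def del: bval_simps)
  qed
qed simp

lemma ptime_dm:
  assumes "ptime a" "ptime b"
  shows "ptime (\<lambda>x. foldl (dm_step (b x)) (0, 0) (nbits (a x)))"
proof (rule ptime_foldl)
  show "pbd (\<lambda>x. 2 * sz (a x) + 1 + sz (a x))" by (intro pbd_add pbd_mult pbd_const pbd_sz assms)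
  show "sz (foldl (dm_step (b x)) (0, 0) (take n (nbits (a x)))) \<le> 2 * sz (a x) + 1 + sz (a x)" for x n
  proof -
    let ?f = "foldl (dm_step (b x)) (0, 0) (take n (nbits (a x)))"
    have "(2 :: nat) ^ length (take n (nbits (a x))) \<le> 2 ^ sz (a x)" by (intro power_increasing) auto
    then have "sz (fst ?f) \<le> sz (a x)" "sz (snd ?f) \<le> sz (a x)"
      unfolding sz_nat_le using dm_step_le[of "b x" "take n (nbits (a x))"] by linarith+
    then show ?thesis using sz_Pair[of "fst ?f" "snd ?f"] by simp
  qed
  show "ptime (\<lambda>z. dm_step (b (fst z)) (fst (snd z)) (snd (snd z)))"
    unfolding dm_step_def by (intro pt ptime_comp[OF assms(2)])
qed (intro pt assms)+

lemma ptime_mod_nat [pt]: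
  assumes "ptime a" "ptime b"
  shows "ptime (\<lambda>x. (a x :: nat) mod b x)"
proof -
  have eq: "a x mod b x = (if 0 < b x then snd (foldl (dm_step (b x)) (0, 0) (nbits (a x))) else a x)" for x
    by (simp add: dm_step_correct)
  show ?thesis unfolding eq by (intro pt ptime_dm assms)
qed

lemma ptime_dvd_nat [pt]:
  assumes "ptime a" "ptime b"
  shows "ptime (\<lambda>x. (a x :: nat) dvd b x)"
  unfolding dvd_eq_mod_eq_0 by (intro pt assms)

subsection \<open>Indexing and loops of polynomial length\<close>

lemma foldl_const_funpow: "foldl (\<lambda>a _. g a) a xs = (g ^^ length xs) a"
  by (induction xs arbitrary: a) (auto simp: funpow_swap1)

lemma ptime_length [pt]:
  assumes "ptime xs"
  shows "ptime (\<lambda>x. length (xs x))"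
proof -
  have fl: "foldl (\<lambda>n _. Suc n) m ys = m + length ys" for m and ys :: "'b list" by (induction ys arbitrary: m) auto
  have "ptime (\<lambda>x. foldl (\<lambda>n _. Suc n) 0 (xs x))"
  proof (rule ptime_foldl)
    show "sz (foldl (\<lambda>n _. Suc n) 0 (take n (xs x))) \<le> sz (xs x)" for x n
      unfolding fl using sz_nat_le_self[of "0 + length (take n (xs x))"] length_le_sz[of "xs x"] by simp
  qed (intro pt assms pbd_sz)+
  then show ?thesis by (simp add: fl)
qed

lemma ptime_take [pt]:
  assumes "ptime n" "ptime xs"
  shows "ptime (\<lambda>x. take (n x) (xs x))"
proof -
  let ?f = "\<lambda>x st y. if fst st < n x then (Suc (fst st), y # snd st) else st"
  have fl: "foldl (?f x) (0, []) ys = (min (n x) (length ys), rev (take (n x) ys))" for x and ys :: "'b list"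
    by (induction ys rule: rev_induct) (auto simp: min_def)
  have "ptime (\<lambda>x. foldl (?f x) (0, []) (xs x))"
  proof (rule ptime_foldl)
    show "pbd (\<lambda>x. 2 * sz (xs x) + 1 + sz (xs x))" by (intro pbd_add pbd_mult pbd_const pbd_sz assms)
    show "sz (foldl (?f x) (0, []) (take k (xs x))) \<le> 2 * sz (xs x) + 1 + sz (xs x)" for x k
    proof -
      have "sz (min (n x) (length (take k (xs x)))) \<le> sz (xs x)"
        using sz_nat_le_self[of "min (n x) (length (take k (xs x)))"] length_le_sz[of "xs x"] by simp
      moreover have "sz (take (n x) (take k (xs x))) \<le> sz (xs x)" by (rule order_trans[OF sz_take sz_take])
      ultimately show ?thesis unfolding fl sz_Pair by simp
    qed
  qed (intro pt assms ptime_comp[OF assms(1)])+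
  from ptime_rev[OF ptime_snd[OF this]] show ?thesis by (simp add: fl)
qed

text \<open>Beyond the end \<open>!\<close> has no computable meaning, so indexing takes a default
  value.\<close>

definition nthd :: "'a list \<Rightarrow> nat \<Rightarrow> 'a \<Rightarrow> 'a" where
  "nthd xs i d = (if i < length xs then xs ! i else d)"

lemma ptime_nthd [pt]:
  assumes "ptime xs" "ptime i" "ptime d"
  shows "ptime (\<lambda>x. nthd (xs x) (i x) (d x))"
proof -
  let ?f = "\<lambda>x st y. (Suc (fst st), if fst st = i x then y else snd st)"
  have fl: "foldl (?f x) (0, d x) ys = (length ys, nthd ys (i x) (d x))" for x and ys :: "'b list"
    by (induction ys rule: rev_induct) (auto simp: nthd_def nth_append)
  have "ptime (\<lambda>x. foldl (?f x) (0, d x) (xs x))"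
  proof (rule ptime_foldl)
    show "pbd (\<lambda>x. 2 * sz (xs x) + 1 + (sz (xs x) + sz (d x)))" by (intro pbd_add pbd_mult pbd_const pbd_sz assms)
    show "sz (foldl (?f x) (0, d x) (take k (xs x))) \<le> 2 * sz (xs x) + 1 + (sz (xs x) + sz (d x))" for x k
    proof -
      have "sz (length (take k (xs x))) \<le> sz (xs x)"
        using sz_nat_le_self[of "length (take k (xs x))"] length_le_sz[of "xs x"] by simp
      moreover have "sz (nthd (take k (xs x)) (i x) (d x)) \<le> sz (xs x) + sz (d x)"
        using sz_mem[of "take k (xs x) ! i x" "xs x"]
        by (auto simp: nthd_def dest: in_set_takeD[OF nth_mem] intro: trans_le_add1)
      ultimately show ?thesis unfolding fl sz_Pair by simp
    qed
  qed (intro pt assms ptime_comp[OF assms(2)])+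
  from ptime_snd[OF this] show ?thesis by (simp add: fl)
qed

lemma ptime_ticks_eq:
  fixes n :: "'e :: pcode \<Rightarrow> nat"
  assumes "ptime n" "pbd n"
  shows "ptime (\<lambda>x. replicate (n x) ())"
proof -
  obtain c :: "'e \<Rightarrow> unit list" where c: "ptime c" "\<And>x. n x \<le> length (c x)" using ptime_ticks[OF assms(2)] by blast
  have "take (n x) (c x) = replicate (n x) ()" for x
    using c(2)[of x] by (intro nth_equalityI) auto
  then show ?thesis using ptime_take[OF assms(1) c(1)] by simp
qed

lemma ptime_upt:
  assumes "ptime n" "pbd n"
  shows "ptime (\<lambda>x. [0..<n x])"
proof -
  let ?f = "\<lambda>st _. (Suc (fst st), fst st # snd st)"
  have fl: "foldl ?f (0, []) ys = (length ys, rev [0..<length ys])" for ys :: "unit list"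
    by (induction ys rule: rev_induct) auto
  have "ptime (\<lambda>x. foldl ?f (0, []) (replicate (n x) ()))"
  proof (rule ptime_foldl)
    show "pbd (\<lambda>x. 2 * n x + 1 + n x * (2 * n x + 1))" by (intro pbd_add pbd_mult pbd_const assms)
    show "sz (foldl ?f (0, []) (take k (replicate (n x) ()))) \<le> 2 * n x + 1 + n x * (2 * n x + 1)" for x k
    proof -
      let ?m = "length (take k (replicate (n x) ()))"
      have m: "?m \<le> n x" by simp
      have "sz [0..<?m] \<le> length [0..<?m] * (2 * n x + 1)"
        using m sz_nat_le_self by (intro sz_list_bound) (auto intro!: order_trans[OF sz_nat_le_self])
      also have "\<dots> \<le> n x * (2 * n x + 1)" using m by (intro mult_right_mono) auto
      finally show ?thesis using m order_trans[OF sz_nat_le_self[of ?m] m] unfolding fl sz_Pair by simp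
    qed
  qed (intro pt ptime_ticks_eq assms)+
  from ptime_rev[OF ptime_snd[OF this]] show ?thesis by (simp add: fl)
qed

text \<open>The exponent itself, and not just its length, has to be polynomially bounded, since it
  multiplies the length of the result.\<close>

lemma ptime_power_nat:
  assumes "ptime a" "ptime k" "pbd k"
  shows "ptime (\<lambda>x. a x ^ k x :: nat)"
proof -
  have fl: "foldl (\<lambda>m _. m * a x) 1 ys = a x ^ length ys" for x and ys :: "unit list"
    by (induction ys rule: rev_induct) auto
  have "ptime (\<lambda>x. foldl (\<lambda>m _. m * a x) 1 (replicate (k x) ()))"
  proof (rule ptime_foldl)
    show "pbd (\<lambda>x. sz (a x) * k x + 1)" by (intro pbd_add pbd_mult pbd_const pbd_sz assms)
    show "sz (foldl (\<lambda>m _. m * a x) 1 (take n (replicate (k x) ()))) \<le> sz (a x) * k x + 1" for x n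
    proof -
      let ?m = "length (take n (replicate (k x) ()))"
      have "a x ^ ?m \<le> (2 ^ sz (a x)) ^ ?m" using less_two_sz[of "a x"] by (intro power_mono) auto
      also have "\<dots> \<le> (2 ^ sz (a x)) ^ k x" by (intro power_increasing) auto
      also have "\<dots> < 2 ^ (sz (a x) * k x + 1)" by (simp add: power_mult)
      finally show ?thesis unfolding fl sz_nat_le .
    qed
  qed (intro pt ptime_ticks_eq assms ptime_comp[OF assms(1)])+
  then show ?thesis by (simp only: fl length_replicate)
qed

subsection \<open>Integers\<close>

lemma ptime_int [pt]:
  assumes "ptime n"
  shows "ptime (\<lambda>x. int (n x))"
  by (rule ptime_comp[OF ptimeI[OF pw_Cons[of _ False]] assms])
    (simp add: code_int_def code_nat_def bin_int_def)

lemma ptime_neg_int: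
  assumes "ptime n"
  shows "ptime (\<lambda>x. - int (n x))"
proof -
  have "ptime (\<lambda>n. - int n)"
    by (rule ptimeI[OF pw_case[OF pw_id pw_const[of _ "[False]"] pw_Cons[of _ True] pw_Cons[of _ True]]])
      (auto simp: code_int_def code_nat_def bin_int_def split: list.splits dest: arg_cong[of _ _ "\<lambda>xs. xs = []"])
  then show ?thesis using assms by (rule ptime_comp)
qed

lemma ptime_nat_abs [pt]:
  assumes "ptime i"
  shows "ptime (\<lambda>x. nat \<bar>i x :: int\<bar>)"
  by (rule ptime_comp[OF ptimeI[OF pw_tl, where f = "\<lambda>i. nat \<bar>i\<bar>"] assms])
    (simp add: code_int_def code_nat_def bin_int_def)

lemma ptime_neg [pt]:
  assumes "ptime i"
  shows "ptime (\<lambda>x. (i x :: int) < 0)"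
  by (rule ptime_comp[OF ptimeI[OF pw_case[OF pw_id pw_const[of _ "[]"] pw_const[of _ "[True]"] pw_const[of _ "[False]"]],
      where f = "\<lambda>i. i < 0"] assms])
    (simp add: code_int_def code_bool_def bin_int_def)

lemma ptime_uminus_int [pt]:
  assumes "ptime i"
  shows "ptime (\<lambda>x. - i x :: int)"
proof -
  have eq: "- i x = (if i x < 0 then int (nat \<bar>i x\<bar>) else - int (nat \<bar>i x\<bar>))" for x by simp
  show ?thesis by (subst eq) (intro pt ptime_neg_int assms)
qed

lemma ptime_add_int [pt]:
  assumes "ptime i" "ptime j"
  shows "ptime (\<lambda>x. i x + j x :: int)"
proof -
  let ?a = "\<lambda>x. nat \<bar>i x\<bar>" and ?b = "\<lambda>x. nat \<bar>j x\<bar>"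
  have eq: "i x + j x = (if i x < 0 then if j x < 0 then - int (?a x + ?b x)
      else if ?a x \<le> ?b x then int (?b x - ?a x) else - int (?a x - ?b x)
    else if j x < 0 then if ?b x \<le> ?a x then int (?a x - ?b x) else - int (?b x - ?a x)
      else int (?a x + ?b x))" for x
    by auto
  show ?thesis by (subst eq) (intro pt ptime_neg_int assms)
qed

lemma ptime_diff_int [pt]:
  assumes "ptime i" "ptime j"
  shows "ptime (\<lambda>x. i x - j x :: int)"
  unfolding diff_conv_add_uminus by (intro pt assms)

lemma ptime_mult_int [pt]:
  assumes "ptime i" "ptime j"
  shows "ptime (\<lambda>x. i x * j x :: int)"
proof -
  have eq: "i x * j x = (if (i x < 0) = (j x < 0) then int (nat \<bar>i x\<bar> * nat \<bar>j x\<bar>) else - int (nat \<bar>i x\<bar> * nat \<bar>j x\<bar>))" for x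
    by (auto simp: nat_mult_distrib[symmetric] abs_mult[symmetric] abs_if not_less mult_nonneg_nonneg mult_le_0_iff zero_le_mult_iff)
  show ?thesis by (subst eq) (intro pt ptime_neg_int assms)
qed

lemma ptime_eq_int [pt]:
  assumes "ptime i" "ptime j"
  shows "ptime (\<lambda>x. i x = (j x :: int))"
proof -
  have eq: "(i x = j x) = (nat \<bar>i x - j x\<bar> = 0)" for x by auto
  show ?thesis unfolding eq by (intro pt assms)
qed

lemma sum_list_abs_le: "(\<And>y. y \<in> set ys \<Longrightarrow> \<bar>y\<bar> \<le> B) \<Longrightarrow> \<bar>sum_list ys\<bar> \<le> int (length ys) * (B :: int)"
proof (induction ys)
  case (Cons y ys)
  then have "\<bar>y\<bar> \<le> B" "\<bar>sum_list ys\<bar> \<le> int (length ys) * B" by auto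
  then have "\<bar>y + sum_list ys\<bar> \<le> B + int (length ys) * B" by linarith
  then show ?case by (simp add: algebra_simps)
qed simp

lemma ptime_sum_list [pt]:
  assumes "ptime xs"
  shows "ptime (\<lambda>x. sum_list (xs x) :: int)"
proof -
  have fl: "foldl (\<lambda>m y. m + y) 0 ys = sum_list ys" for ys :: "int list"
    by (induction ys rule: rev_induct) auto
  have "ptime (\<lambda>x. foldl (\<lambda>m y. m + y) 0 (xs x))"
  proof (rule ptime_foldl)
    \<comment> \<open>Fewer than \<open>2 ^ s\<close> entries of absolute value at most
      \<open>2 ^ s\<close> have a sum below \<open>2 ^ (2 * s)\<close>; the successor accounts for
      the sign bit.\<close>
    show "pbd (\<lambda>x. Suc (2 * sz (xs x)))" by (intro pbd_Suc pbd_mult pbd_const pbd_sz assms)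
    show "sz (foldl (\<lambda>m y. m + y) 0 (take n (xs x))) \<le> Suc (2 * sz (xs x))" for x n
    proof -
      let ?t = "take n (xs x)" and ?s = "sz (xs x)"
      have "\<bar>y\<bar> \<le> 2 ^ ?s" if "y \<in> set ?t" for y
      proof -
        have "(2 :: int) ^ sz y \<le> 2 ^ ?s" using sz_mem[OF in_set_takeD[OF that]] by (intro power_increasing) auto
        then show ?thesis using abs_less_two_sz[of y] by linarith
      qed
      from sum_list_abs_le[OF this] have "\<bar>sum_list ?t\<bar> \<le> int (length ?t) * 2 ^ ?s" .
      also have "length ?t \<le> ?s" using length_le_sz[of "xs x"] by (auto intro: min.coboundedI1)
      then have "length ?t < 2 ^ ?s" using less_exp[of ?s] by (rule le_less_trans)
      then have "int (length ?t) < 2 ^ ?s" by (metis of_nat_less_iff of_nat_numeral of_nat_power)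
      then have "int (length ?t) * 2 ^ ?s < 2 ^ ?s * 2 ^ ?s" by simp
      also have "\<dots> = 2 ^ (2 * ?s)" by (simp add: mult_2 power_add)
      finally show ?thesis unfolding sz_int_le by (simp add: fl)
    qed
  qed (intro pt assms)+
  then show ?thesis by (simp add: fl)
qed

section \<open>Counting approximate roots of an integer polynomial\<close>

text \<open>\<open>wdeg p F m w\<close> says that \<open>p ^ m\<close> is the exact power of \<open>p\<close> in the content of \<open>F\<close> and that
  \<open>w\<close> is the degree of \<open>F / p ^ m\<close> modulo \<open>p\<close>, the number of zeros of \<open>F\<close> among the \<open>p\<close>-adic integers of
  a splitting field (Weierstrass degree).\<close>

definition wdeg :: "int \<Rightarrow> int poly \<Rightarrow> nat \<Rightarrow> nat \<Rightarrow> bool" where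
  "wdeg p F m w \<longleftrightarrow> (\<forall>i. p ^ m dvd coeff F i) \<and> \<not> p ^ Suc m dvd coeff F w \<and> (\<forall>i>w. p ^ Suc m dvd coeff F i)"

lemma wdeg_exists:
  assumes "prime p" "F \<noteq> 0"
  shows "\<exists>m w. wdeg p F m w"
proof -
  let ?P = "\<lambda>m. \<forall>i. p ^ m dvd coeff F i"
  have p1: "\<bar>p\<bar> > 1" using prime_gt_1_int[OF assms(1)] by simp
  have bd: "m \<le> nat \<bar>lead_coeff F\<bar>" if "?P m" for m
  proof -
    have "p ^ m dvd lead_coeff F" using that by simp
    then have "\<bar>p ^ m\<bar> \<le> \<bar>lead_coeff F\<bar>" using assms(2) by (intro dvd_imp_le_int) auto
    moreover have "int m < \<bar>p ^ m\<bar>"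
    proof -
      have "int m < 2 ^ m" by (metis less_exp of_nat_less_iff of_nat_numeral of_nat_power)
      also have "\<dots> \<le> \<bar>p\<bar> ^ m" using p1 by (intro power_mono) auto
      finally show ?thesis by (simp add: power_abs)
    qed
    ultimately show ?thesis by linarith
  qed
  define m where "m = (GREATEST m. ?P m)"
  have P0: "?P 0" by simp
  have Pm: "?P m" unfolding m_def by (rule GreatestI_nat[of ?P, OF P0]) (use bd in auto)
  have "\<not> ?P (Suc m)"
  proof
    assume "?P (Suc m)"
    then have "Suc m \<le> m" unfolding m_def by (rule Greatest_le_nat) (use bd in auto)
    then show False by simp
  qed
  then obtain i where i: "\<not> p ^ Suc m dvd coeff F i" by blast
  let ?Q = "\<lambda>i. \<not> p ^ Suc m dvd coeff F i"
  have bq: "j \<le> degree F" if "?Q j" for j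
    using that by (metis coeff_eq_0 dvd_0_right not_less)
  define w where "w = (GREATEST i. ?Q i)"
  have "?Q w" unfolding w_def by (rule GreatestI_nat[of ?Q, OF i]) (use bq in auto)
  moreover have "p ^ Suc m dvd coeff F j" if "j > w" for j
  proof (rule ccontr)
    assume "\<not> p ^ Suc m dvd coeff F j"
    then have "j \<le> w" unfolding w_def by (rule Greatest_le_nat) (use bq in auto)
    then show False using that by simp
  qed
  ultimately show ?thesis using Pm unfolding wdeg_def by blast
qed

lemma dvd_poly_iff_dvd_coeff_0:
  fixes c :: int
  assumes "\<And>i. i \<ge> 1 \<Longrightarrow> c dvd coeff F i"
  shows "c dvd poly F y \<longleftrightarrow> c dvd coeff F 0"
proof (cases F)
  case (pCons a q)
  have "c dvd coeff q i" for i using assms[of "Suc i"] pCons by simp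
  then have "c dvd poly q y" unfolding poly_altdef by (intro dvd_sum) simp
  then show ?thesis using pCons by (simp add: dvd_add_left_iff)
qed

text \<open>Removing one linear factor at a time: a root \<open>\<rho>\<close> modulo \<open>p\<close> is split off by synthetic division.\<close>

lemma sum_multiplicities_le:
  fixes p :: int and F :: "int poly" and \<mu> :: "int \<Rightarrow> nat"
  assumes p: "prime p" and fin: "finite R"
    and inc: "\<And>\<rho> \<sigma>. \<rho> \<in> R \<Longrightarrow> \<sigma> \<in> R \<Longrightarrow> p dvd \<rho> - \<sigma> \<Longrightarrow> \<rho> = \<sigma>"
  shows "\<not> p dvd coeff F w \<Longrightarrow> (\<And>i. i > w \<Longrightarrow> p dvd coeff F i) \<Longrightarrow>
    (\<And>\<rho> i. \<rho> \<in> R \<Longrightarrow> i < \<mu> \<rho> \<Longrightarrow> p dvd coeff (F \<circ>\<^sub>p [:\<rho>, 1:]) i) \<Longrightarrow> (\<Sum>\<rho>\<in>R. \<mu> \<rho>) \<le> w"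
proof (induction w arbitrary: F \<mu>)
  case (0 F \<mu>)
  have "\<mu> \<rho> = 0" if "\<rho> \<in> R" for \<rho>
  proof (rule ccontr)
    assume "\<mu> \<rho> \<noteq> 0"
    then have "p dvd poly F \<rho>" using 0(3)[OF that, of 0] by (simp add: poly_pcompose coeff_pcompose_0)
    then have "p dvd coeff F 0" using dvd_poly_iff_dvd_coeff_0[of p F \<rho>] 0(2) by simp
    then show False using 0(1) by simp
  qed
  then show ?case by simp
next
  case (Suc w F \<mu>)
  note prems = Suc.prems
  show ?case
  proof (cases "\<forall>\<rho>\<in>R. \<mu> \<rho> = 0")
    case False
    then obtain \<rho> where \<rho>: "\<rho> \<in> R" "\<mu> \<rho> > 0" by auto
    define c where "c = poly F \<rho>"
    define G where "G = synthetic_div F \<rho>"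
    have FG: "F = [:- \<rho>, 1:] * G + [:c:]"
      unfolding c_def G_def by (rule synthetic_div_correct'[symmetric])
    have pc: "p dvd c" using Suc.prems(3)[OF \<rho>] by (simp add: coeff_pcompose_0 c_def)
    have cF: "coeff F (Suc i) = coeff G i - \<rho> * coeff G (Suc i)" for i
      by (subst FG) (simp add: coeff_pCons)
    have top: "p dvd coeff G i" if "i \<ge> Suc w" for i
    proof -
      have "\<And>i. i \<ge> Suc w \<Longrightarrow> Suc (degree G) - i = n \<Longrightarrow> p dvd coeff G i" for n
      proof (induction n)
        case 0
        then show ?case by (simp add: coeff_eq_0)
      next
        case (Suc n)
        then have "p dvd coeff G (Suc i)" by simp
        moreover have "p dvd coeff F (Suc i)" using prems(2) Suc.prems by simp
        moreover have "coeff G i = coeff F (Suc i) + \<rho> * coeff G (Suc i)" by (simp add: cF)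
        ultimately show ?case by simp
      qed
      then show ?thesis using that by blast
    qed
    have nw: "\<not> p dvd coeff G w"
    proof
      assume "p dvd coeff G w"
      then have "p dvd coeff F (Suc w)" unfolding cF using top[of "Suc w"] by simp
      then show False using Suc.prems(1) by simp
    qed
    have comp: "F \<circ>\<^sub>p [:\<sigma>, 1:] = [:\<sigma> - \<rho>, 1:] * (G \<circ>\<^sub>p [:\<sigma>, 1:]) + [:c:]" for \<sigma>
    proof -
      have "[:- \<rho>, 1:] \<circ>\<^sub>p [:\<sigma>, 1:] = [:\<sigma> - \<rho>, 1:]" by (simp add: pcompose_pCons)
      then show ?thesis by (subst FG) (simp only: pcompose_add pcompose_mult pcompose_const)
    qed
    define \<mu>' where "\<mu>' = \<mu>(\<rho> := \<mu> \<rho> - 1)"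
    \<comment> \<open>Dividing by the factor lowers the multiplicity at \<open>\<rho>\<close> by
      one. At any other \<open>\<sigma>\<close> it is kept, because \<open>\<sigma> - \<rho>\<close>
      is invertible modulo \<open>p\<close>.\<close>
    have "p dvd coeff (G \<circ>\<^sub>p [:\<sigma>, 1:]) i" if \<sigma>: "\<sigma> \<in> R" and i: "i < \<mu>' \<sigma>" for \<sigma> i
    proof (cases "\<sigma> = \<rho>")
      case True
      have "coeff (F \<circ>\<^sub>p [:\<rho>, 1:]) (Suc i) = coeff (G \<circ>\<^sub>p [:\<rho>, 1:]) i"
        unfolding comp[of \<rho>] by (simp add: coeff_pCons)
      then show ?thesis using Suc.prems(3)[OF \<rho>(1), of "Suc i"] i True by (simp add: \<mu>'_def)
    next
      case False
      have nd: "\<not> p dvd \<sigma> - \<rho>" using inc[OF \<sigma> \<rho>(1)] False by blast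
      have "i < \<mu>' \<sigma> \<Longrightarrow> p dvd coeff (G \<circ>\<^sub>p [:\<sigma>, 1:]) i" for i
      proof (induction i)
        case 0
        have "p dvd (\<sigma> - \<rho>) * coeff (G \<circ>\<^sub>p [:\<sigma>, 1:]) 0 + c"
          using Suc.prems(3)[OF \<sigma>, of 0] 0 False unfolding comp by (simp add: \<mu>'_def)
        then have "p dvd (\<sigma> - \<rho>) * coeff (G \<circ>\<^sub>p [:\<sigma>, 1:]) 0" using pc by (simp add: dvd_add_left_iff)
        then show ?case using p nd by (simp add: prime_dvd_mult_iff)
      next
        case (Suc i)
        then have IH: "p dvd coeff (G \<circ>\<^sub>p [:\<sigma>, 1:]) i" by simp
        have "p dvd coeff (F \<circ>\<^sub>p [:\<sigma>, 1:]) (Suc i)"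
          using prems(3)[OF \<sigma>, of "Suc i"] Suc.prems False
          by (simp add: \<mu>'_def)
        then have "p dvd (\<sigma> - \<rho>) * coeff (G \<circ>\<^sub>p [:\<sigma>, 1:]) (Suc i) + coeff (G \<circ>\<^sub>p [:\<sigma>, 1:]) i"
          unfolding comp by (simp add: coeff_pCons)
        then have "p dvd (\<sigma> - \<rho>) * coeff (G \<circ>\<^sub>p [:\<sigma>, 1:]) (Suc i)" using IH by (simp add: dvd_add_left_iff)
        then show ?case using p nd by (simp add: prime_dvd_mult_iff)
      qed
      then show ?thesis using i by blast
    qed
    then have "(\<Sum>\<rho>\<in>R. \<mu>' \<rho>) \<le> w" using nw top by (intro Suc.IH) auto
    moreover have "(\<Sum>\<rho>\<in>R. \<mu> \<rho>) = Suc (\<Sum>\<rho>\<in>R. \<mu>' \<rho>)"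
    proof -
      have "(\<Sum>\<rho>\<in>R. \<mu> \<rho>) = \<mu> \<rho> + (\<Sum>\<sigma>\<in>R - {\<rho>}. \<mu> \<sigma>)" by (rule sum.remove[OF fin \<rho>(1)])
      moreover have "(\<Sum>\<rho>\<in>R. \<mu>' \<rho>) = \<mu>' \<rho> + (\<Sum>\<sigma>\<in>R - {\<rho>}. \<mu>' \<sigma>)" by (rule sum.remove[OF fin \<rho>(1)])
      moreover have "(\<Sum>\<sigma>\<in>R - {\<rho>}. \<mu>' \<sigma>) = (\<Sum>\<sigma>\<in>R - {\<rho>}. \<mu> \<sigma>)" by (intro sum.cong) (auto simp: \<mu>'_def)
      ultimately show ?thesis using \<rho>(2) by (simp add: \<mu>'_def)
    qed
    ultimately show ?thesis by simp
  qed simp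
qed

lemma coeff_pcompose_scale: "coeff (F \<circ>\<^sub>p [:0, c:]) i = c ^ i * coeff F i" for F :: "int poly"
proof (induction F arbitrary: i)
  case (pCons a F)
  then show ?case by (cases i) (simp_all add: pcompose_pCons coeff_pCons)
qed simp

lemma pcompose_dvd:
  fixes c :: int
  assumes "\<And>i. c dvd coeff F i"
  shows "c dvd coeff (F \<circ>\<^sub>p G) i"
proof -
  have "[:c:] dvd F" using assms by (simp add: const_poly_dvd_iff)
  then obtain H where H: "F = [:c:] * H" by (elim dvdE)
  have "F \<circ>\<^sub>p G = [:c:] * (H \<circ>\<^sub>p G)" unfolding H by (simp add: pcompose_mult pcompose_smult)
  then show ?thesis by simp
qed

text \<open>Substituting \<open>\<rho> + p y\<close> multiplies the \<open>i\<close>-th Taylor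
  coefficient at \<open>\<rho>\<close> by \<open>p ^ i\<close>. So the multiplicity of
  \<open>\<rho>\<close> as a root of \<open>F / p ^ m\<close> modulo \<open>p\<close> bounds both
  the degree on the class of \<open>\<rho>\<close> and the growth of the content, and these
  multiplicities add up to at most \<open>w\<close>.\<close>

theorem wdeg_children:
  assumes p: "prime p" and F: "wdeg p F m w"
    and fin: "finite R" and inc: "\<And>\<rho> \<sigma>. \<rho> \<in> R \<Longrightarrow> \<sigma> \<in> R \<Longrightarrow> p dvd \<rho> - \<sigma> \<Longrightarrow> \<rho> = \<sigma>"
    and ch: "\<And>\<rho>. \<rho> \<in> R \<Longrightarrow> wdeg p (F \<circ>\<^sub>p [:\<rho>, p:]) (m' \<rho>) (w' \<rho>)"
  shows "(\<Sum>\<rho>\<in>R. w' \<rho>) \<le> w" and "\<And>\<rho>. \<rho> \<in> R \<Longrightarrow> m' \<rho> \<le> m + w"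
proof -
  have p0: "p \<noteq> 0" using p by auto
  have "[:p ^ m:] dvd F" using F by (simp add: const_poly_dvd_iff wdeg_def)
  then obtain H where H: "F = [:p ^ m:] * H" by (elim dvdE)
  have cH: "coeff F i = p ^ m * coeff H i" for i unfolding H by simp
  have H1: "\<not> p dvd coeff H w" and H2: "\<And>i. i > w \<Longrightarrow> p dvd coeff H i"
    using F p0 unfolding wdeg_def cH by (auto simp: mult.commute[of p])
  define \<mu> where "\<mu> \<rho> = (LEAST i. \<not> p dvd coeff (H \<circ>\<^sub>p [:\<rho>, 1:]) i)" for \<rho>
  have ex: "\<exists>i. \<not> p dvd coeff (H \<circ>\<^sub>p [:\<rho>, 1:]) i" for \<rho>
  proof (rule ccontr)
    assume "\<nexists>i. \<not> p dvd coeff (H \<circ>\<^sub>p [:\<rho>, 1:]) i"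
    then have "p dvd coeff ((H \<circ>\<^sub>p [:\<rho>, 1:]) \<circ>\<^sub>p [:- \<rho>, 1:]) w"
      using pcompose_dvd[of p "H \<circ>\<^sub>p [:\<rho>, 1:]" "[:- \<rho>, 1:]" w] by blast
    also have "(H \<circ>\<^sub>p [:\<rho>, 1:]) \<circ>\<^sub>p [:- \<rho>, 1:] = H"
      by (simp add: pcompose_assoc[symmetric] pcompose_pCons)
    finally show False using H1 by simp
  qed
  have mu: "\<not> p dvd coeff (H \<circ>\<^sub>p [:\<rho>, 1:]) (\<mu> \<rho>)" "\<And>i. i < \<mu> \<rho> \<Longrightarrow> p dvd coeff (H \<circ>\<^sub>p [:\<rho>, 1:]) i" for \<rho>
    unfolding \<mu>_def using LeastI_ex[OF ex[of \<rho>]] not_less_Least by blast+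
  have mu_sum: "(\<Sum>\<rho>\<in>R'. \<mu> \<rho>) \<le> w" if "R' \<subseteq> R" for R'
    using that by (intro sum_multiplicities_le[OF p finite_subset[OF that fin] inc H1 H2 mu(2)]) auto
  have cc: "coeff (F \<circ>\<^sub>p [:\<rho>, p:]) i = p ^ (m + i) * coeff (H \<circ>\<^sub>p [:\<rho>, 1:]) i" for \<rho> i
  proof -
    have "F \<circ>\<^sub>p [:\<rho>, p:] = [:p ^ m:] * ((H \<circ>\<^sub>p [:\<rho>, 1:]) \<circ>\<^sub>p [:0, p:])"
      unfolding H by (simp add: pcompose_mult pcompose_smult pcompose_assoc[symmetric] pcompose_pCons)
    then show ?thesis by (simp add: coeff_pcompose_scale power_add)
  qed
  have key: "m' \<rho> \<le> m + \<mu> \<rho> \<and> w' \<rho> \<le> \<mu> \<rho>" if "\<rho> \<in> R" for \<rho>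
  proof -
    note w = ch[OF that, unfolded wdeg_def cc]
    have 1: "m' \<rho> \<le> m + \<mu> \<rho>"
    proof (rule ccontr)
      assume "\<not> m' \<rho> \<le> m + \<mu> \<rho>"
      then have "p ^ Suc (m + \<mu> \<rho>) dvd p ^ m' \<rho>" by (intro le_imp_power_dvd) simp
      also have "\<dots> dvd p ^ (m + \<mu> \<rho>) * coeff (H \<circ>\<^sub>p [:\<rho>, 1:]) (\<mu> \<rho>)" using w by blast
      finally show False using p0 mu(1)[of \<rho>] by (simp add: mult.commute[of p])
    qed
    \<comment> \<open>Beyond index \<open>\<mu> \<rho>\<close> the factor \<open>p ^ (m + i)\<close>
      alone exceeds the content.\<close>
    have 2: "w' \<rho> \<le> \<mu> \<rho>"
    proof (rule ccontr)
      assume "\<not> w' \<rho> \<le> \<mu> \<rho>"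
      then have "p ^ Suc (m' \<rho>) dvd p ^ (m + w' \<rho>)" using 1 by (intro le_imp_power_dvd) simp
      then have "p ^ Suc (m' \<rho>) dvd p ^ (m + w' \<rho>) * coeff (H \<circ>\<^sub>p [:\<rho>, 1:]) (w' \<rho>)" by (rule dvd_mult2)
      then show False using w by blast
    qed
    show ?thesis using 1 2 by blast
  qed
  have "(\<Sum>\<rho>\<in>R. w' \<rho>) \<le> (\<Sum>\<rho>\<in>R. \<mu> \<rho>)" using key by (intro sum_mono) auto
  then show "(\<Sum>\<rho>\<in>R. w' \<rho>) \<le> w" using mu_sum[of R] by simp
  show "m' \<rho> \<le> m + w" if "\<rho> \<in> R" for \<rho>
    using key[OF that] mu_sum[of "{\<rho>}"] that by simp
qed

text \<open>A necessary condition for \<open>G\<close> to have a zero modulo \<open>p ^ J\<close> that can be read off the coefficients.\<close>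

definition alive :: "nat \<Rightarrow> nat \<Rightarrow> int poly \<Rightarrow> bool" where
  "alive p J G \<longleftrightarrow> (\<forall>s\<le>J. (\<forall>i\<ge>1. int p ^ s dvd coeff G i) \<longrightarrow> int p ^ s dvd coeff G 0)"

lemma alive_of_root:
  assumes "int p ^ J dvd poly G y"
  shows "alive p J G"
  unfolding alive_def
proof (intro allI impI)
  fix s assume s: "s \<le> J" and d: "\<forall>i\<ge>1. int p ^ s dvd coeff G i"
  have "int p ^ s dvd poly G y" using assms le_imp_power_dvd[OF s] dvd_trans by blast
  then show "int p ^ s dvd coeff G 0" using dvd_poly_iff_dvd_coeff_0[of "int p ^ s" G y] d by simp
qed

text \<open>With degree 0, \<open>G\<close> would be a nonzero constant modulo
  \<open>p ^ (m + 1)\<close>, and \<open>m < J\<close> admits this power as the level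
  \<open>s\<close> in \<open>alive\<close>.\<close>

lemma alive_wdeg_pos:
  assumes "alive p J G" "wdeg (int p) G m w" "m < J"
  shows "w \<ge> 1"
proof (rule ccontr)
  assume "\<not> w \<ge> 1"
  then have "w = 0" by simp
  then have "\<forall>i\<ge>1. int p ^ Suc m dvd coeff G i" "\<not> int p ^ Suc m dvd coeff G 0"
    using assms(2) by (auto simp: wdeg_def)
  then show False using assms(1,3) unfolding alive_def by (metis Suc_leI)
qed

text \<open>Each class splits into \<open>p\<close> classes whose degrees add up to at most its own,
  so the sum over a whole level never grows, while a further digit raises the content by at most
  \<open>w\<close>.\<close>

theorem card_alive_le:
  assumes p: "prime p" and F: "wdeg (int p) F m w"
  shows "\<exists>m' w'. (\<forall>\<kappa><p ^ e. wdeg (int p) (F \<circ>\<^sub>p [:int \<kappa>, int p ^ e:]) (m' \<kappa>) (w' \<kappa>) \<and> m' \<kappa> \<le> m + e * w) \<and>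
    (\<Sum>\<kappa><p ^ e. w' \<kappa>) \<le> w"
proof (induction e)
  case 0
  have "F \<circ>\<^sub>p [:0, 1:] = F" by simp
  then show ?case using F by (intro exI[of _ "\<lambda>_. m"] exI[of _ "\<lambda>_. w"]) simp
next
  case (Suc e)
  then obtain m1 w1 where 1: "\<And>\<kappa>. \<kappa> < p ^ e \<Longrightarrow> wdeg (int p) (F \<circ>\<^sub>p [:int \<kappa>, int p ^ e:]) (m1 \<kappa>) (w1 \<kappa>)"
    "\<And>\<kappa>. \<kappa> < p ^ e \<Longrightarrow> m1 \<kappa> \<le> m + e * w" "(\<Sum>\<kappa><p ^ e. w1 \<kappa>) \<le> w" by blast
  have pi: "prime (int p)" using p by simp
  have p0: "p > 0" using p by (rule prime_gt_0_nat)
  have F0: "F \<noteq> 0" using F by (auto simp: wdeg_def)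
  have "\<exists>m w. wdeg (int p) (F \<circ>\<^sub>p [:int \<kappa>, int p ^ Suc e:]) m w" for \<kappa>
    using p0 F0 by (intro wdeg_exists[OF pi]) (simp add: pcompose_eq_0_iff)
  then obtain m2 w2 where 2: "\<And>\<kappa>. wdeg (int p) (F \<circ>\<^sub>p [:int \<kappa>, int p ^ Suc e:]) (m2 \<kappa>) (w2 \<kappa>)" by metis
  \<comment> \<open>A further digit \<open>\<rho>\<close> is appended above the \<open>e\<close>
    digits of \<open>\<kappa>\<close>.\<close>
  have comp: "(F \<circ>\<^sub>p [:int \<kappa>, int p ^ e:]) \<circ>\<^sub>p [:int \<rho>, int p:] = F \<circ>\<^sub>p [:int (\<kappa> + p ^ e * \<rho>), int p ^ Suc e:]" for \<kappa> \<rho>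
    by (simp add: pcompose_assoc[symmetric] pcompose_pCons algebra_simps)
  have inj: "inj_on int A" for A by (simp add: inj_on_def)
  have ch: "(\<Sum>\<rho><p. w2 (\<kappa> + p ^ e * \<rho>)) \<le> w1 \<kappa>" "\<And>\<rho>. \<rho> < p \<Longrightarrow> m2 (\<kappa> + p ^ e * \<rho>) \<le> m1 \<kappa> + w1 \<kappa>"
    if "\<kappa> < p ^ e" for \<kappa>
  proof -
    let ?R = "int ` {..<p}"
    have inc: "\<rho> = \<sigma>" if \<rho>: "\<rho> \<in> ?R" and \<sigma>: "\<sigma> \<in> ?R" and d: "int p dvd \<rho> - \<sigma>" for \<rho> \<sigma>
    proof -
      have "\<bar>\<rho> - \<sigma>\<bar> < int p" using \<rho> \<sigma> by auto
      then show ?thesis using zdvd_not_zless d dvd_imp_le_int[of "\<rho> - \<sigma>" "int p"] by fastforce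
    qed
    have w2': "wdeg (int p) ((F \<circ>\<^sub>p [:int \<kappa>, int p ^ e:]) \<circ>\<^sub>p [:\<rho>, int p:]) (m2 (\<kappa> + p ^ e * nat \<rho>)) (w2 (\<kappa> + p ^ e * nat \<rho>))"
      if "\<rho> \<in> ?R" for \<rho>
    proof -
      obtain x where x: "\<rho> = int x" using \<open>\<rho> \<in> ?R\<close> by blast
      show ?thesis unfolding x comp nat_int by (rule 2)
    qed
    note c = wdeg_children[OF pi 1(1)[OF that] _ inc w2']
    have "(\<Sum>\<rho>\<in>?R. w2 (\<kappa> + p ^ e * nat \<rho>)) \<le> w1 \<kappa>" by (rule c(1)) auto
    then show "(\<Sum>\<rho><p. w2 (\<kappa> + p ^ e * \<rho>)) \<le> w1 \<kappa>" by (simp add: sum.reindex[OF inj])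
    show "m2 (\<kappa> + p ^ e * \<rho>) \<le> m1 \<kappa> + w1 \<kappa>" if "\<rho> < p" for \<rho>
      using c(2)[where \<rho> = "int \<rho>"] \<open>\<rho> < p\<close> by auto
  qed
  have dm: "\<kappa> mod p ^ e < p ^ e" "\<kappa> div p ^ e < p" "\<kappa> = \<kappa> mod p ^ e + p ^ e * (\<kappa> div p ^ e)" if "\<kappa> < p ^ Suc e" for \<kappa>
    using that p0 by (auto simp: less_mult_imp_div_less)
  have w1le: "w1 \<kappa> \<le> w" if "\<kappa> < p ^ e" for \<kappa>
    using member_le_sum[of \<kappa> "{..<p ^ e}" w1] that 1(3) by simp
  have "m2 \<kappa> \<le> m + Suc e * w" if "\<kappa> < p ^ Suc e" for \<kappa>
    using ch(2)[OF dm(1)[OF that] dm(2)[OF that]] dm(3)[OF that] 1(2)[OF dm(1)[OF that]] w1le[OF dm(1)[OF that]] by simp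
  moreover have "(\<Sum>\<kappa><p ^ Suc e. w2 \<kappa>) \<le> w"
  proof -
    have "bij_betw (\<lambda>(\<kappa>, \<rho>). \<kappa> + p ^ e * \<rho>) ({..<p ^ e} \<times> {..<p}) {..<p ^ Suc e}"
    proof (rule bij_betw_byWitness[where f' = "\<lambda>\<kappa>. (\<kappa> mod p ^ e, \<kappa> div p ^ e)"])
      show "(\<lambda>(\<kappa>, \<rho>). \<kappa> + p ^ e * \<rho>) ` ({..<p ^ e} \<times> {..<p}) \<subseteq> {..<p ^ Suc e}"
      proof (clarsimp)
        fix \<kappa> \<rho> assume a: "\<kappa> < p ^ e" "\<rho> < p"
        have "\<kappa> + p ^ e * \<rho> < p ^ e * Suc \<rho>" using a by simp
        also have "\<dots> \<le> p ^ e * p" using a by (intro mult_left_mono) auto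
        finally show "\<kappa> + p ^ e * \<rho> < p * p ^ e" by (simp add: mult.commute)
      qed
    qed (use dm p0 in auto)
    from sum.reindex_bij_betw[OF this, of w2, symmetric]
    have "(\<Sum>\<kappa><p ^ Suc e. w2 \<kappa>) = (\<Sum>\<kappa><p ^ e. \<Sum>\<rho><p. w2 (\<kappa> + p ^ e * \<rho>))"
      by (simp add: sum.cartesian_product case_prod_beta')
    also have "\<dots> \<le> (\<Sum>\<kappa><p ^ e. w1 \<kappa>)" using ch(1) by (intro sum_mono) auto
    finally show ?thesis using 1(3) by simp
  qed
  ultimately show ?case using 2 by blast
qed

text \<open>A living class contributes at least 1 to a sum that is at most \<open>w\<close>;
  \<open>m + e * w < J\<close> keeps all contents in the range where liveness is
  informative.\<close>

corollary card_alive: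
  assumes "prime p" "wdeg (int p) F m w" "m + e * w < J"
  shows "card {\<kappa>. \<kappa> < p ^ e \<and> alive p J (F \<circ>\<^sub>p [:int \<kappa>, int p ^ e:])} \<le> w"
proof -
  obtain m' w' where *: "\<And>\<kappa>. \<kappa> < p ^ e \<Longrightarrow> wdeg (int p) (F \<circ>\<^sub>p [:int \<kappa>, int p ^ e:]) (m' \<kappa>) (w' \<kappa>) \<and> m' \<kappa> \<le> m + e * w"
    "(\<Sum>\<kappa><p ^ e. w' \<kappa>) \<le> w" using card_alive_le[OF assms(1,2), of e] by blast
  let ?A = "{\<kappa>. \<kappa> < p ^ e \<and> alive p J (F \<circ>\<^sub>p [:int \<kappa>, int p ^ e:])}"
  have "card ?A = (\<Sum>\<kappa>\<in>?A. 1)" by simp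
  also have "\<dots> \<le> (\<Sum>\<kappa>\<in>?A. w' \<kappa>)"
  proof (rule sum_mono)
    fix \<kappa> assume "\<kappa> \<in> ?A"
    then show "1 \<le> w' \<kappa>"
      using *(1)[of \<kappa>] assms(3) by (intro alive_wdeg_pos[of p J "F \<circ>\<^sub>p [:int \<kappa>, int p ^ e:]" "m' \<kappa>"]) auto
  qed
  also have "\<dots> \<le> (\<Sum>\<kappa><p ^ e. w' \<kappa>)" by (intro sum_mono2) auto
  finally show ?thesis using *(2) by simp
qed

section \<open>Integer linear dependence\<close>

text \<open>Enumerates the rows other than the pivot row \<open>i\<close>.\<close>

definition skip :: "nat \<Rightarrow> nat \<Rightarrow> nat" where "skip i k = (if k < i then k else Suc k)"

lemma sum_skip:
  fixes f :: "nat \<Rightarrow> int"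
  assumes "i \<le> n"
  shows "(\<Sum>j<Suc n. f j) = f i + (\<Sum>k<n. f (skip i k))"
proof -
  have "(\<Sum>j<Suc n. f j) = f i + (\<Sum>j\<in>{..<Suc n} - {i}. f j)"
    by (rule sum.remove) (use assms in auto)
  also have "bij_betw (skip i) {..<n} ({..<Suc n} - {i})"
    by (rule bij_betw_byWitness[where f' = "\<lambda>j. if j < i then j else j - 1"])
      (use assms in \<open>auto simp: skip_def\<close>)
  from sum.reindex_bij_betw[OF this, of f, symmetric]
  have "(\<Sum>j\<in>{..<Suc n} - {i}. f j) = (\<Sum>k<n. f (skip i k))" .
  finally show ?thesis .
qed

text \<open>One step of fraction-free elimination of column \<open>n\<close> with pivot row \<open>i\<close>.\<close>

definition elim_row :: "nat \<Rightarrow> nat \<Rightarrow> (nat \<Rightarrow> nat \<Rightarrow> int) \<Rightarrow> nat \<Rightarrow> nat \<Rightarrow> int" where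
  "elim_row n i M k c = M i n * M (skip i k) c - M (skip i k) n * M i c"

lemma elim_row_relation:
  assumes i: "i \<le> n" and piv: "M i c0 \<noteq> 0" and b: "\<exists>k<n. b k \<noteq> 0"
    and rel: "\<And>c. c \<in> C \<Longrightarrow> (\<Sum>k<n. b k * elim_row c0 i M k c) = 0"
  shows "\<exists>b'. (\<exists>k<Suc n. b' k \<noteq> 0) \<and> (\<forall>c\<in>insert c0 C. (\<Sum>k<Suc n. b' k * M k c) = 0)"
proof -
  define us where "us j = (if j < i then j else j - 1)" for j :: nat
  have us: "us (skip i k) = k" for k by (simp add: us_def skip_def)
  have ns: "skip i k \<noteq> i" for k by (simp add: skip_def)
  \<comment> \<open>The relation among the reduced rows is multiplied out; the pivot row receives
    the coefficient that collects everything subtracted from the others.\<close>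
  define b' where "b' j = (if j = i then - (\<Sum>k<n. b k * M (skip i k) c0) else b (us j) * M i c0)" for j
  have bs: "b' (skip i k) = b k * M i c0" for k using ns us by (simp add: b'_def)
  have eq: "(\<Sum>k<Suc n. b' k * M k c) = (\<Sum>k<n. b k * elim_row c0 i M k c)" for c
  proof -
    have "(\<Sum>k<Suc n. b' k * M k c) = b' i * M i c + (\<Sum>k<n. b k * M i c0 * M (skip i k) c)"
      by (simp add: sum_skip[OF i] bs del: sum.lessThan_Suc)
    also have "\<dots> = (\<Sum>k<n. b k * M i c0 * M (skip i k) c) - (\<Sum>k<n. b k * M (skip i k) c0) * M i c"
      by (simp add: b'_def)
    also have "\<dots> = (\<Sum>k<n. b k * M i c0 * M (skip i k) c - b k * M (skip i k) c0 * M i c)"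
      by (simp add: sum_subtractf sum_distrib_right)
    finally show ?thesis by (simp add: elim_row_def algebra_simps)
  qed
  have "(\<Sum>k<Suc n. b' k * M k c) = 0" if "c \<in> insert c0 C" for c
    using that rel by (cases "c = c0") (auto simp: eq elim_row_def simp del: sum.lessThan_Suc)
  moreover obtain k where "k < n" "b k \<noteq> 0" using b by blast
  then have "skip i k < Suc n" "b' (skip i k) \<noteq> 0" unfolding bs using piv by (auto simp: skip_def)
  ultimately show ?thesis by blast
qed

text \<open>Elimination consumes one row and one column at a time, so the surplus row
  remains.\<close>

theorem integer_dependence:
  "\<exists>b :: nat \<Rightarrow> int. (\<exists>i<Suc n. b i \<noteq> 0) \<and> (\<forall>c<n. (\<Sum>i<Suc n. b i * M i c) = 0)"
proof (induction n arbitrary: M)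
  case 0
  show ?case by (intro exI[of _ "\<lambda>_. 1"]) auto
next
  case (Suc n)
  show ?case
  proof (cases "\<forall>i<Suc (Suc n). M i n = 0")
    case True
    obtain b where b: "\<exists>i<Suc n. b i \<noteq> 0" "\<And>c. c < n \<Longrightarrow> (\<Sum>i<Suc n. b i * M i c) = 0"
      using Suc[of M] by blast
    define b' where "b' i = (if i < Suc n then b i else 0)" for i
    have "(\<Sum>i<Suc (Suc n). b' i * M i c) = (\<Sum>i<Suc n. b i * M i c)" for c
      by (simp add: b'_def)
    moreover have "(\<Sum>i<Suc n. b i * M i n) = 0" using True by simp
    ultimately have "(\<Sum>i<Suc (Suc n). b' i * M i c) = 0" if "c < Suc n" for c
      using b(2)[of c] that by (cases "c = n") auto
    moreover have "\<exists>i<Suc (Suc n). b' i \<noteq> 0" using b(1) by (auto simp: b'_def)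
    ultimately show ?thesis by blast
  next
    case False
    then obtain i where i: "i < Suc (Suc n)" "M i n \<noteq> 0" by blast
    obtain b where b: "\<exists>k<Suc n. b k \<noteq> 0" "\<And>c. c < n \<Longrightarrow> (\<Sum>k<Suc n. b k * elim_row n i M k c) = 0"
      using Suc[of "elim_row n i M"] by blast
    have "\<exists>b'. (\<exists>k<Suc (Suc n). b' k \<noteq> 0) \<and> (\<forall>c\<in>insert n {..<n}. (\<Sum>k<Suc (Suc n). b' k * M k c) = 0)"
      by (rule elim_row_relation[where b = b and i = i]) (use i b in \<open>auto simp del: sum.lessThan_Suc\<close>)
    then show ?thesis by (auto simp: less_Suc_eq simp del: sum.lessThan_Suc)
  qed
qed

text \<open>A division-free test that tries every pivot. It is applied to matrices of fixed size
  only, where this is a bounded number of branches.\<close>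

fun singular :: "nat \<Rightarrow> (nat \<Rightarrow> nat \<Rightarrow> int) \<Rightarrow> bool" where
  "singular 0 M = False"
| "singular (Suc n) M = ((\<forall>i<Suc n. M i n = 0) \<or> (\<exists>i<Suc n. M i n \<noteq> 0 \<and> singular n (elim_row n i M)))"

theorem singular_iff:
  "singular n M \<longleftrightarrow> (\<exists>b :: nat \<Rightarrow> int. (\<exists>i<n. b i \<noteq> 0) \<and> (\<forall>c<n. (\<Sum>i<n. b i * M i c) = 0))"
proof (induction n arbitrary: M)
  case (Suc n)
  show ?case
  proof (cases "\<forall>i<Suc n. M i n = 0")
    case True
    obtain b where b: "\<exists>i<Suc n. b i \<noteq> 0" "\<And>c. c < n \<Longrightarrow> (\<Sum>i<Suc n. b i * M i c) = 0"
      using integer_dependence[of n M] by blast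
    have "(\<Sum>i<Suc n. b i * M i c) = 0" if "c < Suc n" for c
      using b(2)[of c] that True by (cases "c = n") auto
    then show ?thesis using True b(1) by auto
  next
    case False
    show ?thesis
    proof
      assume "singular (Suc n) M"
      then obtain i where i: "i < Suc n" "M i n \<noteq> 0" "singular n (elim_row n i M)" using False by auto
      then obtain b where b: "\<exists>k<n. b k \<noteq> 0" "\<And>c. c < n \<Longrightarrow> (\<Sum>k<n. b k * elim_row n i M k c) = 0"
        using Suc by blast
      have "\<exists>b'. (\<exists>k<Suc n. b' k \<noteq> 0) \<and> (\<forall>c\<in>insert n {..<n}. (\<Sum>k<Suc n. b' k * M k c) = 0)"
        by (rule elim_row_relation[where b = b and i = i]) (use i b in auto)
      then show "\<exists>b. (\<exists>i<Suc n. b i \<noteq> 0) \<and> (\<forall>c<Suc n. (\<Sum>i<Suc n. b i * M i c) = 0)"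
        by (auto simp: less_Suc_eq simp del: sum.lessThan_Suc)
    next
      assume "\<exists>b. (\<exists>i<Suc n. b i \<noteq> 0) \<and> (\<forall>c<Suc n. (\<Sum>i<Suc n. b i * M i c) = 0)"
      then obtain b where b: "\<exists>i<Suc n. b i \<noteq> 0" "\<And>c. c < Suc n \<Longrightarrow> (\<Sum>i<Suc n. b i * M i c) = 0" by blast
      obtain i where i: "i < Suc n" "M i n \<noteq> 0" using False by blast
      have r: "(\<Sum>k<n. b (skip i k) * M (skip i k) c) = - b i * M i c" if "c < Suc n" for c
        using b(2)[OF that] sum_skip[of i n "\<lambda>j. b j * M j c"] i(1) by simp
      have "(\<Sum>k<n. b (skip i k) * elim_row n i M k c) = 0" if "c < n" for c
      proof -
        have "(\<Sum>k<n. b (skip i k) * elim_row n i M k c) =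
            M i n * (\<Sum>k<n. b (skip i k) * M (skip i k) c) - M i c * (\<Sum>k<n. b (skip i k) * M (skip i k) n)"
          by (simp add: elim_row_def sum_distrib_left sum_subtractf[symmetric] algebra_simps)
        also have "\<dots> = 0" using r[of c] r[of n] that by simp
        finally show ?thesis .
      qed
      moreover have "\<exists>k<n. b (skip i k) \<noteq> 0"
      proof (rule ccontr)
        assume n: "\<not> (\<exists>k<n. b (skip i k) \<noteq> 0)"
        then have "b i * M i n = 0" using r[of n] by simp
        then have bi: "b i = 0" using i by simp
        obtain j where j: "j < Suc n" "b j \<noteq> 0" using b(1) by blast
        have "j \<noteq> i" using bi j by auto
        then have "j = skip i (if j < i then j else j - 1)" "(if j < i then j else j - 1) < n"
          using j i by (auto simp: skip_def)
        then show False using n j by metis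
      qed
      ultimately have "singular n (elim_row n i M)" using Suc by (intro Suc[THEN iffD2] exI[of _ "\<lambda>k. b (skip i k)"]) auto
      then show "singular (Suc n) M" using i by auto
    qed
  qed
qed simp

section \<open>Solutions of a linear recurrence\<close>

lemma satisfies_rec_shift: "satisfies_rec a u \<Longrightarrow> satisfies_rec a (\<lambda>n. u (n + k))"
  unfolding satisfies_rec_def
proof
  fix n assume "\<forall>n. u (n + length a) = (\<Sum>i<length a. a ! i * u (n + i))"
  from this[rule_format, of "n + k"]
  show "u (n + length a + k) = (\<Sum>i<length a. a ! i * u (n + i + k))" by (simp add: algebra_simps)
qed

lemma satisfies_rec_sum:
  assumes "\<And>i. i \<in> I \<Longrightarrow> satisfies_rec a (u i)"
  shows "satisfies_rec a (\<lambda>n. \<Sum>i\<in>I. c i * u i n)"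
proof -
  have "(\<Sum>i\<in>I. c i * u i (n + length a)) = (\<Sum>j<length a. a ! j * (\<Sum>i\<in>I. c i * u i (n + j)))" for n
  proof -
    have "(\<Sum>i\<in>I. c i * u i (n + length a)) = (\<Sum>i\<in>I. \<Sum>j<length a. a ! j * (c i * u i (n + j)))"
      using assms by (intro sum.cong) (auto simp: satisfies_rec_def sum_distrib_left mult.left_commute)
    also have "\<dots> = (\<Sum>j<length a. a ! j * (\<Sum>i\<in>I. c i * u i (n + j)))"
      by (subst sum.swap) (simp add: sum_distrib_left)
    finally show ?thesis .
  qed
  then show ?thesis by (simp add: satisfies_rec_def)
qed

lemma satisfies_rec_diff:
  assumes "satisfies_rec a u" "satisfies_rec a v"
  shows "satisfies_rec a (\<lambda>n. u n - v n)"
  using assms by (simp add: satisfies_rec_def sum_subtractf[symmetric] right_diff_distrib)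

lemma satisfies_rec_cancel:
  assumes "satisfies_rec a (\<lambda>n. c * v n)" "c \<noteq> 0"
  shows "satisfies_rec a v"
  unfolding satisfies_rec_def
proof
  fix n
  have "c * v (n + length a) = c * (\<Sum>i<length a. a ! i * v (n + i))"
    using assms(1) by (simp add: satisfies_rec_def sum_distrib_left mult.left_commute)
  then show "v (n + length a) = (\<Sum>i<length a. a ! i * v (n + i))" using assms(2) by simp
qed

lemma satisfies_rec_zero:
  assumes "satisfies_rec a u" "\<And>i. i < length a \<Longrightarrow> u i = 0"
  shows "u n = 0"
proof -
  have "u = (\<lambda>_. 0)"
    by (rule satisfies_rec_unique[OF assms(1)]) (use assms(2) in \<open>auto simp: satisfies_rec_def\<close>)
  then show ?thesis by simp
qed

text \<open>The \<open>length a + 1\<close> shifts by multiples of \<open>T\<close> lie in a space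
  of solutions of rank \<open>length a\<close>, so they are dependent. This is a recurrence along
  the progression; its leading coefficient may differ from 1, which is enough to propagate
  zeros.\<close>

lemma progression_zero:
  assumes u: "satisfies_rec a u" and z: "\<And>i. i < length a \<Longrightarrow> u (r + i * T) = 0"
  shows "u (r + k * T) = 0"
proof -
  let ?d = "length a"
  obtain b :: "nat \<Rightarrow> int" where b: "\<exists>i<Suc ?d. b i \<noteq> 0" "\<And>c. c < ?d \<Longrightarrow> (\<Sum>i<Suc ?d. b i * u (c + i * T)) = 0"
    using integer_dependence[of ?d "\<lambda>i c. u (c + i * T)"] by blast
  have "satisfies_rec a (\<lambda>n. \<Sum>i<Suc ?d. b i * u (n + i * T))"
    by (intro satisfies_rec_sum satisfies_rec_shift u)
  then have rel: "(\<Sum>i<Suc ?d. b i * u (n + i * T)) = 0" for n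
    using b(2) by (rule satisfies_rec_zero)
  define t where "t = (GREATEST i. i < Suc ?d \<and> b i \<noteq> 0)"
  have t: "t < Suc ?d" "b t \<noteq> 0"
    using GreatestI_ex_nat[of "\<lambda>i. i < Suc ?d \<and> b i \<noteq> 0" ?d] b(1) unfolding t_def by auto
  have bz: "b i = 0" if "i < Suc ?d" "i > t" for i
    using Greatest_le_nat[of "\<lambda>i. i < Suc ?d \<and> b i \<noteq> 0" i ?d] that unfolding t_def by auto
  have rel': "(\<Sum>i<Suc t. b i * u (n + i * T)) = 0" for n
  proof -
    have "(\<Sum>i<Suc t. b i * u (n + i * T)) = (\<Sum>i<Suc ?d. b i * u (n + i * T))"
      using t bz by (intro sum.mono_neutral_left) auto
    then show ?thesis using rel by simp
  qed
  show ?thesis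
  proof (induction k rule: less_induct)
    case (less k)
    show ?case
    proof (cases "k < ?d")
      case False
      then have kt: "t \<le> k" using t by simp
      have "(\<Sum>i<t. b i * u (r + (k - t) * T + i * T)) = 0"
      proof (intro sum.neutral ballI)
        fix i assume "i \<in> {..<t}"
        then have "u (r + (k - t + i) * T) = 0" using kt by (intro less) auto
        then show "b i * u (r + (k - t) * T + i * T) = 0" by (simp add: algebra_simps)
      qed
      then have "b t * u (r + (k - t) * T + t * T) = 0" using rel'[of "r + (k - t) * T"] by simp
      moreover have "r + (k - t) * T + t * T = r + k * T" using add_mult_distrib[of "k - t" t T] kt by simp
      ultimately show ?thesis using t by simp
    qed (use z in simp)
  qed
qed

subsection \<open>Periods modulo a prime\<close>

definition dif :: "nat \<Rightarrow> (nat \<Rightarrow> int) \<Rightarrow> nat \<Rightarrow> int" where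
  "dif T u n = u (n + T) - u n"

lemma newton_forward: "u (r + k * T) = (\<Sum>j\<le>k. int (k choose j) * (dif T ^^ j) u r)"
proof (induction k arbitrary: u)
  case (Suc k)
  have "u (r + Suc k * T) = u (r + k * T) + dif T u (r + k * T)"
    by (simp add: dif_def algebra_simps)
  also have "\<dots> = (\<Sum>j\<le>k. int (k choose j) * (dif T ^^ j) u r) + (\<Sum>j\<le>k. int (k choose j) * (dif T ^^ Suc j) u r)"
    unfolding Suc[of u] Suc[of "dif T u"] by (simp add: funpow_Suc_right del: funpow.simps)
  also have "(\<Sum>j\<le>k. int (k choose j) * (dif T ^^ j) u r) = u r + (\<Sum>j<k. int (k choose Suc j) * (dif T ^^ Suc j) u r)"
    by (subst sum.atMost_shift) simp
  also have "(\<Sum>j<k. int (k choose Suc j) * (dif T ^^ Suc j) u r) = (\<Sum>j\<le>k. int (k choose Suc j) * (dif T ^^ Suc j) u r)"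
    by (simp add: lessThan_Suc_atMost[symmetric])
  finally have "u (r + Suc k * T) = u r + (\<Sum>j\<le>k. int (Suc k choose Suc j) * (dif T ^^ Suc j) u r)"
    by (simp add: sum.distrib[symmetric] algebra_simps del: funpow.simps)
  also have "\<dots> = (\<Sum>j\<le>Suc k. int (Suc k choose j) * (dif T ^^ j) u r)"
    by (subst (2) sum.atMost_shift) (simp add: lessThan_Suc_atMost del: funpow.simps binomial_Suc_Suc)
  finally show ?case .
qed simp

text \<open>Every integer solution is an integer combination of these, so a period modulo
  \<open>p\<close> has to be found for \<open>length a\<close> sequences only and then serves all
  solutions.\<close>

definition fundamental :: "int list \<Rightarrow> nat \<Rightarrow> nat \<Rightarrow> int" where
  "fundamental a i = (SOME u. satisfies_rec a u \<and> (\<forall>j<length a. u j = of_bool (j = i)))"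

fun rec_list :: "int list \<Rightarrow> int list \<Rightarrow> nat \<Rightarrow> int list" where
  "rec_list a w 0 = w"
| "rec_list a w (Suc n) = rec_list a (tl w @ [\<Sum>i<length a. a ! i * w ! i]) n"

lemma rec_solution_exists:
  assumes "length w = length a"
  shows "\<exists>u. satisfies_rec a u \<and> (\<forall>j<length a. u j = w ! j)"
proof (cases "a = []")
  case True
  then show ?thesis by (intro exI[of _ "\<lambda>_. 0"]) (auto simp: satisfies_rec_def)
next
  case False
  have len: "length (rec_list a w n) = length a" if "length w = length a" for w n
    using that False by (induction n arbitrary: w) auto
  have nth: "rec_list a w (n + i) ! 0 = rec_list a w n ! i" if "length w = length a" "i < length a" for w n i
    using that
  proof (induction i arbitrary: w n)
    case (Suc i)
    have step: "rec_list a w (Suc m) = tl (rec_list a w m) @ [\<Sum>i<length a. a ! i * rec_list a w m ! i]" if "length w = length a" for w m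
      using that False by (induction m arbitrary: w) auto
    have "rec_list a w (n + Suc i) ! 0 = rec_list a w (Suc n) ! i" using Suc.IH[of w "Suc n"] Suc.prems by simp
    also have "\<dots> = rec_list a w n ! Suc i"
      unfolding step[OF Suc.prems(1)] using len[OF Suc.prems(1), of n] Suc.prems(2) by (auto simp: nth_append nth_tl)
    finally show ?case .
  qed simp
  have step: "rec_list a w (Suc m) = tl (rec_list a w m) @ [\<Sum>i<length a. a ! i * rec_list a w m ! i]" if "length w = length a" for w m
    using that False by (induction m arbitrary: w) auto
  let ?u = "\<lambda>n. rec_list a w n ! 0"
  obtain e where e: "length a = Suc e" using False by (cases a) auto
  have "?u (n + length a) = (\<Sum>i<length a. a ! i * ?u (n + i))" for n
  proof -
    have "?u (n + length a) = rec_list a w (Suc n) ! e" using nth[OF assms, of e "Suc n"] e by simp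
    also have "\<dots> = (\<Sum>i<length a. a ! i * rec_list a w n ! i)"
      unfolding step[OF assms] using len[OF assms, of n] e by (simp add: nth_append)
    also have "\<dots> = (\<Sum>i<length a. a ! i * ?u (n + i))" using nth[OF assms] by (intro sum.cong) auto
    finally show ?thesis .
  qed
  moreover have "?u j = w ! j" if "j < length a" for j using nth[OF assms that, of 0] by simp
  ultimately show ?thesis unfolding satisfies_rec_def by (intro exI[of _ ?u]) auto
qed

lemma fundamental:
  assumes "i < length a"
  shows "satisfies_rec a (fundamental a i)" "j < length a \<Longrightarrow> fundamental a i j = of_bool (j = i)"
proof -
  have "\<exists>u. satisfies_rec a u \<and> (\<forall>j<length a. u j = of_bool (j = i))"
    using rec_solution_exists[of "map (\<lambda>j. of_bool (j = i)) [0..<length a]" a] by auto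
  from someI_ex[OF this, folded fundamental_def]
  show "satisfies_rec a (fundamental a i)" "j < length a \<Longrightarrow> fundamental a i j = of_bool (j = i)" by auto
qed

lemma fundamental_expansion:
  assumes "satisfies_rec a u"
  shows "u n = (\<Sum>i<length a. u i * fundamental a i n)"
proof -
  have "satisfies_rec a (\<lambda>n. u n - (\<Sum>i<length a. u i * fundamental a i n))"
    by (intro satisfies_rec_diff assms satisfies_rec_sum) (use fundamental in auto)
  moreover have "u j - (\<Sum>i<length a. u i * fundamental a i j) = 0" if "j < length a" for j
  proof -
    have "(\<Sum>i<length a. u i * fundamental a i j) = (\<Sum>i<length a. if j = i then u i else 0)"
      using fundamental(2) that by (intro sum.cong) auto
    then show ?thesis using that by simp
  qed
  ultimately have "u n - (\<Sum>i<length a. u i * fundamental a i n) = 0" by (rule satisfies_rec_zero)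
  then show ?thesis by simp
qed

text \<open>The windows of length \<open>d\<close> of the \<open>d\<close> basis solutions consist
  of \<open>d * d\<close> residues, so among \<open>p ^ (d * d) + 1\<close> positions two agree. The
  agreement extends forwards by the recurrence and backwards because \<open>a ! 0\<close> is
  invertible modulo \<open>p\<close>.\<close>

theorem period_exists:
  fixes p :: nat
  assumes p: "prime p" and a0: "\<not> int p dvd a ! 0" and a: "a \<noteq> []"
  shows "\<exists>T. 1 \<le> T \<and> T \<le> p ^ (length a * length a) \<and>
    (\<forall>u n. satisfies_rec a u \<longrightarrow> int p dvd u (n + T) - u n)"
proof -
  let ?d = "length a" and ?f = "fundamental a"
  define st where "st n = map (\<lambda>c. nat (?f (c div ?d) (n + c mod ?d) mod int p)) [0..<?d * ?d]" for n
  have p0: "p > 0" using p by (rule prime_gt_0_nat)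
  let ?S = "{xs. set xs \<subseteq> {..<p} \<and> length xs = ?d * ?d}"
  have fS: "finite ?S" "card ?S = p ^ (?d * ?d)"
    using card_lists_length_eq[of "{..<p}" "?d * ?d"] finite_lists_length_eq[of "{..<p}" "?d * ?d"] by auto
  have "st ` {..p ^ (?d * ?d)} \<subseteq> ?S" using p0 by (auto simp: st_def nat_less_iff)
  then have "card (st ` {..p ^ (?d * ?d)}) \<le> p ^ (?d * ?d)" unfolding fS(2)[symmetric] by (rule card_mono[OF fS(1)])
  then have "card (st ` {..p ^ (?d * ?d)}) \<noteq> card {..p ^ (?d * ?d)}" by simp
  then have "\<not> inj_on st {..p ^ (?d * ?d)}" using card_image by blast
  then obtain x y where "x \<le> p ^ (?d * ?d)" "y \<le> p ^ (?d * ?d)" "x \<noteq> y" "st x = st y"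
    unfolding inj_on_def by auto
  then obtain n0 m0 where nm: "n0 < m0" "m0 \<le> p ^ (?d * ?d)" "st n0 = st m0"
    by (cases "x < y") (auto intro: that[of x y] that[of y x])
  have window: "int p dvd ?f i (m0 + j) - ?f i (n0 + j)" if "i < ?d" "j < ?d" for i j
  proof -
    let ?c = "i * ?d + j"
    have c: "?c < ?d * ?d" "?c div ?d = i" "?c mod ?d = j"
    proof -
      have "?c < Suc i * ?d" using that by simp
      also have "\<dots> \<le> ?d * ?d" using that by (intro mult_right_mono) auto
      finally show "?c < ?d * ?d" .
    qed (use that a in auto)
    have "st n0 ! ?c = st m0 ! ?c" using nm by simp
    then have "nat (?f i (n0 + j) mod int p) = nat (?f i (m0 + j) mod int p)" using c by (simp add: st_def)
    then have "?f i (n0 + j) mod int p = ?f i (m0 + j) mod int p" using p0 by (simp add: eq_nat_nat_iff)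
    then show ?thesis by (simp add: mod_eq_dvd_iff[symmetric])
  qed
  have rec: "?f i (n + ?d) = (\<Sum>k<?d. a ! k * ?f i (n + k))" if "i < ?d" for i n
    using fundamental(1)[OF that] unfolding satisfies_rec_def by blast
  have fwd: "int p dvd ?f i (m0 + j) - ?f i (n0 + j)" if i: "i < ?d" for i j
  proof (induction j rule: less_induct)
    case (less j)
    show ?case
    proof (cases "j < ?d")
      case False
      define l where "l = j - ?d"
      have j: "j = l + ?d" using False by (simp add: l_def)
      have "?f i (m0 + j) - ?f i (n0 + j) = (\<Sum>k<?d. a ! k * (?f i (m0 + (l + k)) - ?f i (n0 + (l + k))))"
        using rec[OF i, of "m0 + l"] rec[OF i, of "n0 + l"] unfolding j
        by (simp add: add.assoc sum_subtractf right_diff_distrib)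
      also have "int p dvd \<dots>" using less j by (intro dvd_sum dvd_mult) simp
      finally show ?thesis .
    qed (use window[OF i] in simp)
  qed
  define T where "T = m0 - n0"
  \<comment> \<open>The recurrence is solved for its oldest term. Truncated subtraction stops the
    descent at index 0, so \<open>s = n0\<close> covers all indices.\<close>
  have bwd: "int p dvd ?f i (n0 - s + j + T) - ?f i (n0 - s + j)" if i: "i < ?d" for i j s
  proof (induction s arbitrary: j)
    case 0
    have "n0 + j + T = m0 + j" using nm by (simp add: T_def)
    then show ?case using fwd[OF i, of j] by (simp only: diff_zero)
  next
    case (Suc s)
    show ?case
    proof (cases "n0 - s = 0")
      case True
      then show ?thesis using Suc[of j] by simp
    next
      case False
      define l where "l = n0 - Suc s"
      have l: "n0 - s = Suc l" using False by (simp add: l_def)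
      have pos: "int p dvd ?f i (l + j + T) - ?f i (l + j)" if "j > 0" for j
        using Suc[of "j - 1"] that unfolding l by simp
      have "int p dvd ?f i (l + T) - ?f i l"
      proof -
        obtain e where e: "?d = Suc e" using a by (cases a) auto
        let ?g = "\<lambda>k. ?f i (l + k + T) - ?f i (l + k)"
        have g: "int p dvd ?g (Suc k)" for k using pos[of "Suc k"] by simp
        have "?g ?d = (\<Sum>k<?d. a ! k * ?g k)"
          using rec[OF i, of "l + T"] rec[OF i, of l]
          by (simp add: sum_subtractf right_diff_distrib algebra_simps)
        also have "\<dots> = a ! 0 * ?g 0 + (\<Sum>k<e. a ! Suc k * ?g (Suc k))"
          unfolding e by (subst sum.lessThan_Suc_shift) simp
        finally have "a ! 0 * ?g 0 = ?g ?d - (\<Sum>k<e. a ! Suc k * ?g (Suc k))" by simp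
        also have "int p dvd \<dots>" unfolding e by (rule dvd_diff[OF g dvd_sum]) (rule dvd_mult[OF g])
        finally have "int p dvd ?g 0" using p a0 by (simp add: prime_dvd_mult_iff)
        then show ?thesis by simp
      qed
      then show ?thesis using pos[of j] unfolding l_def[symmetric] by (cases "j = 0") auto
    qed
  qed
  have "int p dvd u (n + T) - u n" if "satisfies_rec a u" for u n
  proof -
    have "u (n + T) - u n = (\<Sum>i<?d. u i * (?f i (n + T) - ?f i n))"
      using fundamental_expansion[OF that, of "n + T"] fundamental_expansion[OF that, of n]
      by (simp add: sum_subtractf right_diff_distrib)
    also have "int p dvd \<dots>" using bwd[of _ n0 n] by (intro dvd_sum dvd_mult) simp
    finally show ?thesis .
  qed
  then show ?thesis using nm by (intro exI[of _ T]) (auto simp: T_def)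
qed

text \<open>The difference of a solution divided by \<open>c\<close> is again an integer solution,
  so the next difference contributes another factor \<open>c\<close>.\<close>

lemma dif_power_dvd:
  assumes per: "\<And>u n. satisfies_rec a u \<Longrightarrow> c dvd u (n + T) - u n" and c: "c \<noteq> 0"
  shows "satisfies_rec a u \<Longrightarrow> c ^ j dvd (dif T ^^ j) u n"
proof -
  have "satisfies_rec a u \<Longrightarrow> \<exists>w. satisfies_rec a w \<and> (\<forall>n. (dif T ^^ j) u n = c ^ j * w n)"
  proof (induction j)
    case (Suc j)
    then obtain w where w: "satisfies_rec a w" "\<And>n. (dif T ^^ j) u n = c ^ j * w n" by blast
    define v where "v n = (w (n + T) - w n) div c" for n
    have v: "w (n + T) - w n = c * v n" for n using per[OF w(1)] by (simp add: v_def)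
    have "satisfies_rec a v"
    proof (rule satisfies_rec_cancel[OF _ c])
      show "satisfies_rec a (\<lambda>n. c * v n)"
        unfolding v[symmetric] by (intro satisfies_rec_diff satisfies_rec_shift w)
    qed
    moreover have "(dif T ^^ Suc j) u n = c ^ Suc j * v n" for n
      using v[of n] w(2) by (simp add: dif_def right_diff_distrib[symmetric])
    ultimately show ?case by blast
  qed (auto intro: exI[of _ u])
  then show "satisfies_rec a u \<Longrightarrow> c ^ j dvd (dif T ^^ j) u n" by auto
qed

section \<open>Zeros of a recurrence sequence as roots of integer polynomials\<close>

text \<open>With \<open>t = \<kappa> + h y\<close>, \<open>newton q \<kappa> h\<close> is the Newton series \<open>\<Sum>j. q\<^sub>j t (t - 1) \<dots> (t - j + 1)\<close> as a
  polynomial in \<open>y\<close>.\<close>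

fun newton :: "int list \<Rightarrow> int \<Rightarrow> int \<Rightarrow> int poly" where
  "newton [] \<kappa> h = 0"
| "newton (q # qs) \<kappa> h = [:q:] + [:\<kappa>, h:] * newton qs (\<kappa> - 1) h"

text \<open>Restriction to a residue class only changes the parameters of \<open>newton\<close>, so
  one Horner scheme yields the coefficients on every class.\<close>

lemma newton_pcompose: "newton qs c 1 \<circ>\<^sub>p [:\<kappa>, h:] = newton qs (c + \<kappa>) h"
proof (induction qs arbitrary: c)
  case (Cons q qs)
  have "[:c, 1:] \<circ>\<^sub>p [:\<kappa>, h:] = [:c + \<kappa>, h:]" by (simp add: pcompose_pCons)
  moreover have "c - 1 + \<kappa> = c + \<kappa> - 1" by simp
  ultimately show ?case using Cons[of "c - 1"] by (simp only: newton.simps pcompose_add pcompose_mult pcompose_const)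
qed simp

lemma poly_newton: "poly (newton qs c 1) y = (\<Sum>j<length qs. qs ! j * (\<Prod>i<j. c - int i + y))"
proof (induction qs arbitrary: c)
  case (Cons q qs)
  have "(\<Sum>j<length (q # qs). (q # qs) ! j * (\<Prod>i<j. c - int i + y)) =
      q + (\<Sum>j<length qs. qs ! j * (\<Prod>i<Suc j. c - int i + y))"
    unfolding list.size add_Suc_right add_0_right by (subst sum.lessThan_Suc_shift) simp
  also have "(\<Sum>j<length qs. qs ! j * (\<Prod>i<Suc j. c - int i + y)) =
      (\<Sum>j<length qs. (c + y) * (qs ! j * (\<Prod>i<j. c - 1 - int i + y)))"
    by (intro sum.cong refl, subst prod.lessThan_Suc_shift) (simp add: algebra_simps)
  finally have "(\<Sum>j<length (q # qs). (q # qs) ! j * (\<Prod>i<j. c - int i + y)) =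
      q + (c + y) * poly (newton qs (c - 1) 1) y"
    by (simp only: Cons[of "c - 1"] sum_distrib_left)
  then show ?case by (simp add: algebra_simps)
qed simp

lemma prod_falling: "(\<Prod>i<j. int k - int i) = int (fact j * (k choose j))"
proof (induction j)
  case (Suc j)
  have "fact (Suc j) * (k choose Suc j) = fact j * (k choose j) * (k - j)"
  proof -
    have "Suc j * (k choose Suc j) = (k - j) * (k choose j)"
      by (simp only: binomial_absorption binomial_absorb_comp)
    then have "fact j * (Suc j * (k choose Suc j)) = fact j * ((k - j) * (k choose j))" by (rule arg_cong)
    then show ?thesis by (simp only: fact_Suc of_nat_id mult.assoc mult.commute mult.left_commute)
  qed
  moreover have "int (fact j * (k choose j)) * (int k - int j) = int (fact j * (k choose j) * (k - j))"
    by (cases "j \<le> k") (simp_all add: of_nat_diff binomial_eq_0)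
  ultimately show ?case using Suc by simp
qed simp

text \<open>Downwards from the degree: a coefficient of \<open>F\<close> is one of the product minus
  \<open>c\<close> times the next higher one of \<open>F\<close>.\<close>

lemma monic_linear_dvd_cancel:
  fixes c :: int
  assumes "\<And>i. m dvd coeff ([:c, 1:] * F) i"
  shows "m dvd coeff F i"
proof -
  have "i \<ge> Suc (degree F) - n \<Longrightarrow> m dvd coeff F i" for n i
  proof (induction n arbitrary: i)
    case 0
    then show ?case by (simp add: coeff_eq_0)
  next
    case (Suc n)
    then have "m dvd coeff F (Suc i)" by simp
    moreover have "coeff F i = coeff ([:c, 1:] * F) (Suc i) - c * coeff F (Suc i)"
      by (simp add:)
    ultimately show ?case by (simp only: dvd_diff[OF assms dvd_mult])
  qed
  from this[of "Suc (degree F)" i] show ?thesis by simp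
qed

text \<open>Falling factorials are monic, so passing to monomials loses no common divisor: the value
  at \<open>- c\<close> is the first coefficient, and after subtracting it the monic factor
  \<open>[:c, 1:]\<close> cancels.\<close>

lemma newton_content:
  "(\<And>i. m dvd coeff (newton qs c 1) i) \<Longrightarrow> q \<in> set qs \<Longrightarrow> m dvd q"
proof (induction qs arbitrary: c)
  case (Cons q0 qs)
  have "m dvd poly (newton (q0 # qs) c 1) (- c)" unfolding poly_altdef by (intro dvd_sum dvd_mult2 Cons.prems(1))
  then have q0: "m dvd q0" by simp
  have "m dvd coeff ([:c, 1:] * newton qs (c - 1) 1) i" for i
  proof -
    have "coeff ([:c, 1:] * newton qs (c - 1) 1) i = coeff (newton (q0 # qs) c 1) i - coeff [:q0:] i" by simp
    moreover have "m dvd coeff [:q0:] i" using q0 by (cases i) auto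
    ultimately show ?thesis using Cons.prems(1)[of i] by (simp only: dvd_diff)
  qed
  then have "m dvd coeff (newton qs (c - 1) 1) i" for i by (rule monic_linear_dvd_cancel)
  then show ?case using Cons q0 by auto
qed simp

text \<open>Only falling factorials of degree at least \<open>i\<close> contribute to the
  coefficient at \<open>i\<close>.\<close>

lemma newton_coeff_dvd:
  "(\<And>j. i \<le> j \<Longrightarrow> j < length qs \<Longrightarrow> m dvd qs ! j) \<Longrightarrow> m dvd coeff (newton qs c h) i"
proof (induction qs arbitrary: i c)
  case (Cons q qs)
  have tl: "m dvd coeff (newton qs (c - 1) h) k" if "Suc k \<ge> i" for k
    using Cons.prems[of "Suc _"] that by (intro Cons.IH) auto
  show ?case
  proof (cases i)
    case 0
    then show ?thesis using tl[of 0] Cons.prems[of 0] by (simp add: coeff_pCons)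
  next
    case (Suc k)
    then show ?thesis using tl[of k] tl[of i] by (simp add: coeff_pCons)
  qed
qed simp

text \<open>Legendre's formula: the \<open>n div p\<close> multiples of \<open>p\<close> up to
  \<open>n\<close> give one factor \<open>p\<close> each and leave
  \<open>fact (n div p)\<close>.\<close>

lemma multiplicity_fact_rec:
  fixes p :: nat
  assumes p: "prime p"
  shows "multiplicity p (fact n :: nat) = n div p + multiplicity p (fact (n div p) :: nat)"
proof -
  have p1: "p > 1" using p by (rule prime_gt_1_nat)
  have fs: "multiplicity p (fact (Suc n) :: nat) = multiplicity p (Suc n) + multiplicity p (fact n :: nat)" for n
    unfolding fact_Suc of_nat_id by (rule prime_elem_multiplicity_mult_distrib) (use p in auto)
  show ?thesis
  proof (induction n)
    case (Suc n)
    have "multiplicity p (fact (Suc n) :: nat) = multiplicity p (Suc n) + multiplicity p (fact n :: nat)"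
      by (rule fs)
    also have "\<dots> = Suc n div p + multiplicity p (fact (Suc n div p) :: nat)"
    proof (cases "p dvd Suc n")
      case True
      then obtain t where t: "Suc n = p * t" by (elim dvdE)
      then obtain t' where t': "t = Suc t'" by (cases t) auto
      have nd: "n div p = t'" by (rule div_nat_eqI) (use t t' p1 in simp_all)
      have "Suc n div p = t" using t p1 by simp
      moreover have "multiplicity p (Suc n) = Suc (multiplicity p t)"
        unfolding t using p t' by (intro multiplicity_times_same) auto
      moreover have "multiplicity p (fact t :: nat) = multiplicity p t + multiplicity p (fact t' :: nat)"
        unfolding t' by (rule fs)
      ultimately show ?thesis using Suc nd t' by simp
    next
      case False
      then have "Suc n div p = n div p" by (simp add: div_Suc dvd_eq_mod_eq_0)
      then show ?thesis using Suc False by (simp add: not_dvd_imp_multiplicity_0)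
    qed
    finally show ?case .
  qed simp
qed

text \<open>Legendre's bound \<open>n / (p - 1)\<close> is at most \<open>n / 2\<close> for
  \<open>p \<ge> 3\<close>. For \<open>p = 2\<close> it would come close to \<open>n\<close> and
  consume the whole gain \<open>p ^ j\<close> of the differences.\<close>

lemma multiplicity_fact_double_le:
  fixes p :: nat
  assumes p: "prime p" "p \<ge> 3"
  shows "2 * multiplicity p (fact n :: nat) \<le> n"
proof -
  note rec = multiplicity_fact_rec[OF p(1)]
  show ?thesis
  proof (induction n rule: less_induct)
    case (less n)
    show ?case
    proof (cases "n = 0")
      case False
      then have "2 * multiplicity p (fact (n div p) :: nat) \<le> n div p" using p by (intro less) simp
      then have "2 * multiplicity p (fact n :: nat) \<le> 3 * (n div p)" using rec[of n] by simp
      also have "\<dots> \<le> p * (n div p)" using p by (intro mult_right_mono) auto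
      also have "\<dots> \<le> n" by simp
      finally show ?thesis .
    qed simp
  qed
qed

lemma multiplicity_of_nat:
  fixes p n :: nat
  assumes "prime p" "n \<noteq> 0"
  shows "multiplicity (int p) (int n) = multiplicity p n"
proof (rule multiplicity_eqI)
  show "int p ^ multiplicity p n dvd int n"
    using multiplicity_dvd[of p n] by (metis int_dvd_int_iff of_nat_power)
  have "\<not> p ^ Suc (multiplicity p n) dvd n"
    using assms by (subst power_dvd_iff_le_multiplicity) auto
  then show "\<not> int p ^ Suc (multiplicity p n) dvd int n" by (metis int_dvd_int_iff of_nat_power)
qed

text \<open>The factor \<open>J!\<close> clears the denominators of the coefficients \<open>\<delta>\<^sub>j / j!\<close> of Newton's forward
  difference formula.\<close>

definition interp :: "nat \<Rightarrow> (nat \<Rightarrow> int) \<Rightarrow> int list" where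
  "interp J \<delta> = map (\<lambda>j. int (fact J div fact j) * \<delta> j) [0..<J]"

text \<open>With \<open>A\<close> the multiplicity of \<open>p\<close> in \<open>fact J\<close>,
  coefficient \<open>j\<close> is divisible by at least \<open>p\<close> to the power
  \<open>A + j / 2\<close>, whereas \<open>\<delta> j0\<close> keeps the content exponent at most
  \<open>A + V\<close>. So the degree is at most \<open>2 * V\<close>, and \<open>J\<close> exceeds
  every content within \<open>E\<close> levels.\<close>

theorem interp_alive_bound:
  fixes p :: nat
  assumes p: "prime p" "p \<ge> 3" and \<delta>: "\<And>j. int p ^ j dvd \<delta> j"
    and j0: "\<delta> j0 \<noteq> 0" "\<bar>\<delta> j0\<bar> < 2 ^ V" "j0 < J" and J: "J > 2 * (V + 2 * V * E)" and e: "e \<le> E"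
  shows "card {\<kappa>. \<kappa> < p ^ e \<and> alive p J (newton (interp J \<delta>) (int \<kappa>) (int p ^ e))} \<le> J"
proof -
  let ?qs = "interp J \<delta>" and ?F = "newton (interp J \<delta>) 0 1"
  let ?A = "multiplicity p (fact J :: nat)"
  have pi: "prime (int p)" using p by simp
  have fd: "fact J = fact J div fact j * (fact j :: nat)" if "j \<le> J" for j
    using that by (simp add: fact_dvd)
  have fd0: "fact J div fact j \<noteq> (0 :: nat)" if "j \<le> J" for j
    using fd[OF that] by (metis fact_nonzero mult_zero_left)
  have mf: "?A = multiplicity p (fact J div fact j :: nat) + multiplicity p (fact j :: nat)" if "j \<le> J" for j
    by (subst fd[OF that]) (use p fd0[OF that] in \<open>simp add: prime_elem_multiplicity_mult_distrib\<close>)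
  have mq: "p ^ (?A - multiplicity p (fact j :: nat)) dvd (fact J div fact j :: nat)" if "j \<le> J" for j
    using mf[OF that] multiplicity_dvd[of p "fact J div fact j :: nat"] by simp
  have qd: "int p ^ (?A - multiplicity p (fact j :: nat) + j) dvd ?qs ! j" if "j < J" for j
  proof -
    have "int p ^ (?A - multiplicity p (fact j :: nat)) dvd int (fact J div fact j)"
      using mq[of j] that by (metis int_dvd_int_iff of_nat_power less_imp_le)
    then show ?thesis using that \<delta>[of j] by (simp add: interp_def power_add mult_dvd_mono)
  qed
  have q0: "?qs ! j0 \<noteq> 0" "?qs ! j0 \<in> set ?qs"
    using j0 fd0[of j0] by (auto simp: interp_def)
  \<comment> \<open>\<open>newton_content\<close> for the divisor 0, by which only 0 is
    divisible.\<close>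
  have "?F \<noteq> 0"
  proof
    assume "?F = 0"
    then have "0 dvd ?qs ! j0" by (intro newton_content[of 0 ?qs 0 "?qs ! j0"] q0(2)) simp
    then show False using q0 by simp
  qed
  then obtain m w where F: "wdeg (int p) ?F m w" using wdeg_exists[OF pi] by blast
  have "int p ^ m dvd ?qs ! j0"
    by (rule newton_content[OF _ q0(2)]) (use F in \<open>auto simp: wdeg_def\<close>)
  then have "m \<le> multiplicity (int p) (?qs ! j0)"
    using q0(1) pi by (intro multiplicity_geI) auto
  also have "?qs ! j0 = int (fact J div fact j0) * \<delta> j0" using j0 by (simp add: interp_def)
  also have "multiplicity (int p) \<dots> = multiplicity (int p) (int (fact J div fact j0)) + multiplicity (int p) (\<delta> j0)"
    using pi j0 fd0[of j0] by (intro prime_elem_multiplicity_mult_distrib) auto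
  also have "multiplicity (int p) (int (fact J div fact j0)) = multiplicity p (fact J div fact j0 :: nat)"
    by (rule multiplicity_of_nat) (use p j0 fd0[of j0] in auto)
  also have "\<dots> \<le> ?A" using mf[of j0] j0 by simp
  also have "multiplicity (int p) (\<delta> j0) \<le> V"
  proof (rule ccontr)
    assume "\<not> multiplicity (int p) (\<delta> j0) \<le> V"
    then have "int p ^ V dvd \<delta> j0" by (intro multiplicity_dvd') simp
    then have "\<bar>int p ^ V\<bar> \<le> \<bar>\<delta> j0\<bar>" using j0 by (intro dvd_imp_le_int) auto
    moreover have "(2 :: int) ^ V \<le> int p ^ V" using p by (intro power_mono) auto
    ultimately show False using j0 by simp
  qed
  finally have m: "m \<le> ?A + V" by simp
  \<comment> \<open>For \<open>j > 2 * V\<close> the exponent of \<open>qd\<close> is at least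
    \<open>?A + j / 2\<close>, which is larger than \<open>?A + V \<ge> m\<close>.\<close>
  have w: "w \<le> 2 * V"
  proof (rule ccontr)
    assume nw: "\<not> w \<le> 2 * V"
    have "int p ^ Suc m dvd ?qs ! j" if "w \<le> j" "j < J" for j
    proof -
      have "2 * multiplicity p (fact j :: nat) \<le> j" by (rule multiplicity_fact_double_le[OF p])
      moreover have "multiplicity p (fact j :: nat) \<le> ?A" using mf[of j] that by simp
      ultimately have "Suc m \<le> ?A - multiplicity p (fact j :: nat) + j" using m nw that by linarith
      then show ?thesis using qd[OF that(2)] by (rule dvd_trans[OF le_imp_power_dvd])
    qed
    then have "int p ^ Suc m dvd coeff ?F w" by (intro newton_coeff_dvd) (auto simp: interp_def)
    then show False using F by (simp add: wdeg_def)
  qed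
  \<comment> \<open>\<open>?A\<close> uses up at most half of \<open>J\<close>; the other half is
    larger than \<open>V + 2 * V * E\<close>.\<close>
  have "m + e * w < J"
  proof -
    have "e * w \<le> E * (2 * V)" using e w by (intro mult_mono) auto
    moreover have "2 * ?A \<le> J" by (rule multiplicity_fact_double_le[OF p])
    ultimately show ?thesis using m J by (simp add: algebra_simps)
  qed
  from card_alive[OF p(1) F this]
  have "card {\<kappa>. \<kappa> < p ^ e \<and> alive p J (newton ?qs (int \<kappa>) (int p ^ e))} \<le> w"
    by (simp add: newton_pcompose)
  then show ?thesis using w J by simp
qed

text \<open>At a zero of the sequence the truncated series is minus its tail, whose terms are all
  divisible by \<open>p ^ J\<close>.\<close>

lemma interp_root:
  fixes p :: nat
  assumes \<delta>: "\<And>j. int p ^ j dvd \<delta> j" and z: "(\<Sum>j\<le>k. int (k choose j) * \<delta> j) = 0"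
  shows "int p ^ J dvd poly (newton (interp J \<delta>) 0 1) (int k)"
proof -
  have "poly (newton (interp J \<delta>) 0 1) (int k) = (\<Sum>j<J. int (fact J div fact j) * \<delta> j * (\<Prod>i<j. int k - int i))"
    by (simp add: poly_newton interp_def)
  also have "\<dots> = (\<Sum>j<J. int (fact J) * (int (k choose j) * \<delta> j))"
  proof (intro sum.cong refl)
    fix j assume "j \<in> {..<J}"
    then have "fact J = fact J div fact j * (fact j :: nat)" by (simp add: fact_dvd)
    then have "int (fact J) = int (fact J div fact j) * int (fact j)" by (metis of_nat_mult)
    then show "int (fact J div fact j) * \<delta> j * (\<Prod>i<j. int k - int i) = int (fact J) * (int (k choose j) * \<delta> j)"
      by (simp add: prod_falling)
  qed
  also have "\<dots> = int (fact J) * (\<Sum>j<J. int (k choose j) * \<delta> j)" by (simp add: sum_distrib_left)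
  also have "(\<Sum>j<J. int (k choose j) * \<delta> j) = - (\<Sum>j\<in>{J..k}. int (k choose j) * \<delta> j)"
  proof -
    have "(\<Sum>j<J. int (k choose j) * \<delta> j) = (\<Sum>j\<in>{..<J} \<inter> {..k}. int (k choose j) * \<delta> j)"
      by (intro sum.mono_neutral_right) (auto simp: binomial_eq_0)
    moreover have "(\<Sum>j\<le>k. int (k choose j) * \<delta> j) =
        (\<Sum>j\<in>{..<J} \<inter> {..k}. int (k choose j) * \<delta> j) + (\<Sum>j\<in>{J..k}. int (k choose j) * \<delta> j)"
      by (subst sum.union_disjoint[symmetric]) (auto intro!: sum.cong)
    ultimately show ?thesis using z by simp
  qed
  finally have eq: "poly (newton (interp J \<delta>) 0 1) (int k) = int (fact J) * - (\<Sum>j\<in>{J..k}. int (k choose j) * \<delta> j)" .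
  have "int p ^ J dvd int (k choose j) * \<delta> j" if "j \<in> {J..k}" for j
    using \<delta>[of j] le_imp_power_dvd[of J j "int p"] that by (intro dvd_mult) (auto intro: dvd_trans)
  then have "int p ^ J dvd (\<Sum>j\<in>{J..k}. int (k choose j) * \<delta> j)" by (rule dvd_sum)
  then show ?thesis unfolding eq by simp
qed

lemma dif_power_Suc: "(dif T ^^ Suc j) u n = (dif T ^^ j) u (n + T) - (dif T ^^ j) u n"
  by (simp only: funpow.simps comp_apply dif_def)

lemma abs_dif_power_le:
  assumes "\<And>i. i \<le> n + j * T \<Longrightarrow> \<bar>u i\<bar> \<le> B"
  shows "\<bar>(dif T ^^ j) u n\<bar> \<le> 2 ^ j * B"
  using assms
proof (induction j arbitrary: n)
  case (Suc j)
  have "\<bar>(dif T ^^ j) u (n + T)\<bar> \<le> 2 ^ j * B" by (rule Suc.IH) (use Suc.prems in auto)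
  moreover have "\<bar>(dif T ^^ j) u n\<bar> \<le> 2 ^ j * B" by (rule Suc.IH) (use Suc.prems in auto)
  ultimately show ?case unfolding dif_power_Suc power_Suc by linarith
qed simp

lemma dif_power_shift: "(dif T ^^ j) (\<lambda>n. u (n + k)) n = (dif T ^^ j) u (n + k)"
proof (induction j arbitrary: n)
  case (Suc j)
  show ?case by (simp only: dif_power_Suc Suc add.assoc add.commute[of T k])
qed simp

text \<open>Stripping leading zero coefficients at the price of a preperiod \<open>k\<close>
  provides the constant coefficient that has to be invertible in
  \<open>period_exists\<close>.\<close>

lemma satisfies_rec_drop:
  assumes "satisfies_rec a u" "k \<le> length a" "\<And>i. i < k \<Longrightarrow> a ! i = 0"
  shows "satisfies_rec (drop k a) (\<lambda>n. u (n + k))"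
  unfolding satisfies_rec_def
proof
  fix n
  have "u (n + length a) = (\<Sum>i<length a. a ! i * u (n + i))" using assms(1) by (simp add: satisfies_rec_def)
  also have "\<dots> = (\<Sum>i\<in>{k..<length a}. a ! i * u (n + i))"
    using assms(3) by (intro sum.mono_neutral_right) auto
  also have "\<dots> = (\<Sum>i<length a - k. a ! (k + i) * u (n + (k + i)))"
    using assms(2) by (intro sum.reindex_bij_witness[of _ "\<lambda>i. k + i" "\<lambda>i. i - k"]) auto
  finally show "u (n + length (drop k a) + k) = (\<Sum>i<length (drop k a). drop k a ! i * u (n + i + k))"
    using assms(2) by (simp add: algebra_simps)
qed

text \<open>In degenerate situations, which are a small index, a recurrence with zero coefficients
  only, or a progression with vanishing initial differences, there is a zero
  \<open>n' \<le> n\<close> of bounded size. Otherwise the class of \<open>n\<close> lives on every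
  level, together with few others.\<close>

theorem zero_located:
  assumes u: "satisfies_rec a u" and n: "u n = 0" "n < 2 ^ E"
    and L: "\<And>i. \<bar>u i\<bar> \<le> 2 ^ (L * (i + 1))"
    and X: "\<And>c. c \<in> set a \<Longrightarrow> c \<noteq> 0 \<Longrightarrow> \<exists>p :: nat. prime p \<and> 3 \<le> p \<and> p \<le> X \<and> \<not> int p dvd c" "X \<ge> 1"
    and V: "V \<ge> length a + L * (length a + X ^ (length a * length a) * (length a + 1) + 1) + 1"
    and J: "J > 2 * (V + 2 * V * E)"
  shows "(\<exists>n'\<le>n. n' < length a + X ^ (length a * length a) \<and> u n' = 0) \<or>
    (\<exists>p T r \<kappa>. 2 \<le> p \<and> p \<le> X \<and> T \<le> X ^ (length a * length a) \<and> r < length a + X ^ (length a * length a) \<and>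
       n = r + \<kappa> * T \<and> \<kappa> < p ^ E \<and>
       (\<forall>e\<le>E. alive p J (newton (interp J (\<lambda>j. (dif T ^^ j) u r)) (int (\<kappa> mod p ^ e)) (int p ^ e)) \<and>
         card {\<kappa>. \<kappa> < p ^ e \<and> alive p J (newton (interp J (\<lambda>j. (dif T ^^ j) u r)) (int \<kappa>) (int p ^ e))} \<le> J))"
proof -
  let ?d = "length a" and ?TT = "X ^ (length a * length a)"
  have TT: "?TT \<ge> 1" using X(2) by simp
  consider "n < ?d" | "n \<ge> ?d" "\<forall>i<?d. a ! i = 0" | k where "n \<ge> ?d" "k < ?d" "a ! k \<noteq> 0" "\<And>i. i < k \<Longrightarrow> a ! i = 0"
  proof (cases "n \<ge> ?d \<and> \<not> (\<forall>i<?d. a ! i = 0)")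
    case True
    define k where "k = (LEAST k. k < ?d \<and> a ! k \<noteq> 0)"
    have ex: "\<exists>k. k < ?d \<and> a ! k \<noteq> 0" using True by blast
    have "k < ?d \<and> a ! k \<noteq> 0" unfolding k_def by (rule LeastI_ex[OF ex])
    moreover have "a ! i = 0" if "i < k" for i
      using not_less_Least[of i "\<lambda>k. k < ?d \<and> a ! k \<noteq> 0"] that calculation unfolding k_def[symmetric] by auto
    ultimately show ?thesis using True that(3) by blast
  next
    case False
    then show ?thesis by (cases "n < ?d") (use that in auto)
  qed
  then show ?thesis
  proof cases
    case 1
    then show ?thesis using n(1) by (intro disjI1 exI[of _ n]) auto
  next
    case 2
    have "u (0 + ?d) = 0" using u 2(2) unfolding satisfies_rec_def by (simp only:) (intro sum.neutral, simp)
    then show ?thesis using 2(1) X(2) by (intro disjI1 exI[of _ ?d]) auto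
  next
    case 3
    let ?a = "drop k a" and ?u = "\<lambda>n. u (n + k)"
    have u': "satisfies_rec ?a ?u" using 3 by (intro satisfies_rec_drop u) auto
    obtain p :: nat where p: "prime p" "3 \<le> p" "p \<le> X" "\<not> int p dvd a ! k" using X(1)[of "a ! k"] 3 by auto
    obtain T where T: "1 \<le> T" "T \<le> p ^ (length ?a * length ?a)"
      "\<And>v n. satisfies_rec ?a v \<Longrightarrow> int p dvd v (n + T) - v n"
      using period_exists[of p ?a] p 3 by auto
    have "p ^ (length ?a * length ?a) \<le> X ^ (length ?a * length ?a)" using p by (intro power_mono) auto
    also have "\<dots> \<le> ?TT" using X(2) by (intro power_increasing mult_mono) auto
    finally have T': "T \<le> ?TT" using T by simp
    define r \<kappa> where "r = (n - k) mod T" and "\<kappa> = (n - k) div T"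
    have nk: "n = r + k + \<kappa> * T" using 3 by (simp add: r_def \<kappa>_def)
    have r: "r < T" using T by (simp add: r_def)
    let ?\<delta> = "\<lambda>j. (dif T ^^ j) u (r + k)"
    have dvd: "int p ^ j dvd ?\<delta> j" for j
      using dif_power_dvd[of ?a "int p" T ?u j r] T(3) p u' by (simp add: dif_power_shift)
    show ?thesis
    proof (cases "\<forall>j<length ?a. ?\<delta> j = 0")
      \<comment> \<open>The start of the progression is then a zero, and it does not exceed
        \<open>n\<close>.\<close>
      case True
      have "?u (r + i * T) = 0" if "i < length ?a" for i
      proof -
        have "?u (r + i * T) = (\<Sum>j\<le>i. int (i choose j) * ?\<delta> j)"
          using newton_forward[of ?u r i T] by (simp add: dif_power_shift)
        also have "\<dots> = 0" using True that by (intro sum.neutral) auto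
        finally show ?thesis .
      qed
      then have "?u (r + 0 * T) = 0" by (rule progression_zero[OF u'])
      moreover have "r + k < ?d + ?TT" using r T' 3 by simp
      ultimately show ?thesis using nk by (intro disjI1 exI[of _ "r + k"]) auto
    next
      case False
      then obtain j0 where j0: "j0 < length ?a" "?\<delta> j0 \<noteq> 0" by blast
      \<comment> \<open>The origin of \<open>V\<close>: a difference of order less than
        \<open>length a\<close> involves only terms up to
        \<open>length a + ?TT * (length a + 1)\<close>, and its binomial weights add up to
        \<open>2 ^ j0\<close>.\<close>
      have "\<bar>?\<delta> j0\<bar> \<le> 2 ^ j0 * 2 ^ (L * (r + k + j0 * T + 1))"
        by (rule abs_dif_power_le) (rule order_trans[OF L], auto intro!: power_increasing)
      also have "\<dots> = 2 ^ (j0 + L * (r + k + j0 * T + 1))" by (simp add: power_add)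
      also have "\<dots> < 2 ^ V"
      proof (rule power_strict_increasing)
        have "j0 * T \<le> ?d * ?TT" using j0 T' by (intro mult_mono) auto
        then have "r + k + j0 * T + 1 \<le> ?d + ?TT * (?d + 1) + 1" using r T' 3 by (simp add: algebra_simps)
        then have "L * (r + k + j0 * T + 1) \<le> L * (?d + ?TT * (?d + 1) + 1)" by (rule mult_left_mono) simp
        moreover have "j0 + x < V" if "x \<le> y" "?d + y + 1 \<le> V" for x y using that j0 by simp
        ultimately show "j0 + L * (r + k + j0 * T + 1) < V" using V by blast
      qed simp
      finally have V0: "\<bar>?\<delta> j0\<bar> < 2 ^ V" .
      have j0J: "j0 < J" using j0 V J by simp
      have zero: "(\<Sum>j\<le>\<kappa>. int (\<kappa> choose j) * ?\<delta> j) = 0"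
        using newton_forward[of u "r + k" \<kappa> T] n(1) nk by simp
      let ?N = "newton (interp J ?\<delta>)"
      have al: "alive p J (?N (int (\<kappa> mod p ^ e)) (int p ^ e))" for e
      proof (rule alive_of_root)
        have "poly (?N (int (\<kappa> mod p ^ e)) (int p ^ e)) (int (\<kappa> div p ^ e)) = poly (?N 0 1) (int \<kappa>)"
        proof -
          have "int \<kappa> = int (\<kappa> mod p ^ e) + int (\<kappa> div p ^ e) * int p ^ e"
            using arg_cong[OF mod_div_mult_eq[of \<kappa> "p ^ e"], of int]
            by (simp only: of_nat_add of_nat_mult of_nat_power)
          then have "poly [:int (\<kappa> mod p ^ e), int p ^ e:] (int (\<kappa> div p ^ e)) = int \<kappa>"
            by (simp only: poly_pCons poly_0 mult_zero_right add_0_right)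
          then show ?thesis
            using newton_pcompose[of "interp J ?\<delta>" 0 "int (\<kappa> mod p ^ e)" "int p ^ e", symmetric]
            by (simp only: poly_pcompose add_0)
        qed
        then show "int p ^ J dvd poly (?N (int (\<kappa> mod p ^ e)) (int p ^ e)) (int (\<kappa> div p ^ e))"
          using interp_root[OF dvd zero, of J] by simp
      qed
      have card: "card {\<kappa>. \<kappa> < p ^ e \<and> alive p J (?N (int \<kappa>) (int p ^ e))} \<le> J" if "e \<le> E" for e
        by (rule interp_alive_bound[OF p(1,2) dvd j0(2) V0 j0J J that])
      have "\<kappa> \<le> n" unfolding \<kappa>_def by (rule order_trans[OF div_le_dividend diff_le_self])
      also have "n < 2 ^ E" by (rule n(2))
      also have "(2 :: nat) ^ E \<le> p ^ E" using p by (intro power_mono) auto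
      finally have \<kappa>E: "\<kappa> < p ^ E" .
      have "r + k < ?d + ?TT" using r T' 3 by simp
      then show ?thesis using p T' nk \<kappa>E al card
        by (intro disjI2 exI[of _ p] exI[of _ T] exI[of _ "r + k"] exI[of _ \<kappa>]) auto
    qed
  qed
qed

text \<open>One application of the recurrence multiplies the bound by at most
  \<open>d * 2 ^ L\<close>, where \<open>d = length a\<close> is less than
  \<open>2 ^ d\<close>.\<close>

lemma growth:
  assumes u: "satisfies_rec a u" and a: "\<And>c. c \<in> set a \<Longrightarrow> \<bar>c\<bar> \<le> 2 ^ L" and i: "\<And>i. i < length a \<Longrightarrow> \<bar>u i\<bar> \<le> 2 ^ L"
  shows "\<bar>u n\<bar> \<le> 2 ^ ((L + length a) * (n + 1))"
proof (induction n rule: less_induct)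
  case (less n)
  let ?d = "length a"
  show ?case
  proof (cases "n < ?d")
    case True
    have "\<bar>u n\<bar> \<le> 2 ^ L" using i True by simp
    also have "\<dots> \<le> 2 ^ ((L + ?d) * (n + 1))" by (intro power_increasing) auto
    finally show ?thesis .
  next
    case False
    define m where "m = n - ?d"
    have m: "n = m + ?d" using False by (simp add: m_def)
    show ?thesis
    proof (cases "?d = 0")
      case True
      then have "u n = 0" using u by (simp add: satisfies_rec_def)
      then show ?thesis by simp
    next
      case d: False
      have "\<bar>u n\<bar> = \<bar>\<Sum>i<?d. a ! i * u (m + i)\<bar>" using u m by (simp add: satisfies_rec_def)
      also have "\<dots> \<le> (\<Sum>i<?d. \<bar>a ! i * u (m + i)\<bar>)" by (rule sum_abs)
      also have "\<dots> \<le> (\<Sum>i<?d. 2 ^ L * 2 ^ ((L + ?d) * n))"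
      proof (rule sum_mono)
        fix i assume i: "i \<in> {..<?d}"
        have "\<bar>u (m + i)\<bar> \<le> 2 ^ ((L + ?d) * (m + i + 1))" using less i m by simp
        also have "\<dots> \<le> 2 ^ ((L + ?d) * n)" using i m by (intro power_increasing mult_left_mono) auto
        finally show "\<bar>a ! i * u (m + i)\<bar> \<le> 2 ^ L * 2 ^ ((L + ?d) * n)"
          using a[of "a ! i"] i by (simp add: abs_mult mult_mono)
      qed
      also have "\<dots> = int ?d * (2 ^ L * 2 ^ ((L + ?d) * n))" by simp
      also have "\<dots> \<le> 2 ^ ?d * (2 ^ L * 2 ^ ((L + ?d) * n))"
        using less_exp[of ?d] by (intro mult_right_mono) (auto simp: of_nat_less_iff[of ?d "2 ^ ?d", where 'a = int, symmetric] simp del: of_nat_less_iff of_nat_less_numeral_power_cancel_iff)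
      also have "\<dots> = 2 ^ ((L + ?d) * (n + 1))" by (simp add: power_add[symmetric] algebra_simps)
      finally show ?thesis .
    qed
  qed
qed

section \<open>The order of a recurrence sequence\<close>

text \<open>The polynomial \<open>F\<close> evaluated at the shift operator; sequences become a
  module over integer polynomials.\<close>

definition act :: "int poly \<Rightarrow> (nat \<Rightarrow> int) \<Rightarrow> nat \<Rightarrow> int" where
  "act F u n = (\<Sum>i\<le>degree F. coeff F i * u (n + i))"

lemma act_altdef: "degree F \<le> N \<Longrightarrow> act F u n = (\<Sum>i\<le>N. coeff F i * u (n + i))"
  unfolding act_def by (rule sum.mono_neutral_left) (auto simp: coeff_eq_0)

lemma act_0 [simp]: "act 0 u n = 0"
  by (simp add: act_def)

lemma act_pCons: "act (pCons c F) u n = c * u n + act F u (Suc n)"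
proof -
  have "act (pCons c F) u n = (\<Sum>i\<le>Suc (degree F). coeff (pCons c F) i * u (n + i))"
    by (rule act_altdef) (rule degree_pCons_le)
  then show ?thesis unfolding act_def[of F] sum.atMost_Suc_shift by simp
qed

lemma act_add: "act (F + G) u n = act F u n + act G u n"
proof -
  have "degree (F + G) \<le> max (degree F) (degree G)" by (rule degree_add_le_max)
  then show ?thesis
    using act_altdef[of "F + G" "max (degree F) (degree G)" u n] act_altdef[of F "max (degree F) (degree G)" u n]
      act_altdef[of G "max (degree F) (degree G)" u n]
    by (simp add: sum.distrib distrib_right)
qed

lemma act_smult: "act (smult c F) u n = c * act F u n"
  using act_altdef[of "smult c F" "degree F" u n] by (simp add: act_def sum_distrib_left mult.assoc degree_smult_le)

lemma act_mult: "act (F * G) u n = act F (act G u) n"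
  by (induction F arbitrary: n) (simp_all add: act_add act_smult act_pCons mult_pCons_left)

definition char_poly_of :: "int list \<Rightarrow> int poly" where
  "char_poly_of a = Poly (map uminus a @ [1])"

lemma coeff_char_poly_of:
  "coeff (char_poly_of a) i = (if i < length a then - a ! i else if i = length a then 1 else 0)"
  by (simp add: char_poly_of_def nth_default_def nth_append)

lemma degree_char_poly_of: "degree (char_poly_of a) = length a"
  by (rule antisym) (auto intro!: degree_le le_degree simp: coeff_char_poly_of)

lemma act_char_poly_of: "satisfies_rec a u \<Longrightarrow> act (char_poly_of a) u n = 0"
  unfolding act_def degree_char_poly_of satisfies_rec_def
  by (simp add: coeff_char_poly_of lessThan_Suc_atMost[symmetric] sum_negf)

text \<open>Fatou's lemma: a primitive integer polynomial of least degree annihilating \<open>u\<close> divides the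
  monic characteristic polynomial in \<open>\<int>[x]\<close> by Gauss's lemma, hence is monic up to sign.\<close>

lemma integral_recurrence:
  assumes u: "satisfies_rec a u" and B: "B \<noteq> 0" "degree B < length a" "\<And>n. act B u n = 0"
  shows "\<exists>a'. length a' < length a \<and> satisfies_rec a' u"
proof -
  define P where "P G \<longleftrightarrow> G \<noteq> 0 \<and> (\<forall>n. act G u n = 0)" for G
  obtain G0 where G0: "P G0" "\<And>H. P H \<Longrightarrow> degree G0 \<le> degree H"
    using ex_has_least_nat[of P B degree] B unfolding P_def by blast
  define G where "G = primitive_part G0"
  have G0': "G0 = smult (content G0) G" by (simp add: G_def)
  have c0: "content G0 \<noteq> 0" "G \<noteq> 0" using G0(1) unfolding P_def G_def by auto
  have GP: "P G"
    unfolding P_def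
  proof (intro conjI allI c0)
    fix n
    have "act G0 u n = content G0 * act G u n" by (subst G0') (rule act_smult)
    then show "act G u n = 0" using G0(1) c0(1) unfolding P_def by simp
  qed
  have dG: "degree G \<le> degree H" if "P H" for H
    using G0(2)[OF that] by (simp add: G_def)
  have cG: "content G = 1" unfolding G_def using G0(1) unfolding P_def by simp
  let ?\<chi> = "char_poly_of a"
  \<comment> \<open>Pseudo-division, since \<open>G\<close> is not yet known to be monic. The
    remainder annihilates \<open>u\<close> as well and vanishes by minimality of the degree.\<close>
  obtain q r where qr: "pseudo_divmod ?\<chi> G = (q, r)" by force
  define c where "c = lead_coeff G ^ (Suc (degree ?\<chi>) - degree G)"
  have eq: "smult c ?\<chi> = G * q + r" and r: "r = 0 \<or> degree r < degree G"
    using pseudo_divmod[OF c0(2) qr] unfolding c_def by auto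
  have cne: "c \<noteq> 0" using c0(2) by (simp add: c_def)
  have "act r u n = 0" for n
  proof -
    have "act (smult c ?\<chi>) u n = 0" by (simp add: act_smult act_char_poly_of[OF u])
    moreover have "act (G * q) u n = 0"
      unfolding mult.commute[of G q] act_mult using GP unfolding P_def by (simp add: act_def[of q])
    ultimately show ?thesis by (simp add: eq act_add)
  qed
  then have "P r" if "r \<noteq> 0" using that unfolding P_def by blast
  then have "r = 0" using r dG[of r] by (meson not_less)
  then have eq: "smult c ?\<chi> = G * q" using eq by simp
  \<comment> \<open>By Gauss's lemma \<open>q\<close> has the content of the whole left-hand side,
    so the factor \<open>c\<close> can be cancelled without touching \<open>G\<close>.\<close>
  have "content ?\<chi> dvd lead_coeff ?\<chi>" by (rule content_dvd_coeff)
  then have "content ?\<chi> dvd 1" by (simp add: degree_char_poly_of coeff_char_poly_of)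
  then have c\<chi>: "content ?\<chi> = 1"
    by (rule trans[OF normalize_content[symmetric] is_unit_normalize])
  have "content (smult c ?\<chi>) = content q"
    unfolding eq content_mult cG by simp
  then have "content q = \<bar>c\<bar>" by (simp add: c\<chi>)
  then have cq: "content q = \<bar>c\<bar>" .
  define q' where "q' = primitive_part q"
  have q: "q = smult \<bar>c\<bar> q'"
    unfolding q'_def cq[symmetric] by (rule content_times_primitive_part[symmetric])
  have "smult c ?\<chi> = smult \<bar>c\<bar> (G * q')" unfolding eq q by (rule mult_smult_right)
  moreover have "\<bar>c\<bar> = c * sgn c" by (simp add: abs_sgn)
  ultimately have "smult c ?\<chi> = smult c (smult (sgn c) (G * q'))" by simp
  then have "?\<chi> = smult (sgn c) (G * q')" using cne by (simp only: smult_cancel)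
  then have "lead_coeff ?\<chi> = sgn c * (lead_coeff G * lead_coeff q')"
    by (simp add: lead_coeff_mult)
  then have "1 = lead_coeff G * (sgn c * lead_coeff q')"
    by (simp add: degree_char_poly_of coeff_char_poly_of mult.left_commute)
  then have "lead_coeff G dvd 1" by (rule dvdI)
  then have lG: "lead_coeff G * lead_coeff G = 1" by (auto simp: zdvd1_eq abs_if split: if_splits)
  let ?e = "degree G"
  \<comment> \<open>The leading coefficient is 1 or -1 and hence its own inverse.\<close>
  define a' where "a' = map (\<lambda>i. - lead_coeff G * coeff G i) [0..<?e]"
  have "satisfies_rec a' u"
    unfolding satisfies_rec_def
  proof
    fix n
    have "act G u n = 0" using GP unfolding P_def by blast
    then have "(\<Sum>i<?e. coeff G i * u (n + i)) + lead_coeff G * u (n + ?e) = 0"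
      by (simp add: act_def lessThan_Suc_atMost[symmetric])
    then have "lead_coeff G * ((\<Sum>i<?e. coeff G i * u (n + i)) + lead_coeff G * u (n + ?e)) = 0" by simp
    then have "lead_coeff G * (\<Sum>i<?e. coeff G i * u (n + i)) + u (n + ?e) = 0"
      using lG by (simp only: distrib_left mult.assoc[symmetric] mult_1_left)
    then have "u (n + ?e) = - lead_coeff G * (\<Sum>i<?e. coeff G i * u (n + i))" by simp
    also have "\<dots> = (\<Sum>i<?e. a' ! i * u (n + i))"
      unfolding sum_distrib_left by (intro sum.cong) (auto simp: a'_def)
    finally show "u (n + length a') = (\<Sum>i<length a'. a' ! i * u (n + i))" by (simp add: a'_def)
  qed
  moreover have "length a' < length a"
    using dG[of B] B unfolding P_def a'_def by simp
  ultimately show ?thesis by blast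
qed

text \<open>Singularity of the Hankel matrix is a rational condition, the order an integral one;
  \<open>integral_recurrence\<close> closes the gap. In the other direction a shorter recurrence is
  a dependence with last coefficient -1.\<close>

theorem lrs_order_less_iff:
  assumes u: "satisfies_rec a u"
  shows "lrs_order u < length a \<longleftrightarrow> singular (length a) (\<lambda>i j. u (i + j))"
proof
  let ?d = "length a"
  assume "singular ?d (\<lambda>i j. u (i + j))"
  then obtain b :: "nat \<Rightarrow> int" where b: "\<exists>i<?d. b i \<noteq> 0" "\<And>c. c < ?d \<Longrightarrow> (\<Sum>i<?d. b i * u (i + c)) = 0"
    unfolding singular_iff by blast
  have "satisfies_rec a (\<lambda>n. \<Sum>i<?d. b i * u (n + i))"
    by (intro satisfies_rec_sum satisfies_rec_shift u)
  then have rel: "(\<Sum>i<?d. b i * u (n + i)) = 0" for n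
    by (rule satisfies_rec_zero) (use b(2) in \<open>simp add: add.commute\<close>)
  define B where "B = Poly (map b [0..<?d])"
  have cB: "coeff B i = (if i < ?d then b i else 0)" for i by (simp add: B_def nth_default_def)
  obtain i where i: "i < ?d" "b i \<noteq> 0" using b(1) by blast
  then have "B \<noteq> 0" using cB[of i] by auto
  moreover have dB: "degree B \<le> ?d - 1" by (rule degree_le) (auto simp: cB)
  then have "degree B < ?d" using i by simp
  moreover have "act B u n = 0" for n
  proof -
    have "act B u n = (\<Sum>i\<le>?d - 1. coeff B i * u (n + i))" by (rule act_altdef[OF dB])
    also have "\<dots> = (\<Sum>i<?d. b i * u (n + i))"
      using i by (intro sum.cong) (auto simp: cB)
    finally show ?thesis using rel by simp
  qed
  ultimately obtain a' where a': "length a' < ?d" "satisfies_rec a' u"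
    using integral_recurrence[OF u] by blast
  then have "lrs_order u \<le> length a'" unfolding lrs_order_def by (intro Least_le) blast
  then show "lrs_order u < ?d" using a' by simp
next
  let ?d = "length a"
  assume less: "lrs_order u < ?d"
  have "\<exists>a'. length a' = lrs_order u \<and> satisfies_rec a' u"
    unfolding lrs_order_def by (rule LeastI_ex) (use u in blast)
  then obtain a' where a'0: "length a' = lrs_order u" "satisfies_rec a' u" by blast
  then have a': "length a' < ?d" "satisfies_rec a' u" using less by simp_all
  let ?e = "length a'"
  define b where "b i = (if i < ?e then a' ! i else if i = ?e then - 1 else 0)" for i
  have "(\<Sum>i<?d. b i * u (i + c)) = 0" for c
  proof -
    have "(\<Sum>i<?d. b i * u (i + c)) = (\<Sum>i<Suc ?e. b i * u (i + c))"
      using a'(1) by (intro sum.mono_neutral_right) (auto simp: b_def)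
    also have "\<dots> = (\<Sum>i<?e. a' ! i * u (c + i)) - u (c + ?e)"
      by (simp add: b_def add.commute)
    finally show ?thesis using a'(2) by (simp add: satisfies_rec_def)
  qed
  moreover have "b ?e \<noteq> 0" by (simp add: b_def)
  ultimately show "singular ?d (\<lambda>i j. u (i + j))" unfolding singular_iff using a'(1) by blast
qed

section \<open>Counting primes\<close>

text \<open>Kummer's count of carries: the slack 1 in \<open>m \<le> a + b + 1\<close> is a carry in
  base \<open>p\<close>. It is preserved by division by \<open>p\<close>, and every round adds at
  most 1 to the multiplicity.\<close>

lemma multiplicity_fact_le:
  fixes p :: nat
  assumes p: "prime p"
  shows "m \<ge> 1 \<Longrightarrow> a + b \<le> m \<Longrightarrow> m \<le> a + b + 1 \<Longrightarrow>
    \<exists>s. p ^ s \<le> m \<and> multiplicity p (fact m :: nat) \<le> multiplicity p (fact a :: nat) + multiplicity p (fact b :: nat) + s"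
proof (induction m arbitrary: a b rule: less_induct)
  case (less m)
  have p1: "p > 1" using p by (rule prime_gt_1_nat)
  let ?m = "m div p" and ?a = "a div p" and ?b = "b div p"
  note rec = multiplicity_fact_rec[OF p]
  show ?case
  proof (cases "?m = 0")
    case True
    then have "multiplicity p (fact m :: nat) = 0" using rec[of m] by simp
    then show ?thesis using less.prems(1) by (intro exI[of _ 0]) simp
  next
    case False
    have 1: "?a + ?b \<le> ?m" using div_le_mono[OF less.prems(2), of p] div_add1_eq[of a b p] by linarith
    have "a < p * (?a + 1)" "b < p * (?b + 1)"
      using p1 by (simp_all add: dividend_less_times_div)
    then have "m < (?a + ?b + 2) * p" using less.prems(3) by (simp add: algebra_simps)
    then have 2: "?m \<le> ?a + ?b + 1" using less_mult_imp_div_less[of m "?a + ?b + 2" p] by simp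
    obtain s where s: "p ^ s \<le> ?m"
      "multiplicity p (fact ?m :: nat) \<le> multiplicity p (fact ?a :: nat) + multiplicity p (fact ?b :: nat) + s"
      using less.IH[of ?m ?a ?b] 1 2 False p1 less.prems(1) by auto
    have "p ^ Suc s \<le> p * ?m" using s by simp
    also have "\<dots> \<le> m" by simp
    finally show ?thesis using s(2) rec[of m] rec[of a] rec[of b] 2 by (intro exI[of _ "Suc s"]) simp
  qed
qed

lemma central_binomial_prime_power:
  fixes p n :: nat
  assumes p: "prime p" and n: "n \<ge> 1"
  shows "p ^ multiplicity p (2 * n choose n) \<le> 2 * n"
proof -
  obtain s where s: "p ^ s \<le> 2 * n"
    "multiplicity p (fact (2 * n) :: nat) \<le> multiplicity p (fact n :: nat) + multiplicity p (fact n :: nat) + s"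
    using multiplicity_fact_le[OF p, of "2 * n" n n] n by auto
  have C0: "(2 * n choose n) \<noteq> 0" by simp
  have "fact (2 * n) = fact n * fact n * (2 * n choose n)"
    using binomial_fact_lemma[of n "2 * n"] by (simp add: algebra_simps)
  then have "multiplicity p (fact (2 * n) :: nat) =
      multiplicity p (fact n :: nat) + multiplicity p (fact n :: nat) + multiplicity p (2 * n choose n)"
    using p C0 by (simp add: prime_elem_multiplicity_mult_distrib)
  then have "multiplicity p (2 * n choose n) \<le> s" using s(2) by simp
  then have "p ^ multiplicity p (2 * n choose n) \<le> p ^ s"
    using prime_gt_0_nat[OF p] by (intro power_increasing) auto
  then show ?thesis using s(1) by simp
qed

text \<open>Chebyshev: for \<open>2 n = 2 ^ b\<close> the central binomial coefficient is at least
  \<open>4 ^ n / (2 n)\<close>, and it is a product of at most as many prime powers as there are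
  primes up to \<open>2 n\<close>, each at most \<open>2 n\<close>. The added 1 absorbs the
  denominator.\<close>

theorem prime_count:
  assumes b: "b \<ge> 1"
  shows "2 ^ b \<le> b * (card {p :: nat. prime p \<and> p \<le> 2 ^ b} + 1)"
proof -
  define n :: nat where "n = 2 ^ (b - 1)"
  have n: "n \<ge> 1" "2 * n = 2 ^ b" unfolding n_def using b by (cases b; simp)+
  let ?C = "2 * n choose n" and ?P = "{p :: nat. prime p \<and> p \<le> 2 ^ b}"
  have fin: "finite ?P" by (rule finite_subset[of _ "{..2 ^ b}"]) auto
  have C0: "?C \<noteq> 0" by simp
  have "prime_factors ?C \<subseteq> ?P"
  proof
    fix p assume p: "p \<in> prime_factors ?C"
    then have pp: "prime p" "p dvd ?C" by (auto simp: in_prime_factors_iff)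
    then have "multiplicity p ?C \<ge> 1" using C0 by (intro multiplicity_geI) auto
    then have "p ^ 1 \<le> p ^ multiplicity p ?C" using prime_gt_0_nat[OF pp(1)] by (intro power_increasing) auto
    also have "\<dots> \<le> 2 * n" by (rule central_binomial_prime_power[OF pp(1) n(1)])
    finally show "p \<in> ?P" using pp n by simp
  qed
  then have cP: "card (prime_factors ?C) \<le> card ?P" by (intro card_mono fin)
  have "?C = (\<Prod>p\<in>prime_factors ?C. p ^ multiplicity p ?C)" using prod_prime_factors[OF C0] by simp
  also have "\<dots> \<le> (\<Prod>p\<in>prime_factors ?C. 2 ^ b)"
    using central_binomial_prime_power[OF _ n(1)] n(2) by (intro prod_mono) (auto simp: in_prime_factors_iff)
  also have "\<dots> = (2 ^ b) ^ card (prime_factors ?C)" by simp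
  also have "\<dots> \<le> (2 ^ b) ^ card ?P" using cP by (intro power_increasing) auto
  finally have C: "?C \<le> (2 ^ b) ^ card ?P" .
  have "4 ^ n / (2 * real n) \<le> real ?C" using n(1) by (intro central_binomial_lower_bound) simp
  then have "4 ^ n \<le> 2 * real n * real ?C" using n(1) by (simp add: field_simps)
  then have "real (4 ^ n) \<le> real (2 * n * ?C)" by simp
  then have "4 ^ n \<le> 2 * n * ?C" by (simp only: of_nat_le_iff)
  also have "\<dots> \<le> 2 ^ b * (2 ^ b) ^ card ?P" using mult_left_mono[OF C, of "2 ^ b"] n(2) by simp
  also have "\<dots> = 2 ^ (b * (card ?P + 1))" by (simp add: power_add power_mult[symmetric] mult.commute)
  finally have "(2 :: nat) ^ (2 ^ b) \<le> 2 ^ (b * (card ?P + 1))"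
    unfolding n(2)[symmetric] by (simp add: power_mult)
  then show ?thesis by (rule power_le_imp_le_exp[rotated]) simp
qed

text \<open>A product of \<open>k\<close> distinct primes is at least \<open>2 ^ k\<close>.\<close>

lemma card_prime_divisors_le:
  assumes "c \<noteq> 0" "c < 2 ^ k"
  shows "finite {p :: nat. prime p \<and> p dvd c}" "card {p :: nat. prime p \<and> p dvd c} \<le> k"
proof -
  have eq: "{p :: nat. prime p \<and> p dvd c} = prime_factors c"
    using assms(1) by (auto simp: in_prime_factors_iff)
  show "finite {p :: nat. prime p \<and> p dvd c}" unfolding eq by simp
  have "(2 :: nat) ^ card (prime_factors c) = (\<Prod>p\<in>prime_factors c. 2)" by simp
  also have "\<dots> \<le> (\<Prod>p\<in>prime_factors c. p ^ multiplicity p c)"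
  proof (rule prod_mono)
    fix p assume "p \<in> prime_factors c"
    then have pp: "prime p" "p dvd c" by (auto simp: in_prime_factors_iff)
    then have "multiplicity p c \<ge> 1" using assms(1) by (intro multiplicity_geI) auto
    then have "p ^ 1 \<le> p ^ multiplicity p c" using prime_gt_0_nat[OF pp(1)] by (intro power_increasing) auto
    then show "0 \<le> (2 :: nat) \<and> 2 \<le> p ^ multiplicity p c" using prime_ge_2_nat[OF pp(1)] by simp
  qed
  also have "\<dots> = c" using prod_prime_factors[OF assms(1)] by simp
  finally have "(2 :: nat) ^ card (prime_factors c) \<le> c" .
  then have "(2 :: nat) ^ card (prime_factors c) < 2 ^ k" using assms(2) by (rule le_less_trans)
  then have "card (prime_factors c) < k" by (rule power_less_imp_less_exp[rotated]) simp
  then show "card {p :: nat. prime p \<and> p dvd c} \<le> k" unfolding eq by simp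
qed

text \<open>At most \<open>L\<close> primes divide \<open>c\<close> and the prime 2 is excluded, so
  \<open>L + 2\<close> primes suffice. They exist up to \<open>2 ^ (2 * k)\<close> for the least
  \<open>k\<close> with \<open>L + 3 \<le> 2 ^ k\<close>; by minimality
  \<open>2 ^ k \<le> 2 * (L + 3)\<close>, whose square is the bound.\<close>

theorem small_prime_not_dividing:
  assumes c: "c \<noteq> 0" "\<bar>c\<bar> < 2 ^ L"
  shows "\<exists>p :: nat. prime p \<and> 3 \<le> p \<and> p \<le> 4 * (L + 3) ^ 2 \<and> \<not> int p dvd c"
proof -
  define k where "k = (LEAST k. L + 3 \<le> 2 ^ k)"
  have ex: "L + 3 \<le> 2 ^ (L + 3)" using less_exp[of "L + 3"] by simp
  have k: "L + 3 \<le> 2 ^ k" unfolding k_def by (rule LeastI[of "\<lambda>k. L + 3 \<le> 2 ^ k", OF ex])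
  then have k0: "k \<noteq> 0" by (intro notI) simp
  then have "\<not> L + 3 \<le> 2 ^ (k - 1)" unfolding k_def by (intro not_less_Least) simp
  then have k2: "2 ^ k \<le> 2 * (L + 3)" using k0 by (cases k) auto
  let ?b = "2 * k" and ?c = "nat \<bar>c\<bar>"
  let ?P = "{p :: nat. prime p \<and> p \<le> 2 ^ ?b}"
  have fin: "finite ?P" by (rule finite_subset[of _ "{..2 ^ ?b}"]) auto
  have "2 * k \<le> 2 ^ k"
  proof -
    obtain l where l: "k = Suc l" using k0 by (cases k) auto
    have "Suc l \<le> 2 ^ l" using less_exp[of l] by (rule Suc_leI)
    then show ?thesis using l by simp
  qed
  then have "?b * (L + 3) \<le> 2 ^ k * 2 ^ k" using k by (intro mult_mono) auto
  also have "\<dots> = 2 ^ ?b" by (simp add: power_add[symmetric] mult_2)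
  also have "\<dots> \<le> ?b * (card ?P + 1)" using k0 by (intro prime_count) simp
  finally have "?b * (L + 3) \<le> ?b * (card ?P + 1)" .
  then have "L + 3 \<le> card ?P + 1" using k0 unfolding mult_le_cancel1 by simp
  have cc: "?c \<noteq> 0" "?c < 2 ^ L" using c by (auto simp: nat_less_iff)
  note D = card_prime_divisors_le[OF cc]
  have "\<not> ?P \<subseteq> insert 2 {p :: nat. prime p \<and> p dvd ?c}"
  proof
    assume "?P \<subseteq> insert 2 {p :: nat. prime p \<and> p dvd ?c}"
    then have "card ?P \<le> card (insert 2 {p :: nat. prime p \<and> p dvd ?c})" using D(1) by (intro card_mono) auto
    also have "\<dots> \<le> Suc L"
    proof -
      have "(if B then x else Suc x) \<le> Suc L" if "x \<le> L" for B x using that by simp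
      from this[OF D(2)] show ?thesis unfolding card_insert_if[OF D(1)] .
    qed
    finally show False using \<open>L + 3 \<le> card ?P + 1\<close> by simp
  qed
  then obtain p where p: "prime p" "p \<le> 2 ^ ?b" "p \<noteq> 2" "\<not> p dvd ?c" by auto
  have "p \<le> (2 ^ k)\<^sup>2" using p(2) by (simp add: power_mult[symmetric] mult.commute)
  also have "\<dots> \<le> (2 * (L + 3))\<^sup>2" using k2 by (intro power_mono) auto
  also have "\<dots> = 4 * (L + 3)\<^sup>2" by (simp add: power2_eq_square algebra_simps)
  finally have "p \<le> 4 * (L + 3)\<^sup>2" .
  moreover have "p \<ge> 3" using prime_ge_2_nat[OF p(1)] p(3) by simp
  moreover have "\<not> int p dvd c" using p(4) by (metis int_dvd_int_iff dvd_abs_iff abs_ge_zero int_nat_eq)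
  ultimately show ?thesis using p(1) by blast
qed

text \<open>There are at least \<open>2 ^ b / b - 1\<close> primes up to \<open>2 ^ b\<close>, of
  which at most \<open>2 ^ s\<close> divide \<open>c\<close>. The choice of \<open>b\<close> makes
  the loss at most half of \<open>2 ^ b / b\<close>, so a fraction of at least
  \<open>1 / (2 b)\<close> of all numbers is good.\<close>

theorem good_moduli:
  assumes c: "c \<noteq> 0" "\<bar>c\<bar> < 2 ^ (2 ^ s)" and b: "b = 2 * s + 4"
  shows "2 ^ b \<le> 2 * b * card {m :: nat. 1 \<le> m \<and> m \<le> 2 ^ b \<and> \<not> int m dvd c}"
proof -
  let ?P = "{p :: nat. prime p \<and> p \<le> 2 ^ b}" and ?G = "{m :: nat. 1 \<le> m \<and> m \<le> 2 ^ b \<and> \<not> int m dvd c}"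
    and ?D = "{p :: nat. prime p \<and> p dvd nat \<bar>c\<bar>}"
  have cc: "nat \<bar>c\<bar> \<noteq> 0" "nat \<bar>c\<bar> < 2 ^ (2 ^ s)" using c by (auto simp: nat_less_iff)
  note D = card_prime_divisors_le[OF cc]
  have fG: "finite ?G" by (rule finite_subset[of _ "{..2 ^ b}"]) auto
  have "?P \<subseteq> ?G \<union> ?D"
    by (auto dest: prime_gt_0_nat)
  then have "card ?P \<le> card (?G \<union> ?D)" using fG D(1) by (intro card_mono) auto
  also have "\<dots> \<le> card ?G + 2 ^ s" using card_Un_le[of ?G ?D] D(2) by simp
  finally have P: "card ?P \<le> card ?G + 2 ^ s" .
  have "2 ^ b \<le> b * (card ?P + 1)" by (rule prime_count) (simp add: b)
  also have "\<dots> \<le> b * (card ?G + 2 ^ s + 1)" using P by (intro mult_left_mono) auto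
  finally have "2 * 2 ^ b \<le> 2 * b * card ?G + 2 * b * (2 ^ s + 1)" by (simp add: algebra_simps)
  moreover have "2 * b * (2 ^ s + 1) \<le> 2 ^ b"
  proof -
    have "2 * b * (2 ^ s + 1) = 4 * (s + 2) * (2 ^ s + 1)" by (simp add: b)
    also have "\<dots> \<le> 4 * (2 * 2 ^ s) * (2 * 2 ^ s)"
    proof -
      have "Suc s \<le> 2 ^ s" "(1 :: nat) \<le> 2 ^ s" using Suc_leI[OF less_exp[of s]] by simp_all
      then have "s + 2 \<le> 2 * 2 ^ s" "(2 :: nat) ^ s + 1 \<le> 2 * 2 ^ s" by simp_all
      then show ?thesis by (intro mult_mono) auto
    qed
    also have "\<dots> = 2 ^ b" by (simp add: b power_add power_even_eq power2_eq_square)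
    finally show ?thesis .
  qed
  ultimately show ?thesis by linarith
qed

section \<open>The candidate zeros\<close>

lemma pbd_length: "ptime f \<Longrightarrow> pbd (\<lambda>x. length (f x))"
  by (rule pbd_mono[OF pbd_sz]) (auto simp: length_le_sz)

theorem ptime_funpow:
  fixes s :: "'e :: pcode \<Rightarrow> 's :: pcode \<Rightarrow> 's" and c :: "'e \<Rightarrow> unit list"
  assumes s: "ptime (\<lambda>z. s (fst z) (snd z))" and i: "ptime i" and c: "ptime c"
    and B: "pbd B" "\<And>x k. k \<le> length (c x) \<Longrightarrow> sz ((s x ^^ k) (i x)) \<le> B x"
  shows "ptime (\<lambda>x. (s x ^^ length (c x)) (i x))"
proof -
  have "ptime (\<lambda>x. foldl (\<lambda>st _. s x st) (i x) (c x))"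
    by (rule ptime_foldl[where B = B]) (intro pt ptime_comp2[OF s] i c B(1) | simp add: foldl_const_funpow B(2))+
  then show ?thesis by (simp add: foldl_const_funpow)
qed

text \<open>Parameters of type \<^typ>\<open>unit list\<close> are unary numbers. Ranges are written with lengths of lists or
  capped by such a parameter, which makes their polynomial size evident.\<close>

definition cap :: "nat \<Rightarrow> 'a list \<Rightarrow> nat" where "cap n xs = (if n \<le> length xs then n else length xs)"

lemma cap_eq [simp]: "n \<le> length xs \<Longrightarrow> cap n xs = n"
  by (simp add: cap_def)

lemma cap_le: "cap n xs \<le> length xs"
  by (simp add: cap_def)

lemma ptime_cap [pt]: "ptime n \<Longrightarrow> ptime xs \<Longrightarrow> ptime (\<lambda>x. cap (n x) (xs x))"
  unfolding cap_def by (intro pt)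

lemma pbd_cap: "ptime xs \<Longrightarrow> pbd (\<lambda>x. cap (n x) (xs x))"
  by (rule pbd_mono[OF pbd_length]) (auto simp: cap_le)

lemma ptime_ticks_cap [pt]: "ptime n \<Longrightarrow> ptime xs \<Longrightarrow> ptime (\<lambda>x. replicate (cap (n x) (xs x)) ())"
  by (intro ptime_ticks_eq pt pbd_cap)

lemma ptime_upt_cap [pt]: "ptime n \<Longrightarrow> ptime xs \<Longrightarrow> ptime (\<lambda>x. [0..<cap (n x) (xs x)])"
  by (intro ptime_upt pt pbd_cap)

lemma ptime_upt_length [pt]: "ptime xs \<Longrightarrow> ptime (\<lambda>x. [0..<length (xs x)])"
  by (intro ptime_upt pt pbd_length)

lemma ptime_power_cap [pt]: "ptime a \<Longrightarrow> ptime n \<Longrightarrow> ptime xs \<Longrightarrow> ptime (\<lambda>x. a x ^ cap (n x) (xs x) :: nat)"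
  by (intro ptime_power_nat pt pbd_cap)

lemma ptime_power_length [pt]: "ptime a \<Longrightarrow> ptime xs \<Longrightarrow> ptime (\<lambda>x. a x ^ length (xs x) :: nat)"
  by (intro ptime_power_nat pt pbd_length)

lemma sz_nat_mono: "x \<le> y \<Longrightarrow> sz x \<le> sz (y :: nat)"
  unfolding sz_nat_le using less_two_sz[of y] by simp

lemma sz_nat_list: "(\<And>y. y \<in> set ys \<Longrightarrow> y \<le> m) \<Longrightarrow> sz ys \<le> length ys * (2 * sz (m :: nat) + 1)"
  by (rule sz_list_bound) (auto intro: sz_nat_mono)

text \<open>Residues are computed modulo \<open>Suc m\<close>, so that the modulus cannot vanish and \<open>m\<close> represents \<open>- 1\<close>.\<close>

definition eqm :: "nat \<Rightarrow> nat \<Rightarrow> int \<Rightarrow> bool" where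
  "eqm m x i \<longleftrightarrow> int x mod int (Suc m) = i mod int (Suc m)"

lemma eqm_mod: "eqm m x i \<Longrightarrow> eqm m (x mod Suc m) i"
  by (simp add: eqm_def zmod_int)

lemma eqm_add: "eqm m x i \<Longrightarrow> eqm m y j \<Longrightarrow> eqm m (x + y) (i + j)"
  unfolding eqm_def of_nat_add by (rule mod_add_cong)

lemma eqm_mult: "eqm m x i \<Longrightarrow> eqm m y j \<Longrightarrow> eqm m (x * y) (i * j)"
  unfolding eqm_def of_nat_mult by (rule mod_mult_cong)

lemma eqm_refl: "eqm m x (int x)"
  by (simp add: eqm_def)

lemma eqm_neg: "eqm m x i \<Longrightarrow> eqm m (m * x) (- i)"
proof -
  have "eqm m m (- 1)"
  proof -
    have "int m mod int (Suc m) = (int m + (- 1) * int (Suc m)) mod int (Suc m)" by (rule mod_mult_self1[symmetric])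
    then show ?thesis by (simp add: eqm_def)
  qed
  then show "eqm m x i \<Longrightarrow> eqm m (m * x) (- i)" using eqm_mult[of m m "- 1" x i] by simp
qed

lemma eqm_dvd: "eqm m x i \<Longrightarrow> c dvd Suc m \<Longrightarrow> c dvd x \<longleftrightarrow> int c dvd i"
  unfolding eqm_def by (metis dvd_mod_iff int_dvd_int_iff)

definition nmod :: "int \<Rightarrow> nat \<Rightarrow> nat" where
  "nmod i m = (if i < 0 then (m * nat \<bar>i\<bar>) mod Suc m else nat \<bar>i\<bar> mod Suc m)"

lemma eqm_nmod: "eqm m (nmod i m) i"
proof (cases "i < 0")
  case True
  have "eqm m (nat \<bar>i\<bar>) \<bar>i\<bar>" by (simp add: eqm_def)
  from eqm_neg[OF this] show ?thesis using True by (simp add: nmod_def eqm_mod)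
next
  case False
  then have "eqm m (nat \<bar>i\<bar>) i" by (simp add: eqm_def)
  then show ?thesis unfolding nmod_def using False by (simp only: if_False) (rule eqm_mod)
qed

lemma ptime_nmod [pt]: "ptime i \<Longrightarrow> ptime m \<Longrightarrow> ptime (\<lambda>x. nmod (i x) (m x))"
  unfolding nmod_def by (intro pt)

subsection \<open>Terms of the sequence\<close>

definition dotm :: "nat \<Rightarrow> nat list \<Rightarrow> nat list \<Rightarrow> nat" where
  "dotm m xs ys = foldl (\<lambda>s i. (s + nthd xs i 0 * nthd ys i 0) mod Suc m) 0 [0..<length xs]"

lemma ptime_dotm [pt]:
  assumes "ptime m" "ptime xs" "ptime ys"
  shows "ptime (\<lambda>x. dotm (m x) (xs x) (ys x))"
  unfolding dotm_def
proof (rule ptime_foldl)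
  show "sz (foldl (\<lambda>s i. (s + nthd (xs x) i 0 * nthd (ys x) i 0) mod Suc (m x)) 0 (take n [0..<length (xs x)])) \<le> sz (m x)" for x n
  proof -
    have "foldl (\<lambda>s i. (s + nthd (xs x) i 0 * nthd (ys x) i 0) mod Suc (m x)) 0 is \<le> m x" for "is"
      by (induction "is" rule: rev_induct) auto
    then show ?thesis by (rule sz_nat_mono)
  qed
  show "pbd (\<lambda>x. sz (m x))" by (intro pbd_sz assms)
qed (intro pt assms ptime_comp[OF assms(1)] ptime_comp[OF assms(2)] ptime_comp[OF assms(3)])+

lemma dotm_le: "dotm m xs ys \<le> m"
proof -
  have "foldl (\<lambda>s i. (s + nthd xs i 0 * nthd ys i 0) mod Suc m) 0 is \<le> m" for "is"
    by (induction "is" rule: rev_induct) auto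
  then show ?thesis unfolding dotm_def .
qed

lemma set_tl_subset: "set (tl xs) \<subseteq> set xs"
  by (cases xs) auto

lemma eqm_dotm:
  assumes "\<And>i. i < length xs \<Longrightarrow> eqm m (nthd xs i 0) (a i)" "\<And>i. i < length xs \<Longrightarrow> eqm m (nthd ys i 0) (b i)"
  shows "eqm m (dotm m xs ys) (\<Sum>i<length xs. a i * b i)"
proof -
  have "n \<le> length xs \<Longrightarrow> eqm m (foldl (\<lambda>s i. (s + nthd xs i 0 * nthd ys i 0) mod Suc m) 0 [0..<n]) (\<Sum>i<n. a i * b i)" for n
    by (induction n) (auto intro!: eqm_mod eqm_add eqm_mult assms eqm_refl[of m 0, simplified])
  then show ?thesis unfolding dotm_def by simp
qed

definition lrs_step :: "nat \<Rightarrow> nat list \<Rightarrow> nat list \<Rightarrow> nat list" where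
  "lrs_step m as w = tl w @ [dotm m as w]"

lemma ptime_lrs_step [pt]: "ptime m \<Longrightarrow> ptime as \<Longrightarrow> ptime w \<Longrightarrow> ptime (\<lambda>x. lrs_step (m x) (as x) (w x))"
  unfolding lrs_step_def by (intro pt)

text \<open>Stepping through the sequence is affordable, because the differences only involve
  indices of polynomial size; hence the unary index \<open>ts\<close>.\<close>

definition uval :: "nat \<Rightarrow> nat list \<Rightarrow> nat list \<Rightarrow> unit list \<Rightarrow> nat" where
  "uval m as w ts = nthd ((lrs_step m as ^^ length ts) (map (\<lambda>y. y mod Suc m) w)) 0 0"

lemma ptime_uval [pt]:
  assumes "ptime m" "ptime as" "ptime w" "ptime ts"
  shows "ptime (\<lambda>x. uval (m x) (as x) (w x) (ts x))"
  unfolding uval_def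
proof (intro ptime_nthd ptime_const ptime_funpow[where B = "\<lambda>x. (length (w x) + 1) * (2 * sz (m x) + 1)"])
  show "ptime (\<lambda>z. lrs_step (m (fst z)) (as (fst z)) (snd z))"
    by (intro pt ptime_comp[OF assms(1)] ptime_comp[OF assms(2)])
  show "ptime (\<lambda>x. map (\<lambda>y. y mod Suc (m x)) (w x))" by (intro pt ptime_comp[OF assms(1)] assms)
  show "pbd (\<lambda>x. (length (w x) + 1) * (2 * sz (m x) + 1))"
    by (intro pbd_mult pbd_add pbd_const pbd_sz pbd_length assms)
  fix x k
  let ?w = "\<lambda>k. (lrs_step (m x) (as x) ^^ k) (map (\<lambda>y. y mod Suc (m x)) (w x))"
  have le: "length (?w k) \<le> length (w x) + 1 \<and> (\<forall>y\<in>set (?w k). y \<le> m x)"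
  proof (induction k)
    case (Suc k)
    then show ?case by (auto simp: lrs_step_def dotm_le dest: subsetD[OF set_tl_subset])
  qed auto
  then have "sz (?w k) \<le> length (?w k) * (2 * sz (m x) + 1)" by (intro sz_nat_list) auto
  also have "\<dots> \<le> (length (w x) + 1) * (2 * sz (m x) + 1)" using le by (intro mult_right_mono) auto
  finally show "sz (?w k) \<le> (length (w x) + 1) * (2 * sz (m x) + 1)" .
qed (intro assms)+

lemma eqm_uval:
  assumes u: "satisfies_rec a u"
  shows "eqm m (uval m (map (\<lambda>c. nmod c m) a) (map (\<lambda>c. nmod c m) (map u [0..<length a])) ts) (u (length ts))"
proof -
  let ?as = "map (\<lambda>c. nmod c m) a" and ?d = "length a"
  define w0 where "w0 = map (\<lambda>y. y mod Suc m) (map (\<lambda>c. nmod c m) (map u [0..<?d]))"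
  show ?thesis
  proof (cases "?d = 0")
    case True
    have "u n = 0" for n using u True by (simp add: satisfies_rec_def)
    \<comment> \<open>For \<open>d = 0\<close> a step does not preserve the length:
      \<open>[]\<close> becomes \<open>[0]\<close> and stays so.\<close>
    moreover have "(lrs_step m ?as ^^ k) w0 \<in> {[], [0]}" for k
      using True by (induction k) (auto simp: w0_def lrs_step_def dotm_def)
    from this[of "length ts"] have "uval m ?as (map (\<lambda>c. nmod c m) (map u [0..<?d])) ts = 0"
      unfolding uval_def w0_def[symmetric] by (auto simp: nthd_def)
    ultimately show ?thesis by (simp add: eqm_def)
  next
    case False
    define w where "w k = (lrs_step m ?as ^^ k) w0" for k
    have w0: "w 0 = w0" by (simp add: w_def)
    have wS: "w (Suc k) = tl (w k) @ [dotm m ?as (w k)]" for k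
      by (simp only: w_def funpow.simps comp_apply lrs_step_def)
    have inv: "length (w k) = ?d \<and> (\<forall>i<?d. eqm m (w k ! i) (u (k + i)))" for k
    proof (induction k)
      case 0
      then show ?case by (auto simp: w0 w0_def intro!: eqm_mod eqm_nmod)
    next
      case (Suc k)
      then have IH: "length (w k) = ?d" "\<And>i. i < ?d \<Longrightarrow> eqm m (w k ! i) (u (k + i))" by auto
      have "eqm m (dotm m ?as (w k)) (\<Sum>i<length ?as. a ! i * u (k + i))"
        using IH by (intro eqm_dotm) (auto simp: nthd_def eqm_nmod)
      then have d: "eqm m (dotm m ?as (w k)) (u (k + ?d))" using u by (simp add: satisfies_rec_def)
      show ?case
      proof (intro conjI allI impI)
        show "length (w (Suc k)) = ?d" using IH False by (simp add: wS)
        fix i assume i: "i < ?d"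
        show "eqm m (w (Suc k) ! i) (u (Suc k + i))"
        proof (cases "Suc i = ?d")
          case True
          have "w (Suc k) ! i = dotm m ?as (w k)"
            using True IH(1) by (auto simp: wS nth_append)
          moreover have "Suc k + i = k + ?d" using True by simp
          ultimately show ?thesis using d by (simp only:)
        next
          case False
          then have "w (Suc k) ! i = w k ! Suc i"
            using i IH(1) by (auto simp: wS nth_append nth_tl)
          moreover have "Suc k + i = k + Suc i" by simp
          moreover have "Suc i < ?d" using False i by simp
          ultimately show ?thesis using IH(2)[of "Suc i"] by (simp only:)
        qed
      qed
    qed
    have "uval m ?as (map (\<lambda>c. nmod c m) (map u [0..<?d])) ts = nthd (w (length ts)) 0 0"
      unfolding uval_def w_def w0_def ..
    then show ?thesis using False inv[of "length ts"] by (auto simp: nthd_def)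
  qed
qed

definition diff_step :: "nat \<Rightarrow> nat list \<Rightarrow> nat list" where
  "diff_step m xs = map (\<lambda>i. (nthd xs (Suc i) 0 + m * nthd xs i 0) mod Suc m) [0..<length (tl xs)]"

lemma ptime_diff_step [pt]:
  assumes "ptime m" "ptime xs"
  shows "ptime (\<lambda>x. diff_step (m x) (xs x))"
  unfolding diff_step_def by (intro pt assms ptime_comp[OF assms(1)] ptime_comp[OF assms(2)])

text \<open>The iteration count equals \<open>j\<close>; it is written as the length of a unary list
  to fit \<open>ptime_funpow\<close>.\<close>

definition diff_table :: "nat \<Rightarrow> nat list \<Rightarrow> unit list \<Rightarrow> nat list" where
  "diff_table m xs js = map (\<lambda>j. nthd ((diff_step m ^^ length (replicate (cap j js) ())) (map (\<lambda>y. y mod Suc m) xs)) 0 0) [0..<length js]"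

lemma ptime_diff_iterate:
  fixes ts :: "'e :: pcode \<Rightarrow> unit list"
  assumes m: "ptime m" and xs: "ptime xs" and ts: "ptime ts"
  shows "ptime (\<lambda>x. (diff_step (m x) ^^ length (ts x)) (map (\<lambda>y. y mod Suc (m x)) (xs x)))"
proof (rule ptime_funpow)
  show "ptime (\<lambda>z. diff_step (m (fst z)) (snd z))" by (intro pt ptime_comp[OF m])
  show "ptime (\<lambda>x. map (\<lambda>y. y mod Suc (m x)) (xs x))" by (intro pt ptime_comp[OF m] xs)
  show "pbd (\<lambda>x. length (xs x) * (2 * sz (m x) + 1))"
    by (intro pbd_mult pbd_add pbd_const pbd_sz pbd_length m xs)
  fix x k
  define w where "w k = (diff_step (m x) ^^ k) (map (\<lambda>y. y mod Suc (m x)) (xs x))" for k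
  have w0: "w 0 = map (\<lambda>y. y mod Suc (m x)) (xs x)" by (simp add: w_def)
  have wS: "w (Suc k) = diff_step (m x) (w k)" for k by (simp add: w_def)
  have le: "length (w k) \<le> length (xs x) \<and> (\<forall>y\<in>set (w k). y \<le> m x)"
    by (induction k) (auto simp: w0 wS diff_step_def)
  then have "sz (w k) \<le> length (w k) * (2 * sz (m x) + 1)" by (intro sz_nat_list) auto
  also have "\<dots> \<le> length (xs x) * (2 * sz (m x) + 1)" using le by (intro mult_right_mono) auto
  finally show "sz ((diff_step (m x) ^^ k) (map (\<lambda>y. y mod Suc (m x)) (xs x))) \<le> length (xs x) * (2 * sz (m x) + 1)"
    unfolding w_def .
qed (intro ts)

lemma ptime_diff_table [pt]:
  assumes m: "ptime m" and xs: "ptime xs" and js: "ptime js"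
  shows "ptime (\<lambda>x. diff_table (m x) (xs x) (js x))"
  unfolding diff_table_def
  by (intro ptime_map ptime_nthd ptime_const ptime_upt_length js ptime_diff_iterate
      ptime_comp[OF m] ptime_comp[OF xs] ptime_ticks_cap ptime_comp[OF js] ptime_fst ptime_snd ptime_id)

lemma eqm_diff_table:
  assumes "length xs = length js" "\<And>i. i < length js \<Longrightarrow> eqm m (xs ! i) (u (r + i * T))" "j < length js"
  shows "eqm m (diff_table m xs js ! j) ((dif T ^^ j) u r)"
proof -
  define w where "w k = (diff_step m ^^ k) (map (\<lambda>y. y mod Suc m) xs)" for k
  have w0: "w 0 = map (\<lambda>y. y mod Suc m) xs" by (simp add: w_def)
  have wS: "w (Suc k) = diff_step m (w k)" for k by (simp add: w_def)
  have "k < length js \<Longrightarrow> length (w k) = length js - k \<and> (\<forall>i<length js - k. eqm m (w k ! i) ((dif T ^^ k) u (r + i * T)))" for k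
  proof (induction k)
    case 0
    then show ?case using assms by (auto simp: w0 intro: eqm_mod)
  next
    case (Suc k)
    then have IH: "length (w k) = length js - k" "\<And>i. i < length js - k \<Longrightarrow> eqm m (w k ! i) ((dif T ^^ k) u (r + i * T))" by auto
    show ?case
    proof (intro conjI allI impI)
      show "length (w (Suc k)) = length js - Suc k" using IH(1) by (simp add: wS diff_step_def)
      fix i assume i: "i < length js - Suc k"
      have eq: "w (Suc k) ! i = (w k ! Suc i + m * w k ! i) mod Suc m"
        using i IH(1) by (simp add: wS diff_step_def nthd_def)
      have "eqm m (w (Suc k) ! i) ((dif T ^^ k) u (r + Suc i * T) + - (dif T ^^ k) u (r + i * T))"
        unfolding eq using i by (intro eqm_mod eqm_add eqm_neg IH(2)) auto
      also have "(dif T ^^ k) u (r + Suc i * T) + - (dif T ^^ k) u (r + i * T) = (dif T ^^ Suc k) u (r + i * T)"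
        unfolding dif_power_Suc by (simp add: algebra_simps)
      finally show "eqm m (w (Suc k) ! i) ((dif T ^^ Suc k) u (r + i * T))" .
    qed
  qed
  from this[OF assms(3)] have 1: "length (w j) = length js - j"
    "\<And>i. i < length js - j \<Longrightarrow> eqm m (w j ! i) ((dif T ^^ j) u (r + i * T))" by auto
  have "diff_table m xs js ! j = nthd (w j) 0 0" using assms(3) by (simp add: diff_table_def w_def)
  then show ?thesis using 1(1) 1(2)[of 0] assms(3) by (simp add: nthd_def)
qed

subsection \<open>Coefficients of the interpolation polynomial\<close>

lemma nthd_map_upt: "nthd (map f [0..<n]) i d = (if i < n then f i else d)"
  by (simp add: nthd_def)

text \<open>Horner's scheme for the coefficients of \<^const>\<open>newton\<close> of \<^const>\<open>interp\<close>; the first component is the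
  factor \<open>J! / j!\<close>.\<close>

definition hstep :: "nat \<Rightarrow> nat list \<Rightarrow> nat \<Rightarrow> nat \<Rightarrow> nat \<times> nat list \<Rightarrow> nat \<Rightarrow> nat \<times> nat list" where
  "hstep m ds \<kappa> h st j =
     ((Suc j * fst st) mod Suc m,
      map (\<lambda>i. ((if i = 0 then nthd ds j 0 * ((Suc j * fst st) mod Suc m) else h * nthd (snd st) (i - 1) 0) +
        (\<kappa> + m * j) * nthd (snd st) i 0) mod Suc m) [0..<length (() # map (\<lambda>_. ()) (snd st))])"

lemma snd_hstep: "snd (hstep m ds \<kappa> h st j) =
    map (\<lambda>i. ((if i = 0 then nthd ds j 0 * ((Suc j * fst st) mod Suc m) else h * nthd (snd st) (i - 1) 0) +
      (\<kappa> + m * j) * nthd (snd st) i 0) mod Suc m) [0..<Suc (length (snd st))]"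
  unfolding hstep_def by (simp only: snd_conv list.size length_map add_0_right add_Suc_right)

definition hcoeffs :: "nat \<Rightarrow> nat list \<Rightarrow> nat \<Rightarrow> nat \<Rightarrow> unit list \<Rightarrow> nat list" where
  "hcoeffs m ds \<kappa> h js = snd (foldl (hstep m ds \<kappa> h) (1 mod Suc m, []) (rev [0..<length js]))"

lemma ptime_hcoeffs [pt]:
  assumes m: "ptime m" and ds: "ptime ds" and \<kappa>: "ptime \<kappa>" and h: "ptime h" and js: "ptime js"
  shows "ptime (\<lambda>x. hcoeffs (m x) (ds x) (\<kappa> x) (h x) (js x))"
  unfolding hcoeffs_def
proof (intro ptime_snd ptime_foldl)
  show "ptime (\<lambda>z. hstep (m (fst z)) (ds (fst z)) (\<kappa> (fst z)) (h (fst z)) (fst (snd z)) (snd (snd z)))"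
    unfolding hstep_def
    by (intro pt ptime_comp[OF m] ptime_comp[OF ds] ptime_comp[OF \<kappa>] ptime_comp[OF h])
  let ?B = "\<lambda>x. 2 * sz (m x) + 1 + length (js x) * (2 * sz (m x) + 1)"
  show "pbd ?B" by (intro pbd_mult pbd_add pbd_const pbd_sz pbd_length m js)
  fix x n
  let ?f = "\<lambda>is. foldl (hstep (m x) (ds x) (\<kappa> x) (h x)) (1 mod Suc (m x), []) is"
  have le: "fst (?f is) \<le> m x \<and> length (snd (?f is)) \<le> length is \<and> (\<forall>y\<in>set (snd (?f is)). y \<le> m x)" for "is"
  proof (induction "is" rule: rev_induct)
    case (snoc j "is")
    let ?st = "?f is"
    have e: "?f (is @ [j]) = hstep (m x) (ds x) (\<kappa> x) (h x) ?st j" by simp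
    have 1: "fst (hstep (m x) (ds x) (\<kappa> x) (h x) ?st j) \<le> m x"
      unfolding hstep_def fst_conv by (rule mod_Suc_le_divisor)
    have 2: "length (snd (hstep (m x) (ds x) (\<kappa> x) (h x) ?st j)) = Suc (length (snd ?st))"
      by (simp only: snd_hstep length_map length_upt diff_zero)
    have 3: "\<forall>y\<in>set (snd (hstep (m x) (ds x) (\<kappa> x) (h x) ?st j)). y \<le> m x"
      unfolding snd_hstep set_map by (intro ballI) (elim imageE, simp only: mod_Suc_le_divisor)
    show ?case unfolding e using 1 2 3 snoc by simp
  qed simp
  let ?t = "take n (rev [0..<length (js x)])"
  have "sz (snd (?f ?t)) \<le> length (snd (?f ?t)) * (2 * sz (m x) + 1)" using le[of ?t] by (intro sz_nat_list) auto
  also have "\<dots> \<le> length (js x) * (2 * sz (m x) + 1)"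
    using le[of ?t] by (intro mult_right_mono) (auto intro: order_trans)
  finally show "sz (?f ?t) \<le> ?B x"
    using le[of ?t] sz_nat_mono[of "fst (?f ?t)" "m x"] sz_Pair[of "fst (?f ?t)" "snd (?f ?t)"] by simp
qed (intro pt assms)+

lemma drop_interp:
  assumes "j < J"
  shows "drop j (interp J \<delta>) = int (fact J div fact j) * \<delta> j # drop (Suc j) (interp J \<delta>)"
  using assms by (subst Cons_nth_drop_Suc[symmetric]) (simp_all add: interp_def)

lemma eqm_hcoeffs:
  assumes ds: "\<And>j. j < length js \<Longrightarrow> eqm m (nthd ds j 0) (\<delta> j)"
  shows "eqm m (nthd (hcoeffs m ds \<kappa> h js) i 0) (coeff (newton (interp (length js) \<delta>) (int \<kappa>) (int h)) i)"
proof -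
  let ?J = "length js"
  let ?f = "\<lambda>j. foldl (hstep m ds \<kappa> h) (1 mod Suc m, []) (rev [j..<?J])"
  have "j \<le> ?J \<Longrightarrow> eqm m (fst (?f j)) (int (fact ?J div fact j)) \<and>
    (\<forall>i. eqm m (nthd (snd (?f j)) i 0) (coeff (newton (drop j (interp ?J \<delta>)) (int \<kappa> - int j) (int h)) i))" for j
  proof (induction "?J - j" arbitrary: j)
    case 0
    then have "j = ?J" by simp
    then show ?case using eqm_mod[OF eqm_refl[of m 1]] by (simp add: nthd_def interp_def eqm_def)
  next
    case (Suc n)
    then have j: "j < ?J" by simp
    let ?st = "?f (Suc j)"
    have IH: "eqm m (fst ?st) (int (fact ?J div fact (Suc j)))"
      "\<And>i. eqm m (nthd (snd ?st) i 0) (coeff (newton (drop (Suc j) (interp ?J \<delta>)) (int \<kappa> - int (Suc j)) (int h)) i)"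
      using Suc(1)[of "Suc j"] Suc(2) j by auto
    have f: "?f j = hstep m ds \<kappa> h ?st j" using j by (subst upt_conv_Cons) simp_all
    have fd: "fact ?J div fact j = Suc j * (fact ?J div fact (Suc j) :: nat)"
    proof -
      have "fact (Suc j) dvd (fact ?J :: nat)" using j by (intro fact_dvd) simp
      then obtain q where q: "fact ?J = fact (Suc j) * (q :: nat)" by (elim dvdE)
      then have "(fact ?J :: nat) = fact j * (Suc j * q)" by (simp add: algebra_simps)
      then have "fact ?J div fact j = Suc j * (q :: nat)" by simp
      moreover have "fact ?J div fact (Suc j) = q" unfolding q by simp
      ultimately show ?thesis by simp
    qed
    have s: "eqm m ((Suc j * fst ?st) mod Suc m) (int (fact ?J div fact j))"
      unfolding fd of_nat_mult by (intro eqm_mod eqm_mult eqm_refl IH(1))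
    let ?N = "newton (drop (Suc j) (interp ?J \<delta>)) (int \<kappa> - int (Suc j)) (int h)"
    have N: "newton (drop j (interp ?J \<delta>)) (int \<kappa> - int j) (int h) =
        [:int (fact ?J div fact j) * \<delta> j:] + [:int \<kappa> - int j, int h:] * ?N"
      unfolding drop_interp[OF j] by (simp add: algebra_simps)
    have cN: "coeff (newton (drop j (interp ?J \<delta>)) (int \<kappa> - int j) (int h)) i =
        (if i = 0 then \<delta> j * int (fact ?J div fact j) else int h * coeff ?N (i - 1)) + (int \<kappa> + - int j) * coeff ?N i" for i
      unfolding N by (cases i) (simp_all add: coeff_pCons algebra_simps)
    have c: "eqm m (\<kappa> + m * j) (int \<kappa> + - int j)" by (intro eqm_add eqm_refl eqm_neg)
    have "eqm m (nthd (snd (?f j)) i 0) (coeff (newton (drop j (interp ?J \<delta>)) (int \<kappa> - int j) (int h)) i)" for i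
    proof (cases "i < Suc (length (snd ?st))")
      case True
      then have "nthd (snd (?f j)) i 0 = ((if i = 0 then nthd ds j 0 * ((Suc j * fst ?st) mod Suc m) else h * nthd (snd ?st) (i - 1) 0) +
        (\<kappa> + m * j) * nthd (snd ?st) i 0) mod Suc m"
        unfolding f snd_hstep nthd_map_upt by (simp only: if_True)
      moreover have "eqm m (if i = 0 then nthd ds j 0 * ((Suc j * fst ?st) mod Suc m) else h * nthd (snd ?st) (i - 1) 0)
          (if i = 0 then \<delta> j * int (fact ?J div fact j) else int h * coeff ?N (i - 1))"
        using eqm_mult[OF ds[OF j] s] eqm_mult[OF eqm_refl IH(2)] by (simp del: mult_Suc)
      ultimately show ?thesis unfolding cN by (simp only:) (intro eqm_mod eqm_add eqm_mult c IH(2))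
    next
      case False
      then have z: "nthd (snd (?f j)) i 0 = 0" unfolding f snd_hstep nthd_map_upt by (simp only: if_False)
      have "i \<noteq> 0" using False by simp
      then have c0: "coeff (newton (drop j (interp ?J \<delta>)) (int \<kappa> - int j) (int h)) i =
          int h * coeff ?N (i - 1) + (int \<kappa> + - int j) * coeff ?N i"
        unfolding cN by (simp only: if_False)
      have "eqm m (h * nthd (snd ?st) (i - 1) 0 + (\<kappa> + m * j) * nthd (snd ?st) i 0)
          (coeff (newton (drop j (interp ?J \<delta>)) (int \<kappa> - int j) (int h)) i)"
        unfolding c0 by (intro eqm_add eqm_mult eqm_refl c IH(2))
      moreover have "nthd (snd ?st) (i - 1) 0 = 0" "nthd (snd ?st) i 0 = 0" using False by (auto simp: nthd_def)
      ultimately show ?thesis using z by simp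
    qed
    then show ?case using s unfolding f by (simp add: hstep_def del: mult_Suc)
  qed
  from this[of 0] show ?thesis by (simp add: hcoeffs_def)
qed

definition alivec :: "nat \<Rightarrow> unit list \<Rightarrow> nat list \<Rightarrow> bool" where
  "alivec p js R \<longleftrightarrow> (\<forall>s\<in>set [0..<length (() # js)].
     (\<forall>i\<in>set [0..<length (map (\<lambda>_. ()) R)]. i = 0 \<or> p ^ cap s js dvd nthd R i 0) \<longrightarrow> p ^ cap s js dvd nthd R 0 0)"

lemma ptime_alivec [pt]:
  assumes p: "ptime p" and js: "ptime js" and R: "ptime R"
  shows "ptime (\<lambda>x. alivec (p x) (js x) (R x))"
  unfolding alivec_def
  by (intro pt ptime_comp[OF p] ptime_comp[OF js] ptime_comp[OF R] p js R)

text \<open>Divisibility by \<open>p ^ s\<close> with \<open>s \<le> length js\<close> can be read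
  off residues modulo \<open>p ^ length js\<close>, and coefficients beyond the end of
  \<open>R\<close> count as 0.\<close>

lemma alivec_iff:
  assumes m: "Suc m = p ^ length js" and R: "\<And>i. eqm m (nthd R i 0) (coeff G i)"
  shows "alivec p js R \<longleftrightarrow> alive p (length js) G"
proof -
  have d: "p ^ s dvd nthd R i 0 \<longleftrightarrow> int p ^ s dvd coeff G i" if "s \<le> length js" for s i
    using eqm_dvd[OF R, of "p ^ s" i] le_imp_power_dvd[OF that, of p] by (simp add: m)
  have a: "(\<forall>i\<in>set [0..<length (map (\<lambda>_. ()) R)]. i = 0 \<or> p ^ s dvd nthd R i 0) \<longleftrightarrow> (\<forall>i\<ge>1. p ^ s dvd nthd R i 0)" for s
    by (auto simp: nthd_def Ball_def)
  have "alivec p js R \<longleftrightarrow> (\<forall>s\<le>length js. (\<forall>i\<ge>1. p ^ s dvd nthd R i 0) \<longrightarrow> p ^ s dvd nthd R 0 0)"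
    unfolding alivec_def by (auto simp: a[simplified] less_Suc_eq_le simp del: upt_Suc)
  then show ?thesis using d by (simp add: alive_def)
qed

subsection \<open>Descending the tree of residue classes\<close>

text \<open>The state pairs the surviving residues with their modulus. For unsuitable parameters the
  number of survivors is not controlled, and \<open>take\<close> enforces polynomial size; for
  suitable ones it removes nothing, by the bound on living classes.\<close>

definition level_step :: "unit list \<Rightarrow> unit list \<Rightarrow> nat \<Rightarrow> nat \<Rightarrow> nat list \<Rightarrow> nat list \<times> nat \<Rightarrow> nat list \<times> nat" where
  "level_step js zs m p ds st =
     (take (length js) (filter (\<lambda>\<kappa>. alivec p js (hcoeffs m ds \<kappa> (snd st * p) js))
        (concat (map (\<lambda>\<rho>. map (\<lambda>\<kappa>. \<kappa> + snd st * \<rho>) (fst st)) [0..<cap p zs]))), snd st * p)"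

definition levels :: "unit list \<Rightarrow> unit list \<Rightarrow> unit list \<Rightarrow> nat \<Rightarrow> nat \<Rightarrow> nat list \<Rightarrow> nat list \<times> nat" where
  "levels js zs es m p ds = (level_step js zs m p ds ^^ length es) ([0], 1)"

lemma in_residues:
  "\<kappa> \<in> set (concat (map (\<lambda>\<rho>. map (\<lambda>x. x + q * \<rho>) xs) [0..<n])) \<longleftrightarrow> (\<exists>\<rho><n. \<exists>x\<in>set xs. \<kappa> = x + q * \<rho>)"
  for q :: nat
  by auto

lemma fst_level_step: "fst (level_step js zs m p ds st) =
    take (length js) (filter (\<lambda>\<kappa>. alivec p js (hcoeffs m ds \<kappa> (snd st * p) js))
      (concat (map (\<lambda>\<rho>. map (\<lambda>\<kappa>. \<kappa> + snd st * \<rho>) (fst st)) [0..<cap p zs])))"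
  and snd_level_step: "snd (level_step js zs m p ds st) = snd st * p"
  by (simp_all add: level_step_def)

lemma level_inv:
  "snd ((level_step js zs m p ds ^^ k) ([0], 1)) = p ^ k \<and>
   (\<forall>\<kappa>\<in>set (fst ((level_step js zs m p ds ^^ k) ([0], 1))). \<kappa> < p ^ k) \<and>
   length (fst ((level_step js zs m p ds ^^ k) ([0], 1))) \<le> length js + 1"
proof (induction k)
  case (Suc k)
  let ?st = "(level_step js zs m p ds ^^ k) ([0], 1)"
  have q: "snd ?st = p ^ k" "\<And>\<kappa>. \<kappa> \<in> set (fst ?st) \<Longrightarrow> \<kappa> < p ^ k" using Suc by auto
  have sub: "set (take n (filter P xs)) \<subseteq> set xs" for n P and xs :: "nat list" by (auto dest: in_set_takeD)
  have "\<kappa> < p ^ Suc k" if "\<kappa> \<in> set (fst (level_step js zs m p ds ?st))" for \<kappa>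
  proof -
    from subsetD[OF sub that[unfolded fst_level_step[of js zs m p ds ?st]]] obtain \<rho> \<kappa>' where *: "\<rho> < cap p zs" "\<kappa>' \<in> set (fst ?st)" "\<kappa> = \<kappa>' + p ^ k * \<rho>"
      unfolding q(1) in_residues by blast
    have "cap p zs \<le> p" by (simp add: cap_def)
    then have "\<rho> + 1 \<le> p" using *(1) by simp
    have "\<kappa> < p ^ k * (\<rho> + 1)" using *(3) q(2)[OF *(2)] by simp
    also have "\<dots> \<le> p ^ k * p" using \<open>\<rho> + 1 \<le> p\<close> by (intro mult_left_mono) auto
    finally show ?thesis by (simp add: mult.commute)
  qed
  moreover have "snd (level_step js zs m p ds ?st) = p ^ Suc k" unfolding snd_level_step q(1) by (simp add: mult.commute)
  moreover have "length (fst (level_step js zs m p ds ?st)) \<le> length js + 1" unfolding fst_level_step by simp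
  ultimately show ?case by simp
qed simp

lemma ptime_levels [pt]:
  assumes js: "ptime js" and zs: "ptime zs" and es: "ptime es" and m: "ptime m" and p: "ptime p" and ds: "ptime ds"
  shows "ptime (\<lambda>x. levels (js x) (zs x) (es x) (m x) (p x) (ds x))"
  unfolding levels_def
proof (rule ptime_funpow)
  show "ptime (\<lambda>z. level_step (js (fst z)) (zs (fst z)) (m (fst z)) (p (fst z)) (ds (fst z)) (snd z))"
    unfolding level_step_def
    by (intro pt ptime_comp[OF js] ptime_comp[OF zs] ptime_comp[OF m] ptime_comp[OF p] ptime_comp[OF ds])
  let ?b = "\<lambda>x. sz (p x) * length (es x) + 1"
  let ?B = "\<lambda>x. 2 * ((length (js x) + 1) * (2 * ?b x + 1)) + 1 + ?b x"
  show "pbd ?B" by (intro pbd_add pbd_mult pbd_const pbd_length pbd_sz js es p)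
  fix x k assume k: "k \<le> length (es x)"
  let ?st = "(level_step (js x) (zs x) (m x) (p x) (ds x) ^^ k) ([0], 1)"
  note inv = level_inv[of k "js x" "zs x" "m x" "p x" "ds x"]
  have "p x ^ k \<le> (2 ^ sz (p x)) ^ k" using less_two_sz[of "p x"] by (intro power_mono) auto
  also have "\<dots> \<le> (2 ^ sz (p x)) ^ length (es x)" using k by (intro power_increasing) auto
  also have "\<dots> < 2 ^ ?b x" by (simp add: power_mult)
  finally have pk: "p x ^ k < 2 ^ ?b x" .
  have "sz y \<le> ?b x" if "y \<le> p x ^ k" for y using pk that unfolding sz_nat_le by simp
  then have "sz (snd ?st) \<le> ?b x" "\<And>y. y \<in> set (fst ?st) \<Longrightarrow> sz y \<le> ?b x"
    using inv by (auto simp: less_imp_le)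
  moreover from this(2) have "sz (fst ?st) \<le> length (fst ?st) * (2 * ?b x + 1)" by (rule sz_list_bound)
  moreover have "length (fst ?st) * (2 * ?b x + 1) \<le> (length (js x) + 1) * (2 * ?b x + 1)"
    using inv by (intro mult_right_mono) auto
  moreover have "sz ?st = 2 * sz (fst ?st) + 1 + sz (snd ?st)" by (metis prod.collapse sz_Pair)
  ultimately show "sz ?st \<le> ?B x" by linarith
qed (intro pt es)+

lemma distinct_residues:
  assumes "distinct xs" "\<And>x. x \<in> set xs \<Longrightarrow> x < q"
  shows "distinct (concat (map (\<lambda>\<rho>. map (\<lambda>\<kappa>. \<kappa> + q * \<rho>) xs) [0..<n]))"
proof (induction n)
  case (Suc n)
  have "\<kappa> < q * n" if "\<kappa> \<in> set (concat (map (\<lambda>\<rho>. map (\<lambda>\<kappa>. \<kappa> + q * \<rho>) xs) [0..<n]))" for \<kappa>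
  proof -
    from that obtain \<rho> x where *: "\<rho> < n" "x \<in> set xs" "\<kappa> = x + q * \<rho>" unfolding in_residues by blast
    then have "\<kappa> < q * (\<rho> + 1)" using assms(2)[of x] by simp
    also have "\<dots> \<le> q * n" using *(1) by (intro mult_left_mono) auto
    finally show ?thesis .
  qed
  then have "set (concat (map (\<lambda>\<rho>. map (\<lambda>\<kappa>. \<kappa> + q * \<rho>) xs) [0..<n])) \<inter> set (map (\<lambda>\<kappa>. \<kappa> + q * n) xs) = {}"
    by fastforce
  then show ?case using Suc assms(1) by (simp add: distinct_map inj_on_def)
qed simp

lemma levels_contains:
  assumes p: "1 \<le> p" "p \<le> length zs" and m: "Suc m = p ^ length js"
    and ds: "\<And>j. j < length js \<Longrightarrow> eqm m (nthd ds j 0) (\<delta> j)"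
    and al: "\<And>e. e \<le> length es \<Longrightarrow> alive p (length js) (newton (interp (length js) \<delta>) (int (\<kappa> mod p ^ e)) (int p ^ e))"
    and card: "\<And>e. e \<le> length es \<Longrightarrow>
      card {\<kappa>. \<kappa> < p ^ e \<and> alive p (length js) (newton (interp (length js) \<delta>) (int \<kappa>) (int p ^ e))} \<le> length js"
    and \<kappa>: "\<kappa> < p ^ length es"
  shows "\<kappa> \<in> set (fst (levels js zs es m p ds))"
proof -
  let ?S = "\<lambda>e. (level_step js zs m p ds ^^ e) ([0], 1)"
  have "e \<le> length es \<Longrightarrow> distinct (fst (?S e)) \<and> \<kappa> mod p ^ e \<in> set (fst (?S e))" for e
  proof (induction e)
    case (Suc e)
    then have IH: "distinct (fst (?S e))" "\<kappa> mod p ^ e \<in> set (fst (?S e))" by auto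
    have sn: "snd (?S e) = p ^ e" and lt: "\<And>x. x \<in> set (fst (?S e)) \<Longrightarrow> x < p ^ e"
      using level_inv[of e js zs m p ds] by auto
    let ?C = "concat (map (\<lambda>\<rho>. map (\<lambda>\<kappa>. \<kappa> + p ^ e * \<rho>) (fst (?S e))) [0..<p])"
    let ?P = "\<lambda>\<kappa>. alive p (length js) (newton (interp (length js) \<delta>) (int \<kappa>) (int p ^ Suc e))"
    have P: "alivec p js (hcoeffs m ds x (p ^ Suc e) js) = ?P x" for x
      using alivec_iff[OF m eqm_hcoeffs[OF ds, where h = "p ^ Suc e"]] by (simp only: of_nat_power)
    have step: "fst (?S (Suc e)) = take (length js) (filter ?P ?C)"
    proof -
      have "fst (?S (Suc e)) = fst (level_step js zs m p ds (?S e))" by simp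
      then show ?thesis using p unfolding fst_level_step[of js zs m p ds "?S e"] sn power_Suc2[symmetric] P by simp
    qed
    have dC: "distinct (filter ?P ?C)" using distinct_residues[OF IH(1) lt] by (rule distinct_filter)
    have sub: "set (filter ?P ?C) \<subseteq> {\<kappa>. \<kappa> < p ^ Suc e \<and> ?P \<kappa>}"
    proof
      fix x assume "x \<in> set (filter ?P ?C)"
      then obtain \<rho> y where *: "\<rho> < p" "y \<in> set (fst (?S e))" "x = y + p ^ e * \<rho>" "?P x"
        unfolding set_filter mem_Collect_eq in_residues by blast
      then have "x < p ^ e * (\<rho> + 1)" using lt[of y] by simp
      also have "\<dots> \<le> p ^ e * p" using *(1) by (intro mult_left_mono) auto
      finally show "x \<in> {\<kappa>. \<kappa> < p ^ Suc e \<and> ?P \<kappa>}" using *(4) by (simp add: mult.commute)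
    qed
    \<comment> \<open>Distinctness turns the bound on the number of living classes into one on the
      length of the list, so that \<open>take\<close> is the identity.\<close>
    have "length (filter ?P ?C) = card (set (filter ?P ?C))" using dC by (rule distinct_card[symmetric])
    also have "\<dots> \<le> card {\<kappa>. \<kappa> < p ^ Suc e \<and> ?P \<kappa>}" by (rule card_mono[OF _ sub]) simp
    also have "\<dots> \<le> length js" by (rule card[OF Suc.prems])
    finally have tk: "fst (?S (Suc e)) = filter ?P ?C" unfolding step by simp
    have "\<kappa> mod p ^ Suc e = \<kappa> mod p ^ e + p ^ e * (\<kappa> div p ^ e mod p)"
      by (simp only: power_Suc2 mod_mult2_eq add.commute)
    moreover have "\<kappa> div p ^ e mod p < p" using p by simp
    ultimately have "\<kappa> mod p ^ Suc e \<in> set ?C" unfolding in_residues using IH(2) by blast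
    moreover have "?P (\<kappa> mod p ^ Suc e)" by (rule al[OF Suc.prems])
    ultimately show ?case unfolding tk using dC by simp
  qed simp
  from this[of "length es"] show ?thesis using \<kappa> by (simp add: levels_def)
qed

subsection \<open>All candidates\<close>

text \<open>Good values of \<open>p\<close> and \<open>T\<close> are not searched for: running through all of them only adds
  useless candidates.\<close>

definition class_cands :: "unit list \<Rightarrow> unit list \<Rightarrow> unit list \<Rightarrow> int list \<Rightarrow> int list \<Rightarrow> nat \<Rightarrow> nat \<Rightarrow> nat \<Rightarrow> nat list" where
  "class_cands js zs es a us p T r = (let m = p ^ length js - 1 in
     map (\<lambda>\<kappa>. r + \<kappa> * T) (fst (levels js zs es m p (diff_table m
       (map (\<lambda>i. uval m (map (\<lambda>c. nmod c m) a) (map (\<lambda>c. nmod c m) us)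
          (replicate (cap (r + i * T) (zs @ concat (map (\<lambda>_. zs) js))) ())) [0..<length js]) js))))"

definition cands :: "unit list \<Rightarrow> unit list \<Rightarrow> unit list \<Rightarrow> int list \<Rightarrow> int list \<Rightarrow> nat list" where
  "cands js zs es a us = [0..<length zs] @
     concat (map (\<lambda>p. concat (map (\<lambda>T. concat (map (\<lambda>r. class_cands js zs es a us p T r)
       [0..<length zs])) [0..<length zs])) [0..<length zs])"

lemma ptime_cands:
  assumes js: "ptime js" and zs: "ptime zs" and es: "ptime es" and a: "ptime a" and us: "ptime us"
  shows "ptime (\<lambda>x. cands (js x) (zs x) (es x) (a x) (us x))"
proof -
  note c = ptime_comp[OF js] ptime_comp[OF zs] ptime_comp[OF es] ptime_comp[OF a] ptime_comp[OF us]
  show ?thesis unfolding cands_def class_cands_def Let_def by (intro pt c js zs es a us)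
qed

lemma cands_complete:
  assumes u: "satisfies_rec a u" and n: "u n = 0" "n < 2 ^ length es"
    and L: "\<And>i. \<bar>u i\<bar> \<le> 2 ^ (L * (i + 1))"
    and X: "\<And>c. c \<in> set a \<Longrightarrow> c \<noteq> 0 \<Longrightarrow> \<exists>p :: nat. prime p \<and> 3 \<le> p \<and> p \<le> X \<and> \<not> int p dvd c" "X \<ge> 1"
    and V: "V \<ge> length a + L * (length a + X ^ (length a * length a) * (length a + 1) + 1) + 1"
    and J: "length js > 2 * (V + 2 * V * length es)"
    and Z: "length zs > X" "length zs > length a + X ^ (length a * length a)"
  shows "\<exists>n'\<in>set (cands js zs es a (map u [0..<length a])). n' \<le> n \<and> u n' = 0"
proof (rule disjE[OF zero_located[OF u n L _ X(2) V J]])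
  show "\<exists>p :: nat. prime p \<and> 3 \<le> p \<and> p \<le> X \<and> \<not> int p dvd c" if "c \<in> set a" "c \<noteq> 0" for c
    by (rule X(1)[OF that])
next
  assume "\<exists>n'\<le>n. n' < length a + X ^ (length a * length a) \<and> u n' = 0"
  then obtain n' where "n' \<le> n" "n' < length a + X ^ (length a * length a)" "u n' = 0" by blast
  then show ?thesis using Z by (intro bexI[of _ n']) (auto simp: cands_def)
next
  assume "\<exists>p T r \<kappa>. 2 \<le> p \<and> p \<le> X \<and> T \<le> X ^ (length a * length a) \<and> r < length a + X ^ (length a * length a) \<and>
       n = r + \<kappa> * T \<and> \<kappa> < p ^ length es \<and>
       (\<forall>e\<le>length es. alive p (length js) (newton (interp (length js) (\<lambda>j. (dif T ^^ j) u r)) (int (\<kappa> mod p ^ e)) (int p ^ e)) \<and>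
         card {\<kappa>. \<kappa> < p ^ e \<and> alive p (length js) (newton (interp (length js) (\<lambda>j. (dif T ^^ j) u r)) (int \<kappa>) (int p ^ e))} \<le> length js)"
  then obtain p T r \<kappa> where
      p: "2 \<le> p" "p \<le> X" and T: "T \<le> X ^ (length a * length a)" and r: "r < length a + X ^ (length a * length a)"
    and nr: "n = r + \<kappa> * T" and \<kappa>: "\<kappa> < p ^ length es"
    and al: "\<forall>e\<le>length es. alive p (length js) (newton (interp (length js) (\<lambda>j. (dif T ^^ j) u r)) (int (\<kappa> mod p ^ e)) (int p ^ e)) \<and>
      card {\<kappa>. \<kappa> < p ^ e \<and> alive p (length js) (newton (interp (length js) (\<lambda>j. (dif T ^^ j) u r)) (int \<kappa>) (int p ^ e))} \<le> length js"
    by (elim exE conjE) (rule that)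
  define m where "m = p ^ length js - 1"
  have m: "Suc m = p ^ length js" using p by (simp add: m_def)
  let ?zz = "zs @ concat (map (\<lambda>_. zs) js)"
  define xs where "xs = map (\<lambda>i. uval m (map (\<lambda>c. nmod c m) a) (map (\<lambda>c. nmod c m) (map u [0..<length a]))
          (replicate (cap (r + i * T) ?zz) ())) [0..<length js]"
  have lz: "length ?zz = length zs + length js * length zs" by (induction js) auto
  have xs: "length xs = length js" "eqm m (xs ! i) (u (r + i * T))" if "i < length js" for i
  proof -
    \<comment> \<open>\<open>?zz\<close> consists of \<open>length js + 1\<close> copies of
      \<open>zs\<close>, so the cap lies above every index that occurs.\<close>
    have "i * T \<le> length js * length zs" using that T Z by (intro mult_mono) auto
    then have "r + i * T \<le> length ?zz" unfolding lz using r Z by linarith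
    then show "eqm m (xs ! i) (u (r + i * T))"
      using that eqm_uval[OF u, of m "replicate (r + i * T) ()"] by (simp add: xs_def)
  qed (simp add: xs_def)
  have lxs: "length xs = length js" by (simp add: xs_def)
  have ds: "eqm m (nthd (diff_table m xs js) j 0) ((dif T ^^ j) u r)" if "j < length js" for j
    using eqm_diff_table[OF lxs xs(2) that] that by (simp add: nthd_def diff_table_def)
  have "\<kappa> \<in> set (fst (levels js zs es m p (diff_table m xs js)))"
    by (rule levels_contains[OF _ _ m ds]) (use p Z al \<kappa> in auto)
  then have "n \<in> set (class_cands js zs es a (map u [0..<length a]) p T r)"
    unfolding class_cands_def Let_def m_def[symmetric] xs_def[symmetric] nr set_map by (rule imageI)
  moreover have "p < length zs" "T < length zs" "r < length zs" using p T r Z by auto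
  ultimately have "n \<in> set (cands js zs es a (map u [0..<length a]))" unfolding cands_def by auto
  then show ?thesis using n by (intro bexI[of _ n]) auto
qed

section \<open>Circuits for the terms of a recurrence sequence\<close>

primrec gsem :: "(nat \<Rightarrow> int) \<Rightarrow> gate \<Rightarrow> int" where
  "gsem s Const0 = 0"
| "gsem s Const1 = 1"
| "gsem s (Add i j) = s i + s j"
| "gsem s (Sub i j) = s i - s j"
| "gsem s (Mul i j) = s i * s j"

primrec gshift :: "nat \<Rightarrow> gate \<Rightarrow> gate" where
  "gshift k Const0 = Const0"
| "gshift k Const1 = Const1"
| "gshift k (Add i j) = Add (k + i) (k + j)"
| "gshift k (Sub i j) = Sub (k + i) (k + j)"
| "gshift k (Mul i j) = Mul (k + i) (k + j)"

text \<open>Register programs have fixed addresses, so they can be composed without tracking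
  positions in a circuit.\<close>

definition rrun :: "(nat \<times> gate) list \<Rightarrow> (nat \<Rightarrow> int) \<Rightarrow> nat \<Rightarrow> int" where
  "rrun P s = foldl (\<lambda>s p. s(fst p := gsem s (snd p))) s P"

lemma rrun_simps [simp]: "rrun [] s = s" "rrun (p # P) s = rrun P (s(fst p := gsem s (snd p)))"
  "rrun (P @ Q) s = rrun Q (rrun P s)"
  by (simp_all add: rrun_def)

text \<open>An assignment \<open>(r, g)\<close> to a register becomes a block of \<open>K\<close> gates that holds the new values of all
  registers. Register 0 is never assigned: it is always zero, so adding it copies a register.\<close>

definition reg_block :: "nat \<Rightarrow> nat \<Rightarrow> nat \<times> gate \<Rightarrow> gate list" where
  "reg_block K b p = map (\<lambda>r. if r = fst p then gshift b (snd p) else Add (b + r) b) [0..<K]"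

definition assemble :: "nat \<Rightarrow> (nat \<times> gate) list \<Rightarrow> gate list" where
  "assemble K P = replicate K Const0 @ concat (map (\<lambda>k. reg_block K (k * K) (nthd P k (0, Const0))) [0..<length P])"

lemma assemble_snoc: "assemble K (P @ [p]) = assemble K P @ reg_block K (length P * K) p"
proof -
  have *: "map (\<lambda>k. reg_block K (k * K) (nthd (P @ [p]) k (0, Const0))) [0..<length P] =
      map (\<lambda>k. reg_block K (k * K) (nthd P k (0, Const0))) [0..<length P]"
    by (rule map_cong) (auto simp: nthd_def nth_append)
  moreover have "nthd (P @ [p]) (length P) (0, Const0) = p" by (simp add: nthd_def)
  ultimately show ?thesis by (simp add: assemble_def *)
qed

lemma circuit_vals_snoc: "circuit_vals (c @ [g]) = circuit_vals c @ [gate_val (circuit_vals c) g]"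
  by (simp add: circuit_vals_def)

lemma length_circuit_vals [simp]: "length (circuit_vals c) = length c"
  by (induction c rule: rev_induct) (auto simp: circuit_vals_snoc, simp add: circuit_vals_def)

lemma gate_val_append: "gate_args g \<subseteq> {..<length vs} \<Longrightarrow> gate_val (vs @ ws) g = gate_val vs g"
  by (cases g) (auto simp: nth_append)

lemma circuit_vals_block:
  assumes "\<And>g. g \<in> set gs \<Longrightarrow> gate_args g \<subseteq> {..<length c}"
  shows "circuit_vals (c @ gs) = circuit_vals c @ map (gate_val (circuit_vals c)) gs"
  using assms
proof (induction gs rule: rev_induct)
  case (snoc g gs)
  then have "circuit_vals (c @ gs) = circuit_vals c @ map (gate_val (circuit_vals c)) gs" by simp
  moreover have "gate_val (circuit_vals c @ map (gate_val (circuit_vals c)) gs) g = gate_val (circuit_vals c) g"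
    using snoc.prems by (intro gate_val_append) auto
  ultimately show ?case by (simp add: circuit_vals_snoc flip: append_assoc)
qed simp

lemma wf_circuit_append:
  assumes "c = [] \<or> wf_circuit c" "c @ gs \<noteq> []" "\<And>g. g \<in> set gs \<Longrightarrow> gate_args g \<subseteq> {..<length c}"
  shows "wf_circuit (c @ gs)"
  unfolding wf_circuit_def
proof (intro conjI allI impI)
  fix k assume k: "k < length (c @ gs)"
  show "gate_args ((c @ gs) ! k) \<subseteq> {..<k}"
  proof (cases "k < length c")
    case True
    then show ?thesis using assms(1) by (auto simp: wf_circuit_def nth_append)
  next
    case False
    then have "(c @ gs) ! k \<in> set gs" using k by (auto simp: nth_append)
    from assms(3)[OF this] False show ?thesis by auto
  qed
qed (use assms in auto)

lemma gate_args_gshift: "gate_args (gshift b g) = (+) b ` gate_args g"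
  by (cases g) auto

lemma gate_val_gshift:
  assumes "gate_args g \<subseteq> {..<K}" "\<And>r. r < K \<Longrightarrow> vs ! (b + r) = s r"
  shows "gate_val vs (gshift b g) = gsem s g"
  using assms by (cases g) auto

lemma assemble_correct:
  assumes "K > 0" "\<And>p. p \<in> set P \<Longrightarrow> fst p \<noteq> 0 \<and> gate_args (snd p) \<subseteq> {..<K}"
  shows "length (assemble K P) = length P * K + K \<and> wf_circuit (assemble K P) \<and> rrun P (\<lambda>_. 0) 0 = 0 \<and>
    (\<forall>r<K. circuit_vals (assemble K P) ! (length P * K + r) = rrun P (\<lambda>_. 0) r)"
  using assms(2)
proof (induction P rule: rev_induct)
  case Nil
  have "circuit_vals ([] @ replicate K Const0) = circuit_vals [] @ map (gate_val (circuit_vals [])) (replicate K Const0)"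
    by (rule circuit_vals_block) auto
  moreover have "wf_circuit ([] @ replicate K Const0)" using assms(1) by (intro wf_circuit_append) auto
  ultimately show ?case by (simp add: assemble_def circuit_vals_def)
next
  case (snoc p P)
  let ?c = "assemble K P" and ?b = "length P * K" and ?s = "rrun P (\<lambda>_. 0)"
  have IH: "length ?c = ?b + K" "wf_circuit ?c" "?s 0 = 0" "\<And>r. r < K \<Longrightarrow> circuit_vals ?c ! (?b + r) = ?s r"
    using snoc by auto
  have p: "fst p \<noteq> 0" "gate_args (snd p) \<subseteq> {..<K}" using snoc.prems by auto
  have args: "gate_args g \<subseteq> {..<length ?c}" if "g \<in> set (reg_block K ?b p)" for g
    using that p(2) assms(1) unfolding IH(1) by (auto simp: reg_block_def gate_args_gshift subset_iff split: if_splits)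
  have vals: "circuit_vals (?c @ reg_block K ?b p) = circuit_vals ?c @ map (gate_val (circuit_vals ?c)) (reg_block K ?b p)"
    by (rule circuit_vals_block[OF args])
  have "gate_val (circuit_vals ?c) (if r = fst p then gshift ?b (snd p) else Add (?b + r) ?b) = (?s(fst p := gsem ?s (snd p))) r"
    if "r < K" for r
  proof (cases "r = fst p")
    case True
    then show ?thesis using gate_val_gshift[OF p(2) IH(4)] by simp
  next
    case False
    then show ?thesis using IH(4)[OF that] IH(4)[of 0] IH(3) assms(1) by simp
  qed
  then have "(circuit_vals ?c @ map (gate_val (circuit_vals ?c)) (reg_block K ?b p)) ! (length ?c + r) =
      rrun (P @ [p]) (\<lambda>_. 0) r" if "r < K" for r
    using that unfolding length_circuit_vals[of ?c, symmetric] nth_append_length_plus by (simp add: reg_block_def)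
  moreover have "length (P @ [p]) * K = length ?c" using IH(1) by simp
  moreover have "wf_circuit (?c @ reg_block K ?b p)"
    using assms(1) args IH(2) by (intro wf_circuit_append) (auto simp: reg_block_def)
  moreover have "length (?c @ reg_block K ?b p) = length (P @ [p]) * K + K" using IH(1) by (simp add: reg_block_def)
  moreover have "rrun (P @ [p]) (\<lambda>_. 0) 0 = 0" using p(1) IH(3) by simp
  ultimately show ?case unfolding assemble_snoc vals by simp
qed

text \<open>Entry \<open>(i, j)\<close> of matrix number \<open>b\<close>. Below the matrices,
  register 0 holds 0, register 1 holds 1, register 2 a product and register 3 an
  accumulator.\<close>

definition reg :: "nat \<Rightarrow> nat \<Rightarrow> nat \<Rightarrow> nat \<Rightarrow> nat" where
  "reg d b i j = 4 + ((b * d + i) * d + j)"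

lemma mult_add_inj:
  fixes d x y j l :: nat
  assumes "x * d + j = y * d + l" "j < d" "l < d"
  shows "x = y \<and> j = l"
proof -
  have "(x * d + j) div d = x" "(y * d + l) div d = y" using assms(2,3) by simp_all
  then have "x = y" using assms(1) by simp
  then show ?thesis using assms(1) by simp
qed

lemma reg_inj: "i < d \<Longrightarrow> j < d \<Longrightarrow> k < d \<Longrightarrow> l < d \<Longrightarrow> reg d b i j = reg d c k l \<longleftrightarrow> b = c \<and> i = k \<and> j = l"
  using mult_add_inj[of "b * d + i" d j "c * d + k" l] mult_add_inj[of b d i c k] by (auto simp: reg_def)

lemma reg_less: "i < d \<Longrightarrow> j < d \<Longrightarrow> b < 5 \<Longrightarrow> reg d b i j < 5 + 5 * d * d"
proof -
  assume "i < d" "j < d" "b < 5"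
  then have "b * d \<le> 4 * d" "i \<le> d - 1" "d > 0" by auto
  then have "b * d + i \<le> 5 * d - 1" by linarith
  then have "(b * d + i) * d \<le> (5 * d - 1) * d" by (rule mult_le_mono1)
  moreover have "(5 * d - 1) * d + d = 5 * d * d" using \<open>d > 0\<close> by (cases d) (auto simp: algebra_simps)
  ultimately show ?thesis using \<open>j < d\<close> unfolding reg_def by linarith
qed

definition idx :: "nat \<Rightarrow> (nat \<times> nat) list" where "idx d = List.product [0..<d] [0..<d]"

lemma set_idx: "set (idx d) = {..<d} \<times> {..<d}"
  by (auto simp: idx_def)

text \<open>Blocks with distinct targets do not disturb each other as long as each works from any
  state that differs only in the targets and in the scratch registers 2 and 3.\<close>

lemma rrun_fill:
  assumes "inj_on t (set ps)" "distinct ps"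
    and "\<And>p s. p \<in> set ps \<Longrightarrow> (\<forall>q. q \<notin> {2, 3} \<union> t ` set ps \<longrightarrow> s q = s0 q) \<Longrightarrow>
      rrun (blk p) s (t p) = f p \<and> (\<forall>q. q \<notin> {2, 3, t p} \<longrightarrow> rrun (blk p) s q = s q)"
    and "\<And>p. p \<in> set ps \<Longrightarrow> t p \<notin> {2, 3 :: nat}"
  shows "(\<forall>p\<in>set ps. rrun (concat (map blk ps)) s0 (t p) = f p) \<and>
    (\<forall>q. q \<notin> {2, 3} \<union> t ` set ps \<longrightarrow> rrun (concat (map blk ps)) s0 q = s0 q)"
proof -
  let ?G = "{2, 3} \<union> t ` set ps"
  have "(\<forall>p\<in>set qs. rrun (concat (map blk qs)) s0 (t p) = f p) \<and>
      (\<forall>q. q \<notin> ?G \<longrightarrow> rrun (concat (map blk qs)) s0 q = s0 q)"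
    if "set qs \<subseteq> set ps" "distinct qs" for qs
    using that
  proof (induction qs rule: rev_induct)
    case (snoc p qs)
    let ?s = "rrun (concat (map blk qs)) s0"
    have IH: "\<And>r. r \<in> set qs \<Longrightarrow> ?s (t r) = f r" "\<And>q. q \<notin> ?G \<Longrightarrow> ?s q = s0 q" using snoc by auto
    have p: "p \<in> set ps" "p \<notin> set qs" using snoc.prems by auto
    have st: "rrun (blk p) ?s (t p) = f p" "\<And>q. q \<notin> {2, 3, t p} \<Longrightarrow> rrun (blk p) ?s q = ?s q"
      using assms(3)[OF p(1), of ?s] IH(2) by blast+
    have "rrun (blk p) ?s (t r) = f r" if "r \<in> set qs" for r
    proof -
      have r: "r \<in> set ps" "r \<noteq> p" using that snoc.prems by auto
      then have "t r \<noteq> t p" using assms(1) p(1) by (auto dest: inj_onD)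
      then have "t r \<notin> {2, 3, t p}" using assms(4)[OF r(1)] by blast
      from st(2)[OF this] IH(1)[OF that] show ?thesis by simp
    qed
    moreover have "rrun (blk p) ?s q = s0 q" if "q \<notin> ?G" for q
    proof -
      have "q \<notin> {2, 3, t p}" using that p(1) by blast
      from st(2)[OF this] IH(2)[OF that] show ?thesis by simp
    qed
    ultimately show ?case using st(1) by simp
  qed simp
  then show ?thesis using assms(2) by blast
qed

text \<open>Horner's scheme on the binary digits, so the number of gates is linear in the length of
  \<open>z\<close>.\<close>

definition load :: "nat \<Rightarrow> int \<Rightarrow> (nat \<times> gate) list" where
  "load r z = (3, Const0) # concat (map (\<lambda>b. (3, Add 3 3) # (if b then [(3, Add 3 1)] else [])) (nbits (nat \<bar>z\<bar>))) @
     [(r, if z < 0 then Sub 0 3 else Add 0 3)]"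

lemma load_correct:
  assumes "s 0 = 0" "s 1 = 1"
  shows "rrun (load r z) s r = z \<and> (\<forall>q. q \<notin> {2, 3, r} \<longrightarrow> rrun (load r z) s q = s q)"
proof -
  let ?L = "\<lambda>bs. concat (map (\<lambda>b. (3 :: nat, Add 3 3) # (if b then [(3, Add 3 1)] else [])) bs)"
  have "rrun (?L bs) (s(3 := 0)) = s(3 := int (bval bs))" for bs
  proof (induction bs rule: rev_induct)
    case (snoc b bs)
    then show ?case using assms(2) by (auto simp: fun_eq_iff)
  qed simp
  from this[of "nbits (nat \<bar>z\<bar>)"] show ?thesis using assms(1) by (auto simp: load_def)
qed

definition load_matrix :: "nat \<Rightarrow> nat \<Rightarrow> (nat \<Rightarrow> nat \<Rightarrow> int) \<Rightarrow> (nat \<times> gate) list" where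
  "load_matrix d b F = concat (map (\<lambda>p. load (reg d b (fst p) (snd p)) (F (fst p) (snd p))) (idx d))"

definition dot_regs :: "nat \<Rightarrow> nat \<Rightarrow> nat \<Rightarrow> nat \<Rightarrow> nat \<Rightarrow> nat \<Rightarrow> (nat \<times> gate) list" where
  "dot_regs d x y z i j = (3, Const0) # concat (map (\<lambda>k. [(2, Mul (reg d x i k) (reg d y k j)), (3, Add 3 2)]) [0..<d]) @
     [(reg d z i j, Add 3 0)]"

definition mat_mult :: "nat \<Rightarrow> nat \<Rightarrow> nat \<Rightarrow> nat \<Rightarrow> (nat \<times> gate) list" where
  "mat_mult d x y z = concat (map (\<lambda>p. dot_regs d x y z (fst p) (snd p)) (idx d))"

lemma reg_ge: "reg d b i j \<notin> {0, 1, 2, 3}" "reg d b i j \<noteq> 0" "reg d b i j \<noteq> Suc 0" "reg d b i j \<noteq> 2" "reg d b i j \<noteq> 3"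
  by (auto simp: reg_def)

definition mat_at :: "nat \<Rightarrow> nat \<Rightarrow> (nat \<Rightarrow> int) \<Rightarrow> nat \<Rightarrow> nat \<Rightarrow> int" where
  "mat_at d b s i j = s (reg d b i j)"

definition good :: "(nat \<Rightarrow> int) \<Rightarrow> bool" where "good s \<longleftrightarrow> s 0 = 0 \<and> s 1 = 1"

lemma inj_reg_idx: "inj_on (\<lambda>p. reg d b (fst p) (snd p)) (set (idx d))"
  by (rule inj_onI) (auto simp: set_idx reg_inj)

lemma distinct_idx: "distinct (idx d)"
  by (simp add: idx_def distinct_product)

lemma frame_idx:
  assumes "\<forall>q. q \<notin> {2, 3} \<union> (\<lambda>p. reg d z (fst p) (snd p)) ` set (idx d) \<longrightarrow> s' q = s q"
  shows "good s \<Longrightarrow> good s'" "b \<noteq> z \<Longrightarrow> i < d \<Longrightarrow> j < d \<Longrightarrow> mat_at d b s' i j = mat_at d b s i j"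
proof -
  have *: "s' q = s q" if "q \<in> {0, 1}" for q
  proof -
    have "q \<notin> {2, 3} \<union> (\<lambda>p. reg d z (fst p) (snd p)) ` set (idx d)" using that by (auto simp: reg_def)
    then show ?thesis using assms by blast
  qed
  show "good s \<Longrightarrow> good s'" using *[of 0] *[of 1] by (simp add: good_def)
  assume b: "b \<noteq> z" "i < d" "j < d"
  then have "reg d b i j \<notin> {2, 3} \<union> (\<lambda>p. reg d z (fst p) (snd p)) ` set (idx d)"
    using reg_ge by (auto simp: set_idx reg_inj)
  then show "mat_at d b s' i j = mat_at d b s i j" using assms unfolding mat_at_def by blast
qed

lemma load_matrix_correct:
  assumes "good s"
  shows "good (rrun (load_matrix d b F) s)"
    "i < d \<Longrightarrow> j < d \<Longrightarrow> mat_at d c (rrun (load_matrix d b F) s) i j = (if c = b then F i j else mat_at d c s i j)"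
proof -
  have *: "(\<forall>p\<in>set (idx d). rrun (load_matrix d b F) s (reg d b (fst p) (snd p)) = F (fst p) (snd p)) \<and>
    (\<forall>q. q \<notin> {2, 3} \<union> (\<lambda>p. reg d b (fst p) (snd p)) ` set (idx d) \<longrightarrow> rrun (load_matrix d b F) s q = s q)"
    unfolding load_matrix_def
  proof (rule rrun_fill[OF inj_reg_idx distinct_idx])
    fix p s' assume "\<forall>q. q \<notin> {2, 3} \<union> (\<lambda>p. reg d b (fst p) (snd p)) ` set (idx d) \<longrightarrow> s' q = s q"
    from frame_idx(1)[OF this assms] show
      "rrun (load (reg d b (fst p) (snd p)) (F (fst p) (snd p))) s' (reg d b (fst p) (snd p)) = F (fst p) (snd p) \<and>
       (\<forall>q. q \<notin> {2, 3, reg d b (fst p) (snd p)} \<longrightarrow> rrun (load (reg d b (fst p) (snd p)) (F (fst p) (snd p))) s' q = s' q)"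
      unfolding good_def by (intro load_correct) auto
  qed (use reg_ge in auto)
  show "good (rrun (load_matrix d b F) s)" using frame_idx(1)[OF conjunct2[OF *] assms] .
  show "mat_at d c (rrun (load_matrix d b F) s) i j = (if c = b then F i j else mat_at d c s i j)" if "i < d" "j < d"
    using frame_idx(2)[OF conjunct2[OF *], of c i j] conjunct1[OF *] that by (auto simp: mat_at_def set_idx)
qed

lemma dot_regs_correct:
  assumes "good s" "z \<noteq> x" "z \<noteq> y" "i < d" "j < d"
  shows "rrun (dot_regs d x y z i j) s (reg d z i j) = (\<Sum>k<d. mat_at d x s i k * mat_at d y s k j) \<and>
    (\<forall>q. q \<notin> {2, 3, reg d z i j} \<longrightarrow> rrun (dot_regs d x y z i j) s q = s q)"
proof -
  let ?L = "\<lambda>k. rrun (concat (map (\<lambda>k. [(2, Mul (reg d x i k) (reg d y k j)), (3, Add 3 2)]) [0..<k])) (s(3 := 0))"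
  have L: "?L k 3 = (\<Sum>k<k. mat_at d x s i k * mat_at d y s k j) \<and> (\<forall>q. q \<notin> {2, 3} \<longrightarrow> ?L k q = s q)" for k
  proof (induction k)
    case (Suc k)
    then show ?case using reg_ge by (auto simp: mat_at_def)
  qed simp
  from L[of d] show ?thesis using assms(1) by (auto simp: dot_regs_def good_def)
qed

lemma mat_mult_correct:
  assumes "good s" "z \<noteq> x" "z \<noteq> y"
  shows "good (rrun (mat_mult d x y z) s)"
    "i < d \<Longrightarrow> j < d \<Longrightarrow> mat_at d c (rrun (mat_mult d x y z) s) i j =
      (if c = z then \<Sum>k<d. mat_at d x s i k * mat_at d y s k j else mat_at d c s i j)"
proof -
  let ?f = "\<lambda>i j. \<Sum>k<d. mat_at d x s i k * mat_at d y s k j"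
  have *: "(\<forall>p\<in>set (idx d). rrun (mat_mult d x y z) s (reg d z (fst p) (snd p)) = ?f (fst p) (snd p)) \<and>
    (\<forall>q. q \<notin> {2, 3} \<union> (\<lambda>p. reg d z (fst p) (snd p)) ` set (idx d) \<longrightarrow> rrun (mat_mult d x y z) s q = s q)"
    unfolding mat_mult_def
  proof (rule rrun_fill[OF inj_reg_idx distinct_idx])
    fix p s' assume p: "p \<in> set (idx d)"
      and fr: "\<forall>q. q \<notin> {2, 3} \<union> (\<lambda>p. reg d z (fst p) (snd p)) ` set (idx d) \<longrightarrow> s' q = s q"
    have p': "fst p < d" "snd p < d" using p by (auto simp: set_idx)
    have "(\<Sum>k<d. mat_at d x s' (fst p) k * mat_at d y s' k (snd p)) = ?f (fst p) (snd p)"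
      using frame_idx(2)[OF fr] assms(2,3) p' by (intro sum.cong) auto
    with dot_regs_correct[OF frame_idx(1)[OF fr assms(1)] assms(2,3) p'] show
      "rrun (dot_regs d x y z (fst p) (snd p)) s' (reg d z (fst p) (snd p)) = ?f (fst p) (snd p) \<and>
       (\<forall>q. q \<notin> {2, 3, reg d z (fst p) (snd p)} \<longrightarrow> rrun (dot_regs d x y z (fst p) (snd p)) s' q = s' q)"
      by simp
  qed (use reg_ge in auto)
  show "good (rrun (mat_mult d x y z) s)" using frame_idx(1)[OF conjunct2[OF *] assms(1)] .
  show "mat_at d c (rrun (mat_mult d x y z) s) i j = (if c = z then ?f i j else mat_at d c s i j)" if "i < d" "j < d"
    using frame_idx(2)[OF conjunct2[OF *], of c i j] conjunct1[OF *] that by (auto simp: mat_at_def set_idx)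
qed

text \<open>Matrix registers: 0 identity, 1 companion matrix, 2 initial values (first column), 3 current power, 4 scratch.\<close>

definition power_layer :: "nat \<Rightarrow> bool \<Rightarrow> (nat \<times> gate) list" where
  "power_layer d b = mat_mult d 3 3 4 @ mat_mult d 4 (if b then 1 else 0) 3"

text \<open>A square is formed in matrix 4, since a product must not overwrite its factors.
  Multiplication by the identity for a bit 0 brings it back to matrix 3, so all layers have the same
  layout.\<close>

definition lrs_prog :: "nat \<Rightarrow> int list \<Rightarrow> int list \<Rightarrow> nat \<Rightarrow> (nat \<times> gate) list" where
  "lrs_prog d a us n = (1, Const1) # load_matrix d 0 (\<lambda>i j. of_bool (i = j)) @
     load_matrix d 1 (\<lambda>i j. if Suc i < d then of_bool (j = Suc i) else nthd a j 0) @
     load_matrix d 2 (\<lambda>i j. if j = 0 then nthd us i 0 else 0) @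
     load_matrix d 3 (\<lambda>i j. of_bool (i = j)) @
     concat (map (power_layer d) (nbits n)) @ mat_mult d 3 2 4"

text \<open>The output has to be the last gate, so entry (0, 0) of matrix 4 is copied by adding
  register 0.\<close>

definition lrs_circuit :: "nat \<Rightarrow> int list \<Rightarrow> int list \<Rightarrow> nat \<Rightarrow> gate list" where
  "lrs_circuit d a us n = assemble (5 + 5 * d * d) (lrs_prog d a us n) @
     [Add (length (lrs_prog d a us n) * (5 + 5 * d * d) + reg d 4 0 0) (length (lrs_prog d a us n) * (5 + 5 * d * d))]"

text \<open>Specifies the \<open>m\<close>-th power of the companion matrix by its effect on windows
  of the sequence, so no power of a matrix has to be computed explicitly.\<close>

definition advances :: "nat \<Rightarrow> (nat \<Rightarrow> int) \<Rightarrow> nat \<Rightarrow> (nat \<Rightarrow> nat \<Rightarrow> int) \<Rightarrow> bool" where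
  "advances d u m M \<longleftrightarrow> (\<forall>i<d. \<forall>k. u (k + m + i) = (\<Sum>j<d. M i j * u (k + j)))"

lemma advances_mult:
  assumes "advances d u m M" "advances d u n N" "\<And>i j. i < d \<Longrightarrow> j < d \<Longrightarrow> R i j = (\<Sum>l<d. M i l * N l j)"
  shows "advances d u (m + n) R"
  unfolding advances_def
proof (intro allI impI)
  fix i k assume i: "i < d"
  have "u (k + n + m + i) = (\<Sum>l<d. M i l * u (k + n + l))"
    using assms(1) i unfolding advances_def by blast
  then have "u (k + (m + n) + i) = (\<Sum>l<d. M i l * u (k + n + l))" by (simp only: ac_simps)
  also have "\<dots> = (\<Sum>l<d. \<Sum>j<d. M i l * N l j * u (k + j))"
    using assms(2) by (auto simp: advances_def sum_distrib_left mult.assoc intro!: sum.cong)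
  also have "\<dots> = (\<Sum>j<d. \<Sum>l<d. M i l * N l j * u (k + j))" by (rule sum.swap)
  also have "\<dots> = (\<Sum>j<d. R i j * u (k + j))"
    using assms(3) i by (auto simp: sum_distrib_right intro!: sum.cong)
  finally show "u (k + (m + n) + i) = (\<Sum>j<d. R i j * u (k + j))" .
qed

lemma advances_id: "(\<And>i j. i < d \<Longrightarrow> j < d \<Longrightarrow> M i j = of_bool (i = j)) \<Longrightarrow> advances d u 0 M"
  by (auto simp: advances_def of_bool_def if_distrib[of "\<lambda>x. x * _"] cong: if_cong)

lemma advances_companion:
  assumes "satisfies_rec a u" "length a = d"
    "\<And>i j. i < d \<Longrightarrow> j < d \<Longrightarrow> M i j = (if Suc i < d then of_bool (j = Suc i) else nthd a j 0)"
  shows "advances d u 1 M"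
  unfolding advances_def
proof (intro allI impI)
  fix i k assume i: "i < d"
  show "u (k + 1 + i) = (\<Sum>j<d. M i j * u (k + j))"
  proof (cases "Suc i < d")
    case True
    then have "(\<Sum>j<d. M i j * u (k + j)) = (\<Sum>j<d. if j = Suc i then u (k + j) else 0)"
      using i assms(3) by (auto intro!: sum.cong)
    then show ?thesis using True by simp
  next
    case False
    then have "Suc i = d" using i by simp
    then have "u (k + 1 + i) = u (k + length a)" using assms(2) by (intro arg_cong[where f = u]) simp
    also have "\<dots> = (\<Sum>j<d. a ! j * u (k + j))" using assms by (simp add: satisfies_rec_def)
    also have "\<dots> = (\<Sum>j<d. M i j * u (k + j))"
      using i False assms(2,3) by (auto simp: nthd_def intro!: sum.cong)
    finally show ?thesis .
  qed
qed

lemma load_regs: "p \<in> set (load r z) \<Longrightarrow> r \<noteq> 0 \<Longrightarrow> fst p \<noteq> 0 \<and> gate_args (snd p) \<subseteq> {..<5}"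
  unfolding load_def by (cases "z < 0") (auto split: if_split_asm)

lemma lrs_prog_regs:
  assumes "p \<in> set (lrs_prog d a us n)"
  shows "fst p \<noteq> 0 \<and> gate_args (snd p) \<subseteq> {..<5 + 5 * d * d}"
proof -
  have 1: "fst p \<noteq> 0 \<and> gate_args (snd p) \<subseteq> {..<5 + 5 * d * d}" if "p \<in> set (load_matrix d b F)" for b F
  proof -
    from that obtain r where "p \<in> set (load (reg d b (fst r) (snd r)) (F (fst r) (snd r)))"
      by (auto simp: load_matrix_def)
    from load_regs[OF this reg_ge(2)] show ?thesis by auto
  qed
  have 2: "fst p \<noteq> 0 \<and> gate_args (snd p) \<subseteq> {..<5 + 5 * d * d}" if "p \<in> set (mat_mult d x y z)" "x < 5" "y < 5" for x y z
  proof -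
    from that(1) obtain i j where ij: "i < d" "j < d" "p \<in> set (dot_regs d x y z i j)"
      unfolding mat_mult_def by (auto simp: set_idx)
    from ij(3) consider "p = (3, Const0)" | "p = (3, Add 3 2)" | "p = (reg d z i j, Add 3 0)"
      | k where "k < d" "p = (2, Mul (reg d x i k) (reg d y k j))"
      unfolding dot_regs_def by fastforce
    then show ?thesis using ij reg_less that(2,3) reg_ge(2) by cases auto
  qed
  have 3: "p = (1, Const1) \<or> (\<exists>b F. p \<in> set (load_matrix d b F)) \<or> (\<exists>x y z. p \<in> set (mat_mult d x y z) \<and> x < 5 \<and> y < 5)"
  proof -
    have "p = (1, Const1) \<or> (\<exists>b F. p \<in> set (load_matrix d b F)) \<or> (\<exists>b. p \<in> set (power_layer d b)) \<or> p \<in> set (mat_mult d 3 2 4)"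
      using assms unfolding lrs_prog_def by auto
    moreover have "\<exists>x y z. p \<in> set (mat_mult d x y z) \<and> x < 5 \<and> y < 5" if "p \<in> set (power_layer d b)" for b
    proof -
      have "p \<in> set (mat_mult d 3 3 4) \<or> p \<in> set (mat_mult d 4 (if b then 1 else 0) 3)"
        using that unfolding power_layer_def by simp
      then show ?thesis
      proof
        assume "p \<in> set (mat_mult d 3 3 4)"
        then show ?thesis by (intro exI[of _ 3] exI[of _ 4]) simp
      next
        assume "p \<in> set (mat_mult d 4 (if b then 1 else 0) 3)"
        then show ?thesis by (intro exI[of _ 4] exI[of _ "if b then 1 else 0"] exI[of _ 3]) simp
      qed
    qed
    moreover have "p \<in> set (mat_mult d 3 2 4) \<Longrightarrow> \<exists>x y z. p \<in> set (mat_mult d x y z) \<and> x < 5 \<and> y < 5"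
      by (intro exI[of _ 3] exI[of _ 2] exI[of _ 4]) simp
    ultimately show ?thesis by blast
  qed
  then show ?thesis using 1 2 by (elim disjE exE conjE) simp_all
qed

lemma lrs_prog_value:
  assumes "satisfies_rec a u" "length a = d" "us = map u [0..<d]"
  shows "rrun (lrs_prog d a us n) (\<lambda>_. 0) (reg d 4 0 0) = (if d = 0 then 0 else u n)"
proof (cases "d = 0")
  case True
  then show ?thesis
    by (simp add: lrs_prog_def load_matrix_def mat_mult_def power_layer_def idx_def comp_def reg_def concat_eq_Nil_conv[THEN iffD2])
next
  case False
  define s0 where "s0 = (\<lambda>_. 0 :: int)(1 :: nat := 1 :: int)"
  define s1 where "s1 = rrun (load_matrix d 0 (\<lambda>i j. of_bool (i = j))) s0"
  define s2 where "s2 = rrun (load_matrix d 1 (\<lambda>i j. if Suc i < d then of_bool (j = Suc i) else nthd a j 0)) s1"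
  define s3 where "s3 = rrun (load_matrix d 2 (\<lambda>i j. if j = 0 then nthd us i 0 else 0)) s2"
  define s4 where "s4 = rrun (load_matrix d 3 (\<lambda>i j. of_bool (i = j))) s3"
  have g0: "good s0" by (simp add: s0_def good_def)
  have g: "good s1" "good s2" "good s3" "good s4"
    unfolding s1_def s2_def s3_def s4_def by (intro load_matrix_correct g0)+
  note lm = load_matrix_correct(2)[OF g0] load_matrix_correct(2)[OF g(1)] load_matrix_correct(2)[OF g(2)] load_matrix_correct(2)[OF g(3)]
  \<comment> \<open>The loop invariant: matrix 3 advances by the number \<open>m\<close> formed by
    the bits read so far.\<close>
  define inv where "inv m s \<longleftrightarrow> good s \<and> advances d u 0 (mat_at d 0 s) \<and> advances d u 1 (mat_at d 1 s) \<and>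
      (\<forall>i<d. mat_at d 2 s i 0 = u i) \<and> advances d u m (mat_at d 3 s)" for m s
  have v: "mat_at d c s1 i j = (if c = 0 then of_bool (i = j) else mat_at d c s0 i j)"
    "mat_at d c s2 i j = (if c = 1 then if Suc i < d then of_bool (j = Suc i) else nthd a j 0 else mat_at d c s1 i j)"
    "mat_at d c s3 i j = (if c = 2 then if j = 0 then nthd us i 0 else 0 else mat_at d c s2 i j)"
    "mat_at d c s4 i j = (if c = 3 then of_bool (i = j) else mat_at d c s3 i j)" if "i < d" "j < d" for c i j
    using lm(1)[OF that, where b = 0] lm(2)[OF that, where b = 1] lm(3)[OF that, where b = 2] lm(4)[OF that, where b = 3]
    unfolding s1_def s2_def s3_def s4_def by this+
  have "inv 0 s4"
    unfolding inv_def
  proof (intro conjI allI impI)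
    show "advances d u 0 (mat_at d 0 s4)" "advances d u 0 (mat_at d 3 s4)"
      by (rule advances_id; simp add: v)+
    show "advances d u 1 (mat_at d 1 s4)"
      by (rule advances_companion[OF assms(1,2)]; simp add: v)
    show "mat_at d 2 s4 i 0 = u i" if "i < d" for i
      using that assms(3) by (simp add: v nthd_def)
  qed (rule g)
  have layer: "inv (2 * m + of_bool b) (rrun (power_layer d b) s)" if "inv m s" for m b s
  proof -
    let ?t = "rrun (mat_mult d 3 3 4) s" and ?c = "if b then 1 else 0 :: nat"
    let ?r = "rrun (mat_mult d 4 ?c 3) ?t"
    have gs: "good s" using that by (simp add: inv_def)
    note t = mat_mult_correct[OF gs, of 4 3 3]
    have gt: "good ?t" using t(1) by simp
    have tv: "mat_at d c ?t i j = (if c = 4 then \<Sum>k<d. mat_at d 3 s i k * mat_at d 3 s k j else mat_at d c s i j)"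
      if "i < d" "j < d" for c i j using t(2) that by simp
    have rv: "mat_at d c ?r i j = (if c = 3 then \<Sum>k<d. mat_at d 4 ?t i k * mat_at d ?c ?t k j else mat_at d c ?t i j)"
      if "i < d" "j < d" for c i j using mat_mult_correct(2)[OF gt, of 3 4 ?c] that by simp
    have "advances d u (m + m) (mat_at d 4 ?t)"
      using that by (intro advances_mult[of d u m "mat_at d 3 s" m "mat_at d 3 s"]) (auto simp: inv_def tv)
    moreover have "advances d u (of_bool b) (mat_at d ?c s)" using that by (auto simp: inv_def)
    ultimately have "advances d u (m + m + of_bool b) (mat_at d 3 ?r)"
      by (rule advances_mult) (auto simp: rv tv)
    moreover have "advances d u k (mat_at d c ?r) \<longleftrightarrow> advances d u k (mat_at d c s)" if "c < 3" for k c
      using that by (auto simp: advances_def rv tv cong: sum.cong_simp)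
    moreover have "good ?r" using mat_mult_correct(1)[OF gt, of 3 4 ?c] by simp
    ultimately show ?thesis using that False unfolding inv_def power_layer_def
      by (simp add: rv tv mult_2)
  qed
  have "inv (bval bs) (rrun (concat (map (power_layer d) bs)) s4)" for bs
  proof (induction bs rule: rev_induct)
    case Nil
    then show ?case using \<open>inv 0 s4\<close> by simp
  next
    case (snoc b bs)
    from layer[OF this] show ?case by simp
  qed
  from this[of "nbits n"] have fin: "inv n (rrun (concat (map (power_layer d) (nbits n))) s4)" (is "inv n ?s") by simp
  then have "good ?s" by (simp add: inv_def)
  from mat_mult_correct(2)[OF this, of 4 3 2 0 d 0 4]
  have "rrun (mat_mult d 3 2 4) ?s (reg d 4 0 0) = (\<Sum>k<d. mat_at d 3 ?s 0 k * mat_at d 2 ?s k 0)"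
    using False by (simp add: mat_at_def)
  also have "\<dots> = (\<Sum>k<d. mat_at d 3 ?s 0 k * u (0 + k))" using fin by (intro sum.cong) (auto simp: inv_def)
  also have "\<dots> = u (0 + n + 0)"
  proof -
    have "advances d u n (mat_at d 3 ?s)" using fin by (simp add: inv_def)
    from this[unfolded advances_def, rule_format, of 0 0] show ?thesis using False by simp
  qed
  finally have "rrun (mat_mult d 3 2 4) ?s (reg d 4 0 0) = u n" by simp
  moreover have "rrun (lrs_prog d a us n) (\<lambda>_. 0) = rrun (mat_mult d 3 2 4) ?s"
    by (simp add: lrs_prog_def s4_def s3_def s2_def s1_def s0_def)
  ultimately show ?thesis using False by simp
qed

lemma lrs_circuit_correct:
  assumes "satisfies_rec a u" "length a = d" "us = map u [0..<d]"
  shows "wf_circuit (lrs_circuit d a us n)" "circuit_output (lrs_circuit d a us n) = u n"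
proof -
  let ?K = "5 + 5 * d * d" and ?P = "lrs_prog d a us n"
  have as: "length (assemble ?K ?P) = length ?P * ?K + ?K" "wf_circuit (assemble ?K ?P)" "rrun ?P (\<lambda>_. 0) 0 = 0"
    "\<And>r. r < ?K \<Longrightarrow> circuit_vals (assemble ?K ?P) ! (length ?P * ?K + r) = rrun ?P (\<lambda>_. 0) r"
    using assemble_correct[of ?K ?P] lrs_prog_regs[of _ d a us n] by auto
  \<comment> \<open>For \<open>d = 0\<close> there are no matrices and this is register 4, which
    exists because \<open>?K\<close> has the summand 5, and which is never assigned.\<close>
  have r: "reg d 4 0 0 < ?K" using reg_less[of 0 d 0 4] by (cases "d = 0") (auto simp: reg_def)
  show "wf_circuit (lrs_circuit d a us n)"
    unfolding lrs_circuit_def using as(1,2) r by (intro wf_circuit_append) auto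
  have "circuit_output (lrs_circuit d a us n) = rrun ?P (\<lambda>_. 0) (reg d 4 0 0)"
    using as(4)[OF r] as(4)[of 0] as(3) by (simp add: lrs_circuit_def circuit_output_def circuit_vals_snoc)
  also have "\<dots> = u n"
    using lrs_prog_value[OF assms] assms(1,2) by (auto simp: satisfies_rec_def)
  finally show "circuit_output (lrs_circuit d a us n) = u n" .
qed

section \<open>Constructing the circuits in polynomial time\<close>

lemma ptime_recode:
  assumes "ptime f" "\<And>x. code (g x) = code (f x)"
  shows "ptime g"
  using assms unfolding ptime_def computes_def by metis

text \<open>\<open>enc_gate\<close> is the code of this list, so gates can be built and inspected as
  lists of numbers.\<close>

definition gate_nats :: "gate \<Rightarrow> nat list" where
  "gate_nats g = (case g of Const0 \<Rightarrow> [0] | Const1 \<Rightarrow> [1] | Add i j \<Rightarrow> [2, i, j] | Sub i j \<Rightarrow> [3, i, j] | Mul i j \<Rightarrow> [4, i, j])"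

lemma code_gate_nats: "code (gate_nats g) = code g"
  by (cases g) (auto simp: gate_nats_def code_list_def code_nat_def code_gate_def)

lemma ptime_gate_nats [pt]: "ptime g \<Longrightarrow> ptime (\<lambda>x. gate_nats (g x))"
  by (erule ptime_recode) (rule code_gate_nats)

lemma ptime_gates [pt]:
  assumes "ptime i" "ptime j"
  shows "ptime (\<lambda>x. Add (i x) (j x))" "ptime (\<lambda>x. Sub (i x) (j x))" "ptime (\<lambda>x. Mul (i x) (j x))"
proof -
  have p: "ptime (\<lambda>x. [k, i x, j x])" for k :: nat by (intro pt assms)
  show "ptime (\<lambda>x. Add (i x) (j x))" by (rule ptime_recode[OF p[of 2]]) (simp add: code_list_def code_nat_def code_gate_def)
  show "ptime (\<lambda>x. Sub (i x) (j x))" by (rule ptime_recode[OF p[of 3]]) (simp add: code_list_def code_nat_def code_gate_def)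
  show "ptime (\<lambda>x. Mul (i x) (j x))" by (rule ptime_recode[OF p[of 4]]) (simp add: code_list_def code_nat_def code_gate_def)
qed

lemma gshift_nats: "gshift k g = (let l = gate_nats g; o1 = nthd l 0 0; i = k + nthd l (1 :: nat) 0; j = k + nthd l (2 :: nat) 0 in
    if o1 = 0 then Const0 else if o1 = 1 then Const1 else if o1 = 2 then Add i j else if o1 = 3 then Sub i j else Mul i j)"
  by (cases g) (auto simp: gate_nats_def nthd_def)

lemma ptime_gshift [pt]:
  assumes "ptime k" "ptime g"
  shows "ptime (\<lambda>x. gshift (k x) (g x))"
  unfolding gshift_nats Let_def by (intro pt assms)

lemma ptime_assemble [pt]:
  assumes "ptime P"
  shows "ptime (\<lambda>x. assemble K (P x))"
proof -
  have "pbd (\<lambda>x. length (P x))" using pbd_mono[OF pbd_sz[OF assms] length_le_sz] .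
  then show ?thesis
    unfolding assemble_def reg_block_def
    by (intro pt ptime_upt ptime_length[OF assms] ptime_comp[OF assms])
qed

lemma ptime_of_bool_int [pt]: "ptime b \<Longrightarrow> ptime (\<lambda>x. of_bool (b x) :: int)"
  unfolding of_bool_def by (intro pt)

lemma ptime_load [pt]:
  assumes "ptime r" "ptime z"
  shows "ptime (\<lambda>x. load (r x) (z x))"
  unfolding load_def by (intro pt assms)

lemma ptime_load_matrix:
  assumes "ptime (\<lambda>z. F (fst z) (fst (snd z)) (snd (snd z)))"
  shows "ptime (\<lambda>x. load_matrix d b (F x))"
proof -
  have "ptime (\<lambda>z. F (fst z) (fst (snd z)) (snd (snd z)))" by (rule assms)
  then show ?thesis unfolding load_matrix_def reg_def by (intro pt) auto
qed

text \<open>For fixed \<open>d\<close> a layer is one of two constants.\<close>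

lemma ptime_power_layer [pt]:
  assumes "ptime b"
  shows "ptime (\<lambda>x. power_layer d (b x))"
proof -
  have "power_layer d b = (if b then power_layer d True else power_layer d False)" for b by simp
  then have "(\<lambda>x. power_layer d (b x)) = (\<lambda>x. if b x then power_layer d True else power_layer d False)" by auto
  then show ?thesis by (simp only:) (intro pt assms)
qed

lemma ptime_lrs_circuit [pt]:
  assumes "ptime a" "ptime us" "ptime n"
  shows "ptime (\<lambda>x. lrs_circuit d (a x) (us x) (n x))"
proof -
  have p: "ptime (\<lambda>x. lrs_prog d (a x) (us x) (n x))"
    unfolding lrs_prog_def
    by (intro pt ptime_load_matrix assms ptime_comp[OF assms(1)] ptime_comp[OF assms(2)])
  show ?thesis unfolding lrs_circuit_def by (intro pt p)
qed

section \<open>The reduction\<close>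

lemma code_word [simp]: "code (W w) = w" "code x = unW x"
  by (simp_all add: code_word_def)

lemma ptime_encode [pt]: "ptime f \<Longrightarrow> ptime (\<lambda>x. W (code (f x)))"
  by (erule ptime_recode) simp

definition first_field :: "word \<Rightarrow> word" where "first_field x = W (fst (wsplit (unW x)))"
definition rest_fields :: "word \<Rightarrow> word" where "rest_fields x = W (snd (wsplit (unW x)))"

lemma ptime_fields [pt]:
  assumes "ptime f"
  shows "ptime (\<lambda>x. first_field (f x))" "ptime (\<lambda>x. rest_fields (f x))"
  by (rule ptime_comp[OF ptimeI[OF pw_wfst] assms]; simp add: first_field_def)
    (rule ptime_comp[OF ptimeI[OF pw_wsnd] assms]; simp add: rest_fields_def)

primrec fields :: "nat \<Rightarrow> word \<Rightarrow> word list" where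
  "fields 0 x = []"
| "fields (Suc k) x = first_field x # fields k (rest_fields x)"

lemma ptime_fields_list [pt]:
  assumes "ptime f"
  shows "ptime (\<lambda>x. fields k (f x))"
  using assms
proof (induction k arbitrary: f)
  case (Suc k)
  have "ptime (\<lambda>x. fields k (rest_fields (f x)))" by (intro Suc.IH pt Suc.prems)
  then show ?case unfolding fields.simps by (intro pt Suc.prems)
qed (simp add: ptime_const)

lemma fields_enc_words: "fields (length ws) (W (enc_words ws)) = map W ws"
proof (induction ws)
  case (Cons w ws)
  have "wsplit (enc_words (w # ws)) = (w, enc_words ws)" by (simp add: enc_words_def)
  then show ?case using Cons by (simp add: first_field_def rest_fields_def)
qed simp

definition word_tl :: "word \<Rightarrow> word" where "word_tl x = W (tl (unW x))"
definition word_hd :: "word \<Rightarrow> bool" where "word_hd x = (case unW x of [] \<Rightarrow> False | b # _ \<Rightarrow> b)"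

lemma ptime_word_tl [pt]: "ptime f \<Longrightarrow> ptime (\<lambda>x. word_tl (f x))"
  by (rule ptime_comp[OF ptimeI[OF pw_tl]]) (auto simp: word_tl_def)

lemma ptime_word_hd [pt]: "ptime f \<Longrightarrow> ptime (\<lambda>x. word_hd (f x))"
  by (rule ptime_comp[OF ptimeI[OF pw_case[OF pw_id pw_const[of _ "[False]"] pw_const[of _ "[True]"] pw_const[of _ "[False]"]]]])
    (auto simp: word_hd_def code_bool_def split: list.split)

lemma ptime_rev_unW [pt]:
  assumes "ptime f"
  shows "ptime (\<lambda>x. rev (unW (f x)))"
proof -
  let ?s = "\<lambda>st. (word_tl (fst st), word_hd (fst st) # snd st)"
  have it: "(?s ^^ k) (W w, []) = (W (drop k w), rev (take k w))" if "k \<le> length w" for k w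
    using that
  proof (induction k)
    case (Suc k)
    then have "drop k w = w ! k # drop (Suc k) w" by (simp add: Cons_nth_drop_Suc)
    with Suc show ?case by (simp add: word_tl_def word_hd_def take_Suc_conv_app_nth)
  qed simp
  have "ptime (\<lambda>x. (?s ^^ sz x) (x :: word, []))"
  proof (rule ptime_iterate)
    show "sz ((?s ^^ k) (x, [])) \<le> 2 * sz x + 1 + 3 * sz x" if "k \<le> sz x" for x :: word and k
    proof -
      have k: "k \<le> length (unW x)" using that by (simp add: sz_def)
      have "sz ((?s ^^ k) (x, [])) = 2 * (length (unW x) - k) + 1 + 3 * k"
        using it[OF k] k by (simp add: sz_Pair sz_bool_list) (simp add: sz_def)
      also have "\<dots> \<le> 2 * sz x + 1 + 3 * sz x" using k by (simp add: sz_def)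
      finally show ?thesis .
    qed
    show "pbd (\<lambda>x :: word. 2 * sz x + 1 + 3 * sz x)" by (intro pbd_add pbd_mult pbd_const pbd_sz pt)
  qed (intro pt)+
  from ptime_snd[OF this] have "ptime (\<lambda>x :: word. snd ((?s ^^ sz x) (x, [])))" .
  moreover have "snd ((?s ^^ sz x) (x :: word, [])) = rev (unW x)" for x
    using it[of "length (unW x)" "unW x"] by (simp add: sz_def)
  ultimately have "ptime (\<lambda>x :: word. rev (unW x))" by simp
  then show ?thesis using assms by (rule ptime_comp)
qed

text \<open>The leading \<open>True\<close> protects leading zeros, so words can be compared as
  numbers.\<close>

lemma bval_True_inj: "bval (True # xs) = bval (True # ys) \<Longrightarrow> xs = ys"
proof (induction xs arbitrary: ys rule: rev_induct)
  case Nil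
  show ?case
  proof (cases ys rule: rev_cases)
    case (snoc zs z)
    have "bval (True # zs) \<ge> 1" by (simp add: Suc_le_eq)
    moreover have "bval (True # zs @ [z]) = 2 * bval (True # zs) + of_bool z"
      using bval_simps(3)[of "True # zs" z] by simp
    ultimately show ?thesis using Nil snoc by (simp del: bval_simps(2)) (simp add: bval_def)
  qed simp
next
  case (snoc x xs)
  have x: "bval (True # zs @ [z]) = 2 * bval (True # zs) + of_bool z" for zs z
    using bval_simps(3)[of "True # zs" z] by simp
  show ?case
  proof (cases ys rule: rev_cases)
    case Nil
    have "bval (True # xs) \<ge> 1" by (simp add: Suc_le_eq)
    then show ?thesis using snoc.prems Nil by (simp add: x del: bval_simps(2)) (simp add: bval_def)
  next
    case (snoc zs z)
    have e: "2 * bval (True # xs) + of_bool x = 2 * bval (True # zs) + of_bool z"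
      using snoc.prems unfolding snoc x .
    then have "even (2 * bval (True # xs) + of_bool x) = even (2 * bval (True # zs) + of_bool z)" by (simp only:)
    then have "x = z" by (cases x; cases z; simp del: bval_simps)
    then have "bval (True # xs) = bval (True # zs)" using e by (simp del: bval_simps)
    then show ?thesis using \<open>x = z\<close> snoc snoc.IH by blast
  qed
qed

lemma ptime_word_eq [pt]:
  assumes "ptime f" "ptime g"
  shows "ptime (\<lambda>x. f x = (g x :: word))"
proof -
  have "(f x = g x) = (bval (True # rev (unW (f x))) = bval (True # rev (unW (g x))))" for x
    by (metis bval_True_inj rev_rev_ident word.expand)
  then show ?thesis by (simp only:) (intro pt assms)
qed

definition word_nat :: "word \<Rightarrow> nat" where "word_nat x = bval (rev (unW x))"
definition word_int :: "word \<Rightarrow> int" where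
  "word_int x = (if word_hd x then - int (word_nat (word_tl x)) else int (word_nat (word_tl x)))"

lemma word_nat_bin_nat [simp]: "word_nat (W (bin_nat n)) = n"
  by (simp add: word_nat_def flip: nbits_def)

lemma word_int_bin_int [simp]: "word_int (W (bin_int i)) = i"
  by (simp add: word_int_def word_hd_def word_tl_def bin_int_def)

lemma ptime_word_nat [pt]: "ptime f \<Longrightarrow> ptime (\<lambda>x. word_nat (f x))"
  unfolding word_nat_def by (intro pt)

lemma ptime_word_int [pt]: "ptime f \<Longrightarrow> ptime (\<lambda>x. word_int (f x))"
  unfolding word_int_def by (intro pt ptime_neg_int)

definition inst_coeffs :: "nat \<Rightarrow> word \<Rightarrow> int list" where
  "inst_coeffs d x = map (\<lambda>i. word_int (nthd (fields (2 * d + 1) x) i (W []))) [0..<d]"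
definition inst_init :: "nat \<Rightarrow> word \<Rightarrow> int list" where
  "inst_init d x = map (\<lambda>i. word_int (nthd (fields (2 * d + 1) x) i (W []))) [d..<2 * d]"
definition inst_bound :: "nat \<Rightarrow> word \<Rightarrow> nat" where
  "inst_bound d x = word_nat (nthd (fields (2 * d + 1) x) (2 * d) (W []))"

lemma ptime_inst [pt]:
  assumes "ptime f"
  shows "ptime (\<lambda>x. inst_coeffs d (f x))" "ptime (\<lambda>x. inst_init d (f x))" "ptime (\<lambda>x. inst_bound d (f x))"
  unfolding inst_coeffs_def inst_init_def inst_bound_def by (intro pt assms ptime_comp[OF assms])+

lemma ptime_enc_instance [pt]:
  assumes "ptime a" "ptime us" "ptime N"
  shows "ptime (\<lambda>x. W (enc_instance (a x) (us x) (N x)))"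
proof -
  have eq: "W (enc_instance (a x) (us x) (N x)) = W (code (map (\<lambda>i. W (code i)) (a x) @ map (\<lambda>i. W (code i)) (us x) @ [W (code (N x))]))" for x
    by (simp add: enc_instance_def code_list_def comp_def code_int_def code_nat_def)
  show ?thesis unfolding eq by (intro pt assms)
qed

lemma parse_instance:
  assumes "unW x = enc_instance a us N" "length a = d" "length us = d"
  shows "inst_coeffs d x = a" "inst_init d x = us" "inst_bound d x = N"
proof -
  let ?ws = "map bin_int a @ map bin_int us @ [bin_nat N]"
  have l: "length ?ws = 2 * d + 1" using assms by simp
  have "x = W (enc_words ?ws)" using assms(1) by (metis enc_instance_def word.collapse)
  then have f: "fields (2 * d + 1) x = map W ?ws" using fields_enc_words[of ?ws] unfolding l by simp
  show "inst_coeffs d x = a"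
    unfolding inst_coeffs_def f using assms by (intro nth_equalityI) (auto simp: nthd_def nth_append)
  show "inst_init d x = us"
    unfolding inst_init_def f using assms by (intro nth_equalityI) (auto simp: nthd_def nth_append)
  show "inst_bound d x = N"
    unfolding inst_bound_def f using assms by (auto simp: nthd_def nth_append)
qed

text \<open>The Hankel matrix needs exact terms up to index \<open>2 d - 2\<close>; \<open>d\<close>
  extensions supply them, and for fixed \<open>d\<close> their size is no concern.\<close>

definition extend_rec :: "nat \<Rightarrow> int list \<Rightarrow> int list \<Rightarrow> int list" where
  "extend_rec d a xs = xs @ [sum_list (map (\<lambda>i. nthd a i 0 * nthd xs (length xs - d + i) 0) [0..<d])]"

lemma extend_rec_funpow:
  assumes "satisfies_rec a u" "length a = d"
  shows "(extend_rec d a ^^ k) (map u [0..<d]) = map u [0..<d + k]"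
proof (induction k)
  case (Suc k)
  have "sum_list (map (\<lambda>i. nthd a i 0 * nthd (map u [0..<d + k]) (length (map u [0..<d + k]) - d + i) 0) [0..<d]) =
      (\<Sum>i<d. a ! i * u (k + i))"
    using assms(2) by (auto simp: nthd_def sum_list_distinct_conv_sum_set atLeast0LessThan intro!: sum.cong)
  also have "\<dots> = u (k + d)" using assms by (simp add: satisfies_rec_def)
  finally show ?case using Suc by (simp add: extend_rec_def add.commute)
qed simp

lemma ptime_extend_rec:
  assumes "ptime a" "ptime xs"
  shows "ptime (\<lambda>x. (extend_rec d (a x) ^^ k) (xs x))"
proof (induction k)
  case (Suc k)
  show ?case unfolding funpow.simps comp_apply extend_rec_def[of _ _ "(extend_rec d _ ^^ k) _"]
    by (intro pt Suc ptime_comp[OF Suc] ptime_comp[OF assms(1)])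
qed (simp add: assms)

lemma ptime_All_less: "(\<And>i. i < n \<Longrightarrow> ptime (\<lambda>x. P x i)) \<Longrightarrow> ptime (\<lambda>x. \<forall>i<n. P x i)" for n :: nat
proof (induction n)
  case (Suc n)
  have "(\<forall>i<Suc n. P x i) = (P x n \<and> (\<forall>i<n. P x i))" for x by (auto simp: less_Suc_eq)
  then show ?case using Suc by (simp only:) (intro pt; simp)
qed (simp add: ptime_const)

lemma ptime_Ex_less: "(\<And>i. i < n \<Longrightarrow> ptime (\<lambda>x. P x i)) \<Longrightarrow> ptime (\<lambda>x. \<exists>i<n. P x i)" for n :: nat
  using ptime_Not[OF ptime_All_less[of n "\<lambda>x i. \<not> P x i"]] ptime_Not by fastforce

lemma ptime_singular:
  assumes "\<And>i j. ptime (\<lambda>x. M x i j)"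
  shows "ptime (\<lambda>x. singular n (M x))"
  using assms
proof (induction n arbitrary: M)
  case (Suc n)
  have "ptime (\<lambda>x. singular n (elim_row n i (M x)))" for i
    by (rule Suc.IH) (unfold elim_row_def, intro pt Suc.prems)
  then show ?case unfolding singular.simps by (intro pt ptime_All_less ptime_Ex_less Suc.prems)
qed (simp add: ptime_const)

definition full_rank :: "nat \<Rightarrow> word \<Rightarrow> bool" where
  "full_rank d x \<longleftrightarrow> \<not> singular d (\<lambda>i j. nthd ((extend_rec d (inst_coeffs d x) ^^ d) (inst_init d x)) (i + j) 0)"

lemma ptime_full_rank: "ptime (full_rank d)"
  unfolding full_rank_def by (intro pt ptime_singular ptime_extend_rec)

lemma singular_cong:
  assumes "\<And>i j. i < n \<Longrightarrow> j < n \<Longrightarrow> M i j = M' i j"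
  shows "singular n M = singular n M'"
  unfolding singular_iff using assms by (simp cong: sum.cong_simp)

lemma full_rank_iff:
  assumes "satisfies_rec a u" "inst_coeffs d x = a" "length a = d" "inst_init d x = map u [0..<d]"
  shows "full_rank d x \<longleftrightarrow> lrs_order u = d"
proof -
  have "singular d (\<lambda>i j. nthd ((extend_rec d a ^^ d) (map u [0..<d])) (i + j) 0) = singular d (\<lambda>i j. u (i + j))"
    by (rule singular_cong) (simp add: extend_rec_funpow[OF assms(1,3)] nthd_def)
  then have "full_rank d x \<longleftrightarrow> \<not> lrs_order u < d"
    using lrs_order_less_iff[OF assms(1)] assms(2-4) by (simp add: full_rank_def)
  moreover have "lrs_order u \<le> d" unfolding lrs_order_def by (rule Least_le) (use assms in blast)
  ultimately show ?thesis by simp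
qed

text \<open>Parsing is total and returns something for every word. Encoding the parsed data again
  and comparing the result with \<open>x\<close> singles out the genuine instances.\<close>

definition admissible :: "nat \<Rightarrow> word \<Rightarrow> bool" where
  "admissible d x \<longleftrightarrow> W (enc_instance (inst_coeffs d x) (inst_init d x) (inst_bound d x)) = x \<and>
     0 < inst_bound d x \<and> full_rank d x"

lemma length_inst [simp]: "length (inst_coeffs d x) = d" "length (inst_init d x) = d"
  by (simp_all add: inst_coeffs_def inst_init_def)

lemma admissible_sequence:
  assumes "admissible d x"
  obtains u where "satisfies_rec (inst_coeffs d x) u" "inst_init d x = map u [0..<d]" "lrs_order u = d"
proof -
  obtain u where u: "satisfies_rec (inst_coeffs d x) u" "\<forall>j<d. u j = inst_init d x ! j"
    using rec_solution_exists[of "inst_init d x" "inst_coeffs d x"] by auto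
  then have "inst_init d x = map u [0..<d]" by (intro nth_equalityI) auto
  then show ?thesis using full_rank_iff[OF u(1)] assms u(1) that by (simp add: admissible_def)
qed

lemma mem_skolem_iff:
  "unW x \<in> bounded_skolem d \<longleftrightarrow> admissible d x \<and>
     (\<exists>u. satisfies_rec (inst_coeffs d x) u \<and> inst_init d x = map u [0..<d] \<and> (\<exists>n\<le>inst_bound d x. u n = 0))"
proof
  assume "unW x \<in> bounded_skolem d"
  then obtain a u N where e: "unW x = enc_instance a (map u [0..<d]) N" and o: "lrs_order u = d" "length a = d" "satisfies_rec a u"
    and N: "N > 0" "\<exists>n\<in>{0..N}. u n = 0"
    unfolding bounded_skolem_def by blast
  have l: "length (map u [0..<d]) = d" by simp
  note p = parse_instance[OF e o(2) l]
  have "W (enc_instance a (map u [0..<d]) N) = x" using e by (metis word.collapse)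
  moreover have "full_rank d x" using full_rank_iff[OF o(3) p(1) o(2) p(2)] o(1) by simp
  ultimately show "admissible d x \<and>
     (\<exists>u. satisfies_rec (inst_coeffs d x) u \<and> inst_init d x = map u [0..<d] \<and> (\<exists>n\<le>inst_bound d x. u n = 0))"
    using N o unfolding admissible_def p by (auto intro!: exI[of _ u])
next
  assume a: "admissible d x \<and>
     (\<exists>u. satisfies_rec (inst_coeffs d x) u \<and> inst_init d x = map u [0..<d] \<and> (\<exists>n\<le>inst_bound d x. u n = 0))"
  then obtain u n where u: "satisfies_rec (inst_coeffs d x) u" "inst_init d x = map u [0..<d]" "n \<le> inst_bound d x" "u n = 0"
    by blast
  have "unW x = enc_instance (inst_coeffs d x) (map u [0..<d]) (inst_bound d x)"
    using a u(2) unfolding admissible_def by (metis word.sel)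
  moreover have "lrs_order u = d" using a full_rank_iff[OF u(1) _ _ u(2)] by (simp add: admissible_def)
  moreover have "is_lrs u" using u(1) unfolding is_lrs_def by blast
  moreover have "0 < inst_bound d x" using a by (simp add: admissible_def)
  moreover have "\<exists>n\<in>{0..inst_bound d x}. u n = 0" using u by auto
  ultimately show "unW x \<in> bounded_skolem d"
    unfolding bounded_skolem_def using u(1) length_inst by blast
qed

lemma inst_size:
  assumes "admissible d x"
  shows "c \<in> set (inst_coeffs d x) \<Longrightarrow> \<bar>c\<bar> < 2 ^ sz x" "c \<in> set (inst_init d x) \<Longrightarrow> \<bar>c\<bar> < 2 ^ sz x" "inst_bound d x < 2 ^ sz x"
proof -
  let ?ws = "map bin_int (inst_coeffs d x) @ map bin_int (inst_init d x) @ [bin_nat (inst_bound d x)]"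
  have x: "x = W (enc_words ?ws)" using assms by (simp add: admissible_def enc_instance_def)
  have sz: "length w \<le> sz x" if "w \<in> set ?ws" for w
  proof -
    have "sz (W w) \<le> sz (map W ?ws)" using that by (intro sz_mem) auto
    also have "\<dots> = sz x" by (subst x) (simp add: sz_def code_list_def comp_def)
    finally show ?thesis by (simp add: sz_def)
  qed
  have int: "\<bar>c\<bar> < 2 ^ sz x" if "bin_int c \<in> set ?ws" for c
  proof -
    have "sz c \<le> sz x" using sz[OF that] by (simp add: sz_def code_int_def)
    then have "(2 :: int) ^ sz c \<le> 2 ^ sz x" by (rule power_increasing) simp
    then show ?thesis using abs_less_two_sz[of c] by linarith
  qed
  show "c \<in> set (inst_coeffs d x) \<Longrightarrow> \<bar>c\<bar> < 2 ^ sz x" "c \<in> set (inst_init d x) \<Longrightarrow> \<bar>c\<bar> < 2 ^ sz x"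
    by (rule int; simp)+
  show "inst_bound d x < 2 ^ sz x"
    using sz[of "bin_nat (inst_bound d x)"] by (simp add: length_bin_nat)
qed

theorem circuit_reduction:
  "\<exists>F :: word \<Rightarrow> gate list list. ptime F \<and> (\<forall>x. (\<forall>c\<in>set (F x). wf_circuit c) \<and>
     (unW x \<in> bounded_skolem d \<longleftrightarrow> (\<exists>c\<in>set (F x). circuit_output c = 0)))"
proof -
  \<comment> \<open>\<open>X\<close> is the bound of \<open>small_prime_not_dividing\<close> for
    coefficients of \<open>sz x\<close> bits, and \<open>V\<close> the one required by
    \<open>zero_located\<close> for the rate \<open>sz x + d\<close> from
    \<open>growth\<close>.\<close>
  define X where "X = (\<lambda>x :: word. 4 * (sz x + 3) ^ 2)"
  define V where "V = (\<lambda>x :: word. d + (sz x + d) * (d + X x ^ (d * d) * (d + 1) + 1) + 1)"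
  have pw: "pbd (sz :: word \<Rightarrow> nat)" using pbd_sz[OF ptime_id] .
  have pX: "pbd X" unfolding X_def by (intro pbd_mult pbd_power pbd_add pbd_const pw)
  have pV: "pbd V" unfolding V_def by (intro pbd_mult pbd_power pbd_add pbd_const pw pX)
  \<comment> \<open>Unary lists whose lengths are the number of levels, the precision, and the range
    for prime, period and start.\<close>
  obtain es :: "word \<Rightarrow> unit list" where es: "ptime es" "\<And>x. sz x \<le> length (es x)"
    using ptime_ticks[OF pw] by blast
  have "pbd (\<lambda>x. length (es x))" using pbd_mono[OF pbd_sz[OF es(1)] length_le_sz] .
  then have "pbd (\<lambda>x. 2 * (V x + 2 * V x * length (es x)) + 1)" by (intro pbd_mult pbd_add pbd_const pV)
  then obtain js :: "word \<Rightarrow> unit list" where js: "ptime js" "\<And>x. 2 * (V x + 2 * V x * length (es x)) + 1 \<le> length (js x)"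
    using ptime_ticks by blast
  have "pbd (\<lambda>x. X x + (d + X x ^ (d * d)) + 1)" by (intro pbd_mult pbd_power pbd_add pbd_const pX)
  then obtain zs :: "word \<Rightarrow> unit list" where zs: "ptime zs" "\<And>x. X x + (d + X x ^ (d * d)) + 1 \<le> length (zs x)"
    using ptime_ticks by blast
  \<comment> \<open>Candidates beyond the bound may be zeros of the sequence and would falsify the
    equivalence, so they are discarded.\<close>
  define F where "F x = (if admissible d x then map (lrs_circuit d (inst_coeffs d x) (inst_init d x))
    (filter (\<lambda>n. n \<le> inst_bound d x) (cands (js x) (zs x) (es x) (inst_coeffs d x) (inst_init d x))) else [])" for x
  have "ptime F"
    unfolding F_def admissible_def
    by (intro pt ptime_cands ptime_comp[OF ptime_full_rank] js(1) zs(1) es(1))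
  moreover have "(\<forall>c\<in>set (F x). wf_circuit c) \<and> (unW x \<in> bounded_skolem d \<longleftrightarrow> (\<exists>c\<in>set (F x). circuit_output c = 0))" for x
  proof (cases "admissible d x")
    case False
    then show ?thesis by (auto simp: F_def mem_skolem_iff)
  next
    case True
    let ?a = "inst_coeffs d x" and ?N = "inst_bound d x"
    let ?C = "cands (js x) (zs x) (es x) ?a (inst_init d x)"
    obtain u where u: "satisfies_rec ?a u" "inst_init d x = map u [0..<d]" "lrs_order u = d"
      by (rule admissible_sequence[OF True])
    note circ = lrs_circuit_correct[OF u(1) length_inst(1) u(2)]
    have F: "F x = map (lrs_circuit d ?a (inst_init d x)) (filter (\<lambda>n. n \<le> ?N) ?C)" using True by (simp add: F_def)
    have "unW x \<in> bounded_skolem d \<longleftrightarrow> (\<exists>n\<le>?N. u n = 0)"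
    proof -
      have "v = u" if "satisfies_rec ?a v" "inst_init d x = map v [0..<d]" for v
        using satisfies_rec_unique[OF that(1) u(1)] that(2) u(2) by simp
      then show ?thesis using u(1,2) True unfolding mem_skolem_iff by blast
    qed
    also have "\<dots> \<longleftrightarrow> (\<exists>n\<in>set ?C. n \<le> ?N \<and> u n = 0)"
    proof
      assume "\<exists>n\<le>?N. u n = 0"
      then obtain n where n: "n \<le> ?N" "u n = 0" by blast
      have "n < 2 ^ sz x" using n(1) inst_size(3)[OF True] by simp
      also have "\<dots> \<le> 2 ^ length (es x)" using es(2) by (intro power_increasing) auto
      finally have n2: "n < 2 ^ length (es x)" .
      have "\<exists>n'\<in>set (cands (js x) (zs x) (es x) ?a (map u [0..<length ?a])). n' \<le> n \<and> u n' = 0"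
      proof (rule cands_complete[OF u(1) n(2) n2])
        show "\<bar>u i\<bar> \<le> 2 ^ ((sz x + d) * (i + 1))" for i
        proof -
          have "\<bar>c\<bar> \<le> 2 ^ sz x" if "c \<in> set ?a" for c using inst_size(1)[OF True that] by simp
          moreover have "\<bar>u j\<bar> \<le> 2 ^ sz x" if "j < length ?a" for j
            using inst_size(2)[OF True, of "u j"] that u(2) by simp
          ultimately show ?thesis using growth[OF u(1), of "sz x" i] by simp
        qed
        show "\<exists>p :: nat. prime p \<and> 3 \<le> p \<and> p \<le> X x \<and> \<not> int p dvd c" if "c \<in> set ?a" "c \<noteq> 0" for c
          unfolding X_def by (rule small_prime_not_dividing[OF that(2) inst_size(1)[OF True that(1)]])
        show "X x \<ge> 1" by (simp add: X_def)
        show "V x \<ge> length ?a + (sz x + d) * (length ?a + X x ^ (length ?a * length ?a) * (length ?a + 1) + 1) + 1"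
          by (simp add: V_def)
        show "length (js x) > 2 * (V x + 2 * V x * length (es x))" using js(2)[of x] by linarith
        show "length (zs x) > X x" "length (zs x) > length ?a + X x ^ (length ?a * length ?a)"
          using zs(2)[of x] by simp_all
      qed
      then obtain n' where "n' \<in> set ?C" "n' \<le> n" "u n' = 0" using u(2) by auto
      then show "\<exists>n\<in>set ?C. n \<le> ?N \<and> u n = 0" using n(1) by (intro bexI[of _ n']) auto
    qed blast
    also have "\<dots> \<longleftrightarrow> (\<exists>c\<in>set (F x). circuit_output c = 0)" using circ(2) by (auto simp: F)
    finally show ?thesis using circ(1) by (auto simp: F)
  qed
  ultimately show ?thesis by blast
qed

text \<open>Every word is the code of a \<open>word\<close>, so the domain in
  \<open>computes\<close> is no restriction here.\<close>

lemma polytime_of_ptime: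
  assumes "ptime f"
  shows "polytime_computable (\<lambda>w. code (f (W w)))"
proof -
  obtain G where G: "computes G f" using assms by (rule ptimeE)
  have "b \<in> range (code :: word \<Rightarrow> bool list)" for b by (rule range_eqI[of _ _ "W b"]) simp
  then have "range (code :: word \<Rightarrow> bool list) = UNIV" by blast
  with computesD(1)[OF G] have "pw UNIV G" by simp
  moreover have "G w = code (f (W w))" for w using computesD(2)[OF G, of "W w"] by simp
  ultimately show ?thesis using pw_polytime[of G] by (metis ext)
qed

theorem disj_reducible_skolem: "disj_reducible (bounded_skolem d) EqSLP"
proof -
  obtain F :: "word \<Rightarrow> gate list list" where F: "ptime F" "\<And>x c. c \<in> set (F x) \<Longrightarrow> wf_circuit c"
    "\<And>x. unW x \<in> bounded_skolem d \<longleftrightarrow> (\<exists>c\<in>set (F x). circuit_output c = 0)"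
    using circuit_reduction[of d] by blast
  have code: "code (F (W w)) = enc_words (map enc_circuit (F (W w)))" for w
    by (simp add: code_list_def enc_circuit_def code_gate_def cong: map_cong)
  have "w \<in> bounded_skolem d \<longleftrightarrow> (\<exists>y\<in>set (map enc_circuit (F (W w))). y \<in> EqSLP)" for w
    using F(3)[of "W w"] F(2)[of _ "W w"] by (auto simp: EqSLP_def dest: injD[OF inj_enc_circuit])
  then show ?thesis
    unfolding disj_reducible_def using polytime_of_ptime[OF F(1)] code by blast
qed

section \<open>The randomized algorithm\<close>

lemma sz_mult: "sz (a * b :: nat) \<le> sz a + sz b"
proof -
  have "a * b < 2 ^ sz a * 2 ^ sz b" by (intro mult_strict_mono less_two_sz) auto
  then show ?thesis by (simp add: sz_nat_le power_add)
qed

lemma ptime_prod_list [pt]: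
  assumes "ptime xs"
  shows "ptime (\<lambda>x. prod_list (xs x) :: nat)"
proof -
  have fl: "foldl (\<lambda>m y. m * y) 1 ys = prod_list ys" for ys :: "nat list"
    by (induction ys rule: rev_induct) auto
  have "sz (prod_list ys) \<le> 1 + sz ys" for ys :: "nat list"
  proof (induction ys)
    case (Cons y ys)
    then show ?case using sz_mult[of y "prod_list ys"] by simp
  qed (simp add: sz_nat_le)
  then have "sz (foldl (\<lambda>m y. m * y) 1 (take n (xs x))) \<le> 1 + sz (xs x)" for n x
    unfolding fl using sz_take[of n "xs x"] by (meson add_left_mono order_trans)
  moreover have "pbd (\<lambda>x. 1 + sz (xs x))" by (intro pbd_add pbd_const pbd_sz assms)
  ultimately have "ptime (\<lambda>x. foldl (\<lambda>m y. m * y) 1 (xs x))" by (intro ptime_foldl[where B = "\<lambda>x. 1 + sz (xs x)"] pt assms)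
  then show ?thesis unfolding fl .
qed

text \<open>\<open>Suc (m - 1)\<close> is \<open>m\<close> unless \<open>m = 0\<close>, where reduction modulo \<open>m\<close> would not bound the values.\<close>

definition mod_gate :: "nat \<Rightarrow> nat list \<Rightarrow> gate \<Rightarrow> nat" where
  "mod_gate m vs g = (let l = gate_nats g; k = nthd l 0 0; x = nthd vs (nthd l 1 0) 0; y = nthd vs (nthd l 2 0) 0 in
     (if k = 0 then 0 else if k = 1 then 1 else if k = 2 then x + y else if k = 3 then x + (m - 1) * y else x * y) mod Suc (m - 1))"

lemma mod_gate_le: "mod_gate m vs g \<le> m"
proof -
  have "k mod Suc (m - 1) \<le> m" for k using mod_less_divisor[of "Suc (m - 1)" k] by linarith
  then show ?thesis unfolding mod_gate_def Let_def .
qed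

definition mod_vals :: "nat \<Rightarrow> gate list \<Rightarrow> nat list" where
  "mod_vals m c = foldl (\<lambda>vs g. vs @ [mod_gate m vs g]) [] c"

lemma mod_vals_snoc: "mod_vals m (c @ [g]) = mod_vals m c @ [mod_gate m (mod_vals m c) g]"
  by (simp add: mod_vals_def)

lemma ptime_mod_vals [pt]:
  assumes "ptime m" "ptime c"
  shows "ptime (\<lambda>x. mod_vals (m x) (c x))"
  unfolding mod_vals_def
proof (rule ptime_foldl)
  show "ptime (\<lambda>z. fst (snd z) @ [mod_gate (m (fst z)) (fst (snd z)) (snd (snd z))])"
    unfolding mod_gate_def Let_def by (intro pt ptime_comp[OF assms(1)])
  show "pbd (\<lambda>x. length (c x) * (2 * sz (m x) + 1))" by (intro pbd_mult pbd_add pbd_const pbd_sz assms pbd_length)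
  fix x n
  let ?v = "\<lambda>gs. foldl (\<lambda>vs g. vs @ [mod_gate (m x) vs g]) [] gs"
  have v: "length (?v gs) = length gs \<and> (\<forall>y\<in>set (?v gs). y \<le> m x)" for gs
    by (induction gs rule: rev_induct) (simp_all add: mod_gate_le)
  then have "sz (?v (take n (c x))) \<le> length (?v (take n (c x))) * (2 * sz (m x) + 1)" by (intro sz_nat_list) blast
  also have "\<dots> \<le> length (c x) * (2 * sz (m x) + 1)" using v by (intro mult_le_mono1) simp
  finally show "sz (?v (take n (c x))) \<le> length (c x) * (2 * sz (m x) + 1)" .
qed (intro pt assms)+

lemma mod_vals_eq:
  assumes "m > 0" "\<forall>k<length c. gate_args (c ! k) \<subseteq> {..<k}"
  shows "mod_vals m c = map (\<lambda>z. nat (z mod int m)) (circuit_vals c)"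
  using assms(2)
proof (induction c rule: rev_induct)
  case Nil
  show ?case by (simp add: mod_vals_def circuit_vals_def)
next
  case (snoc g c)
  have "gate_args (c ! k) \<subseteq> {..<k}" if "k < length c" for k
    using snoc.prems[rule_format, of k] that by (simp add: nth_append)
  then have IH: "mod_vals m c = map (\<lambda>z. nat (z mod int m)) (circuit_vals c)" using snoc.IH by blast
  have g: "gate_args g \<subseteq> {..<length c}" using snoc.prems[rule_format, of "length c"] by simp
  let ?v = "\<lambda>i. circuit_vals c ! i"
  have v: "int (nthd (mod_vals m c) i 0) = ?v i mod int m" if "i < length c" for i
    using that assms(1) by (simp add: IH nthd_def)
  have m: "int (m - 1) = int m - 1" "Suc (m - 1) = m" "int (m - Suc 0) = int m - 1" using assms(1) by simp_all
  have sub: "(x mod int m + (int m - 1) * (y mod int m)) mod int m = (x - y) mod int m" for x y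
  proof -
    have "x mod int m + (int m - 1) * (y mod int m) = (x mod int m - y mod int m) + int m * (y mod int m)"
      by (simp add: algebra_simps)
    then have "(x mod int m + (int m - 1) * (y mod int m)) mod int m = (x mod int m - y mod int m) mod int m"
      by (simp only: mod_mult_self2)
    then show ?thesis by (simp only: mod_diff_eq)
  qed
  have "int (mod_gate m (mod_vals m c) g) = gate_val (circuit_vals c) g mod int m"
  proof (cases "g = Const1")
    case True
    then show ?thesis using zmod_int[of 1 m] unfolding mod_gate_def m(2) by (simp add: gate_nats_def nthd_def[of "_ # _"])
  next
    case False
    then show ?thesis using g unfolding mod_gate_def m(2) Let_def
      by (cases g) (simp_all add: gate_nats_def nthd_def[of "_ # _"] v of_nat_mod m(3) sub mod_add_eq mod_mult_eq)
  qed
  then have "mod_gate m (mod_vals m c) g = nat (gate_val (circuit_vals c) g mod int m)" by linarith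
  then show ?case by (simp add: mod_vals_snoc circuit_vals_snoc IH)
qed

definition mod_output :: "nat \<Rightarrow> gate list \<Rightarrow> nat" where
  "mod_output m c = nthd (mod_vals m c) (length c - 1) 0"

lemma mod_output_eq:
  assumes "m > 0" "wf_circuit c"
  shows "int (mod_output m c) = circuit_output c mod int m"
proof -
  have "c \<noteq> []" using assms(2) by (simp add: wf_circuit_def)
  then have "circuit_vals c \<noteq> []" by (metis length_circuit_vals length_0_conv)
  then show ?thesis using \<open>c \<noteq> []\<close> assms
    by (simp add: mod_output_def mod_vals_eq wf_circuit_def nthd_def circuit_output_def last_conv_nth)
qed

lemma prod_mod_outputs:
  assumes "m > 0" "\<And>c. c \<in> set cs \<Longrightarrow> wf_circuit c"
  shows "prod_list (map (mod_output m) cs) mod m = 0 \<longleftrightarrow> int m dvd prod_list (map circuit_output cs)"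
proof -
  have "int (prod_list (map (mod_output m) cs)) mod int m = prod_list (map circuit_output cs) mod int m"
    using assms(2)
  proof (induction cs)
    case (Cons c cs)
    then have "int (prod_list (map (mod_output m) cs)) mod int m = prod_list (map circuit_output cs) mod int m" by simp
    then have "int (mod_output m c) * int (prod_list (map (mod_output m) cs)) mod int m =
        circuit_output c mod int m * prod_list (map circuit_output cs) mod int m"
      using mod_output_eq[OF assms(1), of c] Cons.prems by (metis list.set_intros(1) mod_mult_right_eq)
    then show ?case by (simp add: mod_mult_left_eq)
  qed simp
  moreover have "prod_list (map (mod_output m) cs) mod m = 0 \<longleftrightarrow> int (prod_list (map (mod_output m) cs)) mod int m = 0"
    by (metis of_nat_0_eq_iff of_nat_mod)
  ultimately show ?thesis by (simp add: dvd_eq_mod_eq_0)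
qed

lemma gate_val_bound:
  assumes "\<And>i. i \<in> gate_args g \<Longrightarrow> \<bar>vs ! i\<bar> \<le> B" "1 \<le> B"
  shows "\<bar>gate_val vs g\<bar> \<le> 2 * B \<or> \<bar>gate_val vs g\<bar> \<le> B * B"
proof (cases g)
  case (Mul i j)
  then have "\<bar>vs ! i\<bar> * \<bar>vs ! j\<bar> \<le> B * B" using assms by (intro mult_mono) auto
  then show ?thesis using Mul by (simp add: abs_mult)
next
  case (Add i j)
  then have "\<bar>vs ! i\<bar> \<le> B" "\<bar>vs ! j\<bar> \<le> B" using assms by auto
  then have "\<bar>vs ! i + vs ! j\<bar> \<le> 2 * B" by linarith
  then show ?thesis using Add by simp
next
  case (Sub i j)
  then have "\<bar>vs ! i\<bar> \<le> B" "\<bar>vs ! j\<bar> \<le> B" using assms by auto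
  then have "\<bar>vs ! i - vs ! j\<bar> \<le> 2 * B" by linarith
  then show ?thesis using Sub by simp
qed (use assms in auto)

text \<open>A gate at most squares the bound: doubling, for sums and differences, is no worse than
  squaring once the bound is at least 2.\<close>

lemma circuit_vals_bound:
  assumes "\<forall>k<length c. gate_args (c ! k) \<subseteq> {..<k}"
  shows "\<forall>k<length c. \<bar>circuit_vals c ! k\<bar> \<le> 2 ^ 2 ^ length c"
  using assms
proof (induction c rule: rev_induct)
  case (snoc g c)
  have "gate_args (c ! k) \<subseteq> {..<k}" if "k < length c" for k
    using snoc.prems[rule_format, of k] that by (simp add: nth_append)
  then have IH: "\<bar>circuit_vals c ! k\<bar> \<le> 2 ^ 2 ^ length c" if "k < length c" for k using snoc.IH that by blast
  have g: "gate_args g \<subseteq> {..<length c}" using snoc.prems[rule_format, of "length c"] by simp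
  let ?B = "2 ^ 2 ^ length c :: int"
  have BB: "?B * ?B = 2 ^ 2 ^ length (c @ [g])" by (simp add: mult_2 flip: power_add)
  have B: "2 \<le> ?B" by (metis one_le_numeral one_le_power power_increasing power_one_right)
  then have "2 * ?B \<le> ?B * ?B" by (intro mult_right_mono) auto
  moreover from this B have "?B \<le> ?B * ?B" by linarith
  moreover have "\<bar>gate_val (circuit_vals c) g\<bar> \<le> 2 * ?B \<or> \<bar>gate_val (circuit_vals c) g\<bar> \<le> ?B * ?B"
    using g IH B by (intro gate_val_bound) auto
  ultimately have *: "\<bar>gate_val (circuit_vals c) g\<bar> \<le> ?B * ?B" "?B \<le> ?B * ?B" by linarith+
  show ?case
  proof (intro allI impI)
    fix k assume k: "k < length (c @ [g])"
    show "\<bar>circuit_vals (c @ [g]) ! k\<bar> \<le> 2 ^ 2 ^ length (c @ [g])"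
      unfolding BB[symmetric]
    proof (cases "k < length c")
      case True
      then show "\<bar>circuit_vals (c @ [g]) ! k\<bar> \<le> ?B * ?B" using order_trans[OF IH[OF True] *(2)] by (simp add: circuit_vals_snoc nth_append)
    next
      case False
      then have "k = length c" using k by simp
      then show "\<bar>circuit_vals (c @ [g]) ! k\<bar> \<le> ?B * ?B" using *(1) by (simp add: circuit_vals_snoc nth_append)
    qed
  qed
qed simp

lemma circuit_output_bound:
  assumes "wf_circuit c"
  shows "\<bar>circuit_output c\<bar> \<le> 2 ^ 2 ^ length c"
proof -
  have c: "c \<noteq> []" using assms by (simp add: wf_circuit_def)
  then have "circuit_vals c \<noteq> []" by (metis length_circuit_vals length_0_conv)
  then have "circuit_output c = circuit_vals c ! (length c - 1)" by (simp add: circuit_output_def last_conv_nth)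
  then show ?thesis using circuit_vals_bound[of c] assms c by (simp add: wf_circuit_def)
qed

text \<open>Every output is at most \<open>2 ^ 2 ^ sz cs\<close> in absolute value; the second
  \<open>sz cs\<close> in the exponent absorbs the number of factors.\<close>

lemma prod_outputs_bound:
  assumes "\<And>c. c \<in> set cs \<Longrightarrow> wf_circuit c" "2 * sz cs + 1 \<le> s"
  shows "\<bar>prod_list (map circuit_output cs)\<bar> < 2 ^ (2 ^ s)"
proof -
  have len: "length c \<le> sz cs" if "c \<in> set cs" for c using sz_mem[OF that] length_le_sz[of c] by linarith
  have "\<bar>prod_list (map circuit_output ds)\<bar> \<le> (2 ^ 2 ^ sz cs) ^ length ds" if "set ds \<subseteq> set cs" for ds
    using that
  proof (induction ds)
    case (Cons c ds)
    have "\<bar>circuit_output c\<bar> \<le> 2 ^ 2 ^ length c" using assms(1) Cons.prems by (intro circuit_output_bound) auto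
    also have "(2 :: int) ^ 2 ^ length c \<le> 2 ^ 2 ^ sz cs" using len[of c] Cons.prems by (intro power_increasing) auto
    finally have "\<bar>circuit_output c\<bar> \<le> 2 ^ 2 ^ sz cs" .
    then show ?case using Cons by (auto simp: abs_mult intro!: mult_mono)
  qed simp
  from this[of cs] have "\<bar>prod_list (map circuit_output cs)\<bar> \<le> 2 ^ (2 ^ sz cs * length cs)" by (simp add: power_mult)
  also have "\<dots> < 2 ^ (2 ^ s)"
  proof (rule power_strict_increasing)
    have "2 ^ sz cs * length cs < 2 ^ sz cs * 2 ^ sz cs"
      using le_less_trans[OF length_le_sz[of cs] less_exp[of "sz cs"]] by (intro mult_strict_left_mono) auto
    also have "\<dots> = 2 ^ (2 * sz cs)" by (simp add: mult_2 power_add)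
    also have "\<dots> \<le> 2 ^ s" using assms(2) by (intro power_increasing) auto
    finally show "2 ^ sz cs * length cs < 2 ^ s" .
  qed simp
  finally show ?thesis .
qed

section \<open>Random moduli\<close>

definition chunk :: "nat \<Rightarrow> bool list \<Rightarrow> nat \<Rightarrow> bool list" where
  "chunk b r i = map (\<lambda>j. nthd r (i * b + j) False) [0..<b]"

lemma length_chunk [simp]: "length (chunk b r i) = b"
  by (simp add: chunk_def)

lemma chunk_append:
  assumes "length c = b"
  shows "chunk b (c @ r) 0 = c" "chunk b (c @ r) (Suc i) = chunk b r i"
  using assms by (auto simp: chunk_def nthd_def nth_append intro!: nth_equalityI)

text \<open>Independence of the blocks in counting form: cutting off the first block reduces
  \<open>t + 1\<close> blocks to a product.\<close>

lemma card_chunks_le: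
  assumes "finite B" "B \<subseteq> {c. length c = b}"
  shows "finite {r. length r = t * b \<and> (\<forall>i<t. chunk b r i \<in> B)} \<and>
    card {r. length r = t * b \<and> (\<forall>i<t. chunk b r i \<in> B)} \<le> card B ^ t"
proof (induction t)
  case 0
  have "{r :: bool list. length r = 0 * b \<and> (\<forall>i<0. chunk b r i \<in> B)} = {[]}" by auto
  then show ?case by simp
next
  case (Suc t)
  let ?S = "\<lambda>t. {r. length r = t * b \<and> (\<forall>i<t. chunk b r i \<in> B)}"
  have sub: "?S (Suc t) \<subseteq> (\<lambda>(c, r). c @ r) ` (B \<times> ?S t)"
  proof
    fix r assume r: "r \<in> ?S (Suc t)"
    define c where "c = take b r"
    define q where "q = drop b r"
    have rc: "r = c @ q" "length c = b" "length q = t * b" using r by (auto simp: c_def q_def)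
    have "c \<in> B" using r chunk_append(1)[OF rc(2), of q] by (auto simp: rc(1))
    moreover have "chunk b q i \<in> B" if "i < t" for i
      using r that chunk_append(2)[OF rc(2), of q i] by (auto simp: rc(1))
    ultimately show "r \<in> (\<lambda>(c, r). c @ r) ` (B \<times> ?S t)" using rc by (intro image_eqI[of _ _ "(c, q)"]) auto
  qed
  have fin: "finite ((\<lambda>(c, r). c @ r) ` (B \<times> ?S t))" using Suc assms(1) by auto
  have "card (?S (Suc t)) \<le> card ((\<lambda>(c, r). c @ r) ` (B \<times> ?S t))" by (rule card_mono[OF fin sub])
  also have "\<dots> \<le> card (B \<times> ?S t)" using Suc assms(1) by (intro card_image_le) auto
  also have "\<dots> \<le> card B * card B ^ t" using Suc by (simp add: card_cartesian_product)
  finally show ?case using finite_subset[OF sub fin] by simp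
qed

lemma finite_bits: "finite {c :: bool list. length c = b}" and card_bits: "card {c :: bool list. length c = b} = 2 ^ b"
  using finite_lists_length_eq[of "UNIV :: bool set" b] card_lists_length_eq[of "UNIV :: bool set" b] by auto

text \<open>Adding 1 turns uniform blocks of bits into uniform numbers between 1 and
  \<open>2 ^ b\<close> and excludes the modulus 0.\<close>

lemma bij_bval: "bij_betw (\<lambda>c. bval c + 1) {c. length c = b} {m. 1 \<le> m \<and> m \<le> 2 ^ b}"
proof -
  have inj: "inj_on (\<lambda>c. bval c + 1) {c. length c = b}"
    by (rule inj_onI) (auto intro!: bval_True_inj)
  have "(\<lambda>c. bval c + 1) ` {c. length c = b} \<subseteq> {m. 1 \<le> m \<and> m \<le> 2 ^ b}"
    using bval_less by (auto simp: Suc_le_eq)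
  moreover have "card ((\<lambda>c. bval c + 1) ` {c :: bool list. length c = b}) = card {m :: nat. 1 \<le> m \<and> m \<le> 2 ^ b}"
    using card_image[OF inj] by (simp add: card_bits flip: atLeastAtMost_def[unfolded atLeast_def atMost_def Int_def mem_Collect_eq])
  moreover have "finite {m :: nat. 1 \<le> m \<and> m \<le> 2 ^ b}" by simp
  ultimately have "(\<lambda>c. bval c + 1) ` {c. length c = b} = {m. 1 \<le> m \<and> m \<le> 2 ^ b}" by (intro card_subset_eq)
  with inj show ?thesis unfolding bij_betw_def by blast
qed

lemma one_minus_inverse_power: "n > 0 \<Longrightarrow> (1 - 1 / real n) ^ n \<le> 1 / 2"
proof -
  assume n: "n > 0"
  have "1 - 1 / real n \<le> exp (- (1 / real n))" using exp_ge_add_one_self[of "- (1 / real n)"] by simp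
  then have "(1 - 1 / real n) ^ n \<le> exp (- (1 / real n)) ^ n" using n by (intro power_mono) auto
  also have "\<dots> = exp (- 1)" using n by (simp flip: exp_of_nat_mult)
  also have "\<dots> \<le> 1 / 2" using exp_ge_add_one_self[of "1 :: real"] by (simp add: exp_minus field_simps)
  finally show ?thesis .
qed

text \<open>A product divides \<open>P\<close> only if all its factors do, and one factor does so
  with probability at most \<open>1 - 1 / (2 b)\<close>. Hence \<open>2 b\<close> independent
  factors suffice, and no factor has to be tested for primality.\<close>

lemma random_modulus:
  assumes P: "P \<noteq> 0" "\<bar>P\<bar> < 2 ^ (2 ^ s)" and b: "b = 2 * s + 4"
  shows "measure_pmf.prob (coin_tosses (2 * b * b)) {r. \<not> int (prod_list (map (\<lambda>i. bval (chunk b r i) + 1) [0..<2 * b])) dvd P} \<ge> 1 / 2"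
    (is "measure_pmf.prob _ ?A \<ge> _")
proof -
  define B where "B = {c :: bool list. length c = b \<and> int (bval c + 1) dvd P}"
  define G where "G = {c :: bool list. length c = b \<and> \<not> int (bval c + 1) dvd P}"
  define S where "S = {r :: bool list. length r = 2 * b * b}"
  define R where "R = {r. length r = 2 * b * b \<and> (\<forall>i<2 * b. chunk b r i \<in> B)}"
  have bpos: "b > 0" using b by simp
  have finBG: "finite B" "finite G" using finite_bits[of b] by (auto simp: B_def G_def intro: finite_subset)
  have "{m :: nat. 1 \<le> m \<and> m \<le> 2 ^ b \<and> \<not> int m dvd P} \<subseteq> (\<lambda>c. bval c + 1) ` G"
  proof
    fix m :: nat assume m: "m \<in> {m. 1 \<le> m \<and> m \<le> 2 ^ b \<and> \<not> int m dvd P}"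
    then have "m \<in> (\<lambda>c. bval c + 1) ` {c. length c = b}" using bij_bval[of b] unfolding bij_betw_def by simp
    then show "m \<in> (\<lambda>c. bval c + 1) ` G" using m by (auto simp: G_def)
  qed
  then have "card {m :: nat. 1 \<le> m \<and> m \<le> 2 ^ b \<and> \<not> int m dvd P} \<le> card G"
    using finBG(2) by (meson card_image_le card_mono finite_imageI order_trans)
  then have "2 * b * card {m :: nat. 1 \<le> m \<and> m \<le> 2 ^ b \<and> \<not> int m dvd P} \<le> 2 * b * card G" by (rule mult_le_mono2)
  then have "2 ^ b \<le> 2 * b * card G" using good_moduli[OF P b] by linarith
  then have "real (2 ^ b) \<le> real (2 * b * card G)" by (rule of_nat_mono)
  then have G: "2 ^ b / real (2 * b) \<le> real (card G)" using bpos by (simp add: field_simps)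
  have "B \<union> G = {c. length c = b}" "B \<inter> G = {}" by (auto simp: B_def G_def)
  then have "card B + card G = 2 ^ b" using card_Un_disjoint[OF finBG] by (simp add: card_bits)
  then have "real (card B) + real (card G) = 2 ^ b" by (metis of_nat_add of_nat_numeral of_nat_power)
  then have "real (card B) \<le> 2 ^ b * (1 - 1 / real (2 * b))" using G by (simp add: algebra_simps)
  then have "real (card B) ^ (2 * b) \<le> (2 ^ b * (1 - 1 / real (2 * b))) ^ (2 * b)" by (intro power_mono) auto
  also have "\<dots> = 2 ^ (2 * b * b) * (1 - 1 / real (2 * b)) ^ (2 * b)"
    unfolding power_mult_distrib power_mult[symmetric] by (simp add: mult.commute)
  also have "\<dots> \<le> 2 ^ (2 * b * b) * (1 / 2)" using one_minus_inverse_power[of "2 * b"] bpos by (intro mult_left_mono) auto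
  finally have B: "real (card B) ^ (2 * b) \<le> 2 ^ (2 * b * b) * (1 / 2)" .
  have "card R \<le> card B ^ (2 * b)"
    unfolding R_def by (rule conjunct2[OF card_chunks_le[OF finBG(1)]]) (auto simp: B_def)
  then have "real (card R) \<le> real (card B ^ (2 * b))" by (rule of_nat_mono)
  then have "real (card R) \<le> real (card B) ^ (2 * b)" by (simp only: of_nat_power)
  then have R: "real (card R) \<le> 2 ^ (2 * b * b) / 2" using B by linarith
  have S: "finite S" "card S = 2 ^ (2 * b * b)" using finite_bits card_bits by (auto simp: S_def)
  then have "S \<noteq> {}" by auto
  have sub: "S - R \<subseteq> S \<inter> ?A"
  proof
    fix r assume r: "r \<in> S - R"
    then obtain i where i: "i < 2 * b" "chunk b r i \<notin> B" by (auto simp: S_def R_def)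
    then have ndvd: "\<not> int (bval (chunk b r i) + 1) dvd P" by (auto simp: B_def)
    have "bval (chunk b r i) + 1 dvd prod_list (map (\<lambda>i. bval (chunk b r i) + 1) [0..<2 * b])"
      using i(1) by (intro prod_list_dvd) auto
    then have "int (bval (chunk b r i) + 1) dvd int (prod_list (map (\<lambda>i. bval (chunk b r i) + 1) [0..<2 * b]))"
      by (simp only: int_dvd_int_iff)
    then show "r \<in> S \<inter> ?A" using ndvd r by (auto dest: dvd_trans)
  qed
  have "R \<subseteq> S" by (auto simp: R_def S_def)
  then have "real (card S) - real (card R) = real (card (S - R))"
    using S(1) by (simp add: card_Diff_subset finite_subset card_mono of_nat_diff)
  also have "\<dots> \<le> real (card (S \<inter> ?A))" using sub S(1) by (intro of_nat_mono card_mono) auto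
  finally have q: "2 ^ (2 * b * b) / 2 \<le> real (card (S \<inter> ?A))" using R S(2) by simp
  have "1 / 2 = 2 ^ (2 * b * b) / 2 / (2 :: real) ^ (2 * b * b)" by simp
  also have "\<dots> \<le> real (card (S \<inter> ?A)) / 2 ^ (2 * b * b)" by (rule divide_right_mono[OF q]) simp
  also have "\<dots> = real (card (S \<inter> ?A)) / real (card S)" unfolding S(2) by simp
  also have "\<dots> = measure_pmf.prob (coin_tosses (2 * b * b)) ?A"
    unfolding coin_tosses_def S_def[symmetric] by (rule measure_pmf_of_set[OF \<open>S \<noteq> {}\<close> S(1), symmetric])
  finally show ?thesis .
qed

text \<open>The product of all outputs vanishes exactly on yes-instances, so a nonzero residue is a
  certain proof of a no-instance, and the error is one-sided.\<close>

theorem skolem_coRP: "bounded_skolem d \<in> coRP"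
proof -
  obtain F :: "word \<Rightarrow> gate list list" where F: "ptime F" "\<And>x c. c \<in> set (F x) \<Longrightarrow> wf_circuit c"
    "\<And>x. unW x \<in> bounded_skolem d \<longleftrightarrow> (\<exists>c\<in>set (F x). circuit_output c = 0)"
    using circuit_reduction[of d] by blast
  have "pbd (\<lambda>x. 2 * sz (F x) + 1)" by (intro pbd_add pbd_mult pbd_const pbd_sz F(1))
  then obtain e where e: "\<And>x. 2 * sz (F x) + 1 \<le> (sz x + 2) ^ e" unfolding pbd_def by blast
  \<comment> \<open>The number of coin tosses may depend on the length of the input only, so the
    size of the circuits is replaced by its polynomial bound.\<close>
  define s where "s = (\<lambda>n :: nat. (n + 2) ^ e)"
  define b where "b = (\<lambda>n. 2 * s n + 4)"
  \<comment> \<open>\<open>2 b\<close> blocks of \<open>b\<close> bits each, written as a polynomial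
    in the input length.\<close>
  define p where "p = (let q = [:2:] * [:2, 1:] ^ e + [:4:] in [:2:] * q * q :: nat poly)"
  have p: "poly p n = 2 * b n * b n" for n
    by (simp add: p_def Let_def b_def s_def poly_power add.commute)
  define M where "M = (\<lambda>n r. prod_list (map (\<lambda>i. bval (chunk (b n) r i) + 1) [0..<2 * b n]))"
  define A where "A = (\<lambda>x r. prod_list (map (mod_output (M (length (unW x)) r)) (F x)) mod M (length (unW x)) r \<noteq> 0)"
  define V where "V = (\<lambda>w. A (first_field w) (unW (first_field (rest_fields w))))"
  have plen: "ptime (\<lambda>x :: word. length (unW x))"
    using ptime_length[OF ptime_rev_unW[OF ptime_id]] by simp
  have pbits: "ptime (\<lambda>x :: word. unW x)" using ptime_rev[OF ptime_rev_unW[OF ptime_id]] by simp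
  have blen: "pbd (\<lambda>x :: word. length (unW x))" using pbd_sz[of "\<lambda>x :: word. x", OF ptime_id] by (simp add: sz_def code_word_def)
  have pb: "ptime (\<lambda>x :: word. b (length (unW x)))" "pbd (\<lambda>x :: word. b (length (unW x)))"
    unfolding b_def s_def by (intro pt ptime_power_nat plen pbd_const) (intro pbd_add pbd_mult pbd_power pbd_const blen)
  have pM: "ptime (\<lambda>z. M (length (unW (fst z))) (unW (snd z)))"
    unfolding M_def chunk_def
    by (intro pt ptime_upt ptime_comp[OF pb(1)] pbd_comp[OF pb(2)] pbd_mult pbd_const ptime_comp[OF pbits])
  have pV: "ptime V"
    unfolding V_def A_def mod_output_def
    by (intro pt ptime_comp[OF F(1)] ptime_comp2[OF pM])
  have V: "code (V (W (enc_words [x, r]))) = [True] \<longleftrightarrow> A (W x) r" for x r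
    by (simp add: code_bool_def V_def first_field_def rest_fields_def enc_words_def wsplit_enc_word[of r "[]", simplified])
  have A: "A x r \<longleftrightarrow> \<not> int (M (length (unW x)) r) dvd prod_list (map circuit_output (F x))" for x r
  proof -
    have "0 \<notin> set (map (\<lambda>i. bval (chunk (b n) r i) + 1) [0..<2 * b n])" for n by auto
    then have "M (length (unW x)) r > 0" unfolding M_def by (simp only: prod_list_zero_iff neq0_conv[symmetric] not_False_eq_True)
    from prod_mod_outputs[OF this F(2)] show ?thesis unfolding A_def by simp
  qed
  have "(x \<in> - bounded_skolem d \<longrightarrow> measure_pmf.prob (coin_tosses (poly p (length x))) {r. code (V (W (enc_words [x, r]))) = [True]} \<ge> 1 / 2) \<and>
      (x \<notin> - bounded_skolem d \<longrightarrow> measure_pmf.prob (coin_tosses (poly p (length x))) {r. code (V (W (enc_words [x, r]))) = [True]} = 0)" for x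
  proof (intro conjI impI)
    let ?P = "prod_list (map circuit_output (F (W x)))"
    have P: "?P = 0 \<longleftrightarrow> x \<in> bounded_skolem d"
      using F(3)[of "W x"] by (auto simp: prod_list_zero_iff)
    show "measure_pmf.prob (coin_tosses (poly p (length x))) {r. code (V (W (enc_words [x, r]))) = [True]} = 0"
      if "x \<notin> - bounded_skolem d"
      using that P by (simp add: V A)
    show "measure_pmf.prob (coin_tosses (poly p (length x))) {r. code (V (W (enc_words [x, r]))) = [True]} \<ge> 1 / 2"
      if "x \<in> - bounded_skolem d"
    proof -
      have "2 * sz (F (W x)) + 1 \<le> s (length x)" using e[of "W x"] by (simp add: s_def sz_def)
      then have "\<bar>?P\<bar> < 2 ^ (2 ^ s (length x))" using F(2) by (intro prod_outputs_bound) auto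
      moreover have "?P \<noteq> 0" using that P by simp
      ultimately show ?thesis
        using random_modulus[of ?P "s (length x)" "b (length x)"] by (simp add: V A p M_def b_def)
    qed
  qed
  then have "- bounded_skolem d \<in> RP"
    unfolding RP_def Let_def mem_Collect_eq
    using polytime_of_ptime[OF pV] by (intro exI[of _ "\<lambda>w. code (V (W w))"] conjI exI[of _ p] allI) blast+
  then show ?thesis by (simp add: coRP_def)
qed

theorem theorem6:
  fixes d :: nat
  shows "disj_reducible (bounded_skolem d) EqSLP \<and> bounded_skolem d \<in> coRP"
  using disj_reducible_skolem skolem_coRP by blast

end
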